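(* Let $(M,g)$ be a connected smooth Riemannian manifold of dimension at least $2$. Let $d_M$ be the Kobayashi pseudodistance of $(M,g)$ and let $\overline{d}_M$ be the integrated form of the Kobayashi-Royden pseudometric $F_M$. Then $d_M=\overline{d}_M$, i.e. $d_M(p,q)=\overline{d}_M(p,q)$ for all $p,q\in M$.
   Context: All structures are $C^\infty$. $\mathbb{D}$ denotes the open unit disc in $\mathbb{R}^2\cong\mathbb{C}$, with standard metric $ds^2$, standard Lebesgue measure $dm$, and $e_1=(1,0)\in\mathbb{R}^2$. A smooth map $u:\mathbb{D}\to M$ is harmonic if it is a critical point of the energy $E(u)=\int_{\mathbb{D}}|du|^2\,dm$, i.e. it satisfies the associated Euler-Lagrange (harmonic map) equation, which in local coordinates on $M$ reads $\frac{\partial^2 u^i}{\partial z\partial\bar z}+\Gamma^i_{jk}(u)\frac{\partial u^j}{\partial z}\frac{\partial u^k}{\partial\bar z}=0$, with $\Gamma^i_{jk}$ the Christoffel symbols of $g$. A smooth map $u:\mathbb{D}\to M$ is conformal if $u^*g=e^{\phi}ds^2$ on $\mathbb{D}$ for some smooth function $\phi$. A conformal harmonic immersion is an immersion $u:\mathbb{D}\to M$ that is both conformal and harmonic. Kobayashi-Royden pseudometric: for $p\in M$ and $\xi\in T_pM$, $F_M(p,\xi):=\inf\frac1r$, where $r$ runs over all positive real numbers for which there exists a conformal harmonic immersion $u:\mathbb{D}\to M$ with $u(0)=p$ and $du(0)\cdot e_1=r\xi$. For $\xi=0$ one sets $F_M(p,0)=0$. Poincaré distance: for $z,w\in\mathbb{D}$,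 $\rho_{\mathbb{D}}(z,w)=\frac12\log\frac{1+d(z,w)}{1-d(z,w)}$ with $d(z,w)=\frac{|z-w|}{|1-z\overline{w}|}$. A Kobayashi chain from $p$ to $q$ is a finite collection of points $z_k,w_k\in\mathbb{D}$ and conformal harmonic immersions $u_k:\mathbb{D}\to M$, $k=1,\dots,m$, such that $u_1(z_1)=p$, $u_m(w_m)=q$ and $u_k(w_k)=u_{k+1}(z_{k+1})$ for $k=1,\dots,m-1$. The Kobayashi pseudodistance is $d_M(p,q)=\inf\sum_k\rho_{\mathbb{D}}(z_k,w_k)$, the infimum being over all Kobayashi chains from $p$ to $q$. The integrated form of $F_M$ is $\overline{d}_M(p,q)=\inf\int_0^1F_M(\gamma(t),\dot\gamma(t))\,dt$, the infimum being over all piecewise smooth paths $\gamma:[0,1]\to M$ from $p$ to $q$. *)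

theory Defs
  imports "HOL-Analysis.Analysis"
begin

section \<open>Smooth maps between Euclidean spaces\<close>

text \<open>These are meant for open sets \<open>S\<close> in finite-dimensional spaces.\<close>

primrec Ck_on :: "nat \<Rightarrow> 'a::real_normed_vector set \<Rightarrow> ('a \<Rightarrow> 'b::real_normed_vector) \<Rightarrow> bool" where
  "Ck_on 0 S f \<longleftrightarrow> continuous_on S f"
| "Ck_on (Suc k) S f \<longleftrightarrow>
     (\<forall>x\<in>S. f differentiable at x) \<and> (\<forall>v. Ck_on k S (\<lambda>x. frechet_derivative f (at x) v))"

definition smooth_on :: "'a::real_normed_vector set \<Rightarrow> ('a \<Rightarrow> 'b::real_normed_vector) \<Rightarrow> bool" where
  "smooth_on S f \<longleftrightarrow> (\<forall>k. Ck_on k S f)"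

section \<open>Smooth manifolds\<close>

text \<open>
  The underlying space of the manifold is a whole type \<open>'m\<close>, and its dimension is \<open>CARD('n)\<close>.
  A chart is a pair of its domain and its coordinate map (whose values off the domain are
  irrelevant). The atlas \<open>A\<close> is any smooth atlas, not necessarily a maximal one.
\<close>

type_synonym ('m, 'n) chart = "'m set \<times> ('m \<Rightarrow> real ^ 'n)"

abbreviation chart_image :: "('m, 'n) chart \<Rightarrow> (real ^ 'n) set" where
  "chart_image c \<equiv> snd c ` fst c"

definition chart_inv :: "('m, 'n) chart \<Rightarrow> real ^ 'n \<Rightarrow> 'm" where
  "chart_inv c = inv_into (fst c) (snd c)"

locale smooth_manifold =
  fixes A :: "('m::{t2_space, second_countable_topology}, 'n::finite) chart set"
  assumes covers: "(\<Union>c\<in>A. fst c) = UNIV"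
    and open_domain: "c \<in> A \<Longrightarrow> open (fst c)"
    and open_image: "c \<in> A \<Longrightarrow> open (chart_image c)"
    and chart_homeomorphism: "c \<in> A \<Longrightarrow> homeomorphism (fst c) (chart_image c) (snd c) (chart_inv c)"
    and smooth_transition:
      "c \<in> A \<Longrightarrow> d \<in> A \<Longrightarrow> smooth_on (snd c ` (fst c \<inter> fst d)) (snd d \<circ> chart_inv c)"

definition smooth_map_on ::
  "('m::topological_space, 'n::finite) chart set \<Rightarrow> 'a::real_normed_vector set \<Rightarrow> ('a \<Rightarrow> 'm) \<Rightarrow> bool" where
  "smooth_map_on A S f \<longleftrightarrow>
     continuous_on S f \<and> (\<forall>c\<in>A. smooth_on {x \<in> S. f x \<in> fst c} (snd c \<circ> f))"

text \<open>
  A tangent vector at \<open>p\<close> is the family of its component vectors in all charts around \<open>p\<close>,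
  related by the Jacobians of the transition maps; the entries that do not belong to a chart
  around \<open>p\<close> are set to \<open>0\<close>, so that equality of tangent vectors is equality of functions.
\<close>

type_synonym ('m, 'n) tangent = "('m, 'n) chart \<Rightarrow> real ^ 'n"

definition tangent_space :: "('m, 'n::finite) chart set \<Rightarrow> 'm \<Rightarrow> ('m, 'n) tangent set" where
  "tangent_space A p = {\<xi>.
     (\<forall>c\<in>A. \<forall>d\<in>A. p \<in> fst c \<inter> fst d \<longrightarrow>
        \<xi> d = frechet_derivative (snd d \<circ> chart_inv c) (at (snd c p)) (\<xi> c)) \<and>
     (\<forall>c. \<not> (c \<in> A \<and> p \<in> fst c) \<longrightarrow> \<xi> c = 0)}"

text \<open>The differential \<open>df(x) \<cdot> v\<close>, a tangent vector at \<open>f x\<close>.\<close>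

definition differential ::
  "('m, 'n::finite) chart set \<Rightarrow> ('a::real_normed_vector \<Rightarrow> 'm) \<Rightarrow> 'a \<Rightarrow> 'a \<Rightarrow> ('m, 'n) tangent" where
  "differential A f x v = (\<lambda>c.
     if c \<in> A \<and> f x \<in> fst c then frechet_derivative (snd c \<circ> f) (at x) v else 0)"

section \<open>Riemannian metrics\<close>

type_synonym ('m, 'n) metric = "'m \<Rightarrow> ('m, 'n) tangent \<Rightarrow> ('m, 'n) tangent \<Rightarrow> real"

text \<open>
  The matrix \<open>(g\<^sub>i\<^sub>j)\<close> at the point of the chart with coordinates \<open>x\<close>; the coordinate vector field
  \<open>\<partial>\<^sub>i\<close> is the differential of the inverse of the coordinate map, applied to the \<open>i\<close>-th unit vector.
\<close>

definition metric_matrix ::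
  "('m, 'n::finite) chart set \<Rightarrow> ('m, 'n) metric \<Rightarrow> ('m, 'n) chart \<Rightarrow> real ^ 'n \<Rightarrow> real ^ 'n ^ 'n" where
  "metric_matrix A g c x = (\<chi> i j. g (chart_inv c x)
     (differential A (chart_inv c) x (axis i 1)) (differential A (chart_inv c) x (axis j 1)))"

locale riemannian_manifold = smooth_manifold A
  for A :: "('m::{t2_space, second_countable_topology}, 'n::finite) chart set" +
  fixes g :: "('m, 'n) metric"
  assumes metric_sym:
      "\<xi> \<in> tangent_space A p \<Longrightarrow> \<eta> \<in> tangent_space A p \<Longrightarrow> g p \<xi> \<eta> = g p \<eta> \<xi>"
    and metric_add:
      "\<xi> \<in> tangent_space A p \<Longrightarrow> \<eta> \<in> tangent_space A p \<Longrightarrow> \<zeta> \<in> tangent_space A p \<Longrightarrow>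
        g p (\<lambda>c. \<xi> c + \<eta> c) \<zeta> = g p \<xi> \<zeta> + g p \<eta> \<zeta>"
    and metric_scale:
      "\<xi> \<in> tangent_space A p \<Longrightarrow> \<zeta> \<in> tangent_space A p \<Longrightarrow> g p (\<lambda>c. a *\<^sub>R \<xi> c) \<zeta> = a * g p \<xi> \<zeta>"
    and metric_pos:
      "\<xi> \<in> tangent_space A p \<Longrightarrow> \<xi> \<noteq> (\<lambda>c. 0) \<Longrightarrow> g p \<xi> \<xi> > 0"
    and metric_smooth:
      "c \<in> A \<Longrightarrow> smooth_on (chart_image c) (\<lambda>x. metric_matrix A g c x $ i $ j)"

definition metric_deriv ::
  "('m, 'n::finite) chart set \<Rightarrow> ('m, 'n) metric \<Rightarrow> ('m, 'n) chart \<Rightarrow> real ^ 'n \<Rightarrow> 'n \<Rightarrow> 'n \<Rightarrow> 'n \<Rightarrow> real" where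
  "metric_deriv A g c x l i j =
     frechet_derivative (\<lambda>y. metric_matrix A g c y $ i $ j) (at x) (axis l 1)"

definition christoffel ::
  "('m, 'n::finite) chart set \<Rightarrow> ('m, 'n) metric \<Rightarrow> ('m, 'n) chart \<Rightarrow> real ^ 'n \<Rightarrow> 'n \<Rightarrow> 'n \<Rightarrow> 'n \<Rightarrow> real" where
  "christoffel A g c x i j k = (\<Sum>l\<in>UNIV. matrix_inv (metric_matrix A g c x) $ i $ l *
     (metric_deriv A g c x j l k + metric_deriv A g c x k l j - metric_deriv A g c x l j k)) / 2"

section \<open>Conformal harmonic immersions of the disc\<close>

abbreviation unit_disc :: "complex set" where
  "unit_disc \<equiv> ball 0 1"

definition d_dz :: "(complex \<Rightarrow> complex) \<Rightarrow> complex \<Rightarrow> complex" where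
  "d_dz f z = (frechet_derivative f (at z) 1 - \<i> * frechet_derivative f (at z) \<i>) / 2"

definition d_dzbar :: "(complex \<Rightarrow> complex) \<Rightarrow> complex \<Rightarrow> complex" where
  "d_dzbar f z = (frechet_derivative f (at z) 1 + \<i> * frechet_derivative f (at z) \<i>) / 2"

definition coord_fun :: "('m, 'n::finite) chart \<Rightarrow> (complex \<Rightarrow> 'm) \<Rightarrow> 'n \<Rightarrow> complex \<Rightarrow> complex" where
  "coord_fun c u i = (\<lambda>z. complex_of_real (snd c (u z) $ i))"

definition harmonic_disc ::
  "('m::topological_space, 'n::finite) chart set \<Rightarrow> ('m, 'n) metric \<Rightarrow> (complex \<Rightarrow> 'm) \<Rightarrow> bool" where
  "harmonic_disc A g u \<longleftrightarrow> smooth_map_on A unit_disc u \<and>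
     (\<forall>c\<in>A. \<forall>z\<in>unit_disc. u z \<in> fst c \<longrightarrow> (\<forall>i.
        d_dz (d_dzbar (coord_fun c u i)) z +
        (\<Sum>j\<in>UNIV. \<Sum>k\<in>UNIV. complex_of_real (christoffel A g c (snd c (u z)) i j k) *
           d_dz (coord_fun c u j) z * d_dzbar (coord_fun c u k) z) = 0))"

definition conformal_disc ::
  "('m::topological_space, 'n::finite) chart set \<Rightarrow> ('m, 'n) metric \<Rightarrow> (complex \<Rightarrow> 'm) \<Rightarrow> bool" where
  "conformal_disc A g u \<longleftrightarrow> smooth_map_on A unit_disc u \<and>
     (\<exists>\<phi> :: complex \<Rightarrow> real. smooth_on unit_disc \<phi> \<and>
        (\<forall>z\<in>unit_disc. \<forall>v w. g (u z) (differential A u z v) (differential A u z w) = exp (\<phi> z) * (v \<bullet> w)))"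

definition immersed_disc ::
  "('m::topological_space, 'n::finite) chart set \<Rightarrow> (complex \<Rightarrow> 'm) \<Rightarrow> bool" where
  "immersed_disc A u \<longleftrightarrow> smooth_map_on A unit_disc u \<and> (\<forall>z\<in>unit_disc. inj (differential A u z))"

definition conformal_harmonic_immersion ::
  "('m::topological_space, 'n::finite) chart set \<Rightarrow> ('m, 'n) metric \<Rightarrow> (complex \<Rightarrow> 'm) \<Rightarrow> bool" where
  "conformal_harmonic_immersion A g u \<longleftrightarrow>
     immersed_disc A u \<and> conformal_disc A g u \<and> harmonic_disc A g u"

section \<open>The Kobayashi pseudodistance\<close>

definition poincare_dist :: "complex \<Rightarrow> complex \<Rightarrow> real" where
  "poincare_dist z w = (let d = cmod (z - w) / cmod (1 - z * cnj w) in ln ((1 + d) / (1 - d)) / 2)"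

definition kobayashi_chain ::
  "('m::topological_space, 'n::finite) chart set \<Rightarrow> ('m, 'n) metric \<Rightarrow> 'm \<Rightarrow> 'm \<Rightarrow>
     (complex \<times> complex \<times> (complex \<Rightarrow> 'm)) list \<Rightarrow> bool" where
  "kobayashi_chain A g p q ch \<longleftrightarrow> ch \<noteq> [] \<and>
     (\<forall>(z, w, u) \<in> set ch. z \<in> unit_disc \<and> w \<in> unit_disc \<and> conformal_harmonic_immersion A g u) \<and>
     (case hd ch of (z, w, u) \<Rightarrow> u z = p) \<and>
     (case last ch of (z, w, u) \<Rightarrow> u w = q) \<and>
     (\<forall>k. Suc k < length ch \<longrightarrow>
        (case (ch ! k, ch ! Suc k) of ((z, w, u), (z', w', u')) \<Rightarrow> u w = u' z'))"

text \<open>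
  Infima are taken in \<open>ennreal\<close>, so that the infimum of the empty set is \<open>\<infinity>\<close>
  (on \<open>real\<close> it would be unspecified).
\<close>

definition kobayashi_dist ::
  "('m::topological_space, 'n::finite) chart set \<Rightarrow> ('m, 'n) metric \<Rightarrow> 'm \<Rightarrow> 'm \<Rightarrow> ennreal" where
  "kobayashi_dist A g p q = (INF ch \<in> {ch. kobayashi_chain A g p q ch}.
     ennreal (\<Sum>(z, w, u)\<leftarrow>ch. poincare_dist z w))"

section \<open>The Kobayashi--Royden pseudometric and its integrated form\<close>

definition kobayashi_royden ::
  "('m::topological_space, 'n::finite) chart set \<Rightarrow> ('m, 'n) metric \<Rightarrow> 'm \<Rightarrow> ('m, 'n) tangent \<Rightarrow> ennreal" where
  "kobayashi_royden A g p \<xi> = (if \<xi> = (\<lambda>c. 0) then 0 else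
     (INF r \<in> {r. r > 0 \<and> (\<exists>u. conformal_harmonic_immersion A g u \<and> u 0 = p \<and>
                            differential A u 0 1 = (\<lambda>c. r *\<^sub>R \<xi> c))}. ennreal (1 / r)))"

text \<open>A curve is smooth on \<open>[a, b]\<close> if it extends to a smooth curve on a neighbourhood of \<open>[a, b]\<close>.\<close>

definition smooth_curve_on ::
  "('m::topological_space, 'n::finite) chart set \<Rightarrow> real \<Rightarrow> real \<Rightarrow> (real \<Rightarrow> 'm) \<Rightarrow> bool" where
  "smooth_curve_on A a b \<gamma> \<longleftrightarrow>
     (\<exists>T \<sigma>. open T \<and> {a..b} \<subseteq> T \<and> smooth_map_on A T \<sigma> \<and> (\<forall>t\<in>{a..b}. \<sigma> t = \<gamma> t))"

definition piecewise_smooth_path ::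
  "('m::topological_space, 'n::finite) chart set \<Rightarrow> (real \<Rightarrow> 'm) \<Rightarrow> bool" where
  "piecewise_smooth_path A \<gamma> \<longleftrightarrow> path \<gamma> \<and>
     (\<exists>(n::nat) \<tau>. \<tau> 0 = 0 \<and> \<tau> n = 1 \<and>
        (\<forall>i<n. \<tau> i < \<tau> (Suc i) \<and> smooth_curve_on A (\<tau> i) (\<tau> (Suc i)) \<gamma>))"

text \<open>
  The velocity \<open>differential A \<gamma> t 1\<close> may be meaningless at the break points and at \<open>0\<close> and \<open>1\<close>;
  these finitely many \<open>t\<close> do not affect the integral.
\<close>

definition integrated_kobayashi_royden ::
  "('m::topological_space, 'n::finite) chart set \<Rightarrow> ('m, 'n) metric \<Rightarrow> 'm \<Rightarrow> 'm \<Rightarrow> ennreal" where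
  "integrated_kobayashi_royden A g p q =
     (INF \<gamma> \<in> {\<gamma>. piecewise_smooth_path A \<gamma> \<and> pathstart \<gamma> = p \<and> pathfinish \<gamma> = q}.
        \<integral>\<^sup>+t\<in>{0..1}. kobayashi_royden A g (\<gamma> t) (differential A \<gamma> t 1) \<partial>lborel)"

end

theory Submission
  imports Defs "HOL-Complex_Analysis.Complex_Analysis"
begin

no_notation fps_nth (infixl "$" 75)

text \<open>
  A disc \<open>u\<close> maps the geodesic from \<open>z\<close> to \<open>w\<close> to a path whose \<open>F\<^sub>M\<close>-length is at most the
  Poincare distance of \<open>z\<close> and \<open>w\<close>, since conformal harmonic immersions may be precomposed with
  Moebius maps. Concatenating these paths along a chain shows that the integrated form is at most \<open>d\<^sub>M\<close>.

  For the converse one needs conformal harmonic discs through any two nearby points. In coordinates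
  rescaled by a small factor, and with the metric made flat away from the origin, the harmonic map
  equation on a large disc is \<open>\<Delta>u = F\<close> with \<open>F\<close> small. It is solved by a contraction for the convolution
  with the logarithmic kernel, through two prescribed points with almost prescribed derivatives; the solution is
  smooth because difference quotients solve the linearized equation. Extended to the plane, the
  derivatives become constant and conformal at infinity, so that Liouville's theorem kills the Hopf
  differential and the map is conformal. Hence \<open>d\<^sub>M\<close> is locally Lipschitz in charts.

  Given a path \<open>\<gamma>\<close>, the function \<open>t \<mapsto> d\<^sub>M(\<gamma>(a), \<gamma>(t))\<close> is then locally Lipschitz, and its upper right
  derivative is at most \<open>F\<^sub>M(\<gamma>, \<gamma>')\<close>: a disc tangent to \<open>\<gamma>\<close> at \<open>t\<close> stays within \<open>o(h)\<close> of
  \<open>\<gamma>(t + h)\<close>. The reverse Fatou lemma for the difference quotients and a subdivision of \<open>[0, 1]\<close>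
  give \<open>d\<^sub>M \<le> \<integral> F\<^sub>M(\<gamma>, \<gamma>')\<close>.
\<close>

section \<open>Calculus of smooth maps\<close>

text \<open>Conformality shapes the construction: a harmonic disc need not be conformal, and
  conformality is not part of the equation that is solved. It is obtained globally instead. When the
  metric is flat far out, the right-hand side has compact support and the derivatives tend to those
  of a linear map z \<mapsto> Re z a + Im z b; choosing a and b orthogonal of equal length makes the
  Hopf differential vanish at infinity. The fixed-point problem therefore carries finite-dimensional
  corrections: the value at 0 and the vector a are adjusted so that both points are hit, and b
  follows a as its conformal partner. The dimension hypothesis provides such a partner. The unknown
  is u together with its two partial derivatives. The logarithm and its first derivatives are
  locally integrable kernels, so the whole argument contracts in the sup norm, without Hoelder or
  Sobolev spaces. The pseudometric is not known to be measurable along a path, so each of the two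
  inequalities is proved against a measurable function on the appropriate side of it.\<close>

lemma Ck_on_Suc_imp: "Ck_on (Suc k) S f \<Longrightarrow> Ck_on k S f"
proof (induction k arbitrary: f)
  case 0
  then show ?case
    by (meson Ck_on.simps continuous_at_imp_continuous_on differentiable_imp_continuous_within)
next
  case (Suc k)
  show ?case
    unfolding Ck_on.simps(2)[of k]
  proof (intro conjI ballI allI)
    show "f differentiable at x" if "x \<in> S" for x using Suc.prems that by simp
    show "Ck_on k S (\<lambda>x. frechet_derivative f (at x) v)" for v
      by (rule Suc.IH) (use Suc.prems in simp)
  qed
qed

lemma Ck_on_le: "Ck_on k S f \<Longrightarrow> j \<le> k \<Longrightarrow> Ck_on j S f"
  by (induction k) (use Ck_on_Suc_imp le_Suc_eq in blast)+

lemma Ck_on_continuous: "Ck_on k S f \<Longrightarrow> continuous_on S f"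
  using Ck_on_le[of k S f 0] by simp

lemma Ck_on_subset: "Ck_on k S f \<Longrightarrow> T \<subseteq> S \<Longrightarrow> Ck_on k T f"
  by (induction k arbitrary: f) (auto intro: continuous_on_subset)

lemma has_derivative_cong_open:
  assumes "open S" "x \<in> S" "\<And>y. y \<in> S \<Longrightarrow> f y = g y"
  shows "(f has_derivative D) (at x) \<longleftrightarrow> (g has_derivative D) (at x)"
proof
  show "(g has_derivative D) (at x)" if "(f has_derivative D) (at x)"
    by (rule has_derivative_transform_within_open[OF that assms])
  show "(f has_derivative D) (at x)" if "(g has_derivative D) (at x)"
    by (rule has_derivative_transform_within_open[OF that assms(1,2) assms(3)[symmetric]])
qed

lemma frechet_derivative_cong_open:
  assumes "open S" "x \<in> S" "\<And>y. y \<in> S \<Longrightarrow> f y = g y"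
  shows "frechet_derivative f (at x) = frechet_derivative g (at x)"
proof -
  have "(f has_derivative D) (at x) \<longleftrightarrow> (g has_derivative D) (at x)" for D
    by (rule has_derivative_cong_open[OF assms])
  then show ?thesis by (simp add: frechet_derivative_def)
qed

lemma differentiable_cong_open:
  assumes "open S" "x \<in> S" "\<And>y. y \<in> S \<Longrightarrow> f y = g y"
  shows "f differentiable (at x) \<longleftrightarrow> g differentiable (at x)"
proof -
  have "(f has_derivative D) (at x) \<longleftrightarrow> (g has_derivative D) (at x)" for D
    by (rule has_derivative_cong_open[OF assms])
  then show ?thesis by (simp add: differentiable_def)
qed

lemma Ck_on_cong:
  assumes "open S" "\<And>x. x \<in> S \<Longrightarrow> f x = g x"
  shows "Ck_on k S f \<longleftrightarrow> Ck_on k S g"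
  using assms(2)
proof (induction k arbitrary: f g)
  case 0
  then show ?case by (simp cong: continuous_on_cong)
next
  case (Suc k)
  have "f differentiable at x \<longleftrightarrow> g differentiable at x" if "x \<in> S" for x
    using differentiable_cong_open[OF assms(1) that] Suc.prems by blast
  moreover have "Ck_on k S (\<lambda>x. frechet_derivative f (at x) v) \<longleftrightarrow>
      Ck_on k S (\<lambda>x. frechet_derivative g (at x) v)" for v
  proof (rule Suc.IH)
    show "frechet_derivative f (at x) v = frechet_derivative g (at x) v" if "x \<in> S" for x
      using frechet_derivative_cong_open[OF assms(1) that Suc.prems] by simp
  qed
  ultimately show ?case by simp
qed

lemma Ck_on_local:
  assumes "\<And>x. x \<in> S \<Longrightarrow> \<exists>T. open T \<and> x \<in> T \<and> Ck_on k T f"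
  shows "Ck_on k S f"
  using assms
proof (induction k arbitrary: f)
  case 0
  have "continuous (at x) f" if "x \<in> S" for x
    using 0[OF that] by (auto simp: continuous_on_eq_continuous_at)
  then show ?case by (simp add: continuous_at_imp_continuous_on)
next
  case (Suc k)
  have "f differentiable at x" if "x \<in> S" for x
    using Suc.prems[OF that] by auto
  moreover have "Ck_on k S (\<lambda>x. frechet_derivative f (at x) v)" for v
  proof (rule Suc.IH)
    fix x assume "x \<in> S"
    from Suc.prems[OF this] obtain T where "open T" "x \<in> T" "Ck_on (Suc k) T f" by blast
    then show "\<exists>T. open T \<and> x \<in> T \<and> Ck_on k T (\<lambda>x. frechet_derivative f (at x) v)"
      by (intro exI[of _ T]) simp
  qed
  ultimately show ?case by simp
qed

text \<open>\<open>Ck_on\<close> is phrased with the chosen \<open>frechet_derivative\<close>;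
  uniqueness of derivatives on an open set lets any explicit family D replace it. The closure lemmas
  that follow are inductions on k through this rule.\<close>

lemma Ck_on_SucI:
  assumes "open S" "\<And>x. x \<in> S \<Longrightarrow> (f has_derivative D x) (at x)"
    and "\<And>v. Ck_on k S (\<lambda>x. D x v)"
  shows "Ck_on (Suc k) S f"
proof -
  have "frechet_derivative f (at x) = D x" if "x \<in> S" for x
    using frechet_derivative_at[OF assms(2)[OF that]] by simp
  then have "Ck_on k S (\<lambda>x. frechet_derivative f (at x) v)" for v
    using assms(3)[of v] Ck_on_cong[OF assms(1), of "\<lambda>x. frechet_derivative f (at x) v" "\<lambda>x. D x v"]
    by simp
  then show ?thesis using assms(2) by (auto simp: differentiable_def)
qed

lemma Ck_on_SucD:
  assumes "Ck_on (Suc k) S f" "x \<in> S"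
  shows "(f has_derivative frechet_derivative f (at x)) (at x)"
  using assms by (simp add: frechet_derivative_works)

section \<open>Stability of the classes C^k under algebra and composition\<close>

lemma Ck_on_const: "Ck_on k S (\<lambda>x. c)"
  by (induction k arbitrary: c) (simp_all add: frechet_derivative_const)

lemma Ck_on_bounded_linear:
  assumes "bounded_linear L" shows "Ck_on k S L"
proof (cases k)
  case 0
  then show ?thesis using assms by (simp add: linear_continuous_on)
next
  case (Suc j)
  have "frechet_derivative L (at x) = L" for x
    by (metis assms bounded_linear_imp_has_derivative frechet_derivative_at)
  then show ?thesis
    using assms Suc Ck_on_const[of j S] by (auto simp: bounded_linear_imp_differentiable)
qed

lemma Ck_on_id: "Ck_on k S (\<lambda>x. x)"
  by (rule Ck_on_bounded_linear) (rule bounded_linear_ident)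

lemma Ck_on_add:
  assumes "open S" "Ck_on k S f" "Ck_on k S g"
  shows "Ck_on k S (\<lambda>x. f x + g x)"
  using assms(2,3)
proof (induction k arbitrary: f g)
  case 0 then show ?case by (simp add: continuous_on_add)
next
  case (Suc k)
  show ?case
  proof (rule Ck_on_SucI[OF assms(1)])
    show "((\<lambda>x. f x + g x) has_derivative (\<lambda>v. frechet_derivative f (at x) v + frechet_derivative g (at x) v)) (at x)"
      if "x \<in> S" for x
      by (intro has_derivative_add Ck_on_SucD[OF Suc.prems(1) that] Ck_on_SucD[OF Suc.prems(2) that])
    show "Ck_on k S (\<lambda>x. frechet_derivative f (at x) v + frechet_derivative g (at x) v)" for v
      by (rule Suc.IH) (use Suc.prems in auto)
  qed
qed

lemma Ck_on_linear_comp: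
  assumes "open S" "bounded_linear L" "Ck_on k S f"
  shows "Ck_on k S (\<lambda>x. L (f x))"
  using assms(3)
proof (induction k arbitrary: f)
  case 0 then show ?case
    by (simp add: bounded_linear.continuous_on[OF assms(2)])
next
  case (Suc k)
  show ?case
  proof (rule Ck_on_SucI[OF assms(1)])
    show "((\<lambda>x. L (f x)) has_derivative (\<lambda>v. L (frechet_derivative f (at x) v))) (at x)"
      if "x \<in> S" for x
      by (intro bounded_linear.has_derivative[OF assms(2)] Ck_on_SucD[OF Suc.prems that])
    show "Ck_on k S (\<lambda>x. L (frechet_derivative f (at x) v))" for v
      by (rule Suc.IH) (use Suc.prems in auto)
  qed
qed

lemma Ck_on_bilinear:
  assumes "open S" "bounded_bilinear B" "Ck_on k S f" "Ck_on k S g"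
  shows "Ck_on k S (\<lambda>x. B (f x) (g x))"
  using assms(3,4)
proof (induction k arbitrary: f g)
  case 0 then show ?case by (simp add: bounded_bilinear.continuous_on[OF assms(2)])
next
  case (Suc k)
  show ?case
  proof (rule Ck_on_SucI[OF assms(1)])
    show "((\<lambda>x. B (f x) (g x)) has_derivative
        (\<lambda>v. B (f x) (frechet_derivative g (at x) v) + B (frechet_derivative f (at x) v) (g x))) (at x)"
      if "x \<in> S" for x
      by (intro bounded_bilinear.FDERIV[OF assms(2)] Ck_on_SucD[OF Suc.prems(1) that] Ck_on_SucD[OF Suc.prems(2) that])
    show "Ck_on k S (\<lambda>x. B (f x) (frechet_derivative g (at x) v) + B (frechet_derivative f (at x) v) (g x))" for v
      by (intro Ck_on_add[OF assms(1)] Suc.IH)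
        (use Suc.prems Ck_on_Suc_imp[OF Suc.prems(1)] Ck_on_Suc_imp[OF Suc.prems(2)] in auto)
  qed
qed

lemma Ck_on_sum:
  assumes "open S" "\<And>i. i \<in> I \<Longrightarrow> Ck_on k S (f i)"
  shows "Ck_on k S (\<lambda>x. \<Sum>i\<in>I. f i x)"
proof (cases "finite I")
  case True
  then show ?thesis using assms(2)
    by (induction I) (auto intro!: Ck_on_add[OF assms(1)] simp: Ck_on_const)
qed (simp add: Ck_on_const)

lemmas Ck_on_scaleR = Ck_on_bilinear[OF _ bounded_bilinear_scaleR]
lemmas Ck_on_mult = Ck_on_bilinear[OF _ bounded_bilinear_mult]
lemmas Ck_on_inner = Ck_on_bilinear[OF _ bounded_bilinear_inner]

lemma Ck_on_minus: "open S \<Longrightarrow> Ck_on k S f \<Longrightarrow> Ck_on k S (\<lambda>x. - f x)"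
  by (rule Ck_on_linear_comp[OF _ bounded_linear_minus[OF bounded_linear_ident]])

lemma Ck_on_diff: "open S \<Longrightarrow> Ck_on k S f \<Longrightarrow> Ck_on k S g \<Longrightarrow> Ck_on k S (\<lambda>x. f x - g x)"
  using Ck_on_add[of S k f "\<lambda>x. - g x"] Ck_on_minus[of S k g] by simp

lemma Ck_on_prod:
  assumes "open S" "\<And>i. i \<in> I \<Longrightarrow> Ck_on k S (f i)"
  shows "Ck_on k S (\<lambda>x. \<Prod>i\<in>I. f i x :: 'b :: {real_normed_algebra_1, comm_ring_1})"
proof (cases "finite I")
  case True
  then show ?thesis using assms(2)
    by (induction I) (auto intro!: Ck_on_mult[OF assms(1)] simp: Ck_on_const)
qed (simp add: Ck_on_const)

text \<open>The chain rule applies the derivative of g at f x to a vector that itself varies with x,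
  whereas \<open>Ck_on\<close> controls derivatives in a fixed direction. Expanding that vector in
  the basis of the target of f separates the two dependences.\<close>

lemma Ck_on_compose:
  fixes f :: "'a::real_normed_vector \<Rightarrow> 'b::euclidean_space" and g :: "'b \<Rightarrow> 'c::real_normed_vector"
  assumes "open S" "open T" "Ck_on k S f" "Ck_on k T g" "\<And>x. x \<in> S \<Longrightarrow> f x \<in> T"
  shows "Ck_on k S (\<lambda>x. g (f x))"
  using assms(3,4)
proof (induction k arbitrary: g)
  case 0 then show ?case using assms(5)
    by (auto intro!: continuous_on_compose2[of T g S f])
next
  case (Suc k)
  let ?D = "\<lambda>x v. \<Sum>b\<in>Basis. (frechet_derivative f (at x) v \<bullet> b) *\<^sub>R frechet_derivative g (at (f x)) b"
  show ?case
  proof (rule Ck_on_SucI[OF assms(1)])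
    fix x assume x: "x \<in> S"
    have g': "(g has_derivative frechet_derivative g (at (f x))) (at (f x))"
      by (rule Ck_on_SucD[OF Suc.prems(2) assms(5)[OF x]])
    then interpret g: linear "frechet_derivative g (at (f x))"
      by (simp add: has_derivative_def bounded_linear.linear)
    have "((\<lambda>x. g (f x)) has_derivative (\<lambda>v. frechet_derivative g (at (f x)) (frechet_derivative f (at x) v))) (at x)"
      by (rule has_derivative_compose[OF Ck_on_SucD[OF Suc.prems(1) x] g'])
    also have "(\<lambda>v. frechet_derivative g (at (f x)) (frechet_derivative f (at x) v)) = ?D x"
    proof
      fix v
      have "frechet_derivative f (at x) v = (\<Sum>b\<in>Basis. (frechet_derivative f (at x) v \<bullet> b) *\<^sub>R b)"
        by (simp add: euclidean_representation)
      then show "frechet_derivative g (at (f x)) (frechet_derivative f (at x) v) = ?D x v"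
        by (metis (no_types, lifting) g.sum g.scaleR sum.cong)
    qed
    finally show "((\<lambda>x. g (f x)) has_derivative ?D x) (at x)" .
  next
    fix v
    have "Ck_on k S (\<lambda>x. frechet_derivative f (at x) v \<bullet> b)" for b
      by (intro Ck_on_inner assms(1) Ck_on_const) (use Suc.prems in auto)
    moreover have "Ck_on k S (\<lambda>x. frechet_derivative g (at (f x)) b)" for b
      by (rule Suc.IH) (use Suc.prems Ck_on_Suc_imp[OF Suc.prems(1)] in auto)
    ultimately show "Ck_on k S (\<lambda>x. ?D x v)"
      by (intro Ck_on_sum Ck_on_scaleR assms(1))
  qed
qed

lemma Ck_on_componentwise:
  fixes f :: "'a::real_normed_vector \<Rightarrow> 'b::euclidean_space"
  assumes "open S" "\<And>b. b \<in> Basis \<Longrightarrow> Ck_on k S (\<lambda>x. f x \<bullet> b)"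
  shows "Ck_on k S f"
proof -
  have "Ck_on k S (\<lambda>x. \<Sum>b\<in>Basis. (f x \<bullet> b) *\<^sub>R b)"
    by (intro Ck_on_sum Ck_on_scaleR assms Ck_on_const)
  then show ?thesis by (simp add: euclidean_representation)
qed

lemma Ck_on_vec:
  fixes f :: "'a::real_normed_vector \<Rightarrow> real ^ 'n"
  assumes "open S" "\<And>i. Ck_on k S (\<lambda>x. f x $ i)"
  shows "Ck_on k S f"
  by (rule Ck_on_componentwise[OF assms(1)]) (auto simp: Basis_vec_def inner_axis assms(2))

lemma Ck_on_nth: "open S \<Longrightarrow> Ck_on k S f \<Longrightarrow> Ck_on k S (\<lambda>x. f x $ i :: real)"
  by (rule Ck_on_linear_comp[OF _ bounded_linear_vec_nth])

lemma Ck_on_Pair: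
  assumes "open S" "Ck_on k S f" "Ck_on k S g"
  shows "Ck_on k S (\<lambda>x. (f x, g x))"
proof -
  have "Ck_on k S (\<lambda>x. (f x, 0) + (0, g x))"
    by (intro Ck_on_add assms Ck_on_linear_comp[OF assms(1) _ assms(2)] Ck_on_linear_comp[OF assms(1) _ assms(3)]
        bounded_linear_Pair bounded_linear_ident bounded_linear_zero)
  then show ?thesis by simp
qed

lemmas Ck_on_fst = Ck_on_linear_comp[OF _ bounded_linear_fst]
lemmas Ck_on_snd = Ck_on_linear_comp[OF _ bounded_linear_snd]
lemmas Ck_on_of_real = Ck_on_linear_comp[OF _ bounded_linear_of_real]

lemma Ck_on_inverse:
  fixes f :: "'a::real_normed_vector \<Rightarrow> real"
  assumes "open S" "Ck_on k S f" "\<And>x. x \<in> S \<Longrightarrow> f x \<noteq> 0"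
  shows "Ck_on k S (\<lambda>x. inverse (f x))"
  using assms(2)
proof (induction k)
  case 0 then show ?case using assms(3) by (simp add: continuous_on_inverse)
next
  case (Suc k)
  let ?D = "\<lambda>x v. - (inverse (f x) * frechet_derivative f (at x) v * inverse (f x))"
  have IH: "Ck_on k S (\<lambda>x. inverse (f x))" by (rule Suc.IH[OF Ck_on_Suc_imp[OF Suc.prems]])
  show ?case
  proof (rule Ck_on_SucI[OF assms(1), where D = ?D])
    fix x assume "x \<in> S"
    show "((\<lambda>x. inverse (f x)) has_derivative ?D x) (at x)"
      by (rule Deriv.has_derivative_inverse[OF assms(3)[OF \<open>x \<in> S\<close>] Ck_on_SucD[OF Suc.prems \<open>x \<in> S\<close>]])
  next
    show "Ck_on k S (\<lambda>x. ?D x v)" for v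
      by (intro Ck_on_minus Ck_on_mult assms(1) IH) (use Suc.prems in auto)
  qed
qed

lemma Ck_on_divide:
  fixes f g :: "'a::real_normed_vector \<Rightarrow> real"
  assumes "open S" "Ck_on k S f" "Ck_on k S g" "\<And>x. x \<in> S \<Longrightarrow> g x \<noteq> 0"
  shows "Ck_on k S (\<lambda>x. f x / g x)"
  unfolding divide_inverse by (intro Ck_on_mult Ck_on_inverse assms)

lemma Ck_on_field_deriv:
  fixes f :: "real \<Rightarrow> real"
  assumes "open S" "\<And>x. x \<in> S \<Longrightarrow> (f has_real_derivative f' x) (at x)" "Ck_on k S f'"
  shows "Ck_on (Suc k) S f"
  by (rule Ck_on_SucI[OF assms(1), where D = "\<lambda>x v. f' x * v"])
    (use assms in \<open>auto simp: has_field_derivative_def intro!: Ck_on_mult Ck_on_const\<close>)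

lemma Ck_on_ln:
  fixes f :: "'a::real_normed_vector \<Rightarrow> real"
  assumes "open S" "Ck_on k S f" "\<And>x. x \<in> S \<Longrightarrow> f x > 0"
  shows "Ck_on k S (\<lambda>x. ln (f x))"
proof -
  have "Ck_on (Suc k) {0<..} (ln :: real \<Rightarrow> real)"
    by (rule Ck_on_field_deriv[where f' = inverse])
      (auto intro!: DERIV_ln Ck_on_inverse Ck_on_id)
  from Ck_on_Suc_imp[OF this] show ?thesis
    by (intro Ck_on_compose[OF assms(1) _ assms(2), of "{0<..}" ln]) (auto simp: assms(3))
qed

text \<open>The complex derivative is holomorphic again, so the induction never leaves the class of
  holomorphic functions.\<close>

lemma Ck_on_holomorphic:
  assumes "open S" "f holomorphic_on S"
  shows "Ck_on k S f"
  using assms(2)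
proof (induction k arbitrary: f)
  case 0 then show ?case by (simp add: holomorphic_on_imp_continuous_on)
next
  case (Suc k)
  show ?case
  proof (rule Ck_on_SucI[OF assms(1), where D = "\<lambda>x v. deriv f x * v"])
    show "(f has_derivative (\<lambda>v. deriv f x * v)) (at x)" if "x \<in> S" for x
      using holomorphic_derivI[OF Suc.prems assms(1) that] by (simp add: has_field_derivative_def)
    show "Ck_on k S (\<lambda>x. deriv f x * v)" for v
      by (intro Ck_on_mult assms(1) Suc.IH holomorphic_deriv Suc.prems Ck_on_const)
  qed
qed

lemma Ck_on_frechet: "Ck_on (Suc k) S f \<Longrightarrow> Ck_on k S (\<lambda>x. frechet_derivative f (at x) v)"
  by simp

lemma smooth_on_frechet: "smooth_on S f \<Longrightarrow> smooth_on S (\<lambda>x. frechet_derivative f (at x) v)"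
  unfolding smooth_on_def using Ck_on_frechet by blast

lemma smooth_on_has_derivative:
  "smooth_on S f \<Longrightarrow> x \<in> S \<Longrightarrow> (f has_derivative frechet_derivative f (at x)) (at x)"
  unfolding smooth_on_def using Ck_on_SucD by blast

lemma smooth_on_continuous_on: "smooth_on S f \<Longrightarrow> continuous_on S f"
  unfolding smooth_on_def using Ck_on_continuous by blast

lemma smooth_on_cong: "open S \<Longrightarrow> (\<And>x. x \<in> S \<Longrightarrow> f x = g x) \<Longrightarrow> smooth_on S f \<longleftrightarrow> smooth_on S g"
  unfolding smooth_on_def using Ck_on_cong by metis

lemma smooth_on_compose:
  fixes f :: "'a::real_normed_vector \<Rightarrow> 'b::euclidean_space" and g :: "'b \<Rightarrow> 'c::real_normed_vector"
  assumes "open S" "open T" "smooth_on S f" "smooth_on T g" "\<And>x. x \<in> S \<Longrightarrow> f x \<in> T"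
  shows "smooth_on S (\<lambda>x. g (f x))"
  using assms unfolding smooth_on_def by (blast intro: Ck_on_compose)

lemma smooth_on_subset: "smooth_on S f \<Longrightarrow> T \<subseteq> S \<Longrightarrow> smooth_on T f"
  unfolding smooth_on_def using Ck_on_subset by blast

section \<open>Bump functions\<close>

text \<open>The parameter n makes the family closed under differentiation: the derivative is a
  combination of the members n + 2 and n + 1. Smoothness of all members is then a single induction
  over the order.\<close>

definition flat_exp :: "nat \<Rightarrow> real \<Rightarrow> real" where
  "flat_exp n t = (if t > 0 then exp (- inverse t) * inverse t ^ n else 0)"

lemma flat_exp_tendsto: "(flat_exp n \<longlongrightarrow> 0) (at_right 0)"
proof -
  have "((\<lambda>t. exp (- t) * t ^ n) \<longlongrightarrow> (0::real)) at_top"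
    using tendsto_power_div_exp_0[of n] by (simp add: exp_minus field_simps)
  from filterlim_compose[OF this filterlim_inverse_at_top_right]
  have "((\<lambda>t. exp (- inverse t) * inverse t ^ n) \<longlongrightarrow> (0::real)) (at_right 0)" .
  then show ?thesis
    by (rule Lim_transform_eventually)
      (auto simp: flat_exp_def eventually_at_right_field intro!: exI[of _ 1])
qed

lemma flat_exp_deriv:
  "(flat_exp n has_real_derivative flat_exp (n + 2) t - real n * flat_exp (n + 1) t) (at t)"
proof (cases t "0 :: real" rule: linorder_cases)
  case less
  have "((\<lambda>t. 0) has_real_derivative 0) (at t)" by simp
  moreover have "\<forall>\<^sub>F s in nhds t. 0 = flat_exp n s"
    using less eventually_nhds_in_open[of "{..<0}" t] by (auto simp: flat_exp_def elim!: eventually_mono)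
  ultimately show ?thesis using less
    by (subst DERIV_cong_ev[symmetric, OF refl _ refl, where f = "\<lambda>_. 0"]) (auto simp: flat_exp_def)
next
  case greater
  have "((\<lambda>t. exp (- inverse t) * inverse t ^ n) has_real_derivative
      exp (- inverse t) * inverse t ^ (n + 2) - real n * (exp (- inverse t) * inverse t ^ (n + 1))) (at t)"
  proof (rule DERIV_cong)
    have "(inverse has_real_derivative - (inverse t * inverse t)) (at t)"
      using greater DERIV_inverse[of t UNIV] by (simp add: power2_eq_square)
    from DERIV_mult[OF DERIV_fun_exp[OF DERIV_minus[OF this]] DERIV_power[OF this, of n]]
    show "((\<lambda>t. exp (- inverse t) * inverse t ^ n) has_real_derivative
        exp (- inverse t) * (inverse t * inverse t) * inverse t ^ n +
        real n * (- (inverse t * inverse t) * inverse t ^ (n - Suc 0)) * exp (- inverse t)) (at t)"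
      by (simp add: algebra_simps)
    show "exp (- inverse t) * (inverse t * inverse t) * inverse t ^ n +
        real n * (- (inverse t * inverse t) * inverse t ^ (n - Suc 0)) * exp (- inverse t) =
      exp (- inverse t) * inverse t ^ (n + 2) - real n * (exp (- inverse t) * inverse t ^ (n + 1))"
      by (cases n) (simp_all add: power2_eq_square algebra_simps)
  qed
  moreover have "\<forall>\<^sub>F s in nhds t. exp (- inverse s) * inverse s ^ n = flat_exp n s"
    using greater eventually_nhds_in_open[of "{0<..}" t] by (auto simp: flat_exp_def elim!: eventually_mono)
  ultimately show ?thesis using greater
    by (subst DERIV_cong_ev[symmetric, OF refl _ refl, where f = "\<lambda>t. exp (- inverse t) * inverse t ^ n"])
      (auto simp: flat_exp_def)
next
  case equal
  \<comment> \<open>At the origin the right difference quotient is the member n + 1 of the family,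
    which tends to 0; the left one vanishes.\<close>
  have "((\<lambda>s. (flat_exp n s - flat_exp n 0) / (s - 0)) \<longlongrightarrow> 0) (at 0)"
  proof (subst filterlim_split_at_real, safe)
    show "((\<lambda>s. (flat_exp n s - flat_exp n 0) / (s - 0)) \<longlongrightarrow> 0) (at_right 0)"
      using flat_exp_tendsto[of "n + 1"]
      by (rule Lim_transform_eventually)
        (auto simp: flat_exp_def eventually_at_right_field divide_inverse intro!: exI[of _ 1])
    show "((\<lambda>s. (flat_exp n s - flat_exp n 0) / (s - 0)) \<longlongrightarrow> 0) (at_left 0)"
      by (rule Lim_transform_eventually[OF tendsto_const])
        (auto simp: flat_exp_def eventually_at_left_field intro!: exI[of _ "-1"])
  qed
  then show ?thesis using equal by (simp add: has_field_derivative_iff flat_exp_def)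
qed

lemma Ck_on_flat_exp: "Ck_on k UNIV (flat_exp n)"
proof (induction k arbitrary: n)
  case 0
  show ?case
    using DERIV_isCont[OF flat_exp_deriv] by (simp add: continuous_at_imp_continuous_on)
next
  case (Suc k)
  show ?case
    by (rule Ck_on_field_deriv[OF open_UNIV flat_exp_deriv])
      (intro Ck_on_diff Ck_on_mult Ck_on_const Suc open_UNIV)
qed

text \<open>The smooth step between the radii 1 and 2 as a quotient of flat exponentials. It is
  built from y \<bullet> y because the norm is not smooth at the origin; 4 - y \<bullet> y and y
  \<bullet> y - 1 have sum 3, so they are never both nonpositive and the denominator is
  positive.\<close>

definition bump :: "'a::euclidean_space \<Rightarrow> real" where
  "bump y = flat_exp 0 (4 - y \<bullet> y) / (flat_exp 0 (4 - y \<bullet> y) + flat_exp 0 (y \<bullet> y - 1))"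

lemma flat_exp_nonneg: "flat_exp n t \<ge> 0"
  and flat_exp_0_pos: "t > 0 \<Longrightarrow> flat_exp n t > 0"
  and flat_exp_0_eq: "t \<le> 0 \<Longrightarrow> flat_exp n t = 0"
  by (auto simp: flat_exp_def)

lemma bump_denominator_pos: "flat_exp 0 (4 - y \<bullet> y) + flat_exp 0 (y \<bullet> y - 1) > 0"
proof (cases "y \<bullet> y < 4")
  case True
  then show ?thesis
    by (intro add_pos_nonneg flat_exp_0_pos flat_exp_nonneg) simp
next
  case False
  then show ?thesis
    by (intro add_nonneg_pos flat_exp_0_pos flat_exp_nonneg) simp
qed

lemma bump_range: "0 \<le> bump y" "bump y \<le> 1"
  unfolding bump_def using bump_denominator_pos[of y] flat_exp_nonneg[of 0 "4 - y \<bullet> y"]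
    flat_exp_nonneg[of 0 "y \<bullet> y - 1"]
  by (auto simp: divide_le_eq_1)

lemma bump_eq_1: "norm y \<le> 1 \<Longrightarrow> bump y = 1"
  using bump_denominator_pos[of y] flat_exp_0_eq[of "y \<bullet> y - 1" 0]
  by (simp add: bump_def dot_square_norm power_le_one)

lemma bump_eq_0: "norm y \<ge> 2 \<Longrightarrow> bump y = 0"
  using flat_exp_0_eq[of "4 - y \<bullet> y" 0] power_mono[of 2 "norm y" 2]
  by (simp add: bump_def dot_square_norm)

lemma Ck_on_bump: "Ck_on k UNIV (bump :: 'a::euclidean_space \<Rightarrow> real)"
proof -
  have sq: "Ck_on k UNIV (\<lambda>y::'a. y \<bullet> y)"
    by (rule Ck_on_inner[OF open_UNIV Ck_on_id Ck_on_id])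
  have *: "Ck_on k UNIV (\<lambda>y::'a. flat_exp 0 (h y))" if "Ck_on k UNIV h" for h
    by (rule Ck_on_compose[OF _ _ that Ck_on_flat_exp]) auto
  have n: "Ck_on k UNIV (\<lambda>y::'a. flat_exp 0 (4 - y \<bullet> y))" "Ck_on k UNIV (\<lambda>y::'a. flat_exp 0 (y \<bullet> y - 1))"
    by (rule *, rule Ck_on_diff[OF open_UNIV], rule Ck_on_const sq, rule Ck_on_const sq)+
  show ?thesis
    unfolding bump_def
    by (rule Ck_on_divide[OF open_UNIV n(1) Ck_on_add[OF open_UNIV n]])
      (rule less_imp_neq[OF bump_denominator_pos, symmetric])
qed

section \<open>Convolution with locally integrable kernels in the plane\<close>

text \<open>Kernels live on \<open>real \<times> real\<close>, where Lebesgue measure is a product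
  and integrals can be taken along coordinate lines; the functions convolved with them live on the
  complex plane.\<close>

abbreviation cx :: "real \<times> real \<Rightarrow> complex" where "cx \<zeta> \<equiv> Complex (fst \<zeta>) (snd \<zeta>)"

lemma norm_cx: "norm (cx \<zeta>) = norm \<zeta>"
  by (simp add: cmod_def norm_prod_def)

lemma continuous_cx: "continuous_on S cx"
  unfolding complex_eq by (intro continuous_intros)

text \<open>The translation acts on f and not on k, so regularity of the convolution comes from f
  even where the kernel is singular.\<close>

definition conv :: "(real \<times> real \<Rightarrow> real) \<Rightarrow> (complex \<Rightarrow> 'e) \<Rightarrow> complex \<Rightarrow> 'e::euclidean_space" where
  "conv k f z = (LINT \<zeta>|lborel. k \<zeta> *\<^sub>R f (z - cx \<zeta>))"

text \<open>For f supported in a fixed ball and z in a bounded set, cutting the kernel off far out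
  does not change the convolution. A locally integrable kernel becomes integrable in this way and
  then acts on every bounded continuous function.\<close>

definition trunc :: "real \<Rightarrow> (real \<times> real \<Rightarrow> real) \<Rightarrow> real \<times> real \<Rightarrow> real" where
  "trunc R k \<zeta> = indicator (cball 0 R) \<zeta> * k \<zeta>"

definition loc_integrable :: "(real \<times> real \<Rightarrow> real) \<Rightarrow> bool" where
  "loc_integrable k \<longleftrightarrow> (\<forall>R. integrable lborel (trunc R k))"

lemma borel_measurable_translate:
  fixes f :: "complex \<Rightarrow> 'e::euclidean_space"
  assumes "continuous_on UNIV f"
  shows "(\<lambda>\<zeta>. f (z - cx \<zeta>)) \<in> borel_measurable borel"
  by (intro borel_measurable_continuous_onI continuous_on_compose2[OF assms] continuous_intros continuous_cx) auto

lemma integrable_conv: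
  fixes f :: "complex \<Rightarrow> 'e::euclidean_space"
  assumes "integrable lborel k" "continuous_on UNIV f" "\<And>z. norm (f z) \<le> M"
  shows "integrable lborel (\<lambda>\<zeta>. k \<zeta> *\<^sub>R f (z - cx \<zeta>))"
proof (rule Bochner_Integration.integrable_bound)
  show "integrable lborel (\<lambda>\<zeta>. M * k \<zeta>)" using assms(1) by simp
  show "(\<lambda>\<zeta>. k \<zeta> *\<^sub>R f (z - cx \<zeta>)) \<in> borel_measurable lborel"
    using assms(1) borel_measurable_translate[OF assms(2)]
    by (intro borel_measurable_scaleR) (auto dest: borel_measurable_integrable)
  have "norm (f w) \<le> \<bar>M\<bar>" for w using assms(3)[of w] by linarith
  then show "AE \<zeta> in lborel. norm (k \<zeta> *\<^sub>R f (z - cx \<zeta>)) \<le> norm (M * k \<zeta>)"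
    by (auto simp: abs_mult mult.commute[of "\<bar>M\<bar>"] intro!: AE_I2 mult_left_mono)
qed

lemma norm_conv_le:
  fixes f :: "complex \<Rightarrow> 'e::euclidean_space"
  assumes "integrable lborel k" "\<And>z. norm (f z) \<le> M"
  shows "norm (conv k f z) \<le> (LINT \<zeta>|lborel. \<bar>k \<zeta>\<bar>) * M"
proof -
  have M: "0 \<le> M" using assms(2)[of 0] norm_ge_zero order_trans by blast
  have "norm (conv k f z) \<le> (LINT \<zeta>|lborel. norm (k \<zeta> *\<^sub>R f (z - cx \<zeta>)))"
    unfolding conv_def by (rule integral_norm_bound)
  also have "\<dots> \<le> (LINT \<zeta>|lborel. \<bar>k \<zeta>\<bar> * M)"
    using assms M by (intro Bochner_Integration.integral_mono_AE') (auto intro!: mult_left_mono)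
  finally show ?thesis by simp
qed

lemma continuous_conv:
  fixes f :: "complex \<Rightarrow> 'e::euclidean_space"
  assumes k: "integrable lborel k" and f: "continuous_on UNIV f" and M: "\<And>z. norm (f z) \<le> M"
  shows "continuous_on UNIV (conv k f)"
proof -
  have "continuous (at z) (conv k f)" for z
  proof (rule continuous_at_sequentiallyI)
    fix u assume u: "u \<longlonglongrightarrow> z"
    have "(\<lambda>n. LINT \<zeta>|lborel. k \<zeta> *\<^sub>R f (u n - cx \<zeta>)) \<longlonglongrightarrow> (LINT \<zeta>|lborel. k \<zeta> *\<^sub>R f (z - cx \<zeta>))"
    proof (rule integral_dominated_convergence[where w = "\<lambda>\<zeta>. \<bar>k \<zeta>\<bar> * M"])
      show "AE \<zeta> in lborel. (\<lambda>n. k \<zeta> *\<^sub>R f (u n - cx \<zeta>)) \<longlonglongrightarrow> k \<zeta> *\<^sub>R f (z - cx \<zeta>)"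
      proof (intro AE_I2 tendsto_intros)
        fix \<zeta> :: "real \<times> real"
        have "isCont f (z - cx \<zeta>)" using f by (simp add: continuous_on_eq_continuous_at)
        then show "(\<lambda>n. f (u n - cx \<zeta>)) \<longlonglongrightarrow> f (z - cx \<zeta>)"
          by (rule isCont_tendsto_compose) (intro tendsto_intros u)
      qed
      show "AE \<zeta> in lborel. norm (k \<zeta> *\<^sub>R f (u n - cx \<zeta>)) \<le> \<bar>k \<zeta>\<bar> * M" for n
        using M by (auto intro!: mult_left_mono)
    qed (use k integrable_conv[OF k f M] in \<open>auto dest: borel_measurable_integrable\<close>)
    then show "(\<lambda>n. conv k f (u n)) \<longlonglongrightarrow> conv k f z" by (simp add: conv_def)
  qed
  then show ?thesis by (simp add: continuous_at_imp_continuous_on)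
qed

lemma conv_add:
  fixes f g :: "complex \<Rightarrow> 'e::euclidean_space"
  assumes "integrable lborel k" "continuous_on UNIV f" "\<And>z. norm (f z) \<le> M"
    "continuous_on UNIV g" "\<And>z. norm (g z) \<le> N"
  shows "conv k (\<lambda>z. f z + g z) z = conv k f z + conv k g z"
  unfolding conv_def scaleR_add_right
  by (rule Bochner_Integration.integral_add) (rule integrable_conv[OF assms(1)]; fact)+

lemma conv_scaleR: "conv k (\<lambda>z. c *\<^sub>R f z) z = c *\<^sub>R conv k f z"
  unfolding conv_def by (subst integral_scaleR_right[symmetric]) (simp add: ac_simps)

lemma conv_diff:
  fixes f g :: "complex \<Rightarrow> 'e::euclidean_space"
  assumes "integrable lborel k" "continuous_on UNIV f" "\<And>z. norm (f z) \<le> M"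
    "continuous_on UNIV g" "\<And>z. norm (g z) \<le> N"
  shows "conv k (\<lambda>z. f z - g z) z = conv k f z - conv k g z"
  unfolding conv_def scaleR_diff_right
  by (rule Bochner_Integration.integral_diff) (rule integrable_conv[OF assms(1)]; fact)+

lemma conv_translate: "conv k f (z + h) = conv k (\<lambda>w. f (w + h)) z"
  by (simp add: conv_def algebra_simps)

lemma conv_trunc:
  assumes "\<And>w. norm w > r \<Longrightarrow> f w = 0" "norm z + r \<le> R"
  shows "conv (trunc R k) f z = conv k f z"
  unfolding conv_def
proof (rule Bochner_Integration.integral_cong[OF refl])
  fix \<zeta> :: "real \<times> real"
  have "f (z - cx \<zeta>) = 0" if "\<zeta> \<notin> cball 0 R"
  proof (rule assms(1))
    have "norm \<zeta> \<le> norm z + norm (z - cx \<zeta>)"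
      using norm_triangle_ineq4[of z "z - cx \<zeta>"] norm_cx[of \<zeta>] by simp
    then show "norm (z - cx \<zeta>) > r" using that assms(2) by simp
  qed
  then show "trunc R k \<zeta> *\<^sub>R f (z - cx \<zeta>) = k \<zeta> *\<^sub>R f (z - cx \<zeta>)"
    by (auto simp: trunc_def indicator_def)
qed

lemma integrable_conv_compact:
  fixes f :: "complex \<Rightarrow> 'e::euclidean_space"
  assumes "loc_integrable k" "continuous_on UNIV f" "\<And>w. norm w > r \<Longrightarrow> f w = 0" "\<And>z. norm (f z) \<le> M"
  shows "integrable lborel (\<lambda>\<zeta>. k \<zeta> *\<^sub>R f (z - cx \<zeta>))"
proof -
  have "trunc (norm z + r) k \<zeta> *\<^sub>R f (z - cx \<zeta>) = k \<zeta> *\<^sub>R f (z - cx \<zeta>)" for \<zeta>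
  proof -
    have "f (z - cx \<zeta>) = 0" if "\<zeta> \<notin> cball 0 (norm z + r)"
    proof (rule assms(3))
      have "norm \<zeta> \<le> norm z + norm (z - cx \<zeta>)"
        using norm_triangle_ineq4[of z "z - cx \<zeta>"] norm_cx[of \<zeta>] by simp
      then show "norm (z - cx \<zeta>) > r" using that by simp
    qed
    then show ?thesis by (auto simp: trunc_def indicator_def)
  qed
  moreover have "integrable lborel (\<lambda>\<zeta>. trunc (norm z + r) k \<zeta> *\<^sub>R f (z - cx \<zeta>))"
    using assms(1,2,4) by (intro integrable_conv) (auto simp: loc_integrable_def)
  ultimately show ?thesis by (rule Bochner_Integration.integrable_cong[OF refl, THEN iffD1])
qed

section \<open>Compactly supported functions and their uniform Taylor expansions\<close>

lemma compact_support_bounded: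
  fixes f :: "'a::euclidean_space \<Rightarrow> 'b::real_normed_vector"
  assumes "continuous_on UNIV f" "\<And>w. norm w > r \<Longrightarrow> f w = 0"
  obtains M where "\<And>z. norm (f z) \<le> M"
proof -
  have "bounded (f ` cball 0 r)"
    by (intro compact_imp_bounded compact_continuous_image continuous_on_subset[OF assms(1)]) auto
  then obtain M where M: "\<And>z. z \<in> cball 0 r \<Longrightarrow> norm (f z) \<le> M"
    unfolding bounded_iff by blast
  have "norm (f z) \<le> max M 0" for z
    using M[of z] assms(2)[of z] by (cases "norm z \<le> r") auto
  then show ?thesis by (rule that)
qed

lemma compact_support_uniformly_continuous:
  fixes f :: "'a::euclidean_space \<Rightarrow> 'b::real_normed_vector"
  assumes "continuous_on UNIV f" "\<And>w. norm w > r \<Longrightarrow> f w = 0"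
  shows "uniformly_continuous_on UNIV f"
  unfolding uniformly_continuous_on_def
proof (intro allI impI)
  fix e :: real assume "e > 0"
  have "uniformly_continuous_on (cball 0 (r + 1)) f"
    by (intro compact_uniformly_continuous continuous_on_subset[OF assms(1)]) auto
  then obtain d where d: "d > 0"
    "\<And>x y. x \<in> cball 0 (r + 1) \<Longrightarrow> y \<in> cball 0 (r + 1) \<Longrightarrow> dist y x < d \<Longrightarrow> dist (f y) (f x) < e"
    using \<open>e > 0\<close> unfolding uniformly_continuous_on_def by metis
  have "dist (f y) (f x) < e" if "dist y x < min d 1" for x y
  proof (cases "norm x \<le> r \<or> norm y \<le> r")
    case True
    then have "x \<in> cball 0 (r + 1)" "y \<in> cball 0 (r + 1)"
      using that norm_triangle_sub[of x y] norm_triangle_sub[of y x]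
      by (auto simp: dist_norm norm_minus_commute)
    then show ?thesis using d(2) that by simp
  next
    case False
    then show ?thesis using assms(2) \<open>e > 0\<close> by simp
  qed
  then show "\<exists>d>0. \<forall>x\<in>UNIV. \<forall>x'\<in>UNIV. dist x' x < d \<longrightarrow> dist (f x') (f x) < e"
    using d(1) by (intro exI[of _ "min d 1"]) auto
qed

lemma frechet_derivative_zero_outside:
  fixes f :: "'a::real_normed_vector \<Rightarrow> 'b::real_normed_vector"
  assumes "\<And>w. norm w > r \<Longrightarrow> f w = 0" "norm w > r"
  shows "frechet_derivative f (at w) v = 0"
proof -
  have "open {w::'a. norm w > r}" by (intro open_Collect_less continuous_intros)
  then have "frechet_derivative f (at w) = frechet_derivative (\<lambda>_. 0) (at w)"
    by (rule frechet_derivative_cong_open) (use assms in auto)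
  then show ?thesis by (simp add: frechet_derivative_const)
qed

text \<open>The Taylor remainder is uniform in z because each partial derivative, being continuous
  with compact support, is uniformly continuous. The mean value inequality is applied to f minus its
  linear part at z, whose derivative is small on a ball around z.\<close>

lemma compact_support_uniform_derivative:
  fixes f :: "'a::euclidean_space \<Rightarrow> 'b::real_normed_vector"
  assumes f: "Ck_on 1 UNIV f" "\<And>w. norm w > r \<Longrightarrow> f w = 0" and "e > 0"
  obtains d where "d > 0"
    "\<And>z h. norm h < d \<Longrightarrow> norm (f (z + h) - f z - frechet_derivative f (at z) h) \<le> e * norm h"
proof -
  let ?D = "\<lambda>z. frechet_derivative f (at z)"
  \<comment> \<open>The operator norm is estimated by a sum over the basis directions, each of which
    gets an equal share of e.\<close>
  define e' where "e' = e / real DIM('a)"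
  have e': "e' > 0" using \<open>e > 0\<close> by (simp add: e'_def)
  have deriv: "(f has_derivative ?D z) (at z)" for z
    using f(1) by (simp add: frechet_derivative_works)
  have "\<forall>b\<in>Basis. \<exists>d>0. \<forall>z w. dist w z < d \<longrightarrow> norm (?D w b - ?D z b) < e'"
  proof
    fix b :: 'a
    have "uniformly_continuous_on UNIV (\<lambda>z. ?D z b)"
      by (rule compact_support_uniformly_continuous)
        (use f(1) frechet_derivative_zero_outside[OF f(2)] in auto)
    then show "\<exists>d>0. \<forall>z w. dist w z < d \<longrightarrow> norm (?D w b - ?D z b) < e'"
      using e' unfolding uniformly_continuous_on_def by (metis UNIV_I dist_norm)
  qed
  then obtain \<delta> where \<delta>: "\<And>b. b \<in> Basis \<Longrightarrow> \<delta> b > 0"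
    "\<And>b z w. b \<in> Basis \<Longrightarrow> dist w z < \<delta> b \<Longrightarrow> norm (?D w b - ?D z b) < e'" by metis
  define d where "d = Min (\<delta> ` Basis)"
  have d: "d > 0" "\<And>b. b \<in> Basis \<Longrightarrow> d \<le> \<delta> b" by (auto simp: d_def \<delta>(1))
  show ?thesis
  proof (rule that[OF d(1)])
    fix z h :: 'a assume h: "norm h < d"
    let ?g = "\<lambda>w. f w - ?D z w"
    have lin: "linear (?D w)" for w
      using deriv[of w] by (simp add: has_derivative_def bounded_linear.linear)
    have bl: "bounded_linear (?D w)" for w using deriv has_derivative_bounded_linear by blast
    have "norm (?g (z + h) - ?g z) \<le> e * norm ((z + h) - z)"
    proof (rule differentiable_bound[of "ball z d" ?g "\<lambda>w v. ?D w v - ?D z v"])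
      show "convex (ball z d)" "z + h \<in> ball z d" "z \<in> ball z d" using h d(1) by (auto simp: dist_norm)
      fix w assume w: "w \<in> ball z d"
      show "(?g has_derivative (\<lambda>v. ?D w v - ?D z v)) (at w within ball z d)"
        by (intro has_derivative_diff has_derivative_at_withinI[OF deriv]
            bounded_linear_imp_has_derivative bl)
      show "onorm (\<lambda>v. ?D w v - ?D z v) \<le> e"
      proof (rule onorm_le)
        fix v :: 'a
        interpret L: linear "\<lambda>v. ?D w v - ?D z v" by (intro linear_compose_sub lin)
        have "?D w v - ?D z v = (\<Sum>b\<in>Basis. (v \<bullet> b) *\<^sub>R (?D w b - ?D z b))"
          by (metis (no_types, lifting) L.scaleR L.sum euclidean_representation sum.cong)
        also have "norm \<dots> \<le> (\<Sum>b\<in>(Basis :: 'a set). norm v * e')"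
        proof (rule order_trans[OF norm_sum sum_mono])
          fix b :: 'a assume b: "b \<in> Basis"
          have "norm (?D w b - ?D z b) \<le> e'"
            using \<delta>(2)[OF b, of w z] d(2)[OF b] w by (simp add: dist_commute less_le_trans less_imp_le)
          then show "norm ((v \<bullet> b) *\<^sub>R (?D w b - ?D z b)) \<le> norm v * e'"
            using Basis_le_norm[OF b, of v] by (simp add: mult_mono)
        qed
        also have "\<dots> = e * norm v" by (simp add: e'_def)
        finally show "norm (?D w v - ?D z v) \<le> e * norm v" .
      qed
    qed
    then show "norm (f (z + h) - f z - ?D z h) \<le> e * norm h"
      using linear_add[OF lin, of z z h] by (simp add: algebra_simps)
  qed
qed

text \<open>The uniform Taylor remainder of f is integrated against the absolute value of k: the
  error is at most the mass of k times the uniform bound.\<close>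

lemma has_derivative_conv_trunc:
  fixes f :: "complex \<Rightarrow> 'e::euclidean_space"
  assumes k: "integrable lborel k" and f: "Ck_on 1 UNIV f" "\<And>w. norm w > r \<Longrightarrow> f w = 0"
  shows "(conv k f has_derivative (\<lambda>v. conv k (\<lambda>w. frechet_derivative f (at w) v) z)) (at z)"
proof -
  let ?D = "\<lambda>w. frechet_derivative f (at w)"
  define I where "I = (LINT \<zeta>|lborel. \<bar>k \<zeta>\<bar>)"
  have I: "I \<ge> 0" by (simp add: I_def)
  have fc: "continuous_on UNIV f" using f(1) Ck_on_continuous by blast
  obtain M where M: "\<And>z. norm (f z) \<le> M" using compact_support_bounded[OF fc f(2)] by blast
  have Dc: "continuous_on UNIV (\<lambda>w. ?D w v)" for v using f(1) by simp
  have "\<exists>N. \<forall>z. norm (?D z v) \<le> N" for v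
  proof -
    have "?D w v = 0" if "norm w > r" for w
      by (rule frechet_derivative_zero_outside[OF f(2) that])
    from compact_support_bounded[OF Dc this] show ?thesis by metis
  qed
  then obtain N where N: "\<And>v z. norm (?D z v) \<le> N v" by metis
  have lin: "linear (?D w)" for w
    using f(1) by (simp add: linear_frechet_derivative)
  have "linear (\<lambda>v. conv k (\<lambda>w. ?D w v) z)"
    by (rule linearI)
      (simp_all add: linear_add[OF lin] linear_scale[OF lin] conv_add[OF k Dc N Dc N] conv_scaleR)
  then have bl: "bounded_linear (\<lambda>v. conv k (\<lambda>w. ?D w v) z)"
    by (simp add: linear_conv_bounded_linear)
  show ?thesis
  proof (rule has_derivativeI[OF bl])
    show "((\<lambda>y. (conv k f y - conv k f z - conv k (\<lambda>w. ?D w (y - z)) z) /\<^sub>R norm (y - z)) \<longlongrightarrow> 0) (at z)"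
    proof (rule LIM_I)
      fix e :: real assume e: "e > 0"
      \<comment> \<open>I + 1 in place of I allows a kernel of mass 0, and the factor 2 leaves room
        for the strict inequality.\<close>
      define e' where "e' = e / (2 * (I + 1))"
      have "e' > 0" using e I by (simp add: e'_def)
      from compact_support_uniform_derivative[OF f this] obtain d where d: "d > 0"
        "\<And>z h. norm h < d \<Longrightarrow> norm (f (z + h) - f z - ?D z h) \<le> e' * norm h" by metis
      have "norm ((conv k f y - conv k f z - conv k (\<lambda>w. ?D w (y - z)) z) /\<^sub>R norm (y - z) - 0) < e"
        if y: "y \<noteq> z" "norm (y - z) < d" for y
      proof -
        let ?h = "y - z"
        have c1: "continuous_on UNIV (\<lambda>w. f (w + ?h))"
          by (intro continuous_on_compose2[OF fc] continuous_intros) auto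
        have c2: "continuous_on UNIV (\<lambda>w. f (w + ?h) - f w)" by (intro continuous_intros c1 fc)
        have n2: "norm (f (w + ?h) - f w) \<le> 2 * M" for w
          using norm_triangle_ineq4[of "f (w + ?h)" "f w"] M[of w] M[of "w + ?h"] by linarith
        have "conv k f y - conv k f z - conv k (\<lambda>w. ?D w ?h) z =
            conv k (\<lambda>w. f (w + ?h) - f w - ?D w ?h) z"
          using conv_translate[of k f z ?h] conv_diff[OF k c1 M fc M, of z] conv_diff[OF k c2 n2 Dc N, of ?h z]
          by simp
        also have "norm \<dots> \<le> I * (e' * norm ?h)"
          unfolding I_def by (rule norm_conv_le[OF k]) (rule d(2)[OF y(2)])
        also have "\<dots> = (I / (I + 1)) * (e / 2) * norm ?h" using I by (simp add: e'_def field_simps)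
        also have "\<dots> \<le> 1 * (e / 2) * norm ?h"
          using I e by (intro mult_right_mono) (auto simp: divide_le_eq_1)
        also have "\<dots> < e * norm ?h" using y e by simp
        finally show ?thesis using y by (simp add: divide_simps mult.commute)
      qed
      then show "\<exists>s>0. \<forall>y. y \<noteq> z \<and> norm (y - z) < s \<longrightarrow>
          norm ((conv k f y - conv k f z - conv k (\<lambda>w. ?D w (y - z)) z) /\<^sub>R norm (y - z) - 0) < e"
        using d(1) by blast
    qed
  qed
qed

text \<open>Differentiability at z concerns only points within distance 1 of z, and for them
  truncation at the radius R = norm z + 1 + r is invisible.\<close>

lemma has_derivative_conv:
  fixes f :: "complex \<Rightarrow> 'e::euclidean_space"
  assumes k: "loc_integrable k" and f: "Ck_on 1 UNIV f" "\<And>w. norm w > r \<Longrightarrow> f w = 0"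
  shows "(conv k f has_derivative (\<lambda>v. conv k (\<lambda>w. frechet_derivative f (at w) v) z)) (at z)"
proof -
  define R where "R = norm z + 1 + r"
  have "(conv (trunc R k) f has_derivative (\<lambda>v. conv (trunc R k) (\<lambda>w. frechet_derivative f (at w) v) z)) (at z)"
    using k by (intro has_derivative_conv_trunc f) (simp add: loc_integrable_def)
  moreover have "(\<lambda>v. conv (trunc R k) (\<lambda>w. frechet_derivative f (at w) v) z) =
      (\<lambda>v. conv k (\<lambda>w. frechet_derivative f (at w) v) z)"
  proof
    fix v
    have "frechet_derivative f (at w) v = 0" if "norm w > r" for w
      by (rule frechet_derivative_zero_outside[OF f(2) that])
    then show "conv (trunc R k) (\<lambda>w. frechet_derivative f (at w) v) z =
        conv k (\<lambda>w. frechet_derivative f (at w) v) z"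
      by (rule conv_trunc[where r = r]) (simp_all add: R_def)
  qed
  moreover have "conv (trunc R k) f w = conv k f w" if "w \<in> ball z 1" for w
  proof (rule conv_trunc[OF f(2)])
    show "norm w + r \<le> R" using that norm_triangle_sub[of w z] by (simp add: R_def dist_norm norm_minus_commute)
  qed simp
  ultimately show ?thesis
    using has_derivative_cong_open[of "ball z 1" z "conv (trunc R k) f" "conv k f"] by simp
qed

section \<open>Integration by parts against singular kernels\<close>

lemma abs_fst_snd_le: "\<bar>fst \<zeta>\<bar> \<le> norm \<zeta>" "\<bar>snd \<zeta>\<bar> \<le> norm (\<zeta> :: real \<times> real)"
  using norm_fst_le[of "fst \<zeta>" "snd \<zeta>"] norm_snd_le[of "snd \<zeta>" "fst \<zeta>"] by simp_all

lemma measurable_trunc: "k \<in> borel_measurable borel \<Longrightarrow> trunc R k \<in> borel_measurable borel"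
  unfolding trunc_def[abs_def] by (intro borel_measurable_times borel_measurable_indicator) auto

lemma measurable_fst_snd_plane [measurable]:
  "(fst :: real \<times> real \<Rightarrow> real) \<in> borel_measurable borel" "(snd :: real \<times> real \<Rightarrow> real) \<in> borel_measurable borel"
  by (auto intro!: borel_measurable_continuous_onI continuous_intros)

lemma AE_prod_nonzero: "AE \<zeta> in lborel. fst \<zeta> \<noteq> (0::real) \<and> snd \<zeta> \<noteq> (0::real)"
proof -
  have "{0::real} \<times> (UNIV :: real set) \<in> null_sets (lborel \<Otimes>\<^sub>M lborel)"
    "(UNIV :: real set) \<times> {0::real} \<in> null_sets (lborel \<Otimes>\<^sub>M lborel)"
    by (auto simp: null_sets_def lborel.emeasure_pair_measure_Times)
  from AE_not_in[OF this(1)] AE_not_in[OF this(2)] show ?thesis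
    unfolding lborel_prod by eventually_elim auto
qed

text \<open>Fubini: on almost every horizontal line the integral of the derivative is a difference
  of two boundary values, and both vanish beyond N. The line t = 0, which contains the singularity
  of the kernels used later, is excluded and has measure zero.\<close>

lemma integral_line_derivative_zero:
  fixes \<Phi> \<Phi>1 :: "real \<times> real \<Rightarrow> 'e::euclidean_space"
  assumes int: "integrable lborel \<Phi>1"
    and d: "\<And>s t. t \<noteq> 0 \<Longrightarrow> ((\<lambda>s. \<Phi> (s, t)) has_vector_derivative \<Phi>1 (s, t)) (at s)"
    and zero: "\<And>s t. \<bar>s\<bar> > N \<Longrightarrow> \<Phi> (s, t) = 0"
  shows "integral\<^sup>L lborel \<Phi>1 = 0"
proof -
  have int': "integrable (lborel \<Otimes>\<^sub>M lborel) (\<lambda>(s, t). \<Phi>1 (s, t))"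
    using int by (simp add: lborel_prod)
  define N' where "N' = \<bar>N\<bar> + 1"
  have "integral\<^sup>L lborel \<Phi>1 = (\<integral>t. (\<integral>s. \<Phi>1 (s, t) \<partial>lborel) \<partial>lborel)"
    using lborel_pair.integral_snd[OF int'] by (simp add: lborel_prod)
  also have "\<dots> = (\<integral>t. 0 \<partial>(lborel :: real measure))"
  proof (rule integral_cong_AE)
    show "AE t in lborel. (\<integral>s. \<Phi>1 (s, t) \<partial>lborel) = 0"
      using lborel_pair.AE_integrable_snd[OF int'] AE_lborel_singleton[of "0::real"]
    proof eventually_elim
      fix t :: real assume i: "integrable lborel (\<lambda>s. \<Phi>1 (s, t))" and t: "t \<noteq> 0"
      have "((\<lambda>s. \<Phi>1 (s, t)) has_integral (\<Phi> (N', t) - \<Phi> (- N', t))) {-N'..N'}"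
        by (rule fundamental_theorem_of_calculus)
          (use N'_def in \<open>auto intro!: has_vector_derivative_at_within[OF d[OF t]]\<close>)
      then have "((\<lambda>s. \<Phi>1 (s, t)) has_integral 0) {-N'..N'}" using zero by (simp add: N'_def)
      moreover have "\<Phi>1 (s, t) = 0" if "s \<notin> {-N'..N'}" for s
      proof (rule vector_derivative_unique_at[OF d[OF t]])
        have "((\<lambda>_. 0) has_vector_derivative (0 :: 'e)) (at s)" by simp
        moreover have "open {s. \<bar>s\<bar> > N}" by (intro open_Collect_less continuous_intros)
        ultimately show "((\<lambda>s. \<Phi> (s, t)) has_vector_derivative 0) (at s)"
          by (rule has_vector_derivative_transform_within_open) (use that zero in \<open>auto simp: N'_def\<close>)
      qed
      ultimately have "((\<lambda>s. \<Phi>1 (s, t)) has_integral 0) UNIV"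
        by (rule has_integral_on_superset) auto
      with has_integral_integral_lborel[OF i] show "(\<integral>s. \<Phi>1 (s, t) \<partial>lborel) = 0"
        by (rule has_integral_unique)
    qed
    show "(\<lambda>t. \<integral>s. \<Phi>1 (s, t) \<partial>lborel) \<in> borel_measurable lborel"
      using lborel_pair.integrable_snd[OF int'] by (rule borel_measurable_integrable)
  qed simp
  finally show ?thesis by simp
qed

lemma integral_line_derivative_zero':
  fixes \<Phi> \<Phi>1 :: "real \<times> real \<Rightarrow> 'e::euclidean_space"
  assumes int: "integrable lborel \<Phi>1"
    and d: "\<And>s t. s \<noteq> 0 \<Longrightarrow> ((\<lambda>t. \<Phi> (s, t)) has_vector_derivative \<Phi>1 (s, t)) (at t)"
    and zero: "\<And>s t. \<bar>t\<bar> > N \<Longrightarrow> \<Phi> (s, t) = 0"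
  shows "integral\<^sup>L lborel \<Phi>1 = 0"
proof -
  have int': "integrable (lborel \<Otimes>\<^sub>M lborel) \<Phi>1" using int by (simp add: lborel_prod)
  have "integral\<^sup>L lborel (\<lambda>(s, t). \<Phi>1 (t, s)) = 0"
    by (rule integral_line_derivative_zero[where \<Phi> = "\<lambda>(s, t). \<Phi> (t, s)" and N = N])
      (use lborel_pair.integrable_product_swap[OF int'] d zero in \<open>auto simp: lborel_prod\<close>)
  then show ?thesis
    using lborel_pair.integral_product_swap[OF borel_measurable_integrable[OF int']]
    by (simp add: lborel_prod)
qed

text \<open>The part of the integration by parts that is common to the directions v = 1 and v =
  \<i>. The sign in - v arises because the integration variable enters f with a minus sign.\<close>

lemma conv_ibp_aux:
  fixes f :: "complex \<Rightarrow> 'e::euclidean_space"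
  assumes k: "loc_integrable k" "loc_integrable k1"
    and f: "Ck_on 1 UNIV f" "\<And>w. norm w > r \<Longrightarrow> f w = 0"
  shows "integrable lborel (\<lambda>\<zeta>. k1 \<zeta> *\<^sub>R f (z - cx \<zeta>) - k \<zeta> *\<^sub>R frechet_derivative f (at (z - cx \<zeta>)) v)"
    and "(LINT \<zeta>|lborel. k1 \<zeta> *\<^sub>R f (z - cx \<zeta>) - k \<zeta> *\<^sub>R frechet_derivative f (at (z - cx \<zeta>)) v) =
      conv k1 f z - conv k (\<lambda>w. frechet_derivative f (at w) v) z"
    and "\<And>\<gamma> t. (\<gamma> has_vector_derivative - v) (at t) \<Longrightarrow>
      ((\<lambda>t. f (\<gamma> t)) has_vector_derivative - frechet_derivative f (at (\<gamma> t)) v) (at t)"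
    and "norm \<zeta> > norm z + r \<Longrightarrow> f (z - cx \<zeta>) = 0"
proof -
  have fc: "continuous_on UNIV f" using f(1) Ck_on_continuous by blast
  have Dc: "continuous_on UNIV (\<lambda>w. frechet_derivative f (at w) v)" using f(1) by simp
  have D0: "frechet_derivative f (at w) v = 0" if "norm w > r" for w
    by (rule frechet_derivative_zero_outside[OF f(2) that])
  obtain M where M: "\<And>z. norm (f z) \<le> M" using compact_support_bounded[OF fc f(2)] by blast
  obtain N where N: "\<And>z. norm (frechet_derivative f (at z) v) \<le> N"
    using compact_support_bounded[OF Dc D0] by blast
  note i1 = integrable_conv_compact[OF k(2) fc f(2) M]
  note i2 = integrable_conv_compact[OF k(1) Dc D0 N]
  show "integrable lborel (\<lambda>\<zeta>. k1 \<zeta> *\<^sub>R f (z - cx \<zeta>) - k \<zeta> *\<^sub>R frechet_derivative f (at (z - cx \<zeta>)) v)"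
    by (intro Bochner_Integration.integrable_diff i1 i2)
  show "(LINT \<zeta>|lborel. k1 \<zeta> *\<^sub>R f (z - cx \<zeta>) - k \<zeta> *\<^sub>R frechet_derivative f (at (z - cx \<zeta>)) v) =
      conv k1 f z - conv k (\<lambda>w. frechet_derivative f (at w) v) z"
    unfolding conv_def by (intro Bochner_Integration.integral_diff i1 i2)
  show "((\<lambda>t. f (\<gamma> t)) has_vector_derivative - frechet_derivative f (at (\<gamma> t)) v) (at t)"
    if "(\<gamma> has_vector_derivative - v) (at t)" for \<gamma> t
  proof -
    have D: "(f has_derivative frechet_derivative f (at (\<gamma> t))) (at (\<gamma> t))"
      using f(1) by (simp add: frechet_derivative_works)
    then interpret L: linear "frechet_derivative f (at (\<gamma> t))"
      by (simp add: has_derivative_def bounded_linear.linear)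
    show ?thesis
      using has_derivative_compose[of \<gamma> "\<lambda>h. h *\<^sub>R - v" t UNIV f "frechet_derivative f (at (\<gamma> t))"] that D
      by (simp add: has_vector_derivative_def L.scaleR L.neg)
  qed
  show "f (z - cx \<zeta>) = 0" if "norm \<zeta> > norm z + r"
    using norm_triangle_ineq4[of z "z - cx \<zeta>"] norm_cx[of \<zeta>] that by (intro f(2)) simp
qed

text \<open>The function \<zeta> \<mapsto> k \<zeta> f (z - \<zeta>) has the s-derivative k1 f - k
  Df, whose integral is zero. On lines with t \<noteq> 0 the singularity is never met, so it
  contributes no boundary term; local integrability of k and k1 makes both parts integrable
  separately.\<close>

lemma conv_ibp1:
  fixes f :: "complex \<Rightarrow> 'e::euclidean_space"
  assumes k: "loc_integrable k" "loc_integrable k1"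
    and d: "\<And>s t. t \<noteq> 0 \<Longrightarrow> ((\<lambda>s. k (s, t)) has_real_derivative k1 (s, t)) (at s)"
    and f: "Ck_on 1 UNIV f" "\<And>w. norm w > r \<Longrightarrow> f w = 0"
  shows "conv k (\<lambda>w. frechet_derivative f (at w) 1) z = conv k1 f z"
proof -
  have aux: "integrable lborel (\<lambda>\<zeta>. k1 \<zeta> *\<^sub>R f (z - cx \<zeta>) - k \<zeta> *\<^sub>R frechet_derivative f (at (z - cx \<zeta>)) 1)"
    "(LINT \<zeta>|lborel. k1 \<zeta> *\<^sub>R f (z - cx \<zeta>) - k \<zeta> *\<^sub>R frechet_derivative f (at (z - cx \<zeta>)) 1) =
      conv k1 f z - conv k (\<lambda>w. frechet_derivative f (at w) 1) z"
    "(\<gamma> has_vector_derivative - 1) (at t) \<Longrightarrow>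
      ((\<lambda>t. f (\<gamma> t)) has_vector_derivative - frechet_derivative f (at (\<gamma> t)) 1) (at t)"
    "norm \<zeta> > norm z + r \<Longrightarrow> f (z - cx \<zeta>) = 0" for \<gamma> t \<zeta>
    by (rule conv_ibp_aux[OF k f(1)]; (rule f(2))?; assumption)+
  have "(LINT \<zeta>|lborel. k1 \<zeta> *\<^sub>R f (z - cx \<zeta>) - k \<zeta> *\<^sub>R frechet_derivative f (at (z - cx \<zeta>)) 1) = 0"
  proof (rule integral_line_derivative_zero[where \<Phi> = "\<lambda>\<zeta>. k \<zeta> *\<^sub>R f (z - cx \<zeta>)" and N = "norm z + r"])
    fix s t :: real
    have "((\<lambda>s. z - Complex s t) has_vector_derivative - 1) (at s)"
      unfolding Complex_eq by (auto intro!: derivative_eq_intros)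
    from has_vector_derivative_scaleR[OF d aux(3)[OF this]]
    show "((\<lambda>s. k (s, t) *\<^sub>R f (z - cx (s, t))) has_vector_derivative
        k1 (s, t) *\<^sub>R f (z - cx (s, t)) - k (s, t) *\<^sub>R frechet_derivative f (at (z - cx (s, t))) 1) (at s)"
      if "t \<noteq> 0" using that by simp
    show "k (s, t) *\<^sub>R f (z - cx (s, t)) = 0" if "\<bar>s\<bar> > norm z + r"
      using aux(4)[of "(s, t)"] that abs_fst_snd_le[of "(s, t)"] by simp
  qed (rule aux(1))
  then show ?thesis using aux(2) by simp
qed

lemma conv_ibp2:
  fixes f :: "complex \<Rightarrow> 'e::euclidean_space"
  assumes k: "loc_integrable k" "loc_integrable k1"
    and d: "\<And>s t. s \<noteq> 0 \<Longrightarrow> ((\<lambda>t. k (s, t)) has_real_derivative k1 (s, t)) (at t)"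
    and f: "Ck_on 1 UNIV f" "\<And>w. norm w > r \<Longrightarrow> f w = 0"
  shows "conv k (\<lambda>w. frechet_derivative f (at w) \<i>) z = conv k1 f z"
proof -
  have aux: "integrable lborel (\<lambda>\<zeta>. k1 \<zeta> *\<^sub>R f (z - cx \<zeta>) - k \<zeta> *\<^sub>R frechet_derivative f (at (z - cx \<zeta>)) \<i>)"
    "(LINT \<zeta>|lborel. k1 \<zeta> *\<^sub>R f (z - cx \<zeta>) - k \<zeta> *\<^sub>R frechet_derivative f (at (z - cx \<zeta>)) \<i>) =
      conv k1 f z - conv k (\<lambda>w. frechet_derivative f (at w) \<i>) z"
    "(\<gamma> has_vector_derivative - \<i>) (at t) \<Longrightarrow>
      ((\<lambda>t. f (\<gamma> t)) has_vector_derivative - frechet_derivative f (at (\<gamma> t)) \<i>) (at t)"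
    "norm \<zeta> > norm z + r \<Longrightarrow> f (z - cx \<zeta>) = 0" for \<gamma> t \<zeta>
    by (rule conv_ibp_aux[OF k f(1)]; (rule f(2))?; assumption)+
  have "(LINT \<zeta>|lborel. k1 \<zeta> *\<^sub>R f (z - cx \<zeta>) - k \<zeta> *\<^sub>R frechet_derivative f (at (z - cx \<zeta>)) \<i>) = 0"
  proof (rule integral_line_derivative_zero'[where \<Phi> = "\<lambda>\<zeta>. k \<zeta> *\<^sub>R f (z - cx \<zeta>)" and N = "norm z + r"])
    fix s t :: real
    have "((\<lambda>t. z - Complex s t) has_vector_derivative - \<i>) (at t)"
      unfolding Complex_eq by (auto intro!: derivative_eq_intros)
    from has_vector_derivative_scaleR[OF d aux(3)[OF this]]
    show "((\<lambda>t. k (s, t) *\<^sub>R f (z - cx (s, t))) has_vector_derivative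
        k1 (s, t) *\<^sub>R f (z - cx (s, t)) - k (s, t) *\<^sub>R frechet_derivative f (at (z - cx (s, t))) \<i>) (at t)"
      if "s \<noteq> 0" using that by simp
    show "k (s, t) *\<^sub>R f (z - cx (s, t)) = 0" if "\<bar>t\<bar> > norm z + r"
      using aux(4)[of "(s, t)"] that abs_fst_snd_le[of "(s, t)"] by simp
  qed (rule aux(1))
  then show ?thesis using aux(2) by simp
qed

section \<open>The logarithmic kernel and the Laplace operator\<close>

lemma loc_integrable_continuous:
  assumes "continuous_on UNIV k" shows "loc_integrable k"
  unfolding loc_integrable_def
proof
  fix R
  have "integrable lborel (\<lambda>\<zeta>. indicator (cball 0 R) \<zeta> *\<^sub>R k \<zeta>)"
    by (rule borel_integrable_compact[OF compact_cball continuous_on_subset[OF assms subset_UNIV]])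
  then show "integrable lborel (trunc R k)" by (simp add: trunc_def[abs_def])
qed

lemma nn_integral_even_finite:
  fixes f :: "real \<Rightarrow> real"
  assumes [measurable]: "f \<in> borel_measurable borel" and even: "\<And>x. f (- x) = f x"
    and fin: "(\<integral>\<^sup>+x. ennreal (f x) * indicator {0..} x \<partial>lborel) < \<infinity>"
  shows "(\<integral>\<^sup>+x. ennreal (f x) \<partial>lborel) < \<infinity>"
proof -
  have "(\<integral>\<^sup>+x. ennreal (f x) \<partial>lborel) \<le>
      (\<integral>\<^sup>+x. ennreal (f x) * indicator {0..} x + ennreal (f x) * indicator {..0} x \<partial>lborel)"
    by (rule nn_integral_mono) (auto split: split_indicator)
  also have "\<dots> = (\<integral>\<^sup>+x. ennreal (f x) * indicator {0..} x \<partial>lborel) +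
      (\<integral>\<^sup>+x. ennreal (f x) * indicator {..0} x \<partial>lborel)"
    by (rule nn_integral_add) auto
  also have "(\<integral>\<^sup>+x. ennreal (f x) * indicator {..0} x \<partial>lborel) =
      (\<integral>\<^sup>+x. ennreal (f (- x)) * indicator {..0} (- x) \<partial>lborel)"
    by (subst nn_integral_real_affine[where c = "-1" and t = 0]) auto
  also have "\<dots> = (\<integral>\<^sup>+x. ennreal (f x) * indicator {0..} x \<partial>lborel)"
    by (simp add: even indicator_def)
  finally show ?thesis using fin by (auto simp: ennreal_add_eq_top less_top le_less_trans top_unique)
qed

lemma integrable_product_plane:
  fixes a :: "real \<Rightarrow> real"
  assumes [measurable]: "a \<in> borel_measurable borel" and nn: "\<And>x. a x \<ge> 0"
    and fin: "(\<integral>\<^sup>+x. ennreal (a x) \<partial>lborel) < \<infinity>"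
  shows "integrable lborel (\<lambda>\<zeta>::real \<times> real. a (fst \<zeta>) * a (snd \<zeta>))"
proof (rule integrableI_nonneg)
  have "(\<integral>\<^sup>+\<zeta>. ennreal (a (fst \<zeta>) * a (snd \<zeta>)) \<partial>(lborel :: (real \<times> real) measure)) =
      (\<integral>\<^sup>+\<zeta>. (\<Prod>b\<in>Basis. ennreal (a (\<zeta> \<bullet> b))) \<partial>(lborel :: (real \<times> real) measure))"
    by (simp add: Basis_prod_def ennreal_mult nn inner_prod_def mult.commute)
  also have "\<dots> = (\<Prod>b\<in>(Basis :: (real \<times> real) set). (\<integral>\<^sup>+x. ennreal (a x) \<partial>lborel))"
    by (rule nn_integral_lborel_prod) auto
  also have "\<dots> < \<infinity>" using fin by (simp add: Basis_prod_def ennreal_mult_less_top)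
  finally show "(\<integral>\<^sup>+\<zeta>. ennreal (a (fst \<zeta>) * a (snd \<zeta>)) \<partial>(lborel :: (real \<times> real) measure)) < \<infinity>" .
  show "(\<lambda>\<zeta>::real \<times> real. a (fst \<zeta>) * a (snd \<zeta>)) \<in> borel_measurable lborel"
    by measurable
qed (use nn in auto)

text \<open>By AM-GM, \<open>1/\<bar>(s,t)\<bar>\<close> is dominated by \<open>\<bar>s\<bar>\<^sup>-\<^sup>1\<^sup>/\<^sup>2 \<bar>t\<bar>\<^sup>-\<^sup>1\<^sup>/\<^sup>2\<close>, which avoids polar coordinates.\<close>

lemma loc_integrable_inverse_norm: "loc_integrable (\<lambda>\<zeta>. 1 / norm \<zeta>)"
  unfolding loc_integrable_def
proof
  fix R :: real
  define a where "a = (\<lambda>s::real. \<bar>s\<bar> powr (-1/2) * indicator {- \<bar>R\<bar>..\<bar>R\<bar>} s)"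
  have [measurable]: "a \<in> borel_measurable borel" by (simp add: a_def)
  have "(\<integral>\<^sup>+x. ennreal (a x) * indicator {0..} x \<partial>lborel) =
      (\<integral>\<^sup>+x. ennreal (x powr (-1/2)) * indicator {0..\<bar>R\<bar>} x \<partial>lborel)"
    by (intro nn_integral_cong) (auto simp: a_def split: split_indicator)
  also have "\<dots> < \<infinity>"
    by (subst nn_integral_has_integral_lebesgue'[OF _ has_integral_powr_from_0]) auto
  finally have "(\<integral>\<^sup>+x. ennreal (a x) \<partial>lborel) < \<infinity>"
    by (intro nn_integral_even_finite) (auto simp: a_def indicator_def)
  then have i: "integrable lborel (\<lambda>\<zeta>::real \<times> real. a (fst \<zeta>) * a (snd \<zeta>))"
    by (intro integrable_product_plane) (auto simp: a_def)
  show "integrable lborel (trunc R (\<lambda>\<zeta>. 1 / norm \<zeta>))"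
  proof (rule Bochner_Integration.integrable_bound[OF i])
    show "trunc R (\<lambda>\<zeta>. 1 / norm \<zeta>) \<in> borel_measurable lborel"
      by (simp add: measurable_trunc)
    show "AE \<zeta> in lborel. norm (trunc R (\<lambda>\<zeta>. 1 / norm \<zeta>) \<zeta>) \<le> norm (a (fst \<zeta>) * a (snd \<zeta>))"
      using AE_prod_nonzero
    proof eventually_elim
      fix \<zeta> :: "real \<times> real" assume nz: "fst \<zeta> \<noteq> 0 \<and> snd \<zeta> \<noteq> 0"
      let ?s = "\<bar>fst \<zeta>\<bar>" and ?t = "\<bar>snd \<zeta>\<bar>"
      show "norm (trunc R (\<lambda>\<zeta>. 1 / norm \<zeta>) \<zeta>) \<le> norm (a (fst \<zeta>) * a (snd \<zeta>))"
      proof (cases "norm \<zeta> \<le> R")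
        case True
        then have st: "?s \<le> \<bar>R\<bar>" "?t \<le> \<bar>R\<bar>"
          using abs_fst_snd_le[of \<zeta>] by auto
        have "?s * ?t \<le> (norm \<zeta>)\<^sup>2"
          using mult_mono[of ?s "norm \<zeta>" ?t "norm \<zeta>"] abs_fst_snd_le[of \<zeta>]
          by (simp add: power2_eq_square)
        then have "sqrt (?s * ?t) \<le> norm \<zeta>" by (intro real_le_lsqrt) auto
        then have "1 / norm \<zeta> \<le> 1 / sqrt (?s * ?t)"
          using nz by (intro divide_left_mono mult_pos_pos) (auto simp: prod_eq_iff)
        also have "\<dots> = ?s powr (-1/2) * ?t powr (-1/2)"
          using nz by (simp add: powr_minus powr_half_sqrt real_sqrt_mult field_simps)
        finally show ?thesis using st by (simp add: a_def trunc_def abs_mult indicator_def abs_le_iff)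
      qed (simp add: trunc_def)
    qed
  qed
qed

lemma loc_integrable_bound:
  assumes [measurable]: "k \<in> borel_measurable borel"
    and b: "\<And>\<zeta>. \<bar>k \<zeta>\<bar> \<le> a / norm \<zeta> + b * norm \<zeta>"
  shows "loc_integrable k"
  unfolding loc_integrable_def
proof
  fix R
  have i: "integrable lborel (\<lambda>\<zeta>. a * trunc R (\<lambda>\<zeta>. 1 / norm \<zeta>) \<zeta> + b * trunc R norm \<zeta>)"
    using loc_integrable_inverse_norm loc_integrable_continuous[of norm]
    by (intro Bochner_Integration.integrable_add integrable_mult_right)
      (auto simp: loc_integrable_def continuous_on_norm_id)
  show "integrable lborel (trunc R k)"
  proof (rule Bochner_Integration.integrable_bound[OF i])
    show "trunc R k \<in> borel_measurable lborel" by (simp add: measurable_trunc)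
    have "norm (trunc R k \<zeta>) \<le> norm (a * trunc R (\<lambda>\<zeta>. 1 / norm \<zeta>) \<zeta> + b * trunc R norm \<zeta>)" for \<zeta>
      using b[of \<zeta>] by (auto simp: trunc_def indicator_def)
    then show "AE \<zeta> in lborel. norm (trunc R k \<zeta>) \<le>
        norm (a * trunc R (\<lambda>\<zeta>. 1 / norm \<zeta>) \<zeta> + b * trunc R norm \<zeta>)" by simp
  qed
qed

definition sqn :: "real \<times> real \<Rightarrow> real" where "sqn \<zeta> = (fst \<zeta>)\<^sup>2 + (snd \<zeta>)\<^sup>2"
text \<open>Twice the logarithm of the norm; with the squared norm the partial derivatives
  \<open>ker1\<close> and \<open>ker2\<close> are rational functions. The normalising factor is
  supplied by \<open>poisson_mass\<close>.\<close>

definition ker0 :: "real \<times> real \<Rightarrow> real" where "ker0 \<zeta> = ln (sqn \<zeta>)"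
definition ker1 :: "real \<times> real \<Rightarrow> real" where "ker1 \<zeta> = 2 * fst \<zeta> / sqn \<zeta>"
definition ker2 :: "real \<times> real \<Rightarrow> real" where "ker2 \<zeta> = 2 * snd \<zeta> / sqn \<zeta>"

lemma sqn_norm: "sqn \<zeta> = (norm \<zeta>)\<^sup>2"
  by (simp add: sqn_def norm_prod_def)

lemma sqn_nonneg: "sqn \<zeta> \<ge> 0" by (simp add: sqn_norm)

lemma continuous_sqn: "continuous_on S sqn"
  unfolding sqn_def by (intro continuous_intros)

lemma measurable_sqn [measurable]: "sqn \<in> borel_measurable borel"
  by (rule borel_measurable_continuous_onI[OF continuous_sqn])

lemma ker_bound: "\<bar>ker1 \<zeta>\<bar> \<le> 2 / norm \<zeta>" "\<bar>ker2 \<zeta>\<bar> \<le> 2 / norm \<zeta>"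
proof -
  have "\<bar>2 * x / sqn \<zeta>\<bar> \<le> 2 / norm \<zeta>" if "\<bar>x\<bar> \<le> norm \<zeta>" for x
    using that by (cases "\<zeta> = 0") (auto simp: sqn_norm power2_eq_square abs_mult divide_simps)
  then show "\<bar>ker1 \<zeta>\<bar> \<le> 2 / norm \<zeta>" "\<bar>ker2 \<zeta>\<bar> \<le> 2 / norm \<zeta>"
    using abs_fst_snd_le[of \<zeta>] by (simp_all add: ker1_def ker2_def)
qed

text \<open>The inequality ln x \<le> x - 1, applied to the norm and to its reciprocal, bounds the
  absolute value of the logarithm by the norm plus its reciprocal; the two derivatives are of the
  size of the reciprocal norm.\<close>

lemma loc_integrable_ker: "loc_integrable ker0" "loc_integrable ker1" "loc_integrable ker2"
proof -
  have "\<bar>ker0 \<zeta>\<bar> \<le> 2 / norm \<zeta> + 2 * norm \<zeta>" for \<zeta>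
  proof (cases "\<zeta> = 0")
    case False
    then have n: "norm \<zeta> > 0" by simp
    have "ker0 \<zeta> = 2 * ln (norm \<zeta>)" using n by (simp add: ker0_def sqn_norm ln_realpow)
    moreover have "ln (norm \<zeta>) \<le> norm \<zeta>" "- ln (norm \<zeta>) \<le> 1 / norm \<zeta>"
      using ln_le_minus_one[OF n] ln_le_minus_one[of "1 / norm \<zeta>"] n by (auto simp: ln_div)
    moreover have "1 / norm \<zeta> \<ge> 0" by simp
    ultimately have "ker0 \<zeta> \<le> 2 * (1 / norm \<zeta>) + 2 * norm \<zeta>" "- ker0 \<zeta> \<le> 2 * (1 / norm \<zeta>) + 2 * norm \<zeta>"
      using n by linarith+
    then show ?thesis by (simp add: abs_le_iff)
  qed (simp add: ker0_def sqn_def)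
  then show "loc_integrable ker0"
    by (intro loc_integrable_bound[where a = 2 and b = 2]) (auto simp: ker0_def[abs_def])
  show "loc_integrable ker1" "loc_integrable ker2"
    using ker_bound
    by (auto intro!: loc_integrable_bound[where a = 2 and b = 0] simp: ker1_def[abs_def] ker2_def[abs_def])
qed

lemma conv_ker0:
  fixes f :: "complex \<Rightarrow> 'e::euclidean_space"
  assumes f: "Ck_on 1 UNIV f" "\<And>w. norm w > r \<Longrightarrow> f w = 0"
  shows "conv ker0 (\<lambda>w. frechet_derivative f (at w) 1) z = conv ker1 f z"
    and "conv ker0 (\<lambda>w. frechet_derivative f (at w) \<i>) z = conv ker2 f z"
proof -
  have "((\<lambda>s. ln (s\<^sup>2 + t\<^sup>2)) has_real_derivative 2 * s / (s\<^sup>2 + t\<^sup>2)) (at s)"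
    "((\<lambda>s. ln (t\<^sup>2 + s\<^sup>2)) has_real_derivative 2 * s / (t\<^sup>2 + s\<^sup>2)) (at s)" if "t \<noteq> 0" for s t :: real
    using that by (auto intro!: derivative_eq_intros simp: sum_power2_gt_zero_iff)
  note d = this
  show "conv ker0 (\<lambda>w. frechet_derivative f (at w) 1) z = conv ker1 f z"
    by (rule conv_ibp1[OF loc_integrable_ker(1,2) _ f(1)])
      (use d(1) f(2) in \<open>auto simp: ker0_def ker1_def sqn_def\<close>)
  show "conv ker0 (\<lambda>w. frechet_derivative f (at w) \<i>) z = conv ker2 f z"
    by (rule conv_ibp2[OF loc_integrable_ker(1,3) _ f(1)])
      (use d(2) f(2) in \<open>auto simp: ker0_def ker2_def sqn_def\<close>)
qed

text \<open>The total mass of the Laplacian of ln (1 + |\<zeta>|^2), classically 4 \<pi>. It is kept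
  as an integral, and the argument divides by it, relying on its positivity.\<close>

definition poisson_mass :: real where
  "poisson_mass = (LINT \<zeta>|lborel. 4 / (1 + sqn \<zeta>)\<^sup>2)"

text \<open>Since (1 + s^2) (1 + t^2) \<le> (1 + s^2 + t^2)^2, the integrand is dominated by a
  product of two densities with the arctangent as antiderivative.\<close>

lemma integrable_poisson: "integrable lborel (\<lambda>\<zeta>. 4 / (1 + sqn \<zeta>)\<^sup>2)"
proof -
  have "(\<integral>\<^sup>+x. ennreal (inverse (1 + x\<^sup>2)) * indicator {0..} x \<partial>lborel) = ennreal (pi / 2 - arctan 0)"
  proof (rule nn_integral_FTC_atLeast)
    show "(arctan has_real_derivative inverse (1 + x\<^sup>2)) (at x)" for x by (rule DERIV_arctan)
    show "(arctan \<longlongrightarrow> pi / 2) at_top" by (rule tendsto_arctan_at_top)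
  qed auto
  then have "(\<integral>\<^sup>+x. ennreal (inverse (1 + x\<^sup>2)) \<partial>lborel) < \<infinity>"
    by (intro nn_integral_even_finite) auto
  then have "integrable lborel (\<lambda>\<zeta>::real \<times> real. inverse (1 + (fst \<zeta>)\<^sup>2) * inverse (1 + (snd \<zeta>)\<^sup>2))"
    by (intro integrable_product_plane[where a = "\<lambda>x. inverse (1 + x\<^sup>2)"]) auto
  then have i: "integrable lborel (\<lambda>\<zeta>::real \<times> real. 4 * (1 / (1 + (fst \<zeta>)\<^sup>2) * (1 / (1 + (snd \<zeta>)\<^sup>2))))"
    by (intro integrable_mult_right) (simp add: inverse_eq_divide)
  show ?thesis
  proof (rule Bochner_Integration.integrable_bound[OF i])
    show "(\<lambda>\<zeta>. 4 / (1 + sqn \<zeta>)\<^sup>2) \<in> borel_measurable lborel" by measurable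
    show "AE \<zeta> in lborel. norm (4 / (1 + sqn \<zeta>)\<^sup>2)
        \<le> norm (4 * (1 / (1 + (fst \<zeta>)\<^sup>2) * (1 / (1 + (snd \<zeta>)\<^sup>2))))"
    proof (rule AE_I2)
      fix \<zeta> :: "real \<times> real"
      have "(1 + (fst \<zeta>)\<^sup>2) * (1 + (snd \<zeta>)\<^sup>2) \<le> (1 + sqn \<zeta>) * (1 + sqn \<zeta>)"
        by (intro mult_mono) (auto simp: sqn_def)
      moreover have "(1 + (fst \<zeta>)\<^sup>2) * (1 + (snd \<zeta>)\<^sup>2) > 0"
        by (intro mult_pos_pos add_pos_nonneg) auto
      ultimately have "4 / ((1 + sqn \<zeta>) * (1 + sqn \<zeta>)) \<le> 4 / ((1 + (fst \<zeta>)\<^sup>2) * (1 + (snd \<zeta>)\<^sup>2))"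
        by (intro divide_left_mono) auto
      then show "norm (4 / (1 + sqn \<zeta>)\<^sup>2) \<le> norm (4 * (1 / (1 + (fst \<zeta>)\<^sup>2) * (1 / (1 + (snd \<zeta>)\<^sup>2))))"
        by (simp add: power2_eq_square abs_mult)
    qed
  qed
qed

lemma poisson_mass_pos: "poisson_mass > 0"
proof -
  have pos: "4 / (1 + sqn \<zeta>)\<^sup>2 > 0" for \<zeta>
    using sqn_nonneg[of \<zeta>] by simp
  have "poisson_mass \<noteq> 0"
  proof
    assume "poisson_mass = 0"
    then have "AE \<zeta> in lborel. 4 / (1 + sqn \<zeta>)\<^sup>2 = 0"
      unfolding poisson_mass_def
      by (subst (asm) integral_nonneg_eq_0_iff_AE[OF integrable_poisson]) (auto simp: less_imp_le)
    then have "AE \<zeta> in (lborel :: (real \<times> real) measure). \<not> True"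
      by eventually_elim (metis pos less_irrefl)
    from emeasure_eq_0_AE[OF this] show False by simp
  qed
  moreover have "poisson_mass \<ge> 0"
    unfolding poisson_mass_def by (intro Bochner_Integration.integral_nonneg) (auto simp: less_imp_le)
  ultimately show ?thesis by simp
qed

lemma lborel_integral_scale:
  fixes g :: "real \<times> real \<Rightarrow> 'e::euclidean_space"
  assumes [measurable]: "g \<in> borel_measurable borel" and "c \<noteq> 0"
  shows "(LINT \<zeta>|lborel. g \<zeta>) = (LINT \<zeta>|lborel. c\<^sup>2 *\<^sub>R g (c *\<^sub>R \<zeta>))"
proof -
  have "(LINT \<zeta>|lborel. g \<zeta>) =
      (LINT \<zeta>|density (distr lborel borel (\<lambda>\<zeta>. 0 + c *\<^sub>R \<zeta>)) (\<lambda>_. ennreal (c\<^sup>2)). g \<zeta>)"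
    by (subst lborel_affine[OF assms(2), of 0]) (simp add: power2_eq_square)
  also have "\<dots> = (LINT \<zeta>|distr lborel borel (\<lambda>\<zeta>. 0 + c *\<^sub>R \<zeta>). c\<^sup>2 *\<^sub>R g \<zeta>)"
    by (rule integral_density) auto
  also have "\<dots> = (LINT \<zeta>|lborel. c\<^sup>2 *\<^sub>R g (c *\<^sub>R \<zeta>))"
    by (subst integral_distr) auto
  finally show ?thesis .
qed

text \<open>
  The first derivatives of \<open>ln (\<bar>\<zeta>\<bar>\<^sup>2 + e)\<close>; its Laplacian \<open>4 e / (\<bar>\<zeta>\<bar>\<^sup>2 + e)\<^sup>2\<close> is an
  approximation of \<open>poisson_mass\<close> times the Dirac measure.
\<close>

definition rker1 :: "real \<Rightarrow> real \<times> real \<Rightarrow> real" where "rker1 e \<zeta> = 2 * fst \<zeta> / (sqn \<zeta> + e)"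
definition rker2 :: "real \<Rightarrow> real \<times> real \<Rightarrow> real" where "rker2 e \<zeta> = 2 * snd \<zeta> / (sqn \<zeta> + e)"

text \<open>Adding e^2 to the squared norm removes the singularity, so the derivatives of f can be
  moved onto the kernels. The scaling \<zeta> \<mapsto> e \<zeta> then turns the resulting density
  into a fixed one and moves e into the argument of f.\<close>

lemma conv_rker_laplace:
  fixes f :: "complex \<Rightarrow> 'e::euclidean_space"
  assumes f: "Ck_on 1 UNIV f" "\<And>w. norm w > r \<Longrightarrow> f w = 0" and "e > 0"
  shows "conv (rker1 (e\<^sup>2)) (\<lambda>w. frechet_derivative f (at w) 1) z +
      conv (rker2 (e\<^sup>2)) (\<lambda>w. frechet_derivative f (at w) \<i>) z =
    (LINT \<zeta>|lborel. (4 / (1 + sqn \<zeta>)\<^sup>2) *\<^sub>R f (z - cx (e *\<^sub>R \<zeta>)))"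
proof -
  define d1 where "d1 \<zeta> = 2 / (sqn \<zeta> + e\<^sup>2) - 4 * (fst \<zeta>)\<^sup>2 / (sqn \<zeta> + e\<^sup>2)\<^sup>2" for \<zeta>
  define d2 where "d2 \<zeta> = 2 / (sqn \<zeta> + e\<^sup>2) - 4 * (snd \<zeta>)\<^sup>2 / (sqn \<zeta> + e\<^sup>2)\<^sup>2" for \<zeta>
  have pos: "sqn \<zeta> + e\<^sup>2 > 0" for \<zeta> using sqn_nonneg[of \<zeta>] \<open>e > 0\<close> by (intro add_nonneg_pos) auto
  then have nz: "sqn \<zeta> + e\<^sup>2 \<noteq> 0" for \<zeta> by (metis less_irrefl)
  have fc: "continuous_on UNIV f" using f(1) Ck_on_continuous by blast
  obtain M where M: "\<And>z. norm (f z) \<le> M" using compact_support_bounded[OF fc f(2)] by blast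
  have cont: "continuous_on UNIV (rker1 (e\<^sup>2))" "continuous_on UNIV (rker2 (e\<^sup>2))"
    "continuous_on UNIV d1" "continuous_on UNIV d2"
    unfolding rker1_def[abs_def] rker2_def[abs_def] d1_def[abs_def] d2_def[abs_def]
    using nz by (auto intro!: continuous_intros continuous_sqn)
  note li = cont[THEN loc_integrable_continuous]
  have der: "((\<lambda>s. 2 * s / (s\<^sup>2 + t\<^sup>2 + e\<^sup>2)) has_real_derivative
      2 / (s\<^sup>2 + t\<^sup>2 + e\<^sup>2) - 4 * s\<^sup>2 / (s\<^sup>2 + t\<^sup>2 + e\<^sup>2)\<^sup>2) (at s)" for s t
    using nz[of "(s, t)"]
    by (auto intro!: derivative_eq_intros simp: sqn_def divide_simps power2_eq_square)
  have "((\<lambda>s. rker1 (e\<^sup>2) (s, t)) has_real_derivative d1 (s, t)) (at s)" for s t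
    using der[of t s] by (simp add: rker1_def d1_def sqn_def)
  from conv_ibp1[OF li(1,3) this f(1)] f(2)
  have 1: "conv (rker1 (e\<^sup>2)) (\<lambda>w. frechet_derivative f (at w) 1) z = conv d1 f z" by blast
  have "((\<lambda>t. rker2 (e\<^sup>2) (s, t)) has_real_derivative d2 (s, t)) (at t)" for s t
    using der[of s t] by (simp add: rker2_def d2_def sqn_def add.commute)
  from conv_ibp2[OF li(2,4) this f(1)] f(2)
  have 2: "conv (rker2 (e\<^sup>2)) (\<lambda>w. frechet_derivative f (at w) \<i>) z = conv d2 f z" by blast
  have sum: "d1 \<zeta> + d2 \<zeta> = 4 * e\<^sup>2 / (sqn \<zeta> + e\<^sup>2)\<^sup>2" for \<zeta>
    using nz[of \<zeta>] unfolding d1_def d2_def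
    by (simp add: divide_simps power2_eq_square) (simp add: sqn_def power2_eq_square algebra_simps)
  have scale: "e\<^sup>2 *\<^sub>R ((4 * e\<^sup>2 / (sqn (e *\<^sub>R \<zeta>) + e\<^sup>2)\<^sup>2) *\<^sub>R v) = (4 / (1 + sqn \<zeta>)\<^sup>2) *\<^sub>R v" for \<zeta> and v :: 'e
  proof -
    have "sqn (e *\<^sub>R \<zeta>) + e\<^sup>2 = e\<^sup>2 * (1 + sqn \<zeta>)" by (simp add: sqn_def power_mult_distrib algebra_simps)
    moreover have "1 + sqn \<zeta> > 0" using sqn_nonneg[of \<zeta>] by simp
    ultimately show ?thesis using \<open>e > 0\<close> by (simp add: divide_simps power2_eq_square)
  qed
  have "conv d1 f z + conv d2 f z = (LINT \<zeta>|lborel. (4 * e\<^sup>2 / (sqn \<zeta> + e\<^sup>2)\<^sup>2) *\<^sub>R f (z - cx \<zeta>))"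
    unfolding conv_def
    by (subst Bochner_Integration.integral_add[symmetric])
      (use integrable_conv_compact[OF li(3) fc _ M] integrable_conv_compact[OF li(4) fc _ M] f(2)
        in \<open>auto simp: sum scaleR_add_left[symmetric]\<close>)
  also have "\<dots> = (LINT \<zeta>|lborel. e\<^sup>2 *\<^sub>R ((4 * e\<^sup>2 / (sqn (e *\<^sub>R \<zeta>) + e\<^sup>2)\<^sup>2) *\<^sub>R f (z - cx (e *\<^sub>R \<zeta>))))"
    by (rule lborel_integral_scale) (use borel_measurable_translate[OF fc] \<open>e > 0\<close> in auto)
  also have "\<dots> = (LINT \<zeta>|lborel. (4 / (1 + sqn \<zeta>)\<^sup>2) *\<^sub>R f (z - cx (e *\<^sub>R \<zeta>)))"
    by (simp only: scale)
  finally show ?thesis using 1 2 by simp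
qed

text \<open>The limit of the regularised identity along e = 1/(n + 1). On the left the singular
  kernels times the derivatives of f dominate; on the right a multiple of the fixed density
  does.\<close>

lemma conv_ker_laplace:
  fixes f :: "complex \<Rightarrow> 'e::euclidean_space"
  assumes f: "Ck_on 1 UNIV f" "\<And>w. norm w > r \<Longrightarrow> f w = 0"
  shows "conv ker1 (\<lambda>w. frechet_derivative f (at w) 1) z +
    conv ker2 (\<lambda>w. frechet_derivative f (at w) \<i>) z = poisson_mass *\<^sub>R f z"
proof -
  define e where "e n = 1 / real (Suc n)" for n
  have e: "e n > 0" for n by (simp add: e_def)
  have e0: "e \<longlonglongrightarrow> 0" unfolding e_def by (rule LIMSEQ_Suc[OF lim_1_over_n])
  have fc: "continuous_on UNIV f" using f(1) Ck_on_continuous by blast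
  obtain M where M: "\<And>z. norm (f z) \<le> M" using compact_support_bounded[OF fc f(2)] by blast
  have lim: "(\<lambda>n. conv (\<lambda>\<zeta>. 2 * p \<zeta> / (sqn \<zeta> + (e n)\<^sup>2)) g z) \<longlonglongrightarrow> conv (\<lambda>\<zeta>. 2 * p \<zeta> / sqn \<zeta>) g z"
    if g: "continuous_on UNIV g" "\<And>w. norm w > r \<Longrightarrow> g w = 0"
      and p: "loc_integrable (\<lambda>\<zeta>. 2 * p \<zeta> / sqn \<zeta>)" "p \<in> borel_measurable borel" "p (0,0) = 0"
    for g :: "complex \<Rightarrow> 'e" and p
  proof -
    note [measurable] = p(2) borel_measurable_translate[OF g(1)]
    obtain N where N: "\<And>z. norm (g z) \<le> N" using compact_support_bounded[OF g] by blast
    have int: "integrable lborel (\<lambda>\<zeta>. (2 * p \<zeta> / sqn \<zeta>) *\<^sub>R g (z - cx \<zeta>))"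
      by (rule integrable_conv_compact[OF p(1) g(1) _ N]) (rule g(2))
    show ?thesis
      unfolding conv_def
    proof (rule integral_dominated_convergence[OF _ _ integrable_norm[OF int]])
      show "AE \<zeta> in lborel. (\<lambda>n. (2 * p \<zeta> / (sqn \<zeta> + (e n)\<^sup>2)) *\<^sub>R g (z - cx \<zeta>)) \<longlonglongrightarrow>
          (2 * p \<zeta> / sqn \<zeta>) *\<^sub>R g (z - cx \<zeta>)"
      proof (rule AE_I2)
        fix \<zeta> :: "real \<times> real"
        show "(\<lambda>n. (2 * p \<zeta> / (sqn \<zeta> + (e n)\<^sup>2)) *\<^sub>R g (z - cx \<zeta>)) \<longlonglongrightarrow>
          (2 * p \<zeta> / sqn \<zeta>) *\<^sub>R g (z - cx \<zeta>)"
        proof (cases "\<zeta> = 0")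
          case False
          then have "sqn \<zeta> \<noteq> 0" by (simp add: sqn_norm)
          then have "(\<lambda>n. (2 * p \<zeta> / (sqn \<zeta> + (e n)\<^sup>2)) *\<^sub>R g (z - cx \<zeta>)) \<longlonglongrightarrow>
            (2 * p \<zeta> / (sqn \<zeta> + 0\<^sup>2)) *\<^sub>R g (z - cx \<zeta>)"
            by (intro tendsto_intros e0) simp
          then show ?thesis by simp
        qed (use p(3) in \<open>simp add: zero_prod_def\<close>)
      qed
      show "AE \<zeta> in lborel. norm ((2 * p \<zeta> / (sqn \<zeta> + (e n)\<^sup>2)) *\<^sub>R g (z - cx \<zeta>))
          \<le> norm ((2 * p \<zeta> / sqn \<zeta>) *\<^sub>R g (z - cx \<zeta>))" for n
      proof (rule AE_I2)
        fix \<zeta> :: "real \<times> real"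
        have "\<bar>2 * p \<zeta> / (sqn \<zeta> + (e n)\<^sup>2)\<bar> \<le> \<bar>2 * p \<zeta> / sqn \<zeta>\<bar>"
        proof (cases "\<zeta> = 0")
          case False
          then have "sqn \<zeta> > 0" by (simp add: sqn_norm)
          then show ?thesis
            by (auto simp: abs_mult intro!: divide_left_mono mult_pos_pos add_pos_nonneg)
        qed (use p(3) in \<open>simp add: zero_prod_def\<close>)
        then show "norm ((2 * p \<zeta> / (sqn \<zeta> + (e n)\<^sup>2)) *\<^sub>R g (z - cx \<zeta>))
          \<le> norm ((2 * p \<zeta> / sqn \<zeta>) *\<^sub>R g (z - cx \<zeta>))"
          by (simp only: norm_scaleR real_norm_def) (intro mult_right_mono, auto)
      qed
    qed (use borel_measurable_translate[OF g(1)] in auto)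
  qed
  have D: "continuous_on UNIV (\<lambda>w. frechet_derivative f (at w) v)"
    "norm w > r \<Longrightarrow> frechet_derivative f (at w) v = 0" for v w
    using f(1) frechet_derivative_zero_outside[OF f(2)] by auto
  have A: "(\<lambda>n. conv (rker1 ((e n)\<^sup>2)) (\<lambda>w. frechet_derivative f (at w) 1) z +
      conv (rker2 ((e n)\<^sup>2)) (\<lambda>w. frechet_derivative f (at w) \<i>) z) \<longlonglongrightarrow>
    conv ker1 (\<lambda>w. frechet_derivative f (at w) 1) z + conv ker2 (\<lambda>w. frechet_derivative f (at w) \<i>) z"
    unfolding rker1_def[abs_def] rker2_def[abs_def] ker1_def[abs_def] ker2_def[abs_def]
    by (intro tendsto_add lim D loc_integrable_ker[unfolded ker1_def[abs_def] ker2_def[abs_def]]) auto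
  have B: "(\<lambda>n. conv (rker1 ((e n)\<^sup>2)) (\<lambda>w. frechet_derivative f (at w) 1) z +
      conv (rker2 ((e n)\<^sup>2)) (\<lambda>w. frechet_derivative f (at w) \<i>) z) =
      (\<lambda>n. LINT \<zeta>|lborel. (4 / (1 + sqn \<zeta>)\<^sup>2) *\<^sub>R f (z - cx (e n *\<^sub>R \<zeta>)))"
    by (rule ext, rule conv_rker_laplace[OF f(1) _ e]) (rule f(2))
  have C: "(\<lambda>n. LINT \<zeta>|lborel. (4 / (1 + sqn \<zeta>)\<^sup>2) *\<^sub>R f (z - cx (e n *\<^sub>R \<zeta>))) \<longlonglongrightarrow>
      (LINT \<zeta>|lborel. (4 / (1 + sqn \<zeta>)\<^sup>2) *\<^sub>R f z)"
  proof (rule integral_dominated_convergence)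
    show "integrable lborel (\<lambda>\<zeta>. (4 / (1 + sqn \<zeta>)\<^sup>2) * M)"
      using integrable_poisson by (rule integrable_mult_left)
    show "AE \<zeta> in lborel. (\<lambda>n. (4 / (1 + sqn \<zeta>)\<^sup>2) *\<^sub>R f (z - cx (e n *\<^sub>R \<zeta>))) \<longlonglongrightarrow> (4 / (1 + sqn \<zeta>)\<^sup>2) *\<^sub>R f z"
    proof (rule AE_I2)
      fix \<zeta> :: "real \<times> real"
      have "cx (e n *\<^sub>R \<zeta>) = of_real (e n) * cx \<zeta>" for n by (simp add: complex_eq_iff)
      then have "(\<lambda>n. z - cx (e n *\<^sub>R \<zeta>)) \<longlonglongrightarrow> z - of_real 0 * cx \<zeta>"
        by (simp only:) (intro tendsto_intros e0)
      moreover have "isCont f z" using fc by (simp add: continuous_on_eq_continuous_at)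
      ultimately have "(\<lambda>n. f (z - cx (e n *\<^sub>R \<zeta>))) \<longlonglongrightarrow> f z"
        by (intro isCont_tendsto_compose[of z f]) auto
      then show "(\<lambda>n. (4 / (1 + sqn \<zeta>)\<^sup>2) *\<^sub>R f (z - cx (e n *\<^sub>R \<zeta>))) \<longlonglongrightarrow> (4 / (1 + sqn \<zeta>)\<^sup>2) *\<^sub>R f z"
        by (intro tendsto_intros)
    qed
    show "AE \<zeta> in lborel. norm ((4 / (1 + sqn \<zeta>)\<^sup>2) *\<^sub>R f (z - cx (e n *\<^sub>R \<zeta>))) \<le> (4 / (1 + sqn \<zeta>)\<^sup>2) * M" for n
    proof (rule AE_I2)
      fix \<zeta> :: "real \<times> real"
      have "norm ((4 / (1 + sqn \<zeta>)\<^sup>2) *\<^sub>R f (z - cx (e n *\<^sub>R \<zeta>))) = (4 / (1 + sqn \<zeta>)\<^sup>2) * norm (f (z - cx (e n *\<^sub>R \<zeta>)))"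
        by simp
      also have "\<dots> \<le> (4 / (1 + sqn \<zeta>)\<^sup>2) * M" by (intro mult_left_mono M) simp
      finally show "norm ((4 / (1 + sqn \<zeta>)\<^sup>2) *\<^sub>R f (z - cx (e n *\<^sub>R \<zeta>))) \<le> (4 / (1 + sqn \<zeta>)\<^sup>2) * M" .
    qed
    have "(\<lambda>\<zeta>. f (z - cx (e n *\<^sub>R \<zeta>))) \<in> borel_measurable borel" for n
      by (intro borel_measurable_continuous_onI continuous_on_compose2[OF fc] continuous_intros
          continuous_on_compose2[OF continuous_cx]) auto
    then show "(\<lambda>\<zeta>. (4 / (1 + sqn \<zeta>)\<^sup>2) *\<^sub>R f (z - cx (e n *\<^sub>R \<zeta>))) \<in> borel_measurable lborel" for n
      by (intro borel_measurable_scaleR) auto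
  qed simp
  have D: "(LINT \<zeta>|lborel. (4 / (1 + sqn \<zeta>)\<^sup>2) *\<^sub>R f z) = poisson_mass *\<^sub>R f z"
    unfolding poisson_mass_def by (intro integral_scaleR_left integrable_poisson)
  show ?thesis
    by (rule LIMSEQ_unique[OF A]) (use C in \<open>simp only: B D\<close>)
qed

text \<open>For z far out, f (z - \<zeta>) is nonzero only for \<zeta> within distance |r| of z,
  where the kernel is at most 2 / (norm z - |r|); that disc lies in a square of area (2
  |r|)^2.\<close>

lemma conv_tendsto_0_at_infinity:
  fixes f :: "complex \<Rightarrow> 'e::euclidean_space"
  assumes k: "\<And>\<zeta>. \<bar>k \<zeta>\<bar> \<le> 2 / norm \<zeta>" and f: "\<And>w. norm w > r \<Longrightarrow> f w = 0" "\<And>z. norm (f z) \<le> M"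
  shows "(conv k f \<longlongrightarrow> 0) at_infinity"
proof (rule Lim_null_comparison)
  define C where "C = 2 * M * (2 * \<bar>r\<bar>)\<^sup>2"
  have M: "0 \<le> M" using f(2)[of 0] norm_ge_zero order_trans by blast
  have *: "norm (conv k f z) \<le> C / (norm z - \<bar>r\<bar>)" if z: "norm z > \<bar>r\<bar>" for z
  proof -
    let ?B = "cbox (Re z - \<bar>r\<bar>, Im z - \<bar>r\<bar>) (Re z + \<bar>r\<bar>, Im z + \<bar>r\<bar>)"
    let ?c = "2 / (norm z - \<bar>r\<bar>) * M"
    have pt: "norm (k \<zeta> *\<^sub>R f (z - cx \<zeta>)) \<le> ?c * indicator ?B \<zeta>" for \<zeta>
    proof (cases "norm (z - cx \<zeta>) \<le> \<bar>r\<bar>")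
      case True
      have "\<bar>Re (z - cx \<zeta>)\<bar> \<le> \<bar>r\<bar>" "\<bar>Im (z - cx \<zeta>)\<bar> \<le> \<bar>r\<bar>"
        using True abs_Re_le_cmod abs_Im_le_cmod order_trans by blast+
      then have "\<zeta> \<in> ?B"
        unfolding cbox_Pair_eq by (cases \<zeta>) auto
      moreover have "norm \<zeta> \<ge> norm z - \<bar>r\<bar>"
        using norm_triangle_ineq2[of z "cx \<zeta>"] True norm_cx[of \<zeta>] by simp
      then have "2 / norm \<zeta> \<le> 2 / (norm z - \<bar>r\<bar>)"
        using z by (intro divide_left_mono) (auto intro!: mult_pos_pos)
      then have "\<bar>k \<zeta>\<bar> \<le> 2 / (norm z - \<bar>r\<bar>)" using k[of \<zeta>] by linarith
      then have "\<bar>k \<zeta>\<bar> * norm (f (z - cx \<zeta>)) \<le> ?c"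
        using z by (intro mult_mono f(2)) auto
      ultimately show ?thesis by simp
    next
      case False
      then have "f (z - cx \<zeta>) = 0" by (intro f(1)) simp
      then show ?thesis using M z by simp
    qed
    have meas: "measure lborel ?B = (2 * \<bar>r\<bar>)\<^sup>2"
      by (subst measure_lborel_cbox) (auto simp: Basis_prod_def power2_eq_square)
    have "norm (conv k f z) \<le> (LINT \<zeta>|lborel. ?c * indicator ?B \<zeta>)"
      unfolding conv_def
    proof (rule order_trans[OF integral_norm_bound Bochner_Integration.integral_mono_AE'])
      show "integrable lborel (\<lambda>\<zeta>. ?c * indicator ?B \<zeta>)"
        by (rule integrable_mult_right, rule integrable_real_indicator, simp, rule emeasure_lborel_cbox_finite)
      show "AE \<zeta> in lborel. 0 \<le> ?c * indicator ?B \<zeta>" using M z by (intro AE_I2) simp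
      show "AE \<zeta> in lborel. norm (k \<zeta> *\<^sub>R f (z - cx \<zeta>)) \<le> ?c * indicator ?B \<zeta>"
        by (rule AE_I2, rule pt)
    qed
    also have "\<dots> = C / (norm z - \<bar>r\<bar>)" using meas by (simp add: C_def)
    finally show ?thesis .
  qed
  show "\<forall>\<^sub>F z in at_infinity. norm (conv k f z) \<le> C / (norm z - \<bar>r\<bar>)"
    unfolding eventually_at_infinity by (intro exI[of _ "\<bar>r\<bar> + 1"]) (use * in auto)
  have "filterlim (\<lambda>z::complex. norm z - \<bar>r\<bar>) at_top at_infinity"
    using filterlim_tendsto_add_at_top[OF tendsto_const[of "- \<bar>r\<bar>"] filterlim_norm_at_top] by simp
  then show "((\<lambda>z::complex. C / (norm z - \<bar>r\<bar>)) \<longlongrightarrow> 0) at_infinity"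
    by (intro tendsto_divide_0[OF tendsto_const] filterlim_at_top_imp_at_infinity)
qed

section \<open>Regularity of fixed points of translation-equivariant operators\<close>

lemma bcontfun_iff:
  fixes f :: "'a::topological_space \<Rightarrow> 'b::real_normed_vector"
  shows "f \<in> bcontfun \<longleftrightarrow> continuous_on UNIV f \<and> (\<exists>M. \<forall>z. norm (f z) \<le> M)"
  by (auto simp: bcontfun_def bounded_iff)

lemma bcontfun_bound:
  fixes f :: "'a::topological_space \<Rightarrow> 'b::real_normed_vector"
  assumes "f \<in> bcontfun" obtains M where "M > 0" "\<And>z. norm (f z) \<le> M"
proof -
  obtain M where "\<And>z. norm (f z) \<le> M" using assms by (auto simp: bcontfun_iff)
  then have "norm (f z) \<le> \<bar>M\<bar> + 1" for z by (smt (verit))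
  then show ?thesis by (intro that[of "\<bar>M\<bar> + 1"]) auto
qed

lemma bcontfun_add:
  fixes f g :: "'a::topological_space \<Rightarrow> 'b::real_normed_vector"
  assumes "f \<in> bcontfun" "g \<in> bcontfun" shows "(\<lambda>z. f z + g z) \<in> bcontfun"
proof -
  obtain M N where "\<And>z. norm (f z) \<le> M" "\<And>z. norm (g z) \<le> N"
    using assms by (auto simp: bcontfun_iff)
  then have "norm (f z + g z) \<le> M + N" for z by (intro norm_triangle_le add_mono)
  then show ?thesis using assms by (auto simp: bcontfun_iff intro!: continuous_intros)
qed

lemma bcontfun_scaleR_fun:
  fixes f :: "'a::topological_space \<Rightarrow> 'b::real_normed_vector" and c :: "'a \<Rightarrow> real"
  assumes "c \<in> bcontfun" "f \<in> bcontfun" shows "(\<lambda>z. c z *\<^sub>R f z) \<in> bcontfun"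
proof -
  obtain M N where "M > 0" "\<And>z. norm (c z) \<le> M" "N > 0" "\<And>z. norm (f z) \<le> N"
    using assms bcontfun_bound by metis
  then have "norm (c z *\<^sub>R f z) \<le> M * N" for z by (auto intro!: mult_mono)
  then show ?thesis using assms by (auto simp: bcontfun_iff intro!: continuous_intros)
qed

lemma bcontfun_const: "(\<lambda>_. c) \<in> bcontfun"
  by (rule const_bcontfun)

lemma bcontfun_scaleR:
  fixes f :: "'a::topological_space \<Rightarrow> 'b::real_normed_vector"
  assumes "f \<in> bcontfun" shows "(\<lambda>z. c *\<^sub>R f z) \<in> bcontfun"
  by (rule bcontfun_scaleR_fun[OF bcontfun_const assms])

lemma bcontfun_diff:
  fixes f g :: "'a::topological_space \<Rightarrow> 'b::real_normed_vector"
  assumes "f \<in> bcontfun" "g \<in> bcontfun" shows "(\<lambda>z. f z - g z) \<in> bcontfun"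
  using bcontfun_add[OF assms(1) bcontfun_scaleR[OF assms(2), of "-1"]] by simp

lemma bcontfun_sum:
  fixes f :: "'i \<Rightarrow> 'a::topological_space \<Rightarrow> 'b::real_normed_vector"
  assumes "\<And>i. i \<in> I \<Longrightarrow> f i \<in> bcontfun" shows "(\<lambda>z. \<Sum>i\<in>I. f i z) \<in> bcontfun"
  using assms
  by (induction I rule: infinite_finite_induct) (auto intro: bcontfun_add bcontfun_const)

lemma bcontfun_inner_const:
  fixes f :: "'a::topological_space \<Rightarrow> 'b::real_inner"
  assumes "f \<in> bcontfun" shows "(\<lambda>z. f z \<bullet> b) \<in> bcontfun"
proof -
  obtain M where M: "\<And>z. norm (f z) \<le> M" using assms by (auto simp: bcontfun_iff)
  have "norm (f z \<bullet> b) \<le> M * norm b" for z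
    using Cauchy_Schwarz_ineq2[of "f z" b] mult_right_mono[OF M[of z], of "norm b"] by simp
  then show ?thesis using assms by (auto simp: bcontfun_iff intro!: continuous_intros)
qed

lemma bcontfun_shift:
  fixes f :: "'a::real_normed_vector \<Rightarrow> 'b::real_normed_vector"
  assumes "f \<in> bcontfun" shows "(\<lambda>z. f (z + h)) \<in> bcontfun"
proof -
  have "continuous_on UNIV (\<lambda>z. f (z + h))"
    by (rule continuous_on_compose2[of UNIV f]) (use assms in \<open>auto simp: bcontfun_iff intro!: continuous_intros\<close>)
  then show ?thesis using assms by (auto simp: bcontfun_iff)
qed

lemma bcontfun_compact_support:
  fixes f :: "'a::euclidean_space \<Rightarrow> 'b::real_normed_vector"
  assumes "continuous_on UNIV f" "\<And>w. norm w > r \<Longrightarrow> f w = 0"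
  shows "f \<in> bcontfun"
proof -
  obtain M where "\<And>z. norm (f z) \<le> M" using compact_support_bounded[OF assms] by blast
  then show ?thesis using assms by (auto simp: bcontfun_iff)
qed

text \<open>The supremum S of g satisfies S \<le> q S + a, hence S \<le> a / (1 - q). The crude
  bound M0 makes S finite.\<close>

lemma sup_absorb:
  fixes g :: "'a \<Rightarrow> real"
  assumes bdd: "\<And>z. g z \<le> M0" and step: "\<And>M z. (\<And>z. g z \<le> M) \<Longrightarrow> g z \<le> q * M + a" and q: "q < 1"
  shows "g z \<le> a / (1 - q)"
proof -
  define S where "S = (SUP z. g z)"
  have up: "g z \<le> S" for z
    unfolding S_def by (rule cSUP_upper) (use bdd in \<open>auto simp: bdd_above_def\<close>)
  have "S \<le> q * S + a"
    unfolding S_def[symmetric] using step[OF up] by (subst (1) S_def) (rule cSUP_least, auto)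
  then have "S \<le> a / (1 - q)" using q by (simp add: field_simps)
  then show ?thesis using up[of z] by linarith
qed

text \<open>A field of linear maps, encoded by its columns \<alpha> b for the basis vectors b, so
  that regularity and support can be stated column by column.\<close>

definition lincomb :: "('u::euclidean_space \<Rightarrow> complex \<Rightarrow> 'e::euclidean_space) \<Rightarrow> 'u \<Rightarrow> complex \<Rightarrow> 'e" where
  "lincomb \<alpha> w z = (\<Sum>b\<in>Basis. (w \<bullet> b) *\<^sub>R \<alpha> b z)"

lemma lincomb_add: "lincomb \<alpha> (v + w) z = lincomb \<alpha> v z + lincomb \<alpha> w z"
  and lincomb_diff: "lincomb \<alpha> (v - w) z = lincomb \<alpha> v z - lincomb \<alpha> w z"
  and lincomb_scaleR: "lincomb \<alpha> (c *\<^sub>R v) z = c *\<^sub>R lincomb \<alpha> v z"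
  by (simp_all add: lincomb_def inner_add_left inner_diff_left scaleR_add_left scaleR_diff_left
      sum.distrib sum_subtractf scaleR_sum_right)

lemma lincomb_const_nonneg:
  fixes \<alpha> :: "'u::euclidean_space \<Rightarrow> complex \<Rightarrow> 'e::euclidean_space"
  assumes "\<And>w z. norm (lincomb \<alpha> w z) \<le> c * norm w"
  shows "c \<ge> 0"
proof -
  obtain b :: 'u where "b \<in> Basis" using nonempty_Basis by blast
  then have "norm (lincomb \<alpha> b 0) \<le> c" using assms[of b 0] by simp
  then show ?thesis using norm_ge_zero order_trans by blast
qed

lemma lincomb_le:
  fixes \<alpha> :: "'u::euclidean_space \<Rightarrow> complex \<Rightarrow> 'e::euclidean_space"
  assumes "\<And>w z. norm (lincomb \<alpha> w z) \<le> c * norm w" "norm w \<le> M"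
  shows "norm (lincomb \<alpha> w z) \<le> c * M"
  using assms(1)[of w z] mult_left_mono[OF assms(2) lincomb_const_nonneg[OF assms(1)]] by linarith

lemma bcontfun_lincomb:
  assumes "\<And>b. b \<in> Basis \<Longrightarrow> \<alpha> b \<in> bcontfun" "X \<in> bcontfun"
  shows "(\<lambda>z. lincomb \<alpha> (X z) z) \<in> bcontfun"
  unfolding lincomb_def by (intro bcontfun_sum bcontfun_scaleR_fun bcontfun_inner_const assms)

text \<open>The features of the potential operator on which existence and regularity rest: it is
  linear, bounded by \<kappa> in the sup norm, and commutes with translations. Equivariance is what
  lets the equation be applied to difference quotients of a solution.\<close>

locale shift_operator =
  fixes T :: "(complex \<Rightarrow> 'e::euclidean_space) \<Rightarrow> complex \<Rightarrow> 'u::euclidean_space" and \<kappa> :: real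
  assumes T_bcontfun: "f \<in> bcontfun \<Longrightarrow> T f \<in> bcontfun"
    and T_add: "f \<in> bcontfun \<Longrightarrow> g \<in> bcontfun \<Longrightarrow> T (\<lambda>z. f z + g z) z = T f z + T g z"
    and T_scaleR: "f \<in> bcontfun \<Longrightarrow> T (\<lambda>z. c *\<^sub>R f z) z = c *\<^sub>R T f z"
    and T_bound: "f \<in> bcontfun \<Longrightarrow> (\<And>z. norm (f z) \<le> M) \<Longrightarrow> norm (T f z) \<le> \<kappa> * M"
    and T_shift: "f \<in> bcontfun \<Longrightarrow> T f (z + h) = T (\<lambda>w. f (w + h)) z"
    and kappa_pos: "\<kappa> > 0"
begin

lemma T_diff: "f \<in> bcontfun \<Longrightarrow> g \<in> bcontfun \<Longrightarrow> T (\<lambda>z. f z - g z) z = T f z - T g z"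
  using T_add[of f "\<lambda>z. (-1) *\<^sub>R g z"] T_scaleR[of g "-1"] bcontfun_scaleR[of g "-1"] by simp

text \<open>The affine map Y \<mapsto> T (\<alpha> Y + B) contracts the space of bounded continuous
  functions by the factor \<kappa> c \<le> 1/2.\<close>

lemma linear_fixed_point:
  assumes \<alpha>: "\<And>b. b \<in> Basis \<Longrightarrow> \<alpha> b \<in> bcontfun" and B: "B \<in> bcontfun"
    and c: "\<And>w z. norm (lincomb \<alpha> w z) \<le> c * norm w" "\<kappa> * c \<le> 1/2"
  obtains Y where "Y \<in> bcontfun" "Y = T (\<lambda>z. lincomb \<alpha> (Y z) z + B z)"
proof -
  define \<Phi> where "\<Phi> Y = Bcontfun (T (\<lambda>z. lincomb \<alpha> (apply_bcontfun Y z) z + B z))" for Y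
  have mem: "(\<lambda>z. lincomb \<alpha> (apply_bcontfun Y z) z + B z) \<in> bcontfun" for Y :: "complex \<Rightarrow>\<^sub>C 'u"
    by (intro bcontfun_add bcontfun_lincomb \<alpha> B) (simp_all add: apply_bcontfun)
  have app: "apply_bcontfun (\<Phi> Y) = T (\<lambda>z. lincomb \<alpha> (apply_bcontfun Y z) z + B z)" for Y
    unfolding \<Phi>_def by (rule Bcontfun_inverse[OF T_bcontfun[OF mem]])
  have "\<exists>!Y. \<Phi> Y = Y"
  proof (rule banach_fix_type[of "1/2"])
    have "dist (\<Phi> Y) (\<Phi> Z) \<le> 1/2 * dist Y Z" for Y Z
    proof (rule dist_bound)
      fix z
      have "\<Phi> Y z - \<Phi> Z z = T (\<lambda>z. lincomb \<alpha> (Y z - Z z) z) z"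
        by (simp add: app T_diff[OF mem mem, symmetric] lincomb_diff)
      also have "norm \<dots> \<le> \<kappa> * (c * dist Y Z)"
      proof (rule T_bound)
        show "(\<lambda>z. lincomb \<alpha> (Y z - Z z) z) \<in> bcontfun"
          by (intro bcontfun_lincomb \<alpha> bcontfun_diff) (simp_all add: apply_bcontfun)
        fix z
        show "norm (lincomb \<alpha> (Y z - Z z) z) \<le> c * dist Y Z"
          by (rule lincomb_le[OF c(1)]) (metis dist_bounded dist_norm)
      qed
      also have "\<dots> \<le> 1/2 * dist Y Z"
        using mult_right_mono[OF c(2), of "dist Y Z"] by (simp add: mult.assoc)
      finally show "dist (\<Phi> Y z) (\<Phi> Z z) \<le> 1/2 * dist Y Z" by (simp add: dist_norm)
    qed
    then show "\<forall>Y Z. dist (\<Phi> Y) (\<Phi> Z) \<le> 1/2 * dist Y Z" by blast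
  qed auto
  then obtain Y where "\<Phi> Y = Y" by blast
  then have "apply_bcontfun Y = T (\<lambda>z. lincomb \<alpha> (apply_bcontfun Y z) z + B z)" using app[of Y] by simp
  then show ?thesis using that[of "apply_bcontfun Y"] apply_bcontfun[of Y] by blast
qed

text \<open>
  If \<open>f\<close> is, to first order, a linear function of \<open>V = T f\<close>, then translating the equation shows
  that the difference quotients of \<open>V\<close> solve a contractive linear equation up to a small error.
\<close>

lemma differentiable_fixed_point:
  assumes f: "f \<in> bcontfun" and V: "V = T f"
    and \<alpha>: "\<And>b. b \<in> Basis \<Longrightarrow> \<alpha> b \<in> bcontfun"
    and c: "\<And>w z. norm (lincomb \<alpha> w z) \<le> c * norm w" "\<kappa> * c \<le> 1/2"
    and B: "B1 \<in> bcontfun" "B2 \<in> bcontfun"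
    and approx: "\<And>e. e > 0 \<Longrightarrow> \<exists>d>0. \<forall>z h. norm h < d \<longrightarrow>
      norm (f (z + h) - f z - lincomb \<alpha> (V (z + h) - V z) z - (Re h *\<^sub>R B1 z + Im h *\<^sub>R B2 z))
        \<le> e * (norm h + norm (V (z + h) - V z))"
  obtains Y1 Y2 where "Y1 \<in> bcontfun" "Y1 = T (\<lambda>z. lincomb \<alpha> (Y1 z) z + B1 z)"
    "Y2 \<in> bcontfun" "Y2 = T (\<lambda>z. lincomb \<alpha> (Y2 z) z + B2 z)"
    "\<And>z. (V has_derivative (\<lambda>h. Re h *\<^sub>R Y1 z + Im h *\<^sub>R Y2 z)) (at z)"
proof -
  obtain Y1 where Y1: "Y1 \<in> bcontfun" "Y1 = T (\<lambda>z. lincomb \<alpha> (Y1 z) z + B1 z)"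
    using linear_fixed_point[OF \<alpha> B(1) c] by blast
  obtain Y2 where Y2: "Y2 \<in> bcontfun" "Y2 = T (\<lambda>z. lincomb \<alpha> (Y2 z) z + B2 z)"
    using linear_fixed_point[OF \<alpha> B(2) c] by blast
  have Vb: "V \<in> bcontfun" unfolding V by (rule T_bcontfun[OF f])
  define \<delta> where "\<delta> h z = V (z + h) - V z" for h z
  define err where "err h z = f (z + h) - f z - lincomb \<alpha> (\<delta> h z) z - (Re h *\<^sub>R B1 z + Im h *\<^sub>R B2 z)" for h z
  have \<delta>b: "\<delta> h \<in> bcontfun" for h unfolding \<delta>_def by (intro bcontfun_diff bcontfun_shift Vb)
  have errb: "err h \<in> bcontfun" for h
    unfolding err_def by (intro bcontfun_diff bcontfun_shift bcontfun_add bcontfun_scaleR bcontfun_lincomb \<alpha> f B \<delta>b)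
  have fsh: "(\<lambda>w. f (w + h) - f w) \<in> bcontfun" for h by (intro bcontfun_diff bcontfun_shift f)
  have \<delta>T: "\<delta> h z = T (\<lambda>w. f (w + h) - f w) z" for h z
    unfolding \<delta>_def V using T_shift[OF f] T_diff[OF bcontfun_shift[OF f] f] by simp
  obtain \<beta>1 where \<beta>1: "\<beta>1 > 0" "\<And>z. norm (B1 z) \<le> \<beta>1" using bcontfun_bound[OF B(1)] by blast
  obtain \<beta>2 where \<beta>2: "\<beta>2 > 0" "\<And>z. norm (B2 z) \<le> \<beta>2" using bcontfun_bound[OF B(2)] by blast
  define \<beta> where "\<beta> = \<beta>1 + \<beta>2"
  have Bh: "norm (Re h *\<^sub>R B1 z + Im h *\<^sub>R B2 z) \<le> \<beta> * norm h" for h z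
  proof -
    have "norm (Re h *\<^sub>R B1 z) \<le> norm h * \<beta>1" "norm (Im h *\<^sub>R B2 z) \<le> norm h * \<beta>2"
      using \<beta>1 \<beta>2 abs_Re_le_cmod[of h] abs_Im_le_cmod[of h] by (auto intro!: mult_mono)
    then show ?thesis by (intro norm_triangle_le) (simp add: \<beta>_def algebra_simps)
  qed
  \<comment> \<open>With this tolerance the error term costs a factor 1/4, which together with
    \<kappa> c \<le> 1/2 leaves the contraction factor 3/4.\<close>
  define e0 where "e0 = 1 / (4 * \<kappa>)"
  have e0: "e0 > 0" "\<kappa> * e0 = 1/4" using kappa_pos by (auto simp: e0_def)
  define K where "K = 4 * (\<kappa> * (\<beta> + e0))"
  have K: "K > 0" using kappa_pos e0 \<beta>1 \<beta>2 by (auto simp: K_def \<beta>_def)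
  obtain d0 where d0: "d0 > 0" "\<And>z h. norm h < d0 \<Longrightarrow> norm (err h z) \<le> e0 * (norm h + norm (\<delta> h z))"
    using approx[OF e0(1)] unfolding err_def \<delta>_def by blast
  \<comment> \<open>A Lipschitz bound has to precede differentiability: it converts the error o(|h|
    + |\<delta>|) of the hypothesis into o(|h|).\<close>
  have lip: "norm (\<delta> h z) \<le> K * norm h" if h: "norm h < d0" for h z
  proof -
    obtain M0 where M0: "\<And>z. norm (\<delta> h z) \<le> M0" using bcontfun_bound[OF \<delta>b[of h]] by blast
    have "norm (\<delta> h z) \<le> (\<kappa> * (\<beta> + e0) * norm h) / (1 - 3/4)"
    proof (rule sup_absorb[OF M0])
      fix M z assume M: "\<And>z. norm (\<delta> h z) \<le> M"
      have "norm (f (w + h) - f w) \<le> c * M + (\<beta> + e0) * norm h + e0 * M" for w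
      proof -
        have "f (w + h) - f w = lincomb \<alpha> (\<delta> h w) w + (Re h *\<^sub>R B1 w + Im h *\<^sub>R B2 w) + err h w"
          by (simp add: err_def)
        moreover have "norm (lincomb \<alpha> (\<delta> h w) w) \<le> c * M"
          by (rule lincomb_le[OF c(1) M])
        moreover have "norm (err h w) \<le> e0 * (norm h + M)"
          using d0(2)[OF h, of w] mult_left_mono[OF add_left_mono[OF M[of w]], of e0 "norm h"] e0(1)
          by linarith
        ultimately show ?thesis
          using Bh[of h w] norm_triangle_ineq[of "lincomb \<alpha> (\<delta> h w) w + (Re h *\<^sub>R B1 w + Im h *\<^sub>R B2 w)" "err h w"]
            norm_triangle_ineq[of "lincomb \<alpha> (\<delta> h w) w" "Re h *\<^sub>R B1 w + Im h *\<^sub>R B2 w"]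
          by (simp add: algebra_simps)
      qed
      from T_bound[OF fsh this]
      have "norm (\<delta> h z) \<le> (\<kappa> * c) * M + (\<kappa> * e0) * M + \<kappa> * (\<beta> + e0) * norm h"
        unfolding \<delta>T by (simp add: algebra_simps)
      moreover have "(\<kappa> * c) * M \<le> (1/2) * M"
        using c(2) order_trans[OF norm_ge_zero M[of z]] by (intro mult_right_mono) auto
      ultimately show "norm (\<delta> h z) \<le> 3/4 * M + \<kappa> * (\<beta> + e0) * norm h" using e0(2) by simp
    qed simp
    then show ?thesis by (simp add: K_def algebra_simps)
  qed
  have der: "(V has_derivative (\<lambda>h. Re h *\<^sub>R Y1 z + Im h *\<^sub>R Y2 z)) (at z)" for z
  proof (rule has_derivativeI)
    show "bounded_linear (\<lambda>h. Re h *\<^sub>R Y1 z + Im h *\<^sub>R Y2 z)"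
      by (intro bounded_linear_add bounded_linear_scaleR_const bounded_linear_Re bounded_linear_Im)
    show "((\<lambda>y. (V y - V z - (Re (y - z) *\<^sub>R Y1 z + Im (y - z) *\<^sub>R Y2 z)) /\<^sub>R norm (y - z)) \<longlongrightarrow> 0) (at z)"
    proof (rule LIM_I)
      fix e :: real assume e: "e > 0"
      \<comment> \<open>Absorbing the contraction factor 1/2 doubles the constant \<kappa> e' (1 +
        K), which is e/4 by this choice.\<close>
      define e' where "e' = e / (4 * \<kappa> * (1 + K))"
      have e': "e' > 0" using e K kappa_pos by (simp add: e'_def)
      obtain d where d: "d > 0" "\<And>z h. norm h < d \<Longrightarrow> norm (err h z) \<le> e' * (norm h + norm (\<delta> h z))"
        using approx[OF e'] unfolding err_def \<delta>_def by blast
      have *: "norm (\<delta> h z - (Re h *\<^sub>R Y1 z + Im h *\<^sub>R Y2 z)) \<le> e / 2 * norm h"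
        if h: "norm h < min d d0" for h z
      proof -
        define R where "R z = \<delta> h z - (Re h *\<^sub>R Y1 z + Im h *\<^sub>R Y2 z)" for z
        have Rb: "R \<in> bcontfun"
          unfolding R_def by (intro bcontfun_diff bcontfun_add bcontfun_scaleR \<delta>b Y1 Y2)
        obtain M0 where M0: "\<And>z. norm (R z) \<le> M0" using bcontfun_bound[OF Rb] by blast
        have LYb: "(\<lambda>z. lincomb \<alpha> (Y1 z) z + B1 z) \<in> bcontfun" "(\<lambda>z. lincomb \<alpha> (Y2 z) z + B2 z) \<in> bcontfun"
          by (rule bcontfun_add[OF bcontfun_lincomb[OF \<alpha> Y1(1)] B(1)],
              assumption?, rule bcontfun_add[OF bcontfun_lincomb[OF \<alpha> Y2(1)] B(2)])
        \<comment> \<open>The remainder solves the linear equation with the error term as its only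
          inhomogeneity, because Y1 and Y2 solve the equations with B1 and B2.\<close>
        have RT: "R z = T (\<lambda>w. lincomb \<alpha> (R w) w + err h w) z" for z
        proof -
          have "R z = T (\<lambda>w. f (w + h) - f w) z - (Re h *\<^sub>R T (\<lambda>z. lincomb \<alpha> (Y1 z) z + B1 z) z
              + Im h *\<^sub>R T (\<lambda>z. lincomb \<alpha> (Y2 z) z + B2 z) z)"
            unfolding R_def \<delta>T by (simp only: Y1(2)[symmetric] Y2(2)[symmetric])
          also have "\<dots> = T (\<lambda>w. f (w + h) - f w - (Re h *\<^sub>R (lincomb \<alpha> (Y1 w) w + B1 w)
              + Im h *\<^sub>R (lincomb \<alpha> (Y2 w) w + B2 w))) z"
            by (simp add: T_diff[OF fsh] T_add T_scaleR bcontfun_scaleR bcontfun_add LYb)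
          also have "(\<lambda>w. f (w + h) - f w - (Re h *\<^sub>R (lincomb \<alpha> (Y1 w) w + B1 w)
              + Im h *\<^sub>R (lincomb \<alpha> (Y2 w) w + B2 w))) = (\<lambda>w. lincomb \<alpha> (R w) w + err h w)"
            by (simp add: fun_eq_iff R_def err_def lincomb_add lincomb_diff lincomb_scaleR algebra_simps)
          finally show ?thesis .
        qed
        have "norm (R z) \<le> (\<kappa> * (e' * (1 + K)) * norm h) / (1 - 1/2)"
        proof (rule sup_absorb[OF M0])
          fix M z assume M: "\<And>z. norm (R z) \<le> M"
          have "norm (lincomb \<alpha> (R w) w + err h w) \<le> c * M + e' * (1 + K) * norm h" for w
          proof (rule norm_triangle_le, rule add_mono)
            show "norm (lincomb \<alpha> (R w) w) \<le> c * M" by (rule lincomb_le[OF c(1) M])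
            have "norm (err h w) \<le> e' * (norm h + norm (\<delta> h w))" using d(2) h by simp
            also have "\<dots> \<le> e' * (norm h + K * norm h)"
              using lip[of h w] h e' by (intro mult_left_mono add_left_mono) auto
            finally show "norm (err h w) \<le> e' * (1 + K) * norm h" by (simp add: algebra_simps)
          qed
          from T_bound[OF bcontfun_add[OF bcontfun_lincomb[OF \<alpha> Rb] errb] this]
          have "norm (R z) \<le> (\<kappa> * c) * M + \<kappa> * (e' * (1 + K)) * norm h"
            unfolding RT[of z] by (simp add: algebra_simps)
          moreover have "(\<kappa> * c) * M \<le> (1/2) * M"
            using c(2) order_trans[OF norm_ge_zero M[of z]] by (intro mult_right_mono) auto
          ultimately show "norm (R z) \<le> 1/2 * M + \<kappa> * (e' * (1 + K)) * norm h" by simp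
        qed simp
        also have "\<kappa> * (e' * (1 + K)) = e / 4"
          using K kappa_pos by (simp add: e'_def)
        finally have "norm (R z) \<le> e / 4 * norm h / (1 - 1 / 2)" .
        also have "\<dots> = e / 2 * norm h" by simp
        finally show ?thesis by (simp add: R_def)
      qed
      have "norm ((V y - V z - (Re (y - z) *\<^sub>R Y1 z + Im (y - z) *\<^sub>R Y2 z)) /\<^sub>R norm (y - z) - 0) < e"
        if y: "y \<noteq> z" "norm (y - z) < min d d0" for y
      proof -
        have "norm (V y - V z - (Re (y - z) *\<^sub>R Y1 z + Im (y - z) *\<^sub>R Y2 z)) \<le> e / 2 * norm (y - z)"
          using *[OF y(2), of z] by (simp add: \<delta>_def)
        also have "\<dots> < e * norm (y - z)" using y e by simp
        finally show ?thesis using y by (simp add: divide_simps mult.commute)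
      qed
      then show "\<exists>s>0. \<forall>y. y \<noteq> z \<and> norm (y - z) < s \<longrightarrow>
          norm ((V y - V z - (Re (y - z) *\<^sub>R Y1 z + Im (y - z) *\<^sub>R Y2 z)) /\<^sub>R norm (y - z) - 0) < e"
        using d(1) d0(1) by (intro exI[of _ "min d d0"]) auto
    qed
  qed
  show ?thesis by (rule that[OF Y1 Y2 der])
qed

end

lemma lincomb_uniform_derivative:
  fixes \<alpha> :: "'u::euclidean_space \<Rightarrow> complex \<Rightarrow> 'e::euclidean_space"
  assumes \<alpha>: "\<And>b. b \<in> Basis \<Longrightarrow> Ck_on 1 UNIV (\<alpha> b)"
    "\<And>b w. b \<in> Basis \<Longrightarrow> norm w > r \<Longrightarrow> \<alpha> b w = 0" and "e > 0"
  obtains d where "d > 0" "\<And>z h w. norm h < d \<Longrightarrow>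
    norm (lincomb \<alpha> w (z + h) - lincomb \<alpha> w z - lincomb (\<lambda>b z. frechet_derivative (\<alpha> b) (at z) h) w z)
      \<le> e * norm h * norm w"
proof -
  define e' where "e' = e / real DIM('u)"
  have e': "e' > 0" using \<open>e > 0\<close> by (simp add: e'_def)
  have "\<forall>b\<in>Basis. \<exists>d>0. \<forall>z h. norm h < d \<longrightarrow>
      norm (\<alpha> b (z + h) - \<alpha> b z - frechet_derivative (\<alpha> b) (at z) h) \<le> e' * norm h"
  proof
    fix b :: 'u assume b: "b \<in> Basis"
    show "\<exists>d>0. \<forall>z h. norm h < d \<longrightarrow>
      norm (\<alpha> b (z + h) - \<alpha> b z - frechet_derivative (\<alpha> b) (at z) h) \<le> e' * norm h"
      using compact_support_uniform_derivative[OF \<alpha>(1)[OF b] \<alpha>(2)[OF b] e'] by blast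
  qed
  from bchoice[OF this] obtain \<delta> where \<delta>: "\<And>b. b \<in> Basis \<Longrightarrow> \<delta> b > 0" "\<And>b z h. b \<in> Basis \<Longrightarrow> norm h < \<delta> b \<Longrightarrow>
      norm (\<alpha> b (z + h) - \<alpha> b z - frechet_derivative (\<alpha> b) (at z) h) \<le> e' * norm h"
    by blast
  define d where "d = Min (\<delta> ` Basis)"
  have d: "d > 0" "\<And>b. b \<in> Basis \<Longrightarrow> d \<le> \<delta> b" by (auto simp: d_def \<delta>(1))
  show ?thesis
  proof (rule that[OF d(1)])
    fix z h :: complex and w :: 'u assume h: "norm h < d"
    have "lincomb \<alpha> w (z + h) - lincomb \<alpha> w z - lincomb (\<lambda>b z. frechet_derivative (\<alpha> b) (at z) h) w z =
        (\<Sum>b\<in>Basis. (w \<bullet> b) *\<^sub>R (\<alpha> b (z + h) - \<alpha> b z - frechet_derivative (\<alpha> b) (at z) h))"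
      by (simp add: lincomb_def sum_subtractf scaleR_diff_right)
    also have "norm \<dots> \<le> (\<Sum>b\<in>(Basis :: 'u set). norm w * (e' * norm h))"
    proof (rule order_trans[OF norm_sum sum_mono])
      fix b :: 'u assume b: "b \<in> Basis"
      show "norm ((w \<bullet> b) *\<^sub>R (\<alpha> b (z + h) - \<alpha> b z - frechet_derivative (\<alpha> b) (at z) h)) \<le> norm w * (e' * norm h)"
        using \<delta>(2)[OF b less_le_trans[OF h d(2)[OF b]], of z] Basis_le_norm[OF b, of w]
        by (simp add: mult_mono)
    qed
    also have "\<dots> = e * norm h * norm w" by (simp add: e'_def)
    finally show "norm (lincomb \<alpha> w (z + h) - lincomb \<alpha> w z -
        lincomb (\<lambda>b z. frechet_derivative (\<alpha> b) (at z) h) w z) \<le> e * norm h * norm w" .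
  qed
qed

lemma linear_complex_decomp:
  fixes L :: "complex \<Rightarrow> 'e::real_vector"
  assumes "linear L"
  shows "L h = Re h *\<^sub>R L 1 + Im h *\<^sub>R L \<i>"
proof -
  have "L h = L (Re h *\<^sub>R 1 + Im h *\<^sub>R \<i>)" by (rule arg_cong[of _ _ L]) (simp add: complex_eq_iff)
  then show ?thesis using linear_add[OF assms] linear_scale[OF assms] by simp
qed

lemma lincomb_derivative_decomp:
  fixes \<alpha> :: "complex \<Rightarrow> 'u::euclidean_space \<Rightarrow> complex \<Rightarrow> 'e::euclidean_space"
  assumes "\<And>b. b \<in> Basis \<Longrightarrow> linear (D b)" "\<And>b h. b \<in> Basis \<Longrightarrow> \<alpha> h b z = D b h"
  shows "lincomb (\<alpha> h) w z = Re h *\<^sub>R lincomb (\<alpha> 1) w z + Im h *\<^sub>R lincomb (\<alpha> \<i>) w z"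
proof -
  have "(w \<bullet> b) *\<^sub>R \<alpha> h b z = Re h *\<^sub>R (w \<bullet> b) *\<^sub>R \<alpha> 1 b z + Im h *\<^sub>R (w \<bullet> b) *\<^sub>R \<alpha> \<i> b z"
    if b: "b \<in> Basis" for b
    using linear_complex_decomp[OF assms(1)[OF b], of h] by (simp add: assms(2)[OF b] scaleR_add_right mult.commute)
  then show ?thesis by (simp add: lincomb_def sum.distrib scaleR_sum_right)
qed

lemma lincomb_bound:
  fixes \<alpha> :: "'u::euclidean_space \<Rightarrow> complex \<Rightarrow> 'e::euclidean_space"
  assumes "\<And>b. b \<in> Basis \<Longrightarrow> \<alpha> b \<in> bcontfun"
  obtains N where "N > 0" "\<And>w z. norm (lincomb \<alpha> w z) \<le> N * norm w"
proof -
  have "\<forall>b\<in>Basis. \<exists>M. \<forall>z. norm (\<alpha> b z) \<le> M"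
    using assms by (simp add: bcontfun_iff)
  from bchoice[OF this] obtain M where M: "\<And>b z. b \<in> Basis \<Longrightarrow> norm (\<alpha> b z) \<le> M b" by blast
  have "norm (lincomb \<alpha> w z) \<le> ((\<Sum>b\<in>Basis. \<bar>M b\<bar>) + 1) * norm w" for w z
  proof -
    have "norm (lincomb \<alpha> w z) \<le> (\<Sum>b\<in>Basis. \<bar>M b\<bar> * norm w)"
      unfolding lincomb_def
    proof (rule order_trans[OF norm_sum sum_mono])
      fix b :: 'u assume b: "b \<in> Basis"
      have "norm (\<alpha> b z) \<le> \<bar>M b\<bar>" using M[OF b, of z] by linarith
      then show "norm ((w \<bullet> b) *\<^sub>R \<alpha> b z) \<le> \<bar>M b\<bar> * norm w"
        using mult_mono[OF Basis_le_norm[OF b, of w], of "norm (\<alpha> b z)" "\<bar>M b\<bar>"] by (simp add: mult.commute)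
    qed
    also have "\<dots> \<le> ((\<Sum>b\<in>Basis. \<bar>M b\<bar>) + 1) * norm w"
      by (simp add: sum_distrib_right[symmetric] distrib_right)
    finally show ?thesis .
  qed
  moreover have "(\<Sum>b\<in>Basis. \<bar>M b\<bar>) + 1 > 0" by (intro add_nonneg_pos sum_nonneg) auto
  ultimately show ?thesis using that by blast
qed

section \<open>Bootstrapping to all orders of differentiability\<close>

context shift_operator
begin

text \<open>Differentiating the equation gives one of the same shape for the derivative, with an
  inhomogeneity B' built from the derivatives of \<alpha> and B and from X itself. As X is C^k by
  the induction hypothesis, so is B', and the hypothesis applies again to Y1 and Y2; hence the
  induction over arbitrary X and B.\<close>

lemma linear_fixed_point_Ck:
  assumes \<alpha>: "\<And>b. b \<in> Basis \<Longrightarrow> Ck_on k UNIV (\<alpha> b)" "\<And>b w. b \<in> Basis \<Longrightarrow> norm w > r \<Longrightarrow> \<alpha> b w = 0"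
    and c: "\<And>w z. norm (lincomb \<alpha> w z) \<le> c * norm w" "\<kappa> * c \<le> 1/2"
    and B: "Ck_on k UNIV B" "\<And>w. norm w > r \<Longrightarrow> B w = 0"
    and X: "X \<in> bcontfun" "X = T (\<lambda>z. lincomb \<alpha> (X z) z + B z)"
  shows "Ck_on k UNIV X"
  using \<alpha>(1) B X
proof (induction k arbitrary: X B)
  case 0
  show ?case using \<open>X \<in> bcontfun\<close> by (simp add: bcontfun_iff)
next
  case (Suc k)
  let ?D = "\<lambda>h b z. frechet_derivative (\<alpha> b) (at z) h"
  define B' where "B' h z = lincomb (?D h) (X z) z + frechet_derivative B (at z) h" for h z
  have \<alpha>1: "Ck_on 1 UNIV (\<alpha> b)" if "b \<in> Basis" for b using Suc.prems(1)[OF that] by (rule Ck_on_le) simp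
  have \<alpha>b: "\<alpha> b \<in> bcontfun" if "b \<in> Basis" for b
    by (rule bcontfun_compact_support[OF Ck_on_continuous[OF \<alpha>1[OF that]]]) (rule \<alpha>(2)[OF that])
  have B1: "Ck_on 1 UNIV B" using Suc.prems(2) by (rule Ck_on_le) simp
  have Bb: "B \<in> bcontfun"
    by (rule bcontfun_compact_support[OF Ck_on_continuous[OF B1]]) (rule Suc.prems(3))
  have \<alpha>k: "Ck_on k UNIV (\<alpha> b)" if "b \<in> Basis" for b
    by (rule Ck_on_Suc_imp[OF Suc.prems(1)[OF that]])
  have Bk: "Ck_on k UNIV B" by (rule Ck_on_Suc_imp[OF Suc.prems(2)])
  have Xk: "Ck_on k UNIV X"
    by (rule Suc.IH[where B = B and X = X]; fact \<alpha>k Bk Suc.prems)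
  have D\<alpha>: "Ck_on k UNIV (?D h b)" "norm w > r \<Longrightarrow> ?D h b w = 0" if "b \<in> Basis" for h b w
    using Suc.prems(1)[OF that] frechet_derivative_zero_outside[OF \<alpha>(2)[OF that]] by simp_all
  have DB: "Ck_on k UNIV (\<lambda>z. frechet_derivative B (at z) h)"
    "norm w > r \<Longrightarrow> frechet_derivative B (at w) h = 0" for h w
    using Suc.prems(2) frechet_derivative_zero_outside[OF Suc.prems(3)] by simp_all
  have B'k: "Ck_on k UNIV (B' h)" for h
    unfolding B'_def lincomb_def
    by (rule Ck_on_add[OF open_UNIV Ck_on_sum[OF open_UNIV Ck_on_scaleR[OF open_UNIV
            Ck_on_inner[OF open_UNIV Xk Ck_on_const] D\<alpha>(1)]] DB(1)])
  have B'0: "B' h w = 0" if "norm w > r" for h w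
    using D\<alpha>(2) DB(2) that by (simp add: B'_def lincomb_def)
  have B'b: "B' h \<in> bcontfun" for h
    by (rule bcontfun_compact_support[OF Ck_on_continuous[OF B'k]]) (rule B'0)
  have lin: "linear (frechet_derivative B (at z))" "b \<in> Basis \<Longrightarrow> linear (frechet_derivative (\<alpha> b) (at z))" for z b
    using B1 \<alpha>1 by (auto intro!: linear_frechet_derivative)
  have B'lin: "B' h z = Re h *\<^sub>R B' 1 z + Im h *\<^sub>R B' \<i> z" for h z
    using linear_complex_decomp[OF lin(1), of z h]
      lincomb_derivative_decomp[of "\<lambda>b. frechet_derivative (\<alpha> b) (at z)" ?D z h "X z", OF lin(2)]
    by (simp add: B'_def algebra_simps)
  have fb: "(\<lambda>z. lincomb \<alpha> (X z) z + B z) \<in> bcontfun"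
    by (intro bcontfun_add bcontfun_lincomb \<alpha>b Bb Suc.prems(4))
  obtain MX where MX: "MX > 0" "\<And>z. norm (X z) \<le> MX" using bcontfun_bound[OF Suc.prems(4)] by blast
  have D\<alpha>b: "?D h b \<in> bcontfun" if "b \<in> Basis" for h b
    by (rule bcontfun_compact_support[OF Ck_on_continuous[OF D\<alpha>(1)[OF that]]]) (rule D\<alpha>(2)[OF that])
  obtain N1 where N1: "N1 > 0" "\<And>w z. norm (lincomb (?D 1) w z) \<le> N1 * norm w"
    using lincomb_bound[of "?D 1", OF D\<alpha>b] by blast
  obtain N2 where N2: "N2 > 0" "\<And>w z. norm (lincomb (?D \<i>) w z) \<le> N2 * norm w"
    using lincomb_bound[of "?D \<i>", OF D\<alpha>b] by blast
  define N where "N = N1 + N2"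
  have N: "N > 0" "norm (lincomb (?D h) w z) \<le> N * norm h * norm w" for h w z
  proof -
    show "N > 0" using N1 N2 by (simp add: N_def)
    have "norm (Re h *\<^sub>R lincomb (?D 1) w z) \<le> norm h * (N1 * norm w)"
      "norm (Im h *\<^sub>R lincomb (?D \<i>) w z) \<le> norm h * (N2 * norm w)"
      unfolding norm_scaleR
      by (intro mult_mono N1(2) N2(2); simp add: abs_Re_le_cmod abs_Im_le_cmod)+
    then have "norm (Re h *\<^sub>R lincomb (?D 1) w z + Im h *\<^sub>R lincomb (?D \<i>) w z) \<le> N * norm h * norm w"
      by (intro norm_triangle_le) (simp add: N_def algebra_simps)
    then show "norm (lincomb (?D h) w z) \<le> N * norm h * norm w"
      using lincomb_derivative_decomp[of "\<lambda>b. frechet_derivative (\<alpha> b) (at z)" ?D z h w, OF lin(2)] by simp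
  qed
  have "\<exists>d>0. \<forall>z h. norm h < d \<longrightarrow>
      norm ((lincomb \<alpha> (X (z + h)) (z + h) + B (z + h)) - (lincomb \<alpha> (X z) z + B z)
        - lincomb \<alpha> (X (z + h) - X z) z - (Re h *\<^sub>R B' 1 z + Im h *\<^sub>R B' \<i> z))
        \<le> e * (norm h + norm (X (z + h) - X z))" if e: "e > 0" for e
  proof -
    define e' where "e' = e / (MX + 1)"
    have e': "e' > 0" using e MX by (simp add: e'_def)
    obtain d1 where d1: "d1 > 0" "\<And>z h w. norm h < d1 \<Longrightarrow>
        norm (lincomb \<alpha> w (z + h) - lincomb \<alpha> w z - lincomb (?D h) w z) \<le> e' * norm h * norm w"
      using lincomb_uniform_derivative[of \<alpha> r e', OF \<alpha>1 \<alpha>(2) e'] by blast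
    obtain d2 where d2: "d2 > 0" "\<And>z h. norm h < d2 \<Longrightarrow>
        norm (B (z + h) - B z - frechet_derivative B (at z) h) \<le> e' * norm h"
      using compact_support_uniform_derivative[OF B1 Suc.prems(3) e'] by blast
    define d where "d = min (min d1 d2) (e / N)"
    have "d > 0" using d1 d2 e N by (simp add: d_def)
    moreover have "norm ((lincomb \<alpha> (X (z + h)) (z + h) + B (z + h)) - (lincomb \<alpha> (X z) z + B z)
        - lincomb \<alpha> (X (z + h) - X z) z - (Re h *\<^sub>R B' 1 z + Im h *\<^sub>R B' \<i> z))
        \<le> e * (norm h + norm (X (z + h) - X z))" if h: "norm h < d" for z h
    proof -
      \<comment> \<open>The error is split into the Taylor remainder of \<alpha>, that of B, and the
        effect of evaluating the derivative of \<alpha> on X (z + h) instead of X z.\<close>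
      define t1 where "t1 = lincomb \<alpha> (X (z + h)) (z + h) - lincomb \<alpha> (X (z + h)) z - lincomb (?D h) (X (z + h)) z"
      define t2 where "t2 = B (z + h) - B z - frechet_derivative B (at z) h"
      define t3 where "t3 = lincomb (?D h) (X (z + h) - X z) z"
      have "(lincomb \<alpha> (X (z + h)) (z + h) + B (z + h)) - (lincomb \<alpha> (X z) z + B z)
        - lincomb \<alpha> (X (z + h) - X z) z - (Re h *\<^sub>R B' 1 z + Im h *\<^sub>R B' \<i> z) = t1 + t2 + t3"
        unfolding B'lin[symmetric] by (simp add: B'_def t1_def t2_def t3_def lincomb_diff)
      also have "norm \<dots> \<le> norm t1 + norm t2 + norm t3"
        by (intro order_trans[OF norm_triangle_ineq] add_right_mono norm_triangle_ineq)
      also have "\<dots> \<le> e' * norm h * MX + e' * norm h + e * norm (X (z + h) - X z)"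
      proof (intro add_mono)
        have "norm t1 \<le> e' * norm h * norm (X (z + h))"
          unfolding t1_def by (rule d1(2)) (use h in \<open>simp add: d_def\<close>)
        also have "\<dots> \<le> e' * norm h * MX" using MX(2) e' by (intro mult_left_mono) auto
        finally show "norm t1 \<le> e' * norm h * MX" .
        show "norm t2 \<le> e' * norm h" unfolding t2_def by (rule d2(2)) (use h in \<open>simp add: d_def\<close>)
        have "N * norm h \<le> e" using h N(1) by (simp add: d_def field_simps)
        then have "N * norm h * norm (X (z + h) - X z) \<le> e * norm (X (z + h) - X z)"
          by (intro mult_right_mono) auto
        then show "norm t3 \<le> e * norm (X (z + h) - X z)"
          unfolding t3_def using N(2) order_trans by blast
      qed
      also have "e' * norm h * MX + e' * norm h = e * norm h"
      proof -
        have "e' * (MX + 1) = e" using MX(1) by (simp add: e'_def)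
        moreover have "e' * norm h * MX + e' * norm h = (e' * (MX + 1)) * norm h" by (simp add: algebra_simps)
        ultimately show ?thesis by simp
      qed
      finally show ?thesis by (simp add: algebra_simps)
    qed
    ultimately show ?thesis by blast
  qed
  from differentiable_fixed_point[OF fb Suc.prems(5) \<alpha>b c B'b[of 1] B'b[of \<i>] this]
  obtain Y1 Y2 where Y: "Y1 \<in> bcontfun" "Y1 = T (\<lambda>z. lincomb \<alpha> (Y1 z) z + B' 1 z)"
    "Y2 \<in> bcontfun" "Y2 = T (\<lambda>z. lincomb \<alpha> (Y2 z) z + B' \<i> z)"
    and der: "\<And>z. (X has_derivative (\<lambda>h. Re h *\<^sub>R Y1 z + Im h *\<^sub>R Y2 z)) (at z)" by blast
  have Yk: "Ck_on k UNIV Y1" "Ck_on k UNIV Y2"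
    by (rule Suc.IH[where B = "B' 1" and X = Y1]; fact \<alpha>k B'k B'0 Y)
      (rule Suc.IH[where B = "B' \<i>" and X = Y2]; fact \<alpha>k B'k B'0 Y)
  show ?case
    by (rule Ck_on_SucI[OF open_UNIV der])
      (intro Ck_on_add Ck_on_scaleR open_UNIV Yk Ck_on_const)
qed

text \<open>Along U the nonlinearity linearises to \<alpha> = DF(U), which is as regular as V.
  Whenever V is C^k, its derivatives solve linear equations with C^k coefficients and are therefore
  C^k themselves, so V gains one order. The growth of U makes these coefficients compactly
  supported.\<close>

lemma smooth_fixed_point:
  assumes F: "\<And>k. Ck_on k UNIV F" "\<And>u. norm u > \<rho> \<Longrightarrow> F u = 0"
    and U: "\<And>z. U z = a0 + Re z *\<^sub>R c1 + Im z *\<^sub>R c2 + V z"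
    and V: "V \<in> bcontfun" "V = T (\<lambda>z. F (U z))"
    and large: "\<And>z. norm z > r \<Longrightarrow> norm (U z) > \<rho>"
    and c: "\<And>u w. norm (frechet_derivative F (at u) w) \<le> c * norm w" "\<kappa> * c \<le> 1/2"
  shows "Ck_on k UNIV V"
proof -
  let ?D = "\<lambda>u. frechet_derivative F (at u)"
  define f where "f z = F (U z)" for z
  define \<alpha> where "\<alpha> b z = ?D (U z) b" for b z
  have F1: "Ck_on 1 UNIV F" by (rule F(1))
  have Uc: "continuous_on UNIV U"
    unfolding U[abs_def] using V(1) by (intro continuous_intros) (simp add: bcontfun_iff)
  have fc: "continuous_on UNIV f"
    unfolding f_def by (rule continuous_on_compose2[OF Ck_on_continuous[OF F1] Uc]) simp
  have f0: "f z = 0" if "norm z > r" for z using large[OF that] F(2) by (simp add: f_def)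
  have fb: "f \<in> bcontfun" by (rule bcontfun_compact_support[OF fc f0])
  have VT: "V = T f" using V(2) by (simp add: f_def[abs_def])
  have lin: "linear (?D u)" for u using F1 by (auto intro!: linear_frechet_derivative)
  have \<alpha>0: "\<alpha> b z = 0" if "norm z > r" for b z
    unfolding \<alpha>_def by (rule frechet_derivative_zero_outside[OF F(2) large[OF that]])
  have Dc: "continuous_on UNIV (\<lambda>u. ?D u b)" for b using F1 by simp
  have \<alpha>b: "\<alpha> b \<in> bcontfun" for b
    by (rule bcontfun_compact_support[OF _ \<alpha>0], unfold \<alpha>_def, rule continuous_on_compose2[OF Dc Uc])
      simp_all
  have lc: "lincomb \<alpha> w z = ?D (U z) w" for w z
  proof -
    have "?D (U z) w = ?D (U z) (\<Sum>b\<in>Basis. (w \<bullet> b) *\<^sub>R b)" by (simp add: euclidean_representation)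
    also have "\<dots> = lincomb \<alpha> w z"
      by (simp add: linear_sum[OF lin] linear_scale[OF lin] lincomb_def \<alpha>_def)
    finally show ?thesis by simp
  qed
  have c': "norm (lincomb \<alpha> w z) \<le> c * norm w" for w z unfolding lc by (rule c(1))
  define B where "B v z = ?D (U z) v" for v z
  have Bb: "B v \<in> bcontfun" for v using \<alpha>b[of v] by (simp add: B_def[abs_def] \<alpha>_def[abs_def])
  \<comment> \<open>Uniform continuity of V, inherited from f through equivariance, keeps the
    increments of U in the range where F is uniformly close to its linearisation.\<close>
  have Vunif: "\<exists>d>0. \<forall>z h. norm h < d \<longrightarrow> norm (V (z + h) - V z) \<le> e" if e: "e > 0" for e
  proof -
    have "uniformly_continuous_on UNIV f" by (rule compact_support_uniformly_continuous[OF fc f0])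
    then obtain d where d: "d > 0" "\<And>x y. dist y x < d \<Longrightarrow> dist (f y) (f x) < e / \<kappa>"
      using e kappa_pos unfolding uniformly_continuous_on_def by (metis UNIV_I divide_pos_pos)
    have "norm (V (z + h) - V z) \<le> e" if "norm h < d" for z h
    proof -
      have "V (z + h) - V z = T (\<lambda>w. f (w + h) - f w) z"
        unfolding VT T_shift[OF fb] by (rule T_diff[OF bcontfun_shift[OF fb] fb, symmetric])
      also have "norm \<dots> \<le> \<kappa> * (e / \<kappa>)"
      proof (rule T_bound)
        show "(\<lambda>w. f (w + h) - f w) \<in> bcontfun" by (intro bcontfun_diff bcontfun_shift fb)
        show "norm (f (w + h) - f w) \<le> e / \<kappa>" for w
          using d(2)[of "w + h" w] that by (simp add: dist_norm)
      qed
      finally show ?thesis using kappa_pos by simp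
    qed
    then show ?thesis using d(1) by blast
  qed
  have approx: "\<exists>d>0. \<forall>z h. norm h < d \<longrightarrow>
      norm (f (z + h) - f z - lincomb \<alpha> (V (z + h) - V z) z - (Re h *\<^sub>R B c1 z + Im h *\<^sub>R B c2 z))
        \<le> e * (norm h + norm (V (z + h) - V z))" if e: "e > 0" for e
  proof -
    define C where "C = norm c1 + norm c2 + 1"
    have C: "C \<ge> 1" by (simp add: C_def)
    define e' where "e' = e / C"
    have e': "e' > 0" using e C by (simp add: e'_def)
    obtain d0 where d0: "d0 > 0" "\<And>u w. norm w < d0 \<Longrightarrow> norm (F (u + w) - F u - ?D u w) \<le> e' * norm w"
      using compact_support_uniform_derivative[OF F1 F(2) e'] by blast
    obtain d1 where d1: "d1 > 0" "\<And>z h. norm h < d1 \<Longrightarrow> norm (V (z + h) - V z) \<le> d0 / 3"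
      using Vunif[of "d0 / 3"] d0(1) by auto
    define d where "d = min d1 (d0 / (2 * C))"
    have "d > 0" using d1 d0 C by (simp add: d_def)
    moreover have "norm (f (z + h) - f z - lincomb \<alpha> (V (z + h) - V z) z - (Re h *\<^sub>R B c1 z + Im h *\<^sub>R B c2 z))
        \<le> e * (norm h + norm (V (z + h) - V z))" if h: "norm h < d" for z h
    proof -
      define l where "l = Re h *\<^sub>R c1 + Im h *\<^sub>R c2"
      define \<delta> where "\<delta> = V (z + h) - V z"
      have "norm (Re h *\<^sub>R c1) \<le> norm h * norm c1" "norm (Im h *\<^sub>R c2) \<le> norm h * norm c2"
        using abs_Re_le_cmod[of h] abs_Im_le_cmod[of h] by (auto intro!: mult_right_mono)
      then have "norm l \<le> norm h * norm c1 + norm h * norm c2"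
        unfolding l_def by (intro norm_triangle_le add_mono)
      also have "\<dots> \<le> C * norm h" by (simp add: C_def algebra_simps)
      finally have l: "norm l \<le> C * norm h" .
      have w: "norm (l + \<delta>) \<le> C * norm h + norm \<delta>" using l by (intro norm_triangle_le) simp
      have "C * norm h < d0 / 2" using h C by (simp add: d_def field_simps)
      moreover have "norm \<delta> \<le> d0 / 3" unfolding \<delta>_def by (rule d1(2)) (use h in \<open>simp add: d_def\<close>)
      ultimately have wd: "norm (l + \<delta>) < d0" using w d0(1) by linarith
      have Uw: "U (z + h) = U z + (l + \<delta>)" by (simp add: U l_def \<delta>_def algebra_simps)
      have "f (z + h) - f z - lincomb \<alpha> (V (z + h) - V z) z - (Re h *\<^sub>R B c1 z + Im h *\<^sub>R B c2 z) =
          F (U z + (l + \<delta>)) - F (U z) - ?D (U z) (l + \<delta>)"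
        unfolding f_def Uw lc B_def \<delta>_def[symmetric]
        by (simp add: l_def linear_add[OF lin] linear_scale[OF lin])
      also have "norm \<dots> \<le> e' * norm (l + \<delta>)" by (rule d0(2)[OF wd])
      also have "\<dots> \<le> e' * (C * norm h + norm \<delta>)" using w e' by (intro mult_left_mono) auto
      also have "\<dots> \<le> e' * (C * norm h + C * norm \<delta>)"
        using mult_right_mono[OF C, of "norm \<delta>"] e' by (intro mult_left_mono add_left_mono) auto
      also have "\<dots> = e * (norm h + norm \<delta>)" using C by (simp add: e'_def field_simps)
      finally show ?thesis by (simp add: \<delta>_def)
    qed
    ultimately show ?thesis by blast
  qed
  obtain Y1 Y2 where Y: "Y1 \<in> bcontfun" "Y1 = T (\<lambda>z. lincomb \<alpha> (Y1 z) z + B c1 z)"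
    "Y2 \<in> bcontfun" "Y2 = T (\<lambda>z. lincomb \<alpha> (Y2 z) z + B c2 z)"
    and der: "\<And>z. (V has_derivative (\<lambda>h. Re h *\<^sub>R Y1 z + Im h *\<^sub>R Y2 z)) (at z)"
    by (rule differentiable_fixed_point[OF fb VT \<alpha>b c' c(2) Bb Bb approx]) blast+
  show ?thesis
  proof (induction k)
    case 0
    show ?case using V(1) by (simp add: bcontfun_iff)
  next
    case (Suc k)
    have aff: "Ck_on k UNIV (\<lambda>z. a0 + Re z *\<^sub>R c1 + Im z *\<^sub>R c2)"
      by (intro Ck_on_add Ck_on_scaleR Ck_on_const open_UNIV Ck_on_bounded_linear bounded_linear_Re bounded_linear_Im)
    have Uk: "Ck_on k UNIV U"
      unfolding U[abs_def] by (rule Ck_on_add[OF open_UNIV aff Suc])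
    have Dk: "Ck_on k UNIV (\<lambda>z. ?D (U z) v)" for v
      by (rule Ck_on_compose[OF open_UNIV open_UNIV Uk]) (use F(1)[of "Suc k"] in auto)
    have \<alpha>k: "Ck_on k UNIV (\<alpha> b)" for b unfolding \<alpha>_def by (rule Dk)
    have Bk: "Ck_on k UNIV (B v)" for v unfolding B_def by (rule Dk)
    have B0: "B v z = 0" if "norm z > r" for v z using \<alpha>0[OF that, of v] by (simp add: B_def \<alpha>_def)
    have Yk: "Ck_on k UNIV Y1"
      by (rule linear_fixed_point_Ck[where B = "B c1" and X = Y1 and \<alpha> = \<alpha> and r = r and c = c];
          (rule \<alpha>k | (rule \<alpha>0, assumption) | fact c' c(2) Bk B0 Y))
    have Yk': "Ck_on k UNIV Y2"
      by (rule linear_fixed_point_Ck[where B = "B c2" and X = Y2 and \<alpha> = \<alpha> and r = r and c = c];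
          (rule \<alpha>k | (rule \<alpha>0, assumption) | fact c' c(2) Bk B0 Y))
    show ?case
      by (rule Ck_on_SucI[OF open_UNIV der])
        (intro Ck_on_add Ck_on_scaleR open_UNIV Yk Yk' Ck_on_const)
  qed
qed

end

section \<open>Existence for a nonlinear equation with small right-hand side\<close>

text \<open>The argument of F depends on V also through the constants of an affine part, hence the
  abstract U. Its Lipschitz constant \<Lambda> is a bound on norm z \<le> r, since an affine part
  with varying slope has none on the whole plane; beyond r both right-hand sides vanish.\<close>

lemma (in shift_operator) nonlinear_fixed_point:
  fixes F :: "'u \<Rightarrow> 'e" and U :: "(complex \<Rightarrow>\<^sub>C 'u) \<Rightarrow> complex \<Rightarrow> 'u"
  assumes F: "continuous_on UNIV F" "\<And>u. norm (F u) \<le> M" "\<And>u v. norm (F u - F v) \<le> c * norm (u - v)"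
      "\<And>u. norm u > \<rho> \<Longrightarrow> F u = 0"
    and \<delta>: "\<kappa> * M \<le> \<delta>" "\<delta> \<ge> 0"
    and U: "\<And>V. V \<in> cball 0 \<delta> \<Longrightarrow> continuous_on UNIV (U V)"
      "\<And>V z. V \<in> cball 0 \<delta> \<Longrightarrow> norm z > r \<Longrightarrow> norm (U V z) > \<rho>"
      "\<And>V W z. V \<in> cball 0 \<delta> \<Longrightarrow> W \<in> cball 0 \<delta> \<Longrightarrow> norm z \<le> r \<Longrightarrow> norm (U V z - U W z) \<le> \<Lambda> * dist V W"
    and small: "c \<ge> 0" "\<Lambda> \<ge> 0" "\<kappa> * (c * \<Lambda>) \<le> 1/2"
  obtains V where "V \<in> cball 0 \<delta>" "apply_bcontfun V = T (\<lambda>z. F (U V z))"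
proof -
  let ?S = "cball (0 :: complex \<Rightarrow>\<^sub>C 'u) \<delta>"
  define \<Phi> where "\<Phi> V = Bcontfun (T (\<lambda>z. F (U V z)))" for V
  have mem: "(\<lambda>z. F (U V z)) \<in> bcontfun" if "V \<in> ?S" for V
  proof -
    have "continuous_on UNIV (\<lambda>z. F (U V z))" by (rule continuous_on_compose2[OF F(1) U(1)[OF that]]) simp
    then show ?thesis using F(2) by (auto simp: bcontfun_iff)
  qed
  have app: "apply_bcontfun (\<Phi> V) = T (\<lambda>z. F (U V z))" if "V \<in> ?S" for V
    unfolding \<Phi>_def by (rule Bcontfun_inverse[OF T_bcontfun[OF mem[OF that]]])
  have "\<exists>!V\<in>?S. \<Phi> V = V"
  proof (rule Banach_fix[of ?S "1/2"])
    show "complete ?S" by (simp add: complete_eq_closed)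
    show "?S \<noteq> {}" using \<delta>(2) by simp
    show "\<Phi> ` ?S \<subseteq> ?S"
    proof safe
      fix V assume V: "V \<in> ?S"
      have "dist (\<Phi> V) 0 \<le> \<delta>"
      proof (rule dist_bound)
        fix z
        have "norm (\<Phi> V z) \<le> \<kappa> * M" unfolding app[OF V] by (rule T_bound[OF mem[OF V] F(2)])
        then show "dist (\<Phi> V z) ((0 :: complex \<Rightarrow>\<^sub>C 'u) z) \<le> \<delta>" using \<delta>(1) by simp
      qed
      then show "\<Phi> V \<in> ?S" by (simp add: dist_commute)
    qed
    show "dist (\<Phi> V) (\<Phi> W) \<le> 1/2 * dist V W" if V: "V \<in> ?S" and W: "W \<in> ?S" for V W
    proof (rule dist_bound)
      fix z
      have "norm (\<Phi> V z - \<Phi> W z) = norm (T (\<lambda>z. F (U V z) - F (U W z)) z)"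
        by (simp add: app[OF V] app[OF W] T_diff[OF mem[OF V] mem[OF W]])
      also have "\<dots> \<le> \<kappa> * (c * (\<Lambda> * dist V W))"
      proof (rule T_bound[OF bcontfun_diff[OF mem[OF V] mem[OF W]]])
        fix z
        show "norm (F (U V z) - F (U W z)) \<le> c * (\<Lambda> * dist V W)"
        proof (cases "norm z \<le> r")
          case True
          from order_trans[OF F(3) mult_left_mono[OF U(3)[OF V W this] small(1)]] show ?thesis .
        next
          case False
          then show ?thesis using F(4)[OF U(2)[OF V]] F(4)[OF U(2)[OF W]] small by simp
        qed
      qed
      also have "\<dots> \<le> 1/2 * dist V W"
        using mult_right_mono[OF small(3), of "dist V W"] by (simp add: mult.assoc)
      finally show "dist (\<Phi> V z) (\<Phi> W z) \<le> 1/2 * dist V W" by (simp add: dist_norm)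
    qed
  qed auto
  then obtain V where "V \<in> ?S" "\<Phi> V = V" by blast
  then show ?thesis using that[of V] app[of V] by simp
qed

text \<open>The logarithmic potential with its two first derivatives, so that the value and the
  derivatives of the solution are treated as independent unknowns. Truncation at R makes the kernels
  integrable; for f supported in radius r the full potential is recovered where norm z + r \<le>
  R.\<close>

definition pot :: "real \<Rightarrow> (complex \<Rightarrow> 'e::euclidean_space) \<Rightarrow> complex \<Rightarrow> 'e \<times> 'e \<times> 'e" where
  "pot R f z = (1 / poisson_mass) *\<^sub>R
     (conv (trunc R ker0) f z, conv (trunc R ker1) f z, conv (trunc R ker2) f z)"

definition pot_const :: "real \<Rightarrow> real" where
  "pot_const R = ((LINT \<zeta>|lborel. \<bar>trunc R ker0 \<zeta>\<bar>) + (LINT \<zeta>|lborel. \<bar>trunc R ker1 \<zeta>\<bar>)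
     + (LINT \<zeta>|lborel. \<bar>trunc R ker2 \<zeta>\<bar>) + 1) / poisson_mass"

lemma shift_operator_pot: "shift_operator (pot R :: (complex \<Rightarrow> 'e::euclidean_space) \<Rightarrow> _) (pot_const R)"
proof
  note k = loc_integrable_ker[unfolded loc_integrable_def, rule_format, of R]
  have m: "poisson_mass > 0" by (rule poisson_mass_pos)
  fix f g :: "complex \<Rightarrow> 'e" and c :: real and z h :: complex
  assume f: "f \<in> bcontfun"
  then have fc: "continuous_on UNIV f" by (simp add: bcontfun_iff)
  obtain N where N: "\<And>z. norm (f z) \<le> N" using bcontfun_bound[OF f] by blast
  show bound: "norm (pot R f z) \<le> pot_const R * M" if M: "\<And>z. norm (f z) \<le> M" for M z
  proof -
    have M0: "M \<ge> 0" using order_trans[OF norm_ge_zero M[of 0]] .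
    let ?I = "\<lambda>k. LINT \<zeta>|lborel. \<bar>trunc R k \<zeta>\<bar>"
    have "norm (conv (trunc R ker0) f z, conv (trunc R ker1) f z, conv (trunc R ker2) f z)
        \<le> norm (conv (trunc R ker0) f z) + (norm (conv (trunc R ker1) f z) + norm (conv (trunc R ker2) f z))"
      by (rule order_trans[OF norm_Pair_le add_left_mono[OF norm_Pair_le]])
    also have "\<dots> \<le> ?I ker0 * M + (?I ker1 * M + ?I ker2 * M)"
      by (intro add_mono norm_conv_le k M)
    also have "\<dots> \<le> (?I ker0 + ?I ker1 + ?I ker2 + 1) * M" using M0 by (simp add: algebra_simps)
    finally show ?thesis
      unfolding pot_def pot_const_def norm_scaleR using m by (simp add: divide_right_mono)
  qed
  show "pot R f \<in> bcontfun"
  proof -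
    have "continuous_on UNIV (pot R f)"
      unfolding pot_def[abs_def] by (intro continuous_intros continuous_conv[OF _ fc N] k)
    then show ?thesis using bound[OF N] by (auto simp: bcontfun_iff)
  qed
  show "pot R (\<lambda>z. f z + g z) z = pot R f z + pot R g z" if g: "g \<in> bcontfun"
  proof -
    have gc: "continuous_on UNIV g" using g by (simp add: bcontfun_iff)
    obtain N' where N': "\<And>z. norm (g z) \<le> N'" using bcontfun_bound[OF g] by blast
    show ?thesis
      by (simp add: pot_def conv_add[OF k(1) fc N gc N'] conv_add[OF k(2) fc N gc N']
          conv_add[OF k(3) fc N gc N'] scaleR_add_right)
  qed
  show "pot R (\<lambda>z. c *\<^sub>R f z) z = c *\<^sub>R pot R f z"
    by (simp add: pot_def conv_scaleR)
  show "pot R f (z + h) = pot R (\<lambda>w. f (w + h)) z"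
    by (simp add: pot_def conv_translate)
next
  have "(LINT \<zeta>|lborel. \<bar>trunc R k \<zeta>\<bar>) \<ge> 0" for k by simp
  then show "pot_const R > 0"
    unfolding pot_const_def using poisson_mass_pos by (intro divide_pos_pos add_nonneg_pos add_nonneg_nonneg) auto
qed

section \<open>Conformal linear maps of the plane\<close>

locale inner_matrix =
  fixes G0 :: "real ^ 'n ^ 'n"
  assumes G0_sym: "transpose G0 = G0" and G0_pos: "x \<noteq> 0 \<Longrightarrow> x \<bullet> (G0 *v x) > 0"
begin

definition ip :: "real ^ 'n \<Rightarrow> real ^ 'n \<Rightarrow> real" where "ip a b = a \<bullet> (G0 *v b)"

lemma ip_commute: "ip a b = ip b a"
  unfolding ip_def by (metis G0_sym dot_lmul_matrix inner_commute vector_transpose_matrix)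

lemma ip_add_left: "ip (a + b) c = ip a c + ip b c"
  and ip_add_right: "ip a (b + c) = ip a b + ip a c"
  and ip_diff_left: "ip (a - b) c = ip a c - ip b c"
  and ip_diff_right: "ip a (b - c) = ip a b - ip a c"
  and ip_scaleR_left: "ip (t *\<^sub>R a) b = t * ip a b"
  and ip_scaleR_right: "ip a (t *\<^sub>R b) = t * ip a b"
  by (simp_all add: ip_def inner_add_left inner_diff_left matrix_vector_right_distrib
      matrix_vector_mult_diff_distrib inner_add_right inner_diff_right matrix_vector_mult_scaleR)

lemma ip_bound: obtains K where "K \<ge> 1" "\<And>a b. \<bar>ip a b\<bar> \<le> K * norm a * norm b"
proof -
  let ?K = "onorm ((*v) G0) + 1"
  have bl: "bounded_linear ((*v) G0)" by (rule matrix_vector_mul_bounded_linear)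
  have "\<bar>ip a b\<bar> \<le> ?K * norm a * norm b" for a b
  proof -
    have "\<bar>ip a b\<bar> \<le> norm a * norm (G0 *v b)" unfolding ip_def by (rule Cauchy_Schwarz_ineq2)
    also have "\<dots> \<le> norm a * (onorm ((*v) G0) * norm b)"
      by (intro mult_left_mono onorm[OF bl]) auto
    also have "\<dots> \<le> ?K * norm a * norm b" by (simp add: algebra_simps)
    finally show ?thesis .
  qed
  moreover have "?K \<ge> 1" using onorm_pos_le[OF bl] by simp
  ultimately show ?thesis using that by blast
qed

text \<open>The constant is the minimum of the quadratic form on the compact unit sphere.\<close>

lemma ip_coercive: obtains l where "l > 0" "\<And>a. ip a a \<ge> l * (norm a)\<^sup>2"
proof -
  have "continuous_on (sphere 0 1) (\<lambda>a. ip a a)"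
    unfolding ip_def by (intro continuous_intros linear_continuous_on matrix_vector_mul_bounded_linear)
  moreover have "sphere (0 :: real ^ 'n) 1 \<noteq> {}" by simp
  ultimately obtain a0 where a0: "a0 \<in> sphere 0 1" "\<And>a. a \<in> sphere 0 1 \<Longrightarrow> ip a0 a0 \<le> ip a a"
    using continuous_attains_inf[OF compact_sphere] by blast
  have "ip a0 a0 * (norm a)\<^sup>2 \<le> ip a a" for a
  proof (cases "a = 0")
    case False
    then have "ip a0 a0 \<le> ip ((1 / norm a) *\<^sub>R a) ((1 / norm a) *\<^sub>R a)" by (intro a0(2)) simp
    also have "\<dots> = ip a a / (norm a)\<^sup>2" by (simp add: ip_scaleR_left ip_scaleR_right power2_eq_square)
    finally show ?thesis using False by (simp add: field_simps)
  qed (simp add: ip_def)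
  moreover have "ip a0 a0 > 0" unfolding ip_def using a0(1) by (intro G0_pos) auto
  ultimately show ?thesis using that by blast
qed

lemma ip_orthonormal_exists:
  assumes "CARD('n) \<ge> 2" "ip e e = 1"
  obtains b where "ip b b = 1" "ip e b = 0"
proof -
  have "DIM(real ^ 'n) \<ge> 2" using assms(1) by simp
  then obtain b where b: "b \<noteq> 0" "orthogonal (G0 *v e) b"
    using orthogonal_to_vector_exists by metis
  have p: "ip b b > 0" unfolding ip_def using b(1) by (rule G0_pos)
  have "ip e b = 0"
    using b(2) ip_commute[of e b] by (simp add: ip_def orthogonal_def inner_commute)
  then show ?thesis
    using p by (intro that[of "(1 / sqrt (ip b b)) *\<^sub>R b"]) (simp_all add: ip_scaleR_left ip_scaleR_right)
qed

text \<open>One Gram-Schmidt step, rescaled to the length of \<open>a\<close>.\<close>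

definition partner :: "real ^ 'n \<Rightarrow> real ^ 'n \<Rightarrow> real ^ 'n" where
  "partner b0 a = (1 / sqrt (ip a a - (ip b0 a)\<^sup>2)) *\<^sub>R (ip a a *\<^sub>R b0 - ip b0 a *\<^sub>R a)"

lemma partner_conformal:
  assumes "ip b0 b0 = 1" "ip a a - (ip b0 a)\<^sup>2 > 0"
  shows "ip a (partner b0 a) = 0" "ip (partner b0 a) (partner b0 a) = ip a a"
proof -
  show "ip a (partner b0 a) = 0"
    by (simp add: partner_def ip_scaleR_right ip_diff_right ip_commute[of a b0])
  have "ip (partner b0 a) (partner b0 a) = (1 / (ip a a - (ip b0 a)\<^sup>2)) *
      ip (ip a a *\<^sub>R b0 - ip b0 a *\<^sub>R a) (ip a a *\<^sub>R b0 - ip b0 a *\<^sub>R a)"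
    using assms(2) unfolding partner_def by (simp add: ip_scaleR_left ip_scaleR_right)
  also have "ip (ip a a *\<^sub>R b0 - ip b0 a *\<^sub>R a) (ip a a *\<^sub>R b0 - ip b0 a *\<^sub>R a) =
      ip a a * (ip a a - (ip b0 a)\<^sup>2)"
    using assms(1)
    by (simp add: ip_scaleR_left ip_scaleR_right ip_diff_left ip_diff_right ip_commute[of a b0]
        power2_eq_square algebra_simps)
  finally show "ip (partner b0 a) (partner b0 a) = ip a a" using assms(2) by simp
qed

lemma inverse_sqrt_lipschitz:
  fixes x y :: real
  assumes "x \<ge> 1/2" "y \<ge> 1/2"
  shows "\<bar>1 / sqrt x - 1 / sqrt y\<bar> \<le> 2 * \<bar>x - y\<bar>"
proof -
  \<comment> \<open>7/10 lies just below sqrt (1/2), and twice its cube still exceeds 1/2.\<close>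
  have s: "sqrt x \<ge> 7/10" "sqrt y \<ge> 7/10"
    by (rule real_le_rsqrt, use assms in \<open>simp add: power2_eq_square\<close>)+
  have "1 / a - 1 / b = (b * b - a * a) / (a * b * (b + a))" if "a > 0" "b > 0" for a b :: real
    using that by (simp add: divide_simps) (simp add: algebra_simps)
  from this[of "sqrt x" "sqrt y"] have "1 / sqrt x - 1 / sqrt y = (y - x) / (sqrt x * sqrt y * (sqrt y + sqrt x))"
    using assms by simp
  note eq = this
  have "sqrt x * sqrt y * (sqrt y + sqrt x) \<ge> (7/10) * (7/10) * (7/10 + 7/10)"
    using s assms by (intro mult_mono add_mono) auto
  then have "sqrt x * sqrt y * (sqrt y + sqrt x) \<ge> 1/2" by simp
  moreover have pos: "sqrt x * sqrt y * (sqrt y + sqrt x) > 0"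
    using assms by (intro mult_pos_pos add_pos_pos) auto
  ultimately have "\<bar>y - x\<bar> / (sqrt x * sqrt y * (sqrt y + sqrt x)) \<le> \<bar>y - x\<bar> / (1/2)"
    by (intro divide_left_mono) auto
  moreover note pos
  ultimately show ?thesis
    by (simp only: eq abs_divide abs_of_pos) (simp add: abs_minus_commute)
qed

text \<open>The constants must not depend on the orthonormal pair (e, b0), because one contraction
  estimate has to serve every pair of points to be joined. Uniformity holds since the unit vectors
  of \<open>ip\<close> are bounded.\<close>

lemma partner_lipschitz:
  obtains \<delta> L where "\<delta> > 0" "\<delta> \<le> 1" "L > 0"
    "\<And>e b0 a. ip e e = 1 \<Longrightarrow> ip b0 b0 = 1 \<Longrightarrow> ip e b0 = 0 \<Longrightarrow> a \<in> cball e \<delta> \<Longrightarrow>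
      ip a a - (ip b0 a)\<^sup>2 \<ge> 1/2"
    "\<And>e b0 a a'. ip e e = 1 \<Longrightarrow> ip b0 b0 = 1 \<Longrightarrow> ip e b0 = 0 \<Longrightarrow> a \<in> cball e \<delta> \<Longrightarrow> a' \<in> cball e \<delta> \<Longrightarrow>
      norm (partner b0 a - partner b0 a') \<le> L * norm (a - a')"
    "\<And>e. ip e e = 1 \<Longrightarrow> norm e \<le> L"
proof -
  obtain K where K: "K \<ge> 1" "\<And>a b. \<bar>ip a b\<bar> \<le> K * norm a * norm b" using ip_bound by blast
  obtain l where l: "l > 0" "\<And>a. ip a a \<ge> l * (norm a)\<^sup>2" using ip_coercive by blast
  define N where "N = 1 / sqrt l + 1"
  have N: "N \<ge> 1" using l(1) by (simp add: N_def)
  have nrm: "norm e \<le> N - 1" if "ip e e = 1" for e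
  proof -
    have "(norm e)\<^sup>2 \<le> 1 / l" using l(2)[of e] that l(1) by (simp add: field_simps)
    then have "norm e \<le> sqrt (1 / l)" by (rule real_le_rsqrt)
    then show ?thesis by (simp add: N_def real_sqrt_divide)
  qed
  define P where "P = K * N * N"
  have P1: "P \<ge> 1" unfolding P_def using K(1) N mult_mono[of 1 "K * N" 1 N] mult_mono[of 1 K 1 N] by simp
  have KP: "K * N \<le> P" unfolding P_def using K(1) N by simp
  \<comment> \<open>Moving e by \<delta> changes inner products with vectors of norm at most N by at
    most 1/8; then \<open>ip a a\<close> is at least 3/4 and the square of \<open>ip b0 a\<close> at
    most 1/64.\<close>
  define \<delta> where "\<delta> = 1 / (8 * P)"
  have \<delta>: "\<delta> > 0" "\<delta> \<le> 1" "P * \<delta> = 1/8" using P1 by (auto simp: \<delta>_def)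
  \<comment> \<open>24 = 8 + 16 collects the two terms of the product estimate for
    \<open>partner\<close>; the extra N makes L bound the unit vectors as well.\<close>
  define L where "L = 24 * P * P * P * N + N"
  have bnd: "\<bar>ip u v\<bar> \<le> P" if "norm u \<le> N" "norm v \<le> N" for u v
  proof -
    have "K * norm u * norm v \<le> K * N * N"
      using that K(1) N by (intro mult_mono) auto
    then show ?thesis using K(2)[of u v] by (simp add: P_def)
  qed
  have bnd1: "\<bar>ip u v\<bar> \<le> P * norm v" if "norm u \<le> N" for u v
  proof -
    have "K * norm u * norm v \<le> P * norm v"
    proof (rule mult_right_mono)
      have "K * norm u \<le> K * N" using that K(1) by (intro mult_left_mono) auto
      then show "K * norm u \<le> P" using KP by linarith
    qed simp
    then show ?thesis using K(2)[of u v] by linarith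
  qed
  have aN: "norm a \<le> N" if "ip e e = 1" "a \<in> cball e \<delta>" for a e
    using nrm[OF that(1)] that(2) \<delta>(2) norm_triangle_sub[of a e] by (simp add: dist_norm norm_minus_commute)
  have D: "ip a a - (ip b0 a)\<^sup>2 \<ge> 1/2"
    if e: "ip e e = 1" "ip b0 b0 = 1" "ip e b0 = 0" "a \<in> cball e \<delta>" for e b0 a
  proof -
    have d: "norm (a - e) \<le> \<delta>" using e(4) by (simp add: dist_norm norm_minus_commute)
    have eN: "norm e \<le> N" "norm b0 \<le> N" using nrm[OF e(1)] nrm[OF e(2)] by auto
    have small: "P * norm (a - e) \<le> 1/8" using mult_left_mono[OF d, of P] P1 \<delta>(3) by simp
    have "ip a a = 1 + ip a (a - e) + ip e (a - e)"
      using e(1) by (simp add: ip_diff_right ip_commute[of e a])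
    then have "ip a a \<ge> 1 - 1/8 - 1/8"
      using bnd1[OF aN[OF e(1,4)], of "a - e"] bnd1[OF eN(1), of "a - e"] small by linarith
    moreover have "ip b0 a = ip b0 (a - e)" using e(3) by (simp add: ip_diff_right ip_commute[of b0 e])
    then have "\<bar>ip b0 a\<bar> \<le> 1/8" using bnd1[OF eN(2), of "a - e"] small by linarith
    then have "(ip b0 a)\<^sup>2 \<le> (1/8)\<^sup>2" using power_mono[of "\<bar>ip b0 a\<bar>" "1/8" 2] by simp
    ultimately show ?thesis by (simp add: power2_eq_square)
  qed
  have lip: "norm (partner b0 a - partner b0 a') \<le> L * norm (a - a')"
    if e: "ip e e = 1" "ip b0 b0 = 1" "ip e b0 = 0" and a: "a \<in> cball e \<delta>" and a': "a' \<in> cball e \<delta>"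
    for e b0 a a'
  proof -
    let ?n = "norm (a - a')"
    have nN: "norm a \<le> N" "norm a' \<le> N" "norm b0 \<le> N"
      using aN[OF e(1) a] aN[OF e(1) a'] nrm[OF e(2)] by auto
    define d d' where "d = ip a a - (ip b0 a)\<^sup>2" and "d' = ip a' a' - (ip b0 a')\<^sup>2"
    define m m' where "m = ip a a *\<^sub>R b0 - ip b0 a *\<^sub>R a" and "m' = ip a' a' *\<^sub>R b0 - ip b0 a' *\<^sub>R a'"
    have q: "ip a a - ip a' a' = ip a (a - a') + ip a' (a - a')"
      by (simp add: ip_diff_right ip_commute[of a' a])
    have q1: "\<bar>ip a a - ip a' a'\<bar> \<le> 2 * P * ?n"
      using bnd1[OF nN(1), of "a - a'"] bnd1[OF nN(2), of "a - a'"] unfolding q by linarith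
    have q2: "\<bar>ip b0 a - ip b0 a'\<bar> \<le> P * ?n"
      using bnd1[OF nN(3), of "a - a'"] by (simp add: ip_diff_right)
    have "(ip b0 a)\<^sup>2 - (ip b0 a')\<^sup>2 = (ip b0 a - ip b0 a') * (ip b0 a + ip b0 a')"
      by (simp add: power2_eq_square algebra_simps)
    then have "\<bar>(ip b0 a)\<^sup>2 - (ip b0 a')\<^sup>2\<bar> \<le> (P * ?n) * (2 * P)"
      using mult_mono[OF q2, of "\<bar>ip b0 a + ip b0 a'\<bar>" "2 * P"] bnd[OF nN(3,1)] bnd[OF nN(3,2)] P1
      by (simp add: abs_mult)
    moreover have "P * ?n \<le> P * P * ?n" using P1 by (intro mult_right_mono) auto
    moreover have "P * ?n * (2 * P) = 2 * (P * P * ?n)" "2 * P * ?n = 2 * (P * ?n)"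
      by (simp_all add: algebra_simps)
    ultimately have dd: "\<bar>d - d'\<bar> \<le> 4 * (P * P * ?n)" unfolding d_def d'_def using q1 by linarith
    have inv: "\<bar>1 / sqrt d - 1 / sqrt d'\<bar> \<le> 8 * (P * P * ?n)"
    proof -
      have "\<bar>1 / sqrt d - 1 / sqrt d'\<bar> \<le> 2 * \<bar>d - d'\<bar>"
        unfolding d_def d'_def by (rule inverse_sqrt_lipschitz[OF D[OF e a] D[OF e a']])
      also have "\<dots> \<le> 2 * (4 * (P * P * ?n))" using dd by simp
      finally show ?thesis by simp
    qed
    have d1: "1 / sqrt d \<le> 2"
    proof -
      have "sqrt d \<ge> 1/2" using D[OF e a] unfolding d_def by (intro real_le_rsqrt) (simp add: power2_eq_square)
      moreover from this have "sqrt d > 0" by linarith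
      ultimately show ?thesis by (simp add: divide_le_eq)
    qed
    have d0: "1 / sqrt d \<ge> 0" using D[OF e a] unfolding d_def by simp
    have "m - m' = (ip a a - ip a' a') *\<^sub>R b0 - (ip b0 a - ip b0 a') *\<^sub>R a - ip b0 a' *\<^sub>R (a - a')"
      by (simp add: m_def m'_def algebra_simps)
    also have "norm \<dots> \<le> \<bar>ip a a - ip a' a'\<bar> * norm b0 + \<bar>ip b0 a - ip b0 a'\<bar> * norm a + \<bar>ip b0 a'\<bar> * ?n"
      by (intro order_trans[OF norm_triangle_ineq4] add_mono) auto
    also have "\<dots> \<le> (2 * P * ?n) * N + (P * ?n) * N + P * ?n"
      using q1 q2 nN bnd[OF nN(3,2)] P1 N by (intro add_mono mult_mono) auto
    also have "\<dots> \<le> 4 * P * N * ?n" using N P1 mult_right_mono[of 1 N "P * ?n"] by (simp add: algebra_simps)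
    finally have mm: "norm (m - m') \<le> 4 * P * N * ?n" .
    have "norm m' \<le> \<bar>ip a' a'\<bar> * norm b0 + \<bar>ip b0 a'\<bar> * norm a'"
      unfolding m'_def by (rule order_trans[OF norm_triangle_ineq4]) simp
    also have "\<dots> \<le> P * N + P * N"
      using bnd[OF nN(2,2)] bnd[OF nN(3,2)] nN P1 by (intro add_mono mult_mono) auto
    finally have m': "norm m' \<le> 2 * P * N" by (simp add: algebra_simps)
    have "partner b0 a - partner b0 a' = (1 / sqrt d) *\<^sub>R (m - m') + (1 / sqrt d - 1 / sqrt d') *\<^sub>R m'"
      by (simp add: partner_def d_def d'_def m_def m'_def algebra_simps)
    also have "norm \<dots> \<le> 2 * (4 * P * N * ?n) + (8 * (P * P * ?n)) * (2 * P * N)"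
    proof (intro order_trans[OF norm_triangle_ineq] add_mono)
      show "norm ((1 / sqrt d) *\<^sub>R (m - m')) \<le> 2 * (4 * P * N * ?n)"
        unfolding norm_scaleR real_norm_def using d0 d1 mm by (intro mult_mono) auto
      show "norm ((1 / sqrt d - 1 / sqrt d') *\<^sub>R m') \<le> (8 * (P * P * ?n)) * (2 * P * N)"
        unfolding norm_scaleR real_norm_def using inv m' P1 by (intro mult_mono) auto
    qed
    finally have *: "norm (partner b0 a - partner b0 a') \<le> 8 * (P * N * ?n) + 16 * (P * P * P * N * ?n)"
      by (simp add: algebra_simps)
    have "P * N * ?n \<le> P * P * P * N * ?n"
      using P1 N mult_mono[of 1 P 1 P] by (intro mult_right_mono) auto
    then have "norm (partner b0 a - partner b0 a') \<le> 24 * (P * P * P * N * ?n)" using * by linarith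
    also have "\<dots> \<le> (24 * P * P * P * N + N) * ?n" using N by (simp add: algebra_simps)
    finally show ?thesis unfolding L_def .
  qed
  show ?thesis
  proof (rule that[OF \<delta>(1,2)])
    show "L > 0" unfolding L_def using P1 N by (intro add_nonneg_pos) auto
    show "norm e \<le> L" if "ip e e = 1" for e
      unfolding L_def using nrm[OF that] P1 N by (intro order_trans[OF _ add_increasing[OF _ order_refl]]) auto
  qed (use D lip in blast)+
qed

end

section \<open>Symmetry of second derivatives\<close>

lemma frechet_derivative_eqI: "(f has_derivative D) (at x) \<Longrightarrow> frechet_derivative f (at x) = D"
  by (rule frechet_derivative_at[symmetric])

lemma has_real_derivative_along_line:
  fixes f :: "'a::real_normed_vector \<Rightarrow> real"
  assumes "(f has_derivative D) (at (y + s *\<^sub>R v))"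
  shows "((\<lambda>s. f (y + s *\<^sub>R v)) has_real_derivative D v) (at s)"
proof -
  have "((\<lambda>s. y + s *\<^sub>R v) has_derivative (\<lambda>h. h *\<^sub>R v)) (at s)"
    by (auto intro!: derivative_eq_intros)
  from has_derivative_compose[OF this assms]
  have "((\<lambda>s. f (y + s *\<^sub>R v)) has_derivative (\<lambda>h. D (h *\<^sub>R v))) (at s)" .
  moreover have "linear D" using assms by (simp add: has_derivative_def bounded_linear.linear)
  then have "(\<lambda>h. D (h *\<^sub>R v)) = (\<lambda>h. D v * h)" by (simp add: linear_scale mult.commute)
  ultimately show ?thesis by (simp add: has_field_derivative_def)
qed

text \<open>The mean value theorem is used twice: for the increment of f in direction w as a
  function of the displacement along v, then for the v-derivative along w. Continuity of the mixed
  derivative at x gives the limit.\<close>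

lemma second_difference_tendsto:
  fixes f :: "'a::real_normed_vector \<Rightarrow> real"
  assumes S: "open S" "x \<in> S" and f: "Ck_on 2 S f"
  shows "((\<lambda>t. (f (x + t *\<^sub>R v + t *\<^sub>R w) - f (x + t *\<^sub>R v) - f (x + t *\<^sub>R w) + f x) / t\<^sup>2) \<longlongrightarrow>
    frechet_derivative (\<lambda>y. frechet_derivative f (at y) v) (at x) w) (at_right 0)"
proof -
  let ?D = "\<lambda>y. frechet_derivative f (at y) v"
  define P where "P y = frechet_derivative ?D (at y) w" for y
  have f2: "Ck_on (Suc (Suc 0)) S f" using f by (simp add: numeral_2_eq_2)
  have df: "(f has_derivative frechet_derivative f (at y)) (at y)" if "y \<in> S" for y
    using Ck_on_SucD[OF f2 that] .
  have D1: "Ck_on (Suc 0) S ?D" using f2 by simp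
  have dD: "(?D has_derivative frechet_derivative ?D (at y)) (at y)" if "y \<in> S" for y
    using Ck_on_SucD[OF D1 that] .
  have "continuous_on S P" unfolding P_def using D1 by simp
  then have cP: "isCont P x" using S by (simp add: continuous_on_eq_continuous_at)
  show ?thesis
  proof (rule tendstoI)
    fix e :: real assume "e > 0"
    have "(P \<longlongrightarrow> P x) (nhds x)" using cP by (simp add: isCont_def tendsto_at_iff_tendsto_nhds)
    then have "\<forall>\<^sub>F y in nhds x. y \<in> S \<and> dist (P y) (P x) < e"
      using tendstoD[OF _ \<open>e > 0\<close>] eventually_nhds_in_open[OF S] by (intro eventually_conj)
    then obtain r where r: "r > 0" "\<And>y. dist y x < r \<Longrightarrow> y \<in> S \<and> dist (P y) (P x) < e"
      by (auto simp: eventually_nhds_metric)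
    define d where "d = r / (norm v + norm w + 1)"
    have d: "d > 0" using r(1) by (simp add: d_def add_nonneg_pos)
    have "dist ((f (x + t *\<^sub>R v + t *\<^sub>R w) - f (x + t *\<^sub>R v) - f (x + t *\<^sub>R w) + f x) / t\<^sup>2) (P x) < e"
      if t: "0 < t" "t < d" for t
    proof -
      have near: "dist (x + a *\<^sub>R v + b *\<^sub>R w) x < r" if "0 \<le> a" "a \<le> t" "0 \<le> b" "b \<le> t" for a b
      proof -
        have "norm (a *\<^sub>R v + b *\<^sub>R w) \<le> a * norm v + b * norm w"
          using that norm_triangle_ineq[of "a *\<^sub>R v" "b *\<^sub>R w"] by simp
        also have "\<dots> \<le> t * norm v + t * norm w" using that by (intro add_mono mult_right_mono) auto
        also have "\<dots> \<le> t * (norm v + norm w + 1)" using t by (simp add: algebra_simps)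
        also have "\<dots> < r"
          using t(2) unfolding d_def by (subst (asm) pos_less_divide_eq) (simp_all add: add_nonneg_pos)
        finally show ?thesis by (simp add: dist_norm)
      qed
      have S': "x + a *\<^sub>R v + b *\<^sub>R w \<in> S" if "0 \<le> a" "a \<le> t" "0 \<le> b" "b \<le> t" for a b
        using r(2)[OF near[OF that]] by simp
      define \<phi> where "\<phi> s = f (x + t *\<^sub>R w + s *\<^sub>R v) - f (x + s *\<^sub>R v)" for s
      have "\<exists>s. 0 < s \<and> s < t \<and> \<phi> t - \<phi> 0 = (t - 0) * (?D (x + t *\<^sub>R w + s *\<^sub>R v) - ?D (x + s *\<^sub>R v))"
      proof (rule MVT2[OF t(1)])
        fix s assume s: "0 \<le> s" "s \<le> t"
        have m: "x + t *\<^sub>R w + s *\<^sub>R v \<in> S" "x + s *\<^sub>R v \<in> S"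
          using S'[of s t] S'[of s 0] s t by (simp_all add: ac_simps)
        show "(\<phi> has_real_derivative ?D (x + t *\<^sub>R w + s *\<^sub>R v) - ?D (x + s *\<^sub>R v)) (at s)"
          unfolding \<phi>_def
          by (rule DERIV_diff[OF has_real_derivative_along_line[OF df[OF m(1)]] has_real_derivative_along_line[OF df[OF m(2)]]])
      qed
      then obtain s where s: "0 < s" "s < t"
        "\<phi> t - \<phi> 0 = t * (?D (x + t *\<^sub>R w + s *\<^sub>R v) - ?D (x + s *\<^sub>R v))" by auto
      have "\<exists>q. 0 < q \<and> q < t \<and> ?D (x + s *\<^sub>R v + t *\<^sub>R w) - ?D (x + s *\<^sub>R v + 0 *\<^sub>R w) = (t - 0) * P (x + s *\<^sub>R v + q *\<^sub>R w)"
      proof (rule MVT2[OF t(1)])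
        fix q assume q: "0 \<le> q" "q \<le> t"
        show "((\<lambda>q. ?D (x + s *\<^sub>R v + q *\<^sub>R w)) has_real_derivative P (x + s *\<^sub>R v + q *\<^sub>R w)) (at q)"
          unfolding P_def by (rule has_real_derivative_along_line[OF dD[OF S']]) (use s q in auto)
      qed
      then obtain q where q: "0 < q" "q < t" "?D (x + s *\<^sub>R v + t *\<^sub>R w) - ?D (x + s *\<^sub>R v) = t * P (x + s *\<^sub>R v + q *\<^sub>R w)" by auto
      have "f (x + t *\<^sub>R v + t *\<^sub>R w) - f (x + t *\<^sub>R v) - f (x + t *\<^sub>R w) + f x = \<phi> t - \<phi> 0"
        by (simp add: \<phi>_def ac_simps)
      also have "\<dots> = t\<^sup>2 * P (x + s *\<^sub>R v + q *\<^sub>R w)"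
        using s(3) q(3) by (simp add: power2_eq_square ac_simps)
      finally have "(f (x + t *\<^sub>R v + t *\<^sub>R w) - f (x + t *\<^sub>R v) - f (x + t *\<^sub>R w) + f x) / t\<^sup>2 = P (x + s *\<^sub>R v + q *\<^sub>R w)"
        using t by simp
      then show ?thesis using r(2)[OF near[of s q]] s q by simp
    qed
    then show "\<forall>\<^sub>F t in at_right 0. dist ((f (x + t *\<^sub>R v + t *\<^sub>R w) - f (x + t *\<^sub>R v) - f (x + t *\<^sub>R w) + f x) / t\<^sup>2)
        (frechet_derivative ?D (at x) w) < e"
      using d unfolding eventually_at_right_field P_def by blast
  qed
qed

lemma frechet_derivative_inner:
  assumes "f differentiable (at x)"
  shows "frechet_derivative (\<lambda>y. f y \<bullet> b) (at x) v = frechet_derivative f (at x) v \<bullet> b"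
proof -
  have "((\<lambda>y. f y \<bullet> b) has_derivative (\<lambda>v. frechet_derivative f (at x) v \<bullet> b)) (at x)"
    using assms by (intro has_derivative_inner_left) (simp add: frechet_derivative_works)
  then show ?thesis by (simp add: frechet_derivative_eqI)
qed

text \<open>The second difference quotient is symmetric in v and w, so its two limits agree;
  components reduce the claim to real-valued functions.\<close>

lemma second_derivative_symmetric:
  fixes f :: "'a::real_normed_vector \<Rightarrow> 'b::euclidean_space"
  assumes S: "open S" "x \<in> S" and f: "Ck_on 2 S f"
  shows "frechet_derivative (\<lambda>y. frechet_derivative f (at y) v) (at x) w =
    frechet_derivative (\<lambda>y. frechet_derivative f (at y) w) (at x) v"
proof (rule euclidean_eqI)
  fix b :: 'b assume "b \<in> Basis"
  let ?g = "\<lambda>y. f y \<bullet> b"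
  have f2: "Ck_on (Suc (Suc 0)) S f" using f by (simp add: numeral_2_eq_2)
  have g: "Ck_on 2 S ?g" by (rule Ck_on_inner[OF S(1) f Ck_on_const])
  have dg: "frechet_derivative (\<lambda>y. frechet_derivative ?g (at y) p) (at x) q =
      frechet_derivative (\<lambda>y. frechet_derivative f (at y) p) (at x) q \<bullet> b" for p q
  proof -
    have "frechet_derivative (\<lambda>y. frechet_derivative ?g (at y) p) (at x) =
        frechet_derivative (\<lambda>y. frechet_derivative f (at y) p \<bullet> b) (at x)"
    proof (rule frechet_derivative_cong_open[OF S])
      fix y assume "y \<in> S"
      then show "frechet_derivative ?g (at y) p = frechet_derivative f (at y) p \<bullet> b"
        using f2 by (intro frechet_derivative_inner) simp
    qed
    then show ?thesis using frechet_derivative_inner[of "\<lambda>y. frechet_derivative f (at y) p" x b q] f2 S(2) by simp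
  qed
  have "(\<lambda>t. (?g (x + t *\<^sub>R v + t *\<^sub>R w) - ?g (x + t *\<^sub>R v) - ?g (x + t *\<^sub>R w) + ?g x) / t\<^sup>2) =
      (\<lambda>t. (?g (x + t *\<^sub>R w + t *\<^sub>R v) - ?g (x + t *\<^sub>R w) - ?g (x + t *\<^sub>R v) + ?g x) / t\<^sup>2)"
    by (simp add: algebra_simps)
  from tendsto_unique[OF _ second_difference_tendsto[OF S g, of v w]
      second_difference_tendsto[OF S g, of w v, folded this]]
  show "frechet_derivative (\<lambda>y. frechet_derivative f (at y) v) (at x) w \<bullet> b =
    frechet_derivative (\<lambda>y. frechet_derivative f (at y) w) (at x) v \<bullet> b"
    by (simp add: dg)
qed

lemma norm_fst_snd_le: "norm (fst p) \<le> norm p" "norm (snd p) \<le> norm p"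
  using norm_fst_le[of "fst p" "snd p"] norm_snd_le[of "snd p" "fst p"] by simp_all

section \<open>Solutions on the plane through two prescribed points\<close>

type_synonym 'n jet = "(real ^ 'n) \<times> (real ^ 'n) \<times> (real ^ 'n)"

context inner_matrix
begin

text \<open>
  \<open>u\<close> solves \<open>\<Delta>u = F(u, u\<^sub>s, u\<^sub>t)\<close> on the disc of radius \<open>2r\<close>, where \<open>u1\<close>, \<open>u2\<close> are its partial
  derivatives; \<open>w1\<close>, \<open>w2\<close> extend them to a solution of the corresponding first-order system
  on the whole plane.
\<close>

definition plane_solution ::
  "('n jet \<Rightarrow> real ^ 'n) \<Rightarrow> real \<Rightarrow> real \<Rightarrow> (complex \<Rightarrow> real ^ 'n) \<Rightarrow> (complex \<Rightarrow> real ^ 'n) \<Rightarrow>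
    (complex \<Rightarrow> real ^ 'n) \<Rightarrow> (complex \<Rightarrow> real ^ 'n) \<Rightarrow> (complex \<Rightarrow> real ^ 'n) \<Rightarrow> real ^ 'n \<Rightarrow> real ^ 'n \<Rightarrow> bool" where
  "plane_solution F r \<sigma> u u1 u2 w1 w2 a b \<longleftrightarrow>
     (\<forall>k. Ck_on k UNIV u \<and> Ck_on k UNIV u1 \<and> Ck_on k UNIV u2) \<and>
     ip a b = 0 \<and> ip a a = ip b b \<and>
     (\<forall>z. norm (u1 z - a) \<le> \<sigma> \<and> norm (u2 z - b) \<le> \<sigma>) \<and>
     (\<forall>z. norm z > r \<longrightarrow> norm (u z) > 2 \<and> F (u z, u1 z, u2 z) = 0) \<and>
     (\<forall>z. norm z < 2 * r \<longrightarrow> (u has_derivative (\<lambda>v. Re v *\<^sub>R u1 z + Im v *\<^sub>R u2 z)) (at z) \<and>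
        w1 z = u1 z \<and> w2 z = u2 z) \<and>
     (\<forall>z. \<exists>D1 D2. (w1 has_derivative D1) (at z) \<and> (w2 has_derivative D2) (at z) \<and>
        D1 1 + D2 \<i> = F (u z, u1 z, u2 z) \<and> D1 \<i> = D2 1) \<and>
     (w1 \<longlongrightarrow> a) at_infinity \<and> (w2 \<longlongrightarrow> b) at_infinity"

text \<open>The radius r and the tolerance \<eta> depend on the inner product, \<rho> and \<sigma>
  alone and are fixed before F and the data x, e, b0, h: F is made small afterwards, with \<eta>
  already known. The case h = 0 is included and covers coinciding points.\<close>

lemma plane_solution_exists:
  assumes \<sigma>: "\<sigma> > 0"
  obtains r \<eta> where "r \<ge> 1" "\<eta> > 0"
    "\<And>F x e b0 h. (\<And>k. Ck_on k UNIV F) \<Longrightarrow> (\<And>U. norm U > \<rho> \<Longrightarrow> F U = 0) \<Longrightarrow> (\<And>U. norm (F U) \<le> \<eta>) \<Longrightarrow>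
       (\<And>U W. norm (frechet_derivative F (at U) W) \<le> \<eta> * norm W) \<Longrightarrow> norm x \<le> 1 \<Longrightarrow>
       ip e e = 1 \<Longrightarrow> ip b0 b0 = 1 \<Longrightarrow> ip e b0 = 0 \<Longrightarrow> 0 \<le> h \<Longrightarrow> h \<le> r \<Longrightarrow>
     \<exists>u u1 u2 w1 w2 a b. plane_solution F r \<sigma> u u1 u2 w1 w2 a b \<and>
       u 0 = x \<and> u (of_real h) = x + h *\<^sub>R e \<and> norm (a - e) \<le> \<sigma> \<and> norm (b - b0) \<le> \<sigma>"
proof -
  obtain \<delta>1 L where L: "\<delta>1 > 0" "\<delta>1 \<le> 1" "L > 0"
    "\<And>e b0 a. ip e e = 1 \<Longrightarrow> ip b0 b0 = 1 \<Longrightarrow> ip e b0 = 0 \<Longrightarrow> a \<in> cball e \<delta>1 \<Longrightarrow>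
      ip a a - (ip b0 a)\<^sup>2 \<ge> 1/2"
    "\<And>e b0 a a'. ip e e = 1 \<Longrightarrow> ip b0 b0 = 1 \<Longrightarrow> ip e b0 = 0 \<Longrightarrow> a \<in> cball e \<delta>1 \<Longrightarrow> a' \<in> cball e \<delta>1 \<Longrightarrow>
      norm (partner b0 a - partner b0 a') \<le> L * norm (a - a')"
    "\<And>e. ip e e = 1 \<Longrightarrow> norm e \<le> L"
    using partner_lipschitz by blast
  obtain K where K: "K \<ge> 1" "\<And>a b. \<bar>ip a b\<bar> \<le> K * norm a * norm b" using ip_bound by blast
  define \<delta> where "\<delta> = min \<delta>1 (min \<sigma> (\<sigma> / L))"
  have \<delta>: "\<delta> > 0" "\<delta> \<le> \<delta>1" "\<delta> \<le> 1" "\<delta> \<le> \<sigma>" "L * \<delta> \<le> \<sigma>"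
  proof -
    show "\<delta> > 0" "\<delta> \<le> \<delta>1" "\<delta> \<le> \<sigma>" using L(1,3) \<sigma> by (auto simp: \<delta>_def)
    then show "\<delta> \<le> 1" using L(2) by linarith
    have "\<delta> \<le> \<sigma> / L" by (simp add: \<delta>_def)
    then show "L * \<delta> \<le> \<sigma>" using L(3) by (simp add: field_simps)
  qed
  \<comment> \<open>Since \<open>ip a a\<close> is at least 1/2, the linear part has norm at least
    norm z / sqrt (2 K), which exceeds max \<rho> 2 + 3 beyond r. The 3 pays for x and for two
    values of V, each of norm at most 1.\<close>
  define r where "r = sqrt (2 * K) * (max \<rho> 2 + 3)"
  have s1: "sqrt (2 * K) \<ge> 1" using K(1) by simp
  have r: "r \<ge> 1" unfolding r_def using mult_mono[of 1 "sqrt (2 * K)" 1 "max \<rho> 2 + 3"] s1 by simp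
  \<comment> \<open>A Lipschitz constant of V \<mapsto> U V on norm z \<le> r: 1 each for V 0, for a
    and for V z, L for b, and r and r L for the two linear terms.\<close>
  define Lam where "Lam = 3 + L + r + r * L"
  have Lam: "Lam \<ge> 1" using L(3) r by (simp add: Lam_def)
  \<comment> \<open>With the radius 3 r, truncation is invisible on norm z < 2 r for densities
    supported in radius r.\<close>
  define \<kappa> where "\<kappa> = pot_const (3 * r)"
  interpret shift_operator "pot (3 * r) :: (complex \<Rightarrow> real ^ 'n) \<Rightarrow> _" \<kappa>
    unfolding \<kappa>_def by (rule shift_operator_pot)
  define \<eta> where "\<eta> = min (\<delta> / \<kappa>) (1 / (2 * \<kappa> * Lam))"
  have \<eta>: "\<eta> > 0" "\<kappa> * \<eta> \<le> \<delta>" "\<kappa> * (\<eta> * Lam) \<le> 1/2" "\<kappa> * \<eta> \<le> 1/2"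
  proof -
    show "\<eta> > 0" using \<delta>(1) kappa_pos Lam by (simp add: \<eta>_def)
    have "\<eta> \<le> \<delta> / \<kappa>" by (simp add: \<eta>_def)
    then show "\<kappa> * \<eta> \<le> \<delta>" using kappa_pos by (simp add: field_simps)
    have "\<eta> \<le> 1 / (2 * \<kappa> * Lam)" by (simp add: \<eta>_def)
    then show 1: "\<kappa> * (\<eta> * Lam) \<le> 1/2" using kappa_pos Lam by (simp add: field_simps)
    have "\<eta> * 1 \<le> \<eta> * Lam" using Lam \<open>\<eta> > 0\<close> by (intro mult_left_mono) auto
    then have "\<kappa> * (\<eta> * 1) \<le> \<kappa> * (\<eta> * Lam)" by (rule mult_left_mono) (use kappa_pos in simp)
    then show "\<kappa> * \<eta> \<le> 1/2" using 1 by simp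
  qed
  show ?thesis
  proof (rule that[OF r \<eta>(1)])
    fix F :: "'n jet \<Rightarrow> real ^ 'n" and x e b0 :: "real ^ 'n" and h :: real
    assume Fk: "\<And>k. Ck_on k UNIV F" and F0: "\<And>U. norm U > \<rho> \<Longrightarrow> F U = 0" and F\<eta>: "\<And>U. norm (F U) \<le> \<eta>"
      and DF: "\<And>U W. norm (frechet_derivative F (at U) W) \<le> \<eta> * norm W" and x: "norm x \<le> 1"
      and e: "ip e e = 1" "ip b0 b0 = 1" "ip e b0 = 0" and h: "0 \<le> h" "h \<le> r"
    \<comment> \<open>The mean over the segment from 0 to h of the component of V that stands for
      the derivative in direction 1. At a fixed point h J V is the increment of the first component
      of V, so a = e - J V is the correction that sends h to x + h e.\<close>
    define J :: "(complex \<Rightarrow>\<^sub>C 'n jet) \<Rightarrow> real ^ 'n"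
      where "J V = integral {0..1} (\<lambda>s. fst (snd (V (of_real (s * h)))))" for V
    define a where "a V = e - J V" for V
    define b where "b V = partner b0 (a V)" for V
    \<comment> \<open>The jet of one affine map, corrected by V; subtracting the first component of
      V 0 forces the value x at 0.\<close>
    define U where "U V z = (x - fst (V 0), a V, b V) + Re z *\<^sub>R (a V, 0, 0) + Im z *\<^sub>R (b V, 0, 0) + V z"
      for V :: "complex \<Rightarrow>\<^sub>C 'n jet" and z
    have Jint: "(\<lambda>s. fst (snd (V (of_real (s * h))))) integrable_on {0..1}"
      for V :: "complex \<Rightarrow>\<^sub>C 'n jet"
      by (intro integrable_continuous_real continuous_intros
          continuous_on_compose2[OF continuous_on_apply_bcontfun[of UNIV V]]) auto
    have Jb: "norm (J V) \<le> B" if "\<And>z. norm (V z) \<le> B" for V :: "complex \<Rightarrow>\<^sub>C 'n jet" and B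
    proof -
      have "B \<ge> 0" using order_trans[OF norm_ge_zero that[of 0]] .
      then have "norm (J V) \<le> B * measure lborel {0..1::real}"
        unfolding J_def
      proof (rule has_integral_bound_real[OF _ finite.emptyI integrable_integral[OF Jint]])
        show "norm (fst (snd (V (of_real (s * h))))) \<le> B" for s
          using norm_fst_snd_le(1)[of "snd (V (of_real (s * h)))"] norm_fst_snd_le(2)[of "V (of_real (s * h))"]
            that[of "of_real (s * h)"] by linarith
      qed
      then show ?thesis by simp
    qed
    have Vn: "norm (V z) \<le> \<delta>" if "V \<in> cball 0 \<delta>" for V :: "complex \<Rightarrow>\<^sub>C 'n jet" and z
      using dist_bounded[of V z 0] that by (simp add: dist_commute)
    have ae: "a V \<in> cball e \<delta>1" "norm (a V - e) \<le> \<delta>" if "V \<in> cball 0 \<delta>" for V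
      using Jb[of V \<delta>, OF Vn[OF that]] \<delta>(2) by (auto simp: a_def dist_norm)
    have adiff: "norm (a V - a W) \<le> dist V W" for V W
    proof -
      have "J (V - W) = J V - J W"
        unfolding J_def minus_bcontfun.rep_eq fst_diff snd_diff
        by (rule Henstock_Kurzweil_Integration.integral_diff[OF Jint Jint])
      then have "a V - a W = - J (V - W)" by (simp add: a_def)
      moreover have "norm ((V - W) z) \<le> dist V W" for z
        using dist_bounded[of V z W] by (simp add: dist_norm)
      then have "norm (J (V - W)) \<le> dist V W" by (rule Jb)
      ultimately show ?thesis by simp
    qed
    have bdiff: "norm (b V - b W) \<le> L * dist V W" if "V \<in> cball 0 \<delta>" "W \<in> cball 0 \<delta>" for V W
      unfolding b_def
      using L(5)[OF e ae(1)[OF that(1)] ae(1)[OF that(2)]] mult_left_mono[OF adiff[of V W], of L] L(3) by linarith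
    have conf: "ip (a V) (b V) = 0" "ip (b V) (b V) = ip (a V) (a V)" "ip (a V) (a V) \<ge> 1/2"
      if "V \<in> cball 0 \<delta>" for V
    proof -
      have D: "ip (a V) (a V) - (ip b0 (a V))\<^sup>2 \<ge> 1/2" by (rule L(4)[OF e ae(1)[OF that]])
      then have "ip (a V) (a V) - (ip b0 (a V))\<^sup>2 > 0" by linarith
      then show "ip (a V) (b V) = 0" "ip (b V) (b V) = ip (a V) (a V)"
        unfolding b_def using partner_conformal[OF e(2)] by blast+
      show "ip (a V) (a V) \<ge> 1/2" using D zero_le_power2[of "ip b0 (a V)"] by linarith
    qed
    have fstU: "fst (U V z) = x - fst (V 0) + (Re z *\<^sub>R a V + Im z *\<^sub>R b V) + fst (V z)" for V z
      by (simp add: U_def)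
    have large: "norm (fst (U V z)) > max \<rho> 2" if V: "V \<in> cball 0 \<delta>" and z: "norm z > r" for V z
    proof -
      let ?l = "Re z *\<^sub>R a V + Im z *\<^sub>R b V"
      \<comment> \<open>As a and b are orthogonal of equal length, the quadratic form on the linear
        part is a constant multiple of |z|^2.\<close>
      have "ip ?l ?l = ((Re z)\<^sup>2 + (Im z)\<^sup>2) * ip (a V) (a V)"
        using conf(1,2)[OF V] ip_commute[of "b V" "a V"]
        by (simp add: ip_add_left ip_add_right ip_scaleR_left ip_scaleR_right power2_eq_square algebra_simps)
      then have "ip ?l ?l = (norm z)\<^sup>2 * ip (a V) (a V)" by (simp only: cmod_power2)
      then have "(norm z)\<^sup>2 * (1/2) \<le> K * (norm ?l)\<^sup>2"
        using mult_left_mono[OF conf(3)[OF V], of "(norm z)\<^sup>2"] K(2)[of ?l ?l] by (simp add: power2_eq_square)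
      then have "(norm z)\<^sup>2 \<le> (sqrt (2 * K) * norm ?l)\<^sup>2" using K(1) by (simp add: power_mult_distrib)
      then have "norm z \<le> sqrt (2 * K) * norm ?l" by (rule power2_le_imp_le) (use K(1) in simp)
      then have "sqrt (2 * K) * (max \<rho> 2 + 3) < sqrt (2 * K) * norm ?l" using z unfolding r_def by linarith
      then have "max \<rho> 2 + 3 < norm ?l" using s1 by (simp add: mult_less_cancel_left_pos)
      moreover have "norm ?l \<le> norm (fst (U V z)) + norm x + norm (fst (V 0)) + norm (fst (V z))"
      proof -
        have "?l = fst (U V z) - x + fst (V 0) - fst (V z)" by (simp add: fstU)
        then show ?thesis
          using norm_triangle_ineq4[of "fst (U V z) - x + fst (V 0)" "fst (V z)"]
            norm_triangle_ineq[of "fst (U V z) - x" "fst (V 0)"] norm_triangle_ineq4[of "fst (U V z)" x]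
          by simp
      qed
      moreover have "norm (fst (V 0)) \<le> 1" "norm (fst (V z)) \<le> 1"
        using norm_fst_snd_le(1)[of "V 0"] norm_fst_snd_le(1)[of "V z"] Vn[OF V, of 0] Vn[OF V, of z] \<delta>(3) by linarith+
      ultimately show ?thesis using x by linarith
    qed
    have largeU: "norm (U V z) > \<rho>" if "V \<in> cball 0 \<delta>" "norm z > r" for V z
      using large[OF that] norm_fst_snd_le(1)[of "U V z"] by simp
    have Ucont: "continuous_on UNIV (U V)" for V unfolding U_def by (intro continuous_intros) auto
    have Ulip: "norm (U V z - U W z) \<le> Lam * dist V W"
      if V: "V \<in> cball 0 \<delta>" and W: "W \<in> cball 0 \<delta>" and z: "norm z \<le> r" for V W z
    proof -
      let ?d = "dist V W"
      have Vd: "norm (V w - W w) \<le> ?d" for w using dist_bounded[of V w W] by (simp add: dist_norm)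
      have "U V z - U W z = ((- (fst (V 0 - W 0)) , 0, 0) + (0, a V - a W, 0)) + ((0, 0, b V - b W)
          + (Re z *\<^sub>R (a V - a W, 0, 0) + Im z *\<^sub>R (b V - b W, 0, 0))) + (V z - W z)"
        by (simp add: U_def prod_eq_iff algebra_simps)
      also have "norm \<dots> \<le> ((?d + ?d) + (L * ?d + (r * ?d + r * (L * ?d)))) + ?d"
      proof (intro order_trans[OF norm_triangle_ineq] add_mono)
        show "norm (- (fst (V 0 - W 0)), 0 :: real ^ 'n, 0 :: real ^ 'n) \<le> ?d"
          using norm_fst_snd_le(1)[of "V 0 - W 0"] Vd[of 0] by (simp add: norm_Pair norm_minus_commute)
        show "norm (0 :: real ^ 'n, a V - a W, 0 :: real ^ 'n) \<le> ?d" using adiff[of V W] by (simp add: norm_Pair)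
        show "norm (0 :: real ^ 'n, 0 :: real ^ 'n, b V - b W) \<le> L * ?d" using bdiff[OF V W] by (simp add: norm_Pair)
        show "norm (Re z *\<^sub>R (a V - a W, 0 :: real ^ 'n, 0 :: real ^ 'n)) \<le> r * ?d"
          using adiff[of V W] abs_Re_le_cmod[of z] z r unfolding norm_scaleR
          by (intro mult_mono) (auto simp: norm_Pair)
        show "norm (Im z *\<^sub>R (b V - b W, 0 :: real ^ 'n, 0 :: real ^ 'n)) \<le> r * (L * ?d)"
          using bdiff[OF V W] abs_Im_le_cmod[of z] z r unfolding norm_scaleR
          by (intro mult_mono) (auto simp: norm_Pair)
      qed (rule Vd)
      also have "\<dots> = Lam * ?d" by (simp add: Lam_def algebra_simps)
      finally show ?thesis .
    qed
    have Flip: "norm (F A - F B) \<le> \<eta> * norm (A - B)" for A B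
    proof (rule differentiable_bound[of UNIV F "\<lambda>A. frechet_derivative F (at A)"])
      show "(F has_derivative frechet_derivative F (at A)) (at A within UNIV)" for A
        using Ck_on_SucD[OF Fk, of A] by simp
      show "onorm (frechet_derivative F (at A)) \<le> \<eta>" for A by (rule onorm_le) (rule DF)
    qed auto
    have Fcont: "continuous_on UNIV F" using Ck_on_continuous[OF Fk] .
    have \<delta>0: "0 \<le> \<delta>" and \<eta>0: "0 \<le> \<eta>" and Lam0: "0 \<le> Lam" using \<delta>(1) \<eta>(1) Lam by auto
    obtain V where V: "V \<in> cball 0 \<delta>" "apply_bcontfun V = pot (3 * r) (\<lambda>z. F (U V z))"
      by (rule nonlinear_fixed_point[of F \<eta> \<eta> \<rho> \<delta> U r Lam, OF Fcont F\<eta> Flip F0 \<eta>(2) \<delta>0 Ucont largeU Ulip \<eta>0 Lam0 \<eta>(3)])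
    have Vk: "Ck_on k UNIV (apply_bcontfun V)" for k
    proof (rule smooth_fixed_point[where F = F and \<rho> = \<rho> and U = "U V" and r = r and c = \<eta>])
      show "U V z = (x - fst (V 0), a V, b V) + Re z *\<^sub>R (a V, 0, 0) + Im z *\<^sub>R (b V, 0, 0) + V z" for z
        by (simp only: U_def)
    qed (rule Fk F0 apply_bcontfun V(2) largeU[OF V(1)] DF \<eta>(4); assumption)+
    have Uk: "Ck_on k UNIV (U V)" for k
      unfolding U_def
      by (intro Ck_on_add Ck_on_scaleR Ck_on_const open_UNIV Ck_on_bounded_linear bounded_linear_Re bounded_linear_Im Vk)
    define f where "f z = F (U V z)" for z
    have fk: "Ck_on k UNIV f" for k
      unfolding f_def by (rule Ck_on_compose[OF open_UNIV open_UNIV Uk Fk]) simp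
    have f0: "f z = 0" if "norm z > r" for z
      unfolding f_def by (rule F0[OF largeU[OF V(1) that]])
    let ?m = "poisson_mass"
    have m: "?m > 0" by (rule poisson_mass_pos)
    define w where "w k z = (1 / ?m) *\<^sub>R conv k f z" for k z
    have Vw: "V z = (w ker0 z, w ker1 z, w ker2 z)" if "norm z < 2 * r" for z
    proof -
      have "conv (trunc (3 * r) k) f z = conv k f z" for k
        by (rule conv_trunc[where r = r]) (use f0 that in auto)
      then show ?thesis unfolding V(2) by (simp add: pot_def w_def f_def[abs_def])
    qed
    have wder: "(w k has_derivative (\<lambda>v. (1 / ?m) *\<^sub>R conv k (\<lambda>y. frechet_derivative f (at y) v) z)) (at z)"
      if "loc_integrable k" for k z
      unfolding w_def by (intro has_derivative_scaleR_right has_derivative_conv[OF that fk f0])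
    have w0der: "(w ker0 has_derivative (\<lambda>v. Re v *\<^sub>R w ker1 z + Im v *\<^sub>R w ker2 z)) (at z)" for z
    proof -
      let ?D = "\<lambda>v. (1 / ?m) *\<^sub>R conv ker0 (\<lambda>y. frechet_derivative f (at y) v) z"
      have d: "(w ker0 has_derivative ?D) (at z)" by (rule wder[OF loc_integrable_ker(1)])
      then have "linear ?D" by (simp add: has_derivative_def bounded_linear.linear)
      then have "?D v = Re v *\<^sub>R ?D 1 + Im v *\<^sub>R ?D \<i>" for v by (rule linear_complex_decomp)
      moreover have "conv ker0 (\<lambda>w. frechet_derivative f (at w) 1) z = conv ker1 f z"
        by (rule conv_ker0(1)[OF fk f0])
      moreover have "conv ker0 (\<lambda>w. frechet_derivative f (at w) \<i>) z = conv ker2 f z"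
        by (rule conv_ker0(2)[OF fk f0])
      ultimately have "?D = (\<lambda>v. Re v *\<^sub>R w ker1 z + Im v *\<^sub>R w ker2 z)"
        by (simp only: w_def fun_eq_iff) simp
      with d show ?thesis by simp
    qed
    \<comment> \<open>Here the independent unknowns are reunited: the second and third components of
      V are the partial derivatives of the first.\<close>
    have V0der: "((\<lambda>z. fst (V z)) has_derivative (\<lambda>v. Re v *\<^sub>R fst (snd (V z)) + Im v *\<^sub>R snd (snd (V z)))) (at z)"
      if "norm z < 2 * r" for z
    proof (rule has_derivative_transform_within_open[where s = "ball 0 (2 * r)" and f = "w ker0"])
      show "(w ker0 has_derivative (\<lambda>v. Re v *\<^sub>R fst (snd (V z)) + Im v *\<^sub>R snd (snd (V z)))) (at z)"
        using w0der[of z] by (simp add: Vw[OF that])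
    qed (use that Vw in auto)
    define u where "u z = fst (U V z)" for z
    define u1 where "u1 z = fst (snd (U V z))" for z
    define u2 where "u2 z = snd (snd (U V z))" for z
    \<comment> \<open>Beyond 2 r the truncated potentials need not be those of f. With the full
      kernels w1 and w2 satisfy the first-order system on the whole plane and converge at
      infinity.\<close>
    define w1 where "w1 z = a V + w ker1 z" for z
    define w2 where "w2 z = b V + w ker2 z" for z
    have u1V: "u1 z = a V + fst (snd (V z))" "u2 z = b V + snd (snd (V z))" for z
      by (simp_all add: u1_def u2_def U_def)
    have uV: "u z = x - fst (V 0) + Re z *\<^sub>R a V + Im z *\<^sub>R b V + fst (V z)" for z
      by (simp add: u_def U_def)
    have UF: "F (u z, u1 z, u2 z) = f z" for z by (simp add: u_def u1_def u2_def f_def)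
    have "plane_solution F r \<sigma> u u1 u2 w1 w2 (a V) (b V)"
      unfolding plane_solution_def
    proof (intro conjI allI impI)
      show "Ck_on k UNIV u" "Ck_on k UNIV u1" "Ck_on k UNIV u2" for k
        unfolding u_def[abs_def] u1_def[abs_def] u2_def[abs_def] by (intro Ck_on_fst Ck_on_snd open_UNIV Uk)+
      show "ip (a V) (b V) = 0" "ip (a V) (a V) = ip (b V) (b V)" using conf[OF V(1)] by auto
      fix z :: complex
      show "norm (u1 z - a V) \<le> \<sigma>" "norm (u2 z - b V) \<le> \<sigma>"
        using norm_fst_snd_le[of "snd (V z)"] norm_fst_snd_le(2)[of "V z"] Vn[OF V(1), of z] \<delta>(4)
        unfolding u1V by simp_all
      show "norm (u z) > 2" if "norm z > r" using large[OF V(1) that] by (simp add: u_def)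
      show "F (u z, u1 z, u2 z) = 0" if "norm z > r" using f0[OF that] by (simp add: UF)
      show "(u has_derivative (\<lambda>v. Re v *\<^sub>R u1 z + Im v *\<^sub>R u2 z)) (at z)" if "norm z < 2 * r"
      proof -
        have "((\<lambda>z. x - fst (V 0) + Re z *\<^sub>R a V + Im z *\<^sub>R b V) has_derivative
            (\<lambda>v. Re v *\<^sub>R a V + Im v *\<^sub>R b V)) (at z)"
          by (auto intro!: derivative_eq_intros)
        from has_derivative_add[OF this V0der[OF that]] show ?thesis
          by (simp add: uV[abs_def] u1V algebra_simps)
      qed
      show "w1 z = u1 z" "w2 z = u2 z" if "norm z < 2 * r"
        by (simp_all add: w1_def w2_def u1V Vw[OF that])
      let ?D = "\<lambda>k v. (1 / ?m) *\<^sub>R conv k (\<lambda>y. frechet_derivative f (at y) v) z"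
      have "(w1 has_derivative ?D ker1) (at z)" "(w2 has_derivative ?D ker2) (at z)"
        unfolding w1_def[abs_def] w2_def[abs_def]
        using has_derivative_add[OF has_derivative_const wder[OF loc_integrable_ker(2)]]
          has_derivative_add[OF has_derivative_const wder[OF loc_integrable_ker(3)]] by simp_all
      moreover have "?D ker1 1 + ?D ker2 \<i> = F (u z, u1 z, u2 z)"
      proof -
        have "conv ker1 (\<lambda>w. frechet_derivative f (at w) 1) z + conv ker2 (\<lambda>w. frechet_derivative f (at w) \<i>) z = ?m *\<^sub>R f z"
          by (rule conv_ker_laplace[OF fk f0])
        then show ?thesis using m by (simp add: UF scaleR_add_right[symmetric])
      qed
      \<comment> \<open>Both sides are the normalised mixed second derivative of the logarithmic
        potential of f.\<close>
      moreover have "?D ker1 \<i> = ?D ker2 1"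
      proof -
        have Df: "Ck_on 1 UNIV (\<lambda>y. frechet_derivative f (at y) v)" for v using fk[of "Suc 1"] by simp
        have Df0: "frechet_derivative f (at y) v = 0" if "norm y > r" for v y
          by (rule frechet_derivative_zero_outside[OF f0 that])
        have "conv ker1 (\<lambda>y. frechet_derivative f (at y) \<i>) z =
            conv ker0 (\<lambda>y. frechet_derivative (\<lambda>y. frechet_derivative f (at y) \<i>) (at y) 1) z"
          by (rule conv_ker0(1)[OF Df Df0, symmetric])
        also have "\<dots> = conv ker0 (\<lambda>y. frechet_derivative (\<lambda>y. frechet_derivative f (at y) 1) (at y) \<i>) z"
        proof -
          have "frechet_derivative (\<lambda>y. frechet_derivative f (at y) \<i>) (at y) 1 =
              frechet_derivative (\<lambda>y. frechet_derivative f (at y) 1) (at y) \<i>" for y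
            by (rule second_derivative_symmetric[OF open_UNIV UNIV_I fk])
          then show ?thesis by simp
        qed
        also have "\<dots> = conv ker2 (\<lambda>y. frechet_derivative f (at y) 1) z"
          by (rule conv_ker0(2)[OF Df Df0])
        finally show ?thesis by simp
      qed
      ultimately show "\<exists>D1 D2. (w1 has_derivative D1) (at z) \<and> (w2 has_derivative D2) (at z) \<and>
          D1 1 + D2 \<i> = F (u z, u1 z, u2 z) \<and> D1 \<i> = D2 1"
        by blast
      have fM: "norm (f z) \<le> \<eta>" for z unfolding f_def by (rule F\<eta>)
      have lim: "(w k \<longlongrightarrow> 0) at_infinity" if k: "\<And>\<zeta>. \<bar>k \<zeta>\<bar> \<le> 2 / norm \<zeta>" for k
      proof -
        have "((\<lambda>z. (1 / ?m) *\<^sub>R conv k f z) \<longlongrightarrow> (1 / ?m) *\<^sub>R 0) at_infinity"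
          by (intro tendsto_intros conv_tendsto_0_at_infinity[OF k f0 fM])
        then show ?thesis by (simp add: w_def[abs_def])
      qed
      show "(w1 \<longlongrightarrow> a V) at_infinity" "(w2 \<longlongrightarrow> b V) at_infinity"
        unfolding w1_def[abs_def] w2_def[abs_def]
        using tendsto_add[OF tendsto_const lim[OF ker_bound(1)], of "a V"]
          tendsto_add[OF tendsto_const lim[OF ker_bound(2)], of "b V"] by simp_all
    qed
    moreover have "u 0 = x" by (simp add: uV)
    moreover have "u (of_real h) = x + h *\<^sub>R e"
    proof -
      have "((\<lambda>s. h *\<^sub>R fst (snd (V (of_real (s * h))))) has_integral
          fst (V (of_real (1 * h))) - fst (V (of_real (0 * h)))) {0..1}"
      proof (rule fundamental_theorem_of_calculus)
        fix s :: real assume s: "s \<in> {0..1}"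
        have "s * h \<le> 1 * r" using s h by (intro mult_mono) auto
        then have "norm (of_real (s * h) :: complex) < 2 * r" using s h r by (simp add: norm_mult)
        note d = V0der[OF this]
        have "((\<lambda>s. of_real (s * h) :: complex) has_derivative (\<lambda>t. of_real (t * h))) (at s)"
          by (auto intro!: derivative_eq_intros)
        from has_derivative_compose[OF this d]
        have "((\<lambda>s. fst (V (of_real (s * h)))) has_vector_derivative h *\<^sub>R fst (snd (V (of_real (s * h))))) (at s)"
          by (simp add: has_vector_derivative_def)
        then show "((\<lambda>s. fst (V (of_real (s * h)))) has_vector_derivative h *\<^sub>R fst (snd (V (of_real (s * h))))) (at s within {0..1})"
          by (rule has_vector_derivative_at_within)
      qed simp
      from integral_unique[OF this]
      have "integral {0..1} (\<lambda>s. h *\<^sub>R fst (snd (V (of_real (s * h))))) =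
          fst (V (of_real (1 * h))) - fst (V (of_real (0 * h)))" .
      moreover have "integral {0..1} (\<lambda>s. h *\<^sub>R fst (snd (V (of_real (s * h))))) = h *\<^sub>R J V"
        unfolding J_def by (rule integral_cmul)
      ultimately have "h *\<^sub>R J V = fst (V (of_real (1 * h))) - fst (V (of_real (0 * h)))" by (rule trans[OF sym, rotated])
      then have "h *\<^sub>R J V = fst (V (of_real h)) - fst (V 0)" by simp
      then show ?thesis by (simp add: uV a_def algebra_simps)
    qed
    moreover have "norm (a V - e) \<le> \<sigma>" using ae(2)[OF V(1)] \<delta>(4) by simp
    moreover have "norm (b V - b0) \<le> \<sigma>"
    proof -
      \<comment> \<open>At a = e the Gram-Schmidt step returns b0, so the Lipschitz bound controls
        the distance from b to b0.\<close>
      have "partner b0 e = b0" using e by (simp add: partner_def ip_commute[of b0 e])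
      then have "norm (b V - b0) \<le> L * norm (a V - e)"
        unfolding b_def using L(5)[OF e ae(1)[OF V(1)], of e] L(1) by simp
      also have "\<dots> \<le> L * \<delta>" using ae(2)[OF V(1)] L(3) by (intro mult_left_mono) auto
      finally show ?thesis using \<delta>(5) by linarith
    qed
    ultimately show "\<exists>u u1 u2 w1 w2 a b. plane_solution F r \<sigma> u u1 u2 w1 w2 a b \<and>
       u 0 = x \<and> u (of_real h) = x + h *\<^sub>R e \<and> norm (a - e) \<le> \<sigma> \<and> norm (b - b0) \<le> \<sigma>"
      by blast
  qed
qed

end

section \<open>Christoffel symbols and the Hopf differential in coordinates\<close>

lemma Ck_on_det:
  fixes M :: "'a::real_normed_vector \<Rightarrow> real ^ 'n ^ 'n"
  assumes "open S" "\<And>i j. Ck_on k S (\<lambda>x. M x $ i $ j)"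
  shows "Ck_on k S (\<lambda>x. det (M x))"
  unfolding det_def
  by (intro Ck_on_sum[OF assms(1)] Ck_on_mult[OF assms(1)] Ck_on_const Ck_on_prod[OF assms(1)] assms(2))

lemma matrix_inv_inverse:
  fixes M :: "real ^ 'n ^ 'n"
  assumes "det M \<noteq> 0"
  shows "M ** matrix_inv M = mat 1" "matrix_inv M ** M = mat 1"
proof -
  have "\<exists>M'. M ** M' = mat 1 \<and> M' ** M = mat 1"
    using assms invertible_det_nz[of M] unfolding invertible_def by blast
  from someI_ex[OF this] show "M ** matrix_inv M = mat 1" "matrix_inv M ** M = mat 1"
    unfolding matrix_inv_def by blast+
qed

text \<open>Cramer's rule presents the inverse as a quotient of determinants, from which its
  smoothness in a parameter is read off.\<close>

lemma matrix_inv_cramer: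
  fixes M :: "real ^ 'n ^ 'n"
  assumes "det M \<noteq> 0"
  shows "matrix_inv M $ i $ j = det (\<chi> a b. if b = i then axis j 1 $ a else M $ a $ b) / det M"
proof -
  have "M *v (matrix_inv M *v axis j 1) = axis j 1"
    by (simp add: matrix_vector_mul_assoc matrix_inv_inverse[OF assms])
  then have "matrix_inv M *v axis j 1 = (\<chi> k. det (\<chi> a b. if b = k then axis j 1 $ a else M $ a $ b) / det M)"
    by (subst (asm) cramer[OF assms])
  moreover have "(matrix_inv M *v axis j 1) $ i = matrix_inv M $ i $ j"
    by (simp add: matrix_vector_mult_basis column_def)
  ultimately show ?thesis by simp
qed

lemma Ck_on_matrix_inv:
  fixes M :: "'a::real_normed_vector \<Rightarrow> real ^ 'n ^ 'n"
  assumes "open S" "\<And>i j. Ck_on k S (\<lambda>x. M x $ i $ j)" "\<And>x. x \<in> S \<Longrightarrow> det (M x) \<noteq> 0"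
  shows "Ck_on k S (\<lambda>x. matrix_inv (M x) $ i $ j)"
proof -
  have "Ck_on k S (\<lambda>x. det (\<chi> a b. if b = i then axis j 1 $ a else M x $ a $ b) / det (M x))"
  proof (intro Ck_on_divide Ck_on_det assms)
    show "Ck_on k S (\<lambda>x. (\<chi> a b. if b = i then axis j 1 $ a else M x $ a $ b) $ a $ b)" for a b
      by (cases "b = i") (auto intro: Ck_on_const assms(2))
  qed
  then show ?thesis
    by (rule Ck_on_cong[OF assms(1), THEN iffD1, rotated]) (simp add: matrix_inv_cramer assms(3))
qed

lemma pos_def_det_nz:
  fixes M :: "real ^ 'n ^ 'n"
  assumes "\<And>v. v \<noteq> 0 \<Longrightarrow> v \<bullet> (M *v v) > 0"
  shows "det M \<noteq> 0"
proof -
  have "inj ((*v) M)"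
    unfolding linear_injective_0[OF matrix_vector_mul_linear] using assms by (metis inner_zero_right less_irrefl)
  then show ?thesis using invertible_det_nz invertible_left_inverse matrix_left_invertible_injective by metis
qed

text \<open>A coordinate form of \<open>metric_deriv\<close> for an arbitrary matrix field G, so
  that it covers rescaled metrics as well; \<open>christoffel_symbol\<close> generalises
  \<open>christoffel\<close> in the same way.\<close>

definition metric_partial :: "(real ^ 'n \<Rightarrow> real ^ 'n ^ 'n) \<Rightarrow> real ^ 'n \<Rightarrow> 'n \<Rightarrow> 'n \<Rightarrow> 'n \<Rightarrow> real" where
  "metric_partial G x l i j = frechet_derivative (\<lambda>y. G y $ i $ j) (at x) (axis l 1)"

definition christoffel_symbol :: "(real ^ 'n \<Rightarrow> real ^ 'n ^ 'n) \<Rightarrow> real ^ 'n \<Rightarrow> 'n \<Rightarrow> 'n \<Rightarrow> 'n \<Rightarrow> real" where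
  "christoffel_symbol G x i j k = (\<Sum>l\<in>UNIV. matrix_inv (G x) $ i $ l *
     (metric_partial G x j l k + metric_partial G x k l j - metric_partial G x l j k)) / 2"

lemma metric_partial_sym:
  assumes "open S" "x \<in> S" "\<And>y. y \<in> S \<Longrightarrow> transpose (G y) = G y"
  shows "metric_partial G x l i j = metric_partial G x l j i"
  unfolding metric_partial_def
  by (subst frechet_derivative_cong_open[OF assms(1,2), of _ "\<lambda>y. G y $ j $ i"])
    (use assms(3) in \<open>auto simp: transpose_def vec_eq_iff\<close>)

text \<open>Multiplication by G lowers the index and removes the inverse matrix. The symmetry of S
  merges the first two terms of the Christoffel symbol, so that the factor 1/2 remains on the third
  alone.\<close>

lemma christoffel_lower:
  fixes G :: "real ^ 'n \<Rightarrow> real ^ 'n ^ 'n" and S :: "'n \<Rightarrow> 'n \<Rightarrow> real"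
  assumes S: "\<And>j k. S j k = S k j" and nz: "det (G x) \<noteq> 0"
  shows "(\<forall>i. p $ i + (\<Sum>j\<in>UNIV. \<Sum>k\<in>UNIV. christoffel_symbol G x i j k * S j k) = 0) \<longleftrightarrow>
    (\<forall>l. (\<Sum>i\<in>UNIV. G x $ l $ i * p $ i) +
      (\<Sum>j\<in>UNIV. \<Sum>k\<in>UNIV. (metric_partial G x j l k - metric_partial G x l j k / 2) * S j k) = 0)"
proof -
  let ?T = "metric_partial G x"
  define X :: "real ^ 'n" where "X = (\<chi> l. \<Sum>j\<in>UNIV. \<Sum>k\<in>UNIV. (?T j l k - ?T l j k / 2) * S j k)"
  have X': "(\<Sum>j\<in>UNIV. \<Sum>k\<in>UNIV. (?T j l k + ?T k l j - ?T l j k) / 2 * S j k) = X $ l" for l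
  proof -
    have "(\<Sum>j\<in>UNIV. \<Sum>k\<in>UNIV. ?T k l j * S j k) = (\<Sum>j\<in>UNIV. \<Sum>k\<in>UNIV. ?T j l k * S j k)"
      by (subst sum.swap) (simp add: S)
    then show ?thesis
      by (simp add: X_def algebra_simps add_divide_distrib diff_divide_distrib sum.distrib sum_subtractf
          sum_divide_distrib[symmetric])
  qed
  have "(\<Sum>j\<in>UNIV. \<Sum>k\<in>UNIV. christoffel_symbol G x i j k * S j k) = (matrix_inv (G x) *v X) $ i" for i
  proof -
    have "(\<Sum>j\<in>UNIV. \<Sum>k\<in>UNIV. christoffel_symbol G x i j k * S j k) =
        (\<Sum>j\<in>UNIV. \<Sum>k\<in>UNIV. \<Sum>l\<in>UNIV. matrix_inv (G x) $ i $ l * ((?T j l k + ?T k l j - ?T l j k) / 2 * S j k))"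
    proof (intro sum.cong refl)
      fix j k
      have "christoffel_symbol G x i j k = (\<Sum>l\<in>UNIV. matrix_inv (G x) $ i $ l * ((?T j l k + ?T k l j - ?T l j k) / 2))"
        by (simp add: christoffel_symbol_def sum_divide_distrib)
      then show "christoffel_symbol G x i j k * S j k =
          (\<Sum>l\<in>UNIV. matrix_inv (G x) $ i $ l * ((?T j l k + ?T k l j - ?T l j k) / 2 * S j k))"
        by (simp only: sum_distrib_right mult.assoc)
    qed
    also have "\<dots> = (\<Sum>j\<in>UNIV. \<Sum>l\<in>UNIV. \<Sum>k\<in>UNIV. matrix_inv (G x) $ i $ l * ((?T j l k + ?T k l j - ?T l j k) / 2 * S j k))"
      by (intro sum.cong refl sum.swap)
    also have "\<dots> = (\<Sum>l\<in>UNIV. \<Sum>j\<in>UNIV. \<Sum>k\<in>UNIV. matrix_inv (G x) $ i $ l * ((?T j l k + ?T k l j - ?T l j k) / 2 * S j k))"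
      by (rule sum.swap)
    also have "\<dots> = (\<Sum>l\<in>UNIV. matrix_inv (G x) $ i $ l * X $ l)"
      by (simp only: sum_distrib_left[symmetric] X')
    finally show ?thesis by (simp add: matrix_vector_mult_def)
  qed
  then have "(\<forall>i. p $ i + (\<Sum>j\<in>UNIV. \<Sum>k\<in>UNIV. christoffel_symbol G x i j k * S j k) = 0) \<longleftrightarrow>
      p + matrix_inv (G x) *v X = 0"
    by (simp add: vec_eq_iff)
  also have "\<dots> \<longleftrightarrow> G x *v p + X = 0"
  proof -
    note inv = matrix_inv_inverse[OF nz]
    have "G x *v (p + matrix_inv (G x) *v X) = G x *v p + X"
      "matrix_inv (G x) *v (G x *v p + X) = p + matrix_inv (G x) *v X"
      by (simp_all add: matrix_vector_right_distrib matrix_vector_mul_assoc inv)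
    then show ?thesis by (metis matrix_vector_mult_0_right)
  qed
  also have "\<dots> \<longleftrightarrow> (\<forall>l. (\<Sum>i\<in>UNIV. G x $ l $ i * p $ i) +
      (\<Sum>j\<in>UNIV. \<Sum>k\<in>UNIV. (?T j l k - ?T l j k / 2) * S j k) = 0)"
    by (simp add: vec_eq_iff matrix_vector_mult_def X_def)
  finally show ?thesis .
qed

text \<open>The identity behind the holomorphy of the Hopf differential: M is the metric, T its
  derivative, w the combination du/ds - \<i> du/dt, and p the Laplacian of u. Substituting the
  lowered equation for M p leaves cubic sums that cancel by the symmetry of T.\<close>

lemma hopf_algebra:
  fixes T :: "'n::finite \<Rightarrow> 'n \<Rightarrow> 'n \<Rightarrow> real" and w :: "'n \<Rightarrow> complex" and p :: "'n \<Rightarrow> real" and M :: "'n \<Rightarrow> 'n \<Rightarrow> real"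
  assumes T: "\<And>l i j. T l i j = T l j i"
    and eq: "\<And>l. (\<Sum>i\<in>UNIV. M l i * p i) +
      (\<Sum>j\<in>UNIV. \<Sum>k\<in>UNIV. (T j l k - T l j k / 2) * Re (w j * cnj (w k))) = 0"
  shows "(\<Sum>i\<in>UNIV. \<Sum>j\<in>UNIV. (\<Sum>l\<in>UNIV. T l i j * cnj (w l)) * w i * w j) +
    2 * (\<Sum>l\<in>UNIV. \<Sum>i\<in>UNIV. M l i * p i * w l) = 0"
proof -
  \<comment> \<open>In P the conjugate sits on a matrix index of T, in Q on the differentiation
    index. P enters with the weights 1/2, -1/4, -1/4 and disappears.\<close>
  define P where "P = (\<Sum>l\<in>UNIV. \<Sum>j\<in>UNIV. \<Sum>k\<in>UNIV. T l j k * w l * w j * cnj (w k))"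
  define Q where "Q = (\<Sum>l\<in>UNIV. \<Sum>j\<in>UNIV. \<Sum>k\<in>UNIV. T l j k * cnj (w l) * w j * w k)"
  have re: "of_real (Re (w j * cnj (w k))) = (w j * cnj (w k) + cnj (w j) * w k) / 2" for j k
    by (simp add: complex_eq_iff)
  have "(\<Sum>l\<in>UNIV. \<Sum>i\<in>UNIV. of_real (M l i) * of_real (p i) * w l) =
      (\<Sum>l\<in>UNIV. of_real (\<Sum>i\<in>UNIV. M l i * p i) * w l)"
    by (simp add: sum_distrib_right)
  also have "\<dots> = (\<Sum>l\<in>UNIV. of_real (- (\<Sum>j\<in>UNIV. \<Sum>k\<in>UNIV. (T j l k - T l j k / 2) * Re (w j * cnj (w k)))) * w l)"
    by (intro sum.cong refl arg_cong2[of _ _ _ _ "(*)"] arg_cong[of _ _ of_real]) (use eq in \<open>simp add: eq_neg_iff_add_eq_0\<close>)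
  also have "\<dots> = - (\<Sum>l\<in>UNIV. \<Sum>j\<in>UNIV. \<Sum>k\<in>UNIV. (of_real (T j l k) - of_real (T l j k) / 2) * ((w j * cnj (w k) + cnj (w j) * w k) / 2) * w l)"
    by (simp only: re of_real_minus of_real_sum of_real_mult of_real_diff of_real_divide of_real_numeral
        sum_distrib_right sum_negf mult_minus_left)
  also have "\<dots> = - ((\<Sum>l\<in>UNIV. \<Sum>j\<in>UNIV. \<Sum>k\<in>UNIV. T j l k * w j * w l * cnj (w k)) / 2
      + (\<Sum>l\<in>UNIV. \<Sum>j\<in>UNIV. \<Sum>k\<in>UNIV. T j l k * cnj (w j) * w l * w k) / 2
      - (\<Sum>l\<in>UNIV. \<Sum>j\<in>UNIV. \<Sum>k\<in>UNIV. T l j k * w l * w j * cnj (w k)) / 4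
      - (\<Sum>l\<in>UNIV. \<Sum>j\<in>UNIV. \<Sum>k\<in>UNIV. T l j k * w l * w k * cnj (w j)) / 4)"
    by (simp only: sum_divide_distrib sum.distrib[symmetric] sum_subtractf[symmetric])
      (intro arg_cong[of _ _ uminus] sum.cong refl, simp add: field_simps)
  also have "(\<Sum>l\<in>UNIV. \<Sum>j\<in>UNIV. \<Sum>k\<in>UNIV. T j l k * w j * w l * cnj (w k)) = P"
    unfolding P_def by (rule sum.swap)
  also have "(\<Sum>l\<in>UNIV. \<Sum>j\<in>UNIV. \<Sum>k\<in>UNIV. T j l k * cnj (w j) * w l * w k) = Q"
    unfolding Q_def by (rule sum.swap)
  also have "(\<Sum>l\<in>UNIV. \<Sum>j\<in>UNIV. \<Sum>k\<in>UNIV. T l j k * w l * w j * cnj (w k)) = P"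
    by (simp add: P_def)
  also have "(\<Sum>l\<in>UNIV. \<Sum>j\<in>UNIV. \<Sum>k\<in>UNIV. T l j k * w l * w k * cnj (w j)) = P"
    unfolding P_def by (rule sum.cong[OF refl], subst sum.swap) (simp add: T)
  finally have "(\<Sum>l\<in>UNIV. \<Sum>i\<in>UNIV. of_real (M l i) * of_real (p i) * w l) = - Q / 2" by simp
  moreover have "(\<Sum>i\<in>UNIV. \<Sum>j\<in>UNIV. (\<Sum>l\<in>UNIV. T l i j * cnj (w l)) * w i * w j) = Q"
  proof -
    have "(\<Sum>i\<in>UNIV. \<Sum>j\<in>UNIV. (\<Sum>l\<in>UNIV. T l i j * cnj (w l)) * w i * w j) =
        (\<Sum>i\<in>UNIV. \<Sum>l\<in>UNIV. \<Sum>j\<in>UNIV. T l i j * cnj (w l) * w i * w j)"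
      unfolding sum_distrib_right by (rule sum.cong[OF refl], rule sum.swap)
    also have "\<dots> = Q" unfolding Q_def by (rule sum.swap)
    finally show ?thesis .
  qed
  ultimately show ?thesis by simp
qed

text \<open>
  The Hopf differential \<open>H\<close> is holomorphic on the whole plane and vanishes at infinity, where the
  metric is flat and the map is asymptotic to a conformal linear one.
\<close>

lemma hopf_differential_zero:
  fixes G :: "real ^ 'n \<Rightarrow> real ^ 'n ^ 'n" and u w1 w2 :: "complex \<Rightarrow> real ^ 'n"
  assumes G: "\<And>k i j. Ck_on k UNIV (\<lambda>x. G x $ i $ j)" "\<And>x. transpose (G x) = G x" "\<And>x. det (G x) \<noteq> 0"
    and flat: "\<And>x. norm x \<ge> 2 \<Longrightarrow> G x = G0" and G0: "inner_matrix G0"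
    and u: "\<And>z. norm z < 2 * r \<Longrightarrow> (u has_derivative (\<lambda>v. Re v *\<^sub>R w1 z + Im v *\<^sub>R w2 z)) (at z)"
      "\<And>z. norm z > r \<Longrightarrow> norm (u z) > 2" and r: "r \<ge> 1"
    and w: "\<And>z. \<exists>D1 D2. (w1 has_derivative D1) (at z) \<and> (w2 has_derivative D2) (at z) \<and>
        (\<forall>i. (D1 1 + D2 \<i>) $ i + (\<Sum>j\<in>UNIV. \<Sum>k\<in>UNIV. christoffel_symbol G (u z) i j k *
          (w1 z $ j * w1 z $ k + w2 z $ j * w2 z $ k)) = 0) \<and> D1 \<i> = D2 1"
    and lim: "(w1 \<longlongrightarrow> a) at_infinity" "(w2 \<longlongrightarrow> b) at_infinity"
    and ab: "inner_matrix.ip G0 a b = 0" "inner_matrix.ip G0 a a = inner_matrix.ip G0 b b"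
  shows "w1 z \<bullet> (G (u z) *v w1 z) = w2 z \<bullet> (G (u z) *v w2 z) \<and> w1 z \<bullet> (G (u z) *v w2 z) = 0"
proof -
  interpret inner_matrix G0 by (rule G0)
  \<comment> \<open>Twice the z-derivative of u wherever w1 and w2 are its partial derivatives. In
    the metric at u z, H is then |w1|^2 - |w2|^2 minus 2 \<i> times the inner product of w1 and
    w2.\<close>
  define wc where "wc i z = complex_of_real (w1 z $ i) - \<i> * complex_of_real (w2 z $ i)" for i z
  define H where "H z = (\<Sum>i\<in>UNIV. \<Sum>j\<in>UNIV. complex_of_real (G (u z) $ i $ j) * wc i z * wc j z)" for z
  have quad: "(\<Sum>i\<in>UNIV. \<Sum>j\<in>UNIV. complex_of_real (M $ i $ j) * (of_real (p $ i) - \<i> * of_real (q $ i)) * (of_real (p $ j) - \<i> * of_real (q $ j)))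
      = of_real (p \<bullet> (M *v p) - q \<bullet> (M *v q)) - 2 * \<i> * of_real (p \<bullet> (M *v q))"
    if "transpose M = M" for M :: "real ^ 'n ^ 'n" and p q :: "real ^ 'n"
  proof -
    have bil: "x \<bullet> (M *v y) = (\<Sum>i\<in>UNIV. \<Sum>j\<in>UNIV. M $ i $ j * x $ i * y $ j)" for x y
      by (simp add: inner_vec_def matrix_vector_mult_def sum_distrib_left mult_ac)
    have sym: "(\<Sum>i\<in>UNIV. \<Sum>j\<in>UNIV. M $ i $ j * q $ i * p $ j) = (\<Sum>i\<in>UNIV. \<Sum>j\<in>UNIV. M $ i $ j * p $ i * q $ j)"
      using that by (subst sum.swap) (simp add: transpose_def vec_eq_iff mult_ac)
    have "(\<Sum>i\<in>UNIV. \<Sum>j\<in>UNIV. complex_of_real (M $ i $ j) * (of_real (p $ i) - \<i> * of_real (q $ i)) * (of_real (p $ j) - \<i> * of_real (q $ j)))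
      = of_real ((\<Sum>i\<in>UNIV. \<Sum>j\<in>UNIV. M $ i $ j * p $ i * p $ j) - (\<Sum>i\<in>UNIV. \<Sum>j\<in>UNIV. M $ i $ j * q $ i * q $ j))
        - \<i> * of_real ((\<Sum>i\<in>UNIV. \<Sum>j\<in>UNIV. M $ i $ j * p $ i * q $ j) + (\<Sum>i\<in>UNIV. \<Sum>j\<in>UNIV. M $ i $ j * q $ i * p $ j))"
      by (simp add: sum_subtractf[symmetric] sum.distrib[symmetric] sum_distrib_left)
        (simp add: algebra_simps)
    then show ?thesis unfolding sym bil by simp
  qed
  have dG0: "metric_partial G x l i j = 0" if "norm x > 2" for x l i j
  proof -
    have "open {x :: real ^ 'n. norm x > 2}" by (intro open_Collect_less continuous_intros)
    then have "frechet_derivative (\<lambda>y. G y $ i $ j) (at x) = frechet_derivative (\<lambda>y. G0 $ i $ j) (at x)"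
      by (rule frechet_derivative_cong_open) (use that flat in auto)
    then show ?thesis by (simp add: metric_partial_def frechet_derivative_const)
  qed
  have Tsym: "metric_partial G x l i j = metric_partial G x l j i" for x l i j
    by (rule metric_partial_sym[of UNIV]) (auto simp: G)
  \<comment> \<open>For norm z < 2 r this is the chain rule; for norm z > r the image lies in the
    flat region and both sides vanish. Since these cases cover the plane, w1 and w2 may differ from
    the derivatives of u far out.\<close>
  have Gu: "((\<lambda>z. G (u z) $ i $ j) has_derivative
      (\<lambda>v. \<Sum>l\<in>UNIV. metric_partial G (u z) l i j * (Re v * w1 z $ l + Im v * w2 z $ l))) (at z)" for i j z
  proof (cases "norm z < 2 * r")
    case True
    have dG: "((\<lambda>x. G x $ i $ j) has_derivative frechet_derivative (\<lambda>x. G x $ i $ j) (at (u z))) (at (u z))"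
      by (rule Ck_on_SucD[OF G(1)]) simp
    then have lin: "linear (frechet_derivative (\<lambda>x. G x $ i $ j) (at (u z)))"
      by (simp add: has_derivative_def bounded_linear.linear)
    have "frechet_derivative (\<lambda>x. G x $ i $ j) (at (u z)) v = (\<Sum>l\<in>UNIV. metric_partial G (u z) l i j * v $ l)" for v
    proof -
      have "frechet_derivative (\<lambda>x. G x $ i $ j) (at (u z)) v =
          frechet_derivative (\<lambda>x. G x $ i $ j) (at (u z)) (\<Sum>l\<in>UNIV. v $ l *\<^sub>R axis l 1)"
        by (simp add: basis_expansion scalar_mult_eq_scaleR[symmetric])
      then show ?thesis by (simp add: linear_sum[OF lin] linear_scale[OF lin] metric_partial_def mult.commute)
    qed
    then show ?thesis using has_derivative_compose[OF u(1)[OF True] dG] by simp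
  next
    case False
    then have z: "norm z > r" using r by simp
    have "open {z :: complex. norm z > r}" by (intro open_Collect_less continuous_intros)
    then have "((\<lambda>z. G (u z) $ i $ j) has_derivative (\<lambda>_. 0)) (at z)"
      by (rule has_derivative_transform_within_open[rotated, of _ _ "\<lambda>_. G0 $ i $ j"])
        (use z u(2) flat in \<open>auto simp: less_imp_le\<close>)
    then show ?thesis using dG0[OF u(2)[OF z]] by simp
  qed
  have hol: "H field_differentiable (at z)" for z
  proof -
    obtain D1 D2 where D: "(w1 has_derivative D1) (at z)" "(w2 has_derivative D2) (at z)"
      "\<And>i. (D1 1 + D2 \<i>) $ i + (\<Sum>j\<in>UNIV. \<Sum>k\<in>UNIV. christoffel_symbol G (u z) i j k *
          (w1 z $ j * w1 z $ k + w2 z $ j * w2 z $ k)) = 0" "D1 \<i> = D2 1"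
      using w[of z] by blast
    let ?T = "metric_partial G (u z)"
    define p where "p = D1 1 + D2 \<i>"
    define dw where "dw i v = complex_of_real (D1 v $ i) - \<i> * complex_of_real (D2 v $ i)" for i v
    have dwc: "(wc i has_derivative dw i) (at z)" for i
      unfolding wc_def dw_def
      by (intro has_derivative_diff has_derivative_of_real has_derivative_mult_right
          bounded_linear.has_derivative[OF bounded_linear_vec_nth] D)
    define DH where "DH v = (\<Sum>i\<in>UNIV. \<Sum>j\<in>UNIV. of_real (G (u z) $ i $ j) * wc i z * dw j v +
        (of_real (G (u z) $ i $ j) * dw i v + of_real (\<Sum>l\<in>UNIV. ?T l i j * (Re v * w1 z $ l + Im v * w2 z $ l)) * wc i z) * wc j z)" for v
    have dH: "(H has_derivative DH) (at z)"
      unfolding H_def DH_def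
      by (intro has_derivative_sum has_derivative_mult has_derivative_of_real Gu dwc)
    have lin: "linear DH" using dH by (simp add: has_derivative_def bounded_linear.linear)
    have Gs: "G (u z) $ i $ j = G (u z) $ j $ i" for i j
      using G(2)[of "u z"] by (simp add: transpose_def vec_eq_iff)
    have dwi: "dw i 1 + \<i> * dw i \<i> = of_real (p $ i)" for i
      using D(4) by (simp add: dw_def p_def algebra_simps)
    have cw: "of_real (\<Sum>l\<in>UNIV. ?T l i j * (Re 1 * w1 z $ l + Im 1 * w2 z $ l)) +
        \<i> * of_real (\<Sum>l\<in>UNIV. ?T l i j * (Re \<i> * w1 z $ l + Im \<i> * w2 z $ l)) = (\<Sum>l\<in>UNIV. ?T l i j * cnj (wc l z))" for i j
      by (simp add: wc_def sum_distrib_left sum.distrib[symmetric] algebra_simps)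
    have "DH 1 + \<i> * DH \<i> = (\<Sum>i\<in>UNIV. \<Sum>j\<in>UNIV. of_real (G (u z) $ i $ j) * wc i z * (dw j 1 + \<i> * dw j \<i>)) +
        (\<Sum>i\<in>UNIV. \<Sum>j\<in>UNIV. of_real (G (u z) $ i $ j) * (dw i 1 + \<i> * dw i \<i>) * wc j z) +
        (\<Sum>i\<in>UNIV. \<Sum>j\<in>UNIV. (of_real (\<Sum>l\<in>UNIV. ?T l i j * (Re 1 * w1 z $ l + Im 1 * w2 z $ l)) +
          \<i> * of_real (\<Sum>l\<in>UNIV. ?T l i j * (Re \<i> * w1 z $ l + Im \<i> * w2 z $ l))) * wc i z * wc j z)"
      unfolding DH_def sum_distrib_left sum.distrib[symmetric]
      by (intro sum.cong refl) (simp only: distrib_left distrib_right mult.assoc mult.left_commute[of \<i>] add_ac)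
    also have "\<dots> = (\<Sum>i\<in>UNIV. \<Sum>j\<in>UNIV. of_real (G (u z) $ i $ j) * wc i z * of_real (p $ j)) +
        (\<Sum>i\<in>UNIV. \<Sum>j\<in>UNIV. of_real (G (u z) $ i $ j) * of_real (p $ i) * wc j z) +
        (\<Sum>i\<in>UNIV. \<Sum>j\<in>UNIV. (\<Sum>l\<in>UNIV. ?T l i j * cnj (wc l z)) * wc i z * wc j z)"
      by (simp only: dwi cw)
    also have "(\<Sum>i\<in>UNIV. \<Sum>j\<in>UNIV. of_real (G (u z) $ i $ j) * of_real (p $ i) * wc j z) =
        (\<Sum>i\<in>UNIV. \<Sum>j\<in>UNIV. of_real (G (u z) $ i $ j) * of_real (p $ j) * wc i z)"
      by (subst sum.swap) (simp add: Gs)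
    also have "(\<Sum>i\<in>UNIV. \<Sum>j\<in>UNIV. of_real (G (u z) $ i $ j) * wc i z * of_real (p $ j)) =
        (\<Sum>i\<in>UNIV. \<Sum>j\<in>UNIV. of_real (G (u z) $ i $ j) * of_real (p $ j) * wc i z)"
      by (simp add: mult_ac)
    also have "(\<Sum>i\<in>UNIV. \<Sum>j\<in>UNIV. of_real (G (u z) $ i $ j) * of_real (p $ j) * wc i z) +
        (\<Sum>i\<in>UNIV. \<Sum>j\<in>UNIV. of_real (G (u z) $ i $ j) * of_real (p $ j) * wc i z) +
        (\<Sum>i\<in>UNIV. \<Sum>j\<in>UNIV. (\<Sum>l\<in>UNIV. ?T l i j * cnj (wc l z)) * wc i z * wc j z) = 0"
    proof -
      let ?S = "\<lambda>j k. Re (wc j z * cnj (wc k z))"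
      have S: "?S j k = w1 z $ j * w1 z $ k + w2 z $ j * w2 z $ k" for j k by (simp add: wc_def)
      have "\<forall>i. p $ i + (\<Sum>j\<in>UNIV. \<Sum>k\<in>UNIV. christoffel_symbol G (u z) i j k * ?S j k) = 0"
        using D(3) unfolding p_def S by blast
      then have "\<forall>l. (\<Sum>i\<in>UNIV. G (u z) $ l $ i * p $ i) +
          (\<Sum>j\<in>UNIV. \<Sum>k\<in>UNIV. (?T j l k - ?T l j k / 2) * ?S j k) = 0"
        by (subst (asm) christoffel_lower) (auto simp: G S mult.commute)
      from hopf_algebra[of ?T "\<lambda>l i. G (u z) $ l $ i" "\<lambda>i. p $ i" "\<lambda>i. wc i z", OF Tsym spec[OF this]]
      show ?thesis by (simp add: add.commute)
    qed
    \<comment> \<open>This is the Cauchy-Riemann equation, in the form DH 1 + \<i> DH \<i> =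
      0.\<close>
    finally have "DH \<i> = \<i> * DH 1"
      by (metis (no_types, lifting) add_eq_0_iff i_squared mult.assoc mult_minus1 mult_minus_right neg_equal_iff_equal)
    then have "DH v = DH 1 * v" for v
      using linear_complex_decomp[OF lin, of v] by (simp add: complex_eq_iff)
    then have "DH = (*) (DH 1)" by blast
    with dH have "(H has_field_derivative DH 1) (at z)" by (simp add: has_field_derivative_def)
    then show ?thesis by (auto simp: field_differentiable_def)
  qed
  \<comment> \<open>Beyond radius r the metric is G0, so H tends to the quadratic expression in the
    limits a and b, which is zero for a conformal pair.\<close>
  have "((\<lambda>z. \<Sum>i\<in>UNIV. \<Sum>j\<in>UNIV. complex_of_real (G0 $ i $ j) * wc i z * wc j z) \<longlongrightarrow>
      (\<Sum>i\<in>UNIV. \<Sum>j\<in>UNIV. complex_of_real (G0 $ i $ j) * (of_real (a $ i) - \<i> * of_real (b $ i)) * (of_real (a $ j) - \<i> * of_real (b $ j)))) at_infinity"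
    unfolding wc_def by (intro tendsto_intros lim)
  also have "(\<Sum>i\<in>UNIV. \<Sum>j\<in>UNIV. complex_of_real (G0 $ i $ j) * (of_real (a $ i) - \<i> * of_real (b $ i)) * (of_real (a $ j) - \<i> * of_real (b $ j))) = 0"
    unfolding quad[OF G0_sym] using ab by (simp add: ip_def)
  finally have "(H \<longlongrightarrow> 0) at_infinity"
  proof (rule Lim_transform_eventually)
    show "\<forall>\<^sub>F z in at_infinity. (\<Sum>i\<in>UNIV. \<Sum>j\<in>UNIV. complex_of_real (G0 $ i $ j) * wc i z * wc j z) = H z"
      unfolding eventually_at_infinity H_def
      using u(2) flat by (intro exI[of _ "r + 1"]) (auto simp: less_imp_le)
  qed
  moreover have "H holomorphic_on UNIV" using hol by (auto simp: holomorphic_on_def)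
  ultimately have "H z = 0" by (intro Liouville_weak_0)
  then have "of_real (w1 z \<bullet> (G (u z) *v w1 z) - w2 z \<bullet> (G (u z) *v w2 z)) - 2 * \<i> * of_real (w1 z \<bullet> (G (u z) *v w2 z)) = (0 :: complex)"
    unfolding H_def wc_def quad[OF G(2)] .
  then show ?thesis by (auto simp: complex_eq_iff)
qed

section \<open>Small conformal harmonic discs in coordinates\<close>

definition laplacian :: "(complex \<Rightarrow> 'e::real_normed_vector) \<Rightarrow> complex \<Rightarrow> 'e" where
  "laplacian u z = frechet_derivative (\<lambda>z. frechet_derivative u (at z) 1) (at z) 1 +
     frechet_derivative (\<lambda>z. frechet_derivative u (at z) \<i>) (at z) \<i>"

text \<open>Four times the complex equation, in real partial derivatives: the imaginary part of the
  complex quadratic term cancels when the Christoffel symbols are symmetric in j and k.\<close>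

definition harmonic_at :: "(real ^ 'n \<Rightarrow> real ^ 'n ^ 'n) \<Rightarrow> (complex \<Rightarrow> real ^ 'n) \<Rightarrow> complex \<Rightarrow> bool" where
  "harmonic_at G u z \<longleftrightarrow> (\<forall>i. laplacian u z $ i + (\<Sum>j\<in>UNIV. \<Sum>k\<in>UNIV. christoffel_symbol G (u z) i j k *
     (frechet_derivative u (at z) 1 $ j * frechet_derivative u (at z) 1 $ k +
      frechet_derivative u (at z) \<i> $ j * frechet_derivative u (at z) \<i> $ k)) = 0)"

text \<open>For a positive definite G the two derivatives have equal length and are orthogonal, so a
  nonzero first derivative makes the differential injective.\<close>

definition conformal_immersive_at :: "(real ^ 'n \<Rightarrow> real ^ 'n ^ 'n) \<Rightarrow> (complex \<Rightarrow> real ^ 'n) \<Rightarrow> complex \<Rightarrow> bool" where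
  "conformal_immersive_at G u z \<longleftrightarrow>
     frechet_derivative u (at z) 1 \<bullet> (G (u z) *v frechet_derivative u (at z) 1) =
       frechet_derivative u (at z) \<i> \<bullet> (G (u z) *v frechet_derivative u (at z) \<i>) \<and>
     frechet_derivative u (at z) 1 \<bullet> (G (u z) *v frechet_derivative u (at z) \<i>) = 0 \<and>
     frechet_derivative u (at z) 1 \<noteq> 0"

lemma has_derivative_partial_snd:
  assumes "(f has_derivative D) (at (e, U))"
  shows "((\<lambda>U. f (e, U)) has_derivative (\<lambda>v. D (0, v))) (at U)"
proof -
  have "((\<lambda>U. (e, U)) has_derivative (\<lambda>v. (0, v))) (at U)" by (auto intro!: derivative_eq_intros)
  from has_derivative_compose[OF this assms] show ?thesis .
qed

text \<open>On a compact set f is uniformly continuous and it vanishes at e = 0; for norm U > R it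
  vanishes for every e. Hence the smallness is uniform over all U.\<close>

lemma small_near_zero_section:
  fixes f :: "real \<times> 'u::euclidean_space \<Rightarrow> 'e::real_normed_vector"
  assumes f: "continuous_on ({-e0<..<e0} \<times> UNIV) f" and e0: "e0 > 0" and zero: "\<And>U. f (0, U) = 0"
    and supp: "\<And>e U. \<bar>e\<bar> < e0 \<Longrightarrow> norm U > R \<Longrightarrow> f (e, U) = 0" and \<eta>: "\<eta> > 0"
  obtains e1 where "0 < e1" "e1 < e0" "\<And>e U. \<bar>e\<bar> \<le> e1 \<Longrightarrow> norm (f (e, U)) \<le> \<eta>"
proof -
  let ?K = "{-e0/2..e0/2} \<times> cball (0 :: 'u) R"
  have "continuous_on ?K f" using e0 by (intro continuous_on_subset[OF f]) auto
  then have "uniformly_continuous_on ?K f" by (intro compact_uniformly_continuous compact_Times) auto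
  then obtain d where d: "d > 0" "\<And>p q. p \<in> ?K \<Longrightarrow> q \<in> ?K \<Longrightarrow> dist q p < d \<Longrightarrow> dist (f q) (f p) < \<eta>"
    using \<eta> unfolding uniformly_continuous_on_def by blast
  define e1 where "e1 = min (e0 / 2) (d / 2)"
  have e1: "0 < e1" "e1 < e0" "e1 \<le> e0 / 2" "e1 < d" using e0 d(1) by (auto simp: e1_def)
  have "norm (f (e, U)) \<le> \<eta>" if e: "\<bar>e\<bar> \<le> e1" for e U
  proof (cases "norm U \<le> R")
    case True
    have "dist (f (e, U)) (f (0, U)) < \<eta>"
      by (rule d(2)) (use True e e1 e0 in \<open>auto simp: dist_Pair_Pair dist_norm\<close>)
    then show ?thesis by (simp add: zero)
  next
    case False
    then show ?thesis using supp[of e U] e e1 \<eta> by simp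
  qed
  then show ?thesis using that e1 by blast
qed

section \<open>The rescaled metric and its harmonic map equation\<close>

locale local_metric =
  fixes G :: "real ^ 'n \<Rightarrow> real ^ 'n ^ 'n" and x0 :: "real ^ 'n" and \<rho>0 :: real
  assumes G_smooth: "Ck_on k (ball x0 \<rho>0) (\<lambda>x. G x $ i $ j)"
    and G_sym: "x \<in> ball x0 \<rho>0 \<Longrightarrow> transpose (G x) = G x"
    and G_pos: "x \<in> ball x0 \<rho>0 \<Longrightarrow> v \<noteq> 0 \<Longrightarrow> v \<bullet> (G x *v v) > 0"
    and radius_pos: "\<rho>0 > 0"
begin

text \<open>The cutoff lives on norm y \<le> 2. The divisor 3 keeps the image of the open ball of
  radius 3 inside the domain, so that this ball overlaps with the flat region in an open
  set.\<close>

definition scale_max :: real where "scale_max = \<rho>0 / 3"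

lemma scale_max_pos: "scale_max > 0"
  using radius_pos by (simp add: scale_max_def)

text \<open>
  For small \<open>e\<close> the harmonic map equation of this metric is a small perturbation of the Laplace
  equation, and on the unit ball it is the one of the metric \<open>G\<close> seen through \<open>y \<mapsto> x0 + e y\<close>.
\<close>

definition scaled :: "real \<Rightarrow> real ^ 'n \<Rightarrow> real ^ 'n ^ 'n" where
  "scaled e y = G x0 + bump y *\<^sub>R (G (x0 + e *\<^sub>R y) - G x0)"

lemma in_ball_scaled: "\<bar>e\<bar> < scale_max \<Longrightarrow> norm y < 3 \<Longrightarrow> x0 + e *\<^sub>R y \<in> ball x0 \<rho>0"
proof -
  assume e: "\<bar>e\<bar> < scale_max" and y: "norm y < 3"
  have "\<bar>e\<bar> * norm y \<le> \<bar>e\<bar> * 3" using y by (intro mult_left_mono) auto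
  then show ?thesis using e by (simp add: dist_norm scale_max_def)
qed

lemma scaled_flat: "norm y \<ge> 2 \<Longrightarrow> scaled e y = G x0"
  by (simp add: scaled_def bump_eq_0)

lemma scaled_inner: "norm y \<le> 1 \<Longrightarrow> scaled e y = G (x0 + e *\<^sub>R y)"
  by (simp add: scaled_def bump_eq_1)

lemma scaled_zero: "scaled 0 y = G x0"
  by (simp add: scaled_def)

text \<open>Smoothness is joint in e and y because smallness for small e will come from continuity
  at e = 0. The open sets norm y < 3 and norm y > 2 cover everything, and on the second the metric
  is constant.\<close>

lemma scaled_smooth: "Ck_on k ({-scale_max<..<scale_max} \<times> UNIV) (\<lambda>p. scaled (fst p) (snd p) $ i $ j)"
proof (rule Ck_on_local)
  fix p :: "real \<times> (real ^ 'n)" assume p: "p \<in> {-scale_max<..<scale_max} \<times> UNIV"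
  let ?I = "{-scale_max<..<scale_max}"
  show "\<exists>T. open T \<and> p \<in> T \<and> Ck_on k T (\<lambda>p. scaled (fst p) (snd p) $ i $ j)"
  proof (cases "norm (snd p) < 3")
    case True
    let ?T = "?I \<times> ball (0 :: real ^ 'n) 3"
    have T: "open ?T" by (intro open_Times) auto
    have fs: "Ck_on k ?T fst" "Ck_on k ?T snd"
      by (auto intro: Ck_on_bounded_linear bounded_linear_fst bounded_linear_snd)
    have "Ck_on k ?T (\<lambda>p. G (x0 + fst p *\<^sub>R snd p) $ i $ j)"
    proof (rule Ck_on_compose[where T = "ball x0 \<rho>0" and g = "\<lambda>x. G x $ i $ j"])
      show "Ck_on k ?T (\<lambda>p. x0 + fst p *\<^sub>R snd p)" by (intro Ck_on_add T Ck_on_const Ck_on_scaleR fs)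
      show "x0 + fst p *\<^sub>R snd p \<in> ball x0 \<rho>0" if "p \<in> ?T" for p
        by (rule in_ball_scaled) (use that in auto)
    qed (use T G_smooth in auto)
    moreover have "Ck_on k ?T (\<lambda>p. bump (snd p))"
      by (rule Ck_on_compose[OF T open_UNIV fs(2) Ck_on_bump]) auto
    ultimately have "Ck_on k ?T (\<lambda>p. G x0 $ i $ j + bump (snd p) * (G (x0 + fst p *\<^sub>R snd p) $ i $ j - G x0 $ i $ j))"
      by (intro Ck_on_add Ck_on_mult Ck_on_diff T Ck_on_const)
    then show ?thesis using T p True by (intro exI[of _ ?T]) (auto simp: scaled_def)
  next
    case False
    let ?T = "?I \<times> {y :: real ^ 'n. norm y > 2}"
    have T: "open ?T" by (intro open_Times open_Collect_less continuous_intros)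
    have "Ck_on k ?T (\<lambda>p. scaled (fst p) (snd p) $ i $ j)"
      by (subst Ck_on_cong[OF T, of _ "\<lambda>_. G x0 $ i $ j"]) (auto simp: scaled_flat Ck_on_const)
    then show ?thesis using T p False by (intro exI[of _ ?T]) auto
  qed
qed

lemma scaled_sym: "\<bar>e\<bar> < scale_max \<Longrightarrow> transpose (scaled e y) = scaled e y"
proof (cases "norm y < 3")
  case True
  assume e: "\<bar>e\<bar> < scale_max"
  have "G x $ i $ j = G x $ j $ i" if "x \<in> ball x0 \<rho>0" for x i j
    using G_sym[OF that] by (simp add: transpose_def vec_eq_iff)
  then show ?thesis using in_ball_scaled[OF e True] radius_pos by (simp add: scaled_def transpose_def vec_eq_iff)
next
  case False
  then show ?thesis using G_sym[of x0] radius_pos by (simp add: scaled_flat)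
qed

text \<open>For norm y < 3 the matrix is a convex combination of two positive definite ones, and
  beyond that it is G x0.\<close>

lemma scaled_pos: "\<bar>e\<bar> < scale_max \<Longrightarrow> v \<noteq> 0 \<Longrightarrow> v \<bullet> (scaled e y *v v) > 0"
proof -
  assume e: "\<bar>e\<bar> < scale_max" and v: "v \<noteq> 0"
  have p0: "v \<bullet> (G x0 *v v) > 0" using G_pos[of x0] v radius_pos by simp
  show ?thesis
  proof (cases "norm y < 3")
    case True
    have p1: "v \<bullet> (G (x0 + e *\<^sub>R y) *v v) > 0" by (rule G_pos[OF in_ball_scaled[OF e True] v])
    have sv: "(c *\<^sub>R A) *v v = c *\<^sub>R (A *v v)" for c :: real and A :: "real ^ 'n ^ 'n"
      by (simp add: vec_eq_iff matrix_vector_mult_def sum_distrib_left mult.assoc)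
    have "v \<bullet> (scaled e y *v v) = (1 - bump y) * (v \<bullet> (G x0 *v v)) + bump y * (v \<bullet> (G (x0 + e *\<^sub>R y) *v v))"
      by (simp add: scaled_def matrix_vector_mult_add_rdistrib matrix_vector_mult_diff_rdistrib sv inner_add_right
          inner_diff_right algebra_simps)
    also have "\<dots> > 0"
    proof (cases "bump y = 0")
      case False
      then have "bump y > 0" using bump_range(1)[of y] by simp
      then show ?thesis using bump_range(2)[of y] p0 p1 by (intro add_nonneg_pos mult_pos_pos mult_nonneg_nonneg) auto
    qed (use p0 in simp)
    finally show ?thesis .
  next
    case False
    then show ?thesis using p0 by (simp add: scaled_flat)
  qed
qed

lemma scaled_smooth_section:
  assumes "\<bar>e\<bar> < scale_max"
  shows "Ck_on k UNIV (\<lambda>y. scaled e y $ i $ j)"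
proof -
  have "Ck_on k UNIV (\<lambda>y. (\<lambda>p. scaled (fst p) (snd p) $ i $ j) (e, y))"
    by (rule Ck_on_compose[where T = "{-scale_max<..<scale_max} \<times> UNIV"])
      (use assms in \<open>auto intro!: open_Times scaled_smooth Ck_on_Pair Ck_on_const Ck_on_id\<close>)
  then show ?thesis by simp
qed

lemma scaled_partial:
  assumes "\<bar>e\<bar> < scale_max"
  shows "metric_partial (scaled e) y l i j =
    frechet_derivative (\<lambda>p. scaled (fst p) (snd p) $ i $ j) (at (e, y)) (0, axis l 1)"
proof -
  let ?f = "\<lambda>p. scaled (fst p) (snd p) $ i $ j"
  have "(?f has_derivative frechet_derivative ?f (at (e, y))) (at (e, y))"
    by (rule Ck_on_SucD[OF scaled_smooth]) (use assms in auto)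
  from has_derivative_partial_snd[OF this]
  show ?thesis by (simp add: metric_partial_def frechet_derivative_eqI)
qed

lemma scaled_christoffel_smooth:
  "Ck_on k ({-scale_max<..<scale_max} \<times> UNIV) (\<lambda>p. christoffel_symbol (scaled (fst p)) (snd p) i j m)"
proof -
  let ?S = "{-scale_max<..<scale_max} \<times> (UNIV :: (real ^ 'n) set)"
  have S: "open ?S" by (intro open_Times) auto
  have d: "Ck_on k ?S (\<lambda>p. metric_partial (scaled (fst p)) (snd p) l i j)" for l i j
  proof (rule Ck_on_cong[OF S, THEN iffD1, rotated])
    show "Ck_on k ?S (\<lambda>p. frechet_derivative (\<lambda>p. scaled (fst p) (snd p) $ i $ j) (at p) (0, axis l 1))"
      by (rule Ck_on_frechet[OF scaled_smooth])
    show "frechet_derivative (\<lambda>p. scaled (fst p) (snd p) $ i $ j) (at p) (0, axis l 1) =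
        metric_partial (scaled (fst p)) (snd p) l i j" if "p \<in> ?S" for p
      using scaled_partial[of "fst p" "snd p"] that by auto
  qed
  have inv: "Ck_on k ?S (\<lambda>p. matrix_inv (scaled (fst p) (snd p)) $ i $ j)" for i j
    by (rule Ck_on_matrix_inv[OF S scaled_smooth]) (use scaled_pos in \<open>auto intro!: pos_def_det_nz\<close>)
  show ?thesis
    unfolding christoffel_symbol_def divide_inverse
    by (intro Ck_on_mult Ck_on_sum Ck_on_add Ck_on_diff Ck_on_const S d inv)
qed

lemma christoffel_flat: "norm y > 2 \<Longrightarrow> christoffel_symbol (scaled e) y i j k = 0"
  and christoffel_zero: "christoffel_symbol (scaled 0) y i j k = 0"
proof -
  have "metric_partial (scaled 0) y l i j = 0" for l i j
    by (simp add: metric_partial_def scaled_zero frechet_derivative_const)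
  then show "christoffel_symbol (scaled 0) y i j k = 0" by (simp add: christoffel_symbol_def)
  show "christoffel_symbol (scaled e) y i j k = 0" if "norm y > 2"
  proof -
    have "open {x :: real ^ 'n. norm x > 2}" by (intro open_Collect_less continuous_intros)
    then have "frechet_derivative (\<lambda>y. scaled e y $ i $ j) (at y) = frechet_derivative (\<lambda>y. G x0 $ i $ j) (at y)" for i j
      by (rule frechet_derivative_cong_open) (use that scaled_flat in auto)
    then show ?thesis by (simp add: christoffel_symbol_def metric_partial_def frechet_derivative_const)
  qed
qed

text \<open>The substitution y \<mapsto> x0 + e y multiplies the first derivatives of the metric by
  e and leaves its inverse unchanged.\<close>

lemma christoffel_scaled:
  assumes "\<bar>e\<bar> < scale_max" "norm y < 1"
  shows "christoffel_symbol (scaled e) y i j k = e * christoffel_symbol G (x0 + e *\<^sub>R y) i j k"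
proof -
  have "metric_partial (scaled e) y l i j = e * metric_partial G (x0 + e *\<^sub>R y) l i j" for l i j
  proof -
    let ?D = "frechet_derivative (\<lambda>x. G x $ i $ j) (at (x0 + e *\<^sub>R y))"
    have D: "((\<lambda>x. G x $ i $ j) has_derivative ?D) (at (x0 + e *\<^sub>R y))"
      by (rule Ck_on_SucD[OF G_smooth in_ball_scaled]) (use assms in auto)
    have "((\<lambda>y. x0 + e *\<^sub>R y) has_derivative (\<lambda>v. e *\<^sub>R v)) (at y)" by (auto intro!: derivative_eq_intros)
    from has_derivative_compose[OF this D]
    have "((\<lambda>y. G (x0 + e *\<^sub>R y) $ i $ j) has_derivative (\<lambda>v. ?D (e *\<^sub>R v))) (at y)" .
    then have "((\<lambda>y. scaled e y $ i $ j) has_derivative (\<lambda>v. ?D (e *\<^sub>R v))) (at y)"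
      by (rule has_derivative_transform_within_open[where s = "ball 0 1"]) (use assms in \<open>auto simp: scaled_inner\<close>)
    moreover have "linear ?D" using D by (simp add: has_derivative_def bounded_linear.linear)
    ultimately show ?thesis by (simp add: metric_partial_def frechet_derivative_eqI linear_scale)
  qed
  then show ?thesis
    using assms(2)
    by (simp add: christoffel_symbol_def scaled_inner sum_distrib_left algebra_simps)
qed

text \<open>The harmonic map equation solved for the Laplacian, as a function of e and the jet. It
  is quadratic in the derivatives; the cutoff gives it compact support in the jet, and for jets of
  norm at most M it is the genuine term.\<close>

definition rhs :: "real \<Rightarrow> real \<times> 'n jet \<Rightarrow> real ^ 'n" where
  "rhs M p = - (bump ((1 / M) *\<^sub>R snd p) *\<^sub>R (\<chi> i. \<Sum>j\<in>UNIV. \<Sum>k\<in>UNIV.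
     christoffel_symbol (scaled (fst p)) (fst (snd p)) i j k *
       (fst (snd (snd p)) $ j * fst (snd (snd p)) $ k + snd (snd (snd p)) $ j * snd (snd (snd p)) $ k)))"

lemma rhs_smooth: "Ck_on k ({-scale_max<..<scale_max} \<times> UNIV) (rhs M)"
proof -
  let ?S = "{-scale_max<..<scale_max} \<times> (UNIV :: 'n jet set)"
  have S: "open ?S" by (intro open_Times) auto
  have bl: "bounded_linear (\<lambda>p::real \<times> 'n jet. (fst p, fst (snd p)))" "bounded_linear (\<lambda>p::real \<times> 'n jet. (1 / M) *\<^sub>R snd p)"
    "bounded_linear (\<lambda>p::real \<times> 'n jet. fst (snd (snd p)) $ j)" "bounded_linear (\<lambda>p::real \<times> 'n jet. snd (snd (snd p)) $ j)" for j
    by (intro bounded_linear_intros bounded_linear_compose[OF bounded_linear_vec_nth])+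
  have chr: "Ck_on k ?S (\<lambda>p. christoffel_symbol (scaled (fst p)) (fst (snd p)) i j m)" for i j m
    using Ck_on_compose[OF S _ Ck_on_bounded_linear[OF bl(1)] scaled_christoffel_smooth] by (auto simp: open_Times)
  have b: "Ck_on k ?S (\<lambda>p. bump ((1 / M) *\<^sub>R snd p))"
    by (rule Ck_on_compose[OF S open_UNIV Ck_on_bounded_linear[OF bl(2)] Ck_on_bump]) simp
  show ?thesis
    unfolding rhs_def[abs_def]
    by (intro Ck_on_minus Ck_on_scaleR S b Ck_on_vec, simp only: vec_lambda_beta)
      (intro Ck_on_sum Ck_on_mult Ck_on_add S chr Ck_on_bounded_linear bl)
qed

lemma rhs_zero: "rhs M (0, U) = 0"
  by (simp add: rhs_def christoffel_zero vec_eq_iff)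

lemma rhs_support: "M > 0 \<Longrightarrow> norm U > 2 * M \<Longrightarrow> rhs M (e, U) = 0"
  by (simp add: rhs_def bump_eq_0 field_simps)

text \<open>At e = 0 the metric is constant and the right-hand side vanishes identically, and so do
  its derivatives in the jet variables; compactness of the support makes both small for small
  e.\<close>

lemma rhs_small:
  assumes M: "M > 0" and \<eta>: "\<eta> > 0"
  obtains e where "0 < e" "e < scale_max" "\<And>U. norm (rhs M (e, U)) \<le> \<eta>"
    "\<And>U W. norm (frechet_derivative (\<lambda>U. rhs M (e, U)) (at U) W) \<le> \<eta> * norm W"
    "\<And>k. Ck_on k UNIV (\<lambda>U. rhs M (e, U))"
proof -
  let ?S = "{-scale_max<..<scale_max} \<times> (UNIV :: 'n jet set)"
  let ?n = "real DIM('n jet)"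
  have S: "open ?S" by (intro open_Times) auto
  note e0 = scale_max_pos
  have mem: "(e, U) \<in> ?S" if "\<bar>e\<bar> < scale_max" for e U using that by auto
  have der: "(rhs M has_derivative frechet_derivative (rhs M) (at (e, U))) (at (e, U))" if "\<bar>e\<bar> < scale_max" for e U
    by (rule Ck_on_SucD[OF rhs_smooth mem[OF that]])
  have sec: "frechet_derivative (\<lambda>U. rhs M (e, U)) (at U) W = frechet_derivative (rhs M) (at (e, U)) (0, W)"
    if "\<bar>e\<bar> < scale_max" for e U W
    by (simp add: frechet_derivative_eqI[OF has_derivative_partial_snd[OF der[OF that]]])
  have cont: "continuous_on ({-scale_max<..<scale_max} \<times> UNIV) (rhs M)"
    using Ck_on_continuous[OF rhs_smooth] by simp
  obtain e1 where e1: "0 < e1" "e1 < scale_max" "\<And>e U. \<bar>e\<bar> \<le> e1 \<Longrightarrow> norm (rhs M (e, U)) \<le> \<eta>"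
    by (rule small_near_zero_section[OF cont e0 rhs_zero _ \<eta>, of "2 * M"]) (use rhs_support[OF M] in auto)
  have "\<exists>e2>0. \<forall>e U. \<bar>e\<bar> \<le> e2 \<longrightarrow> norm (frechet_derivative (rhs M) (at (e, U)) (0, b)) \<le> \<eta> / ?n" for b
  proof -
    have cont: "continuous_on ({-scale_max<..<scale_max} \<times> UNIV) (\<lambda>p. frechet_derivative (rhs M) (at p) (0, b))"
      using Ck_on_continuous[OF Ck_on_frechet[OF rhs_smooth]] by simp
    have z: "frechet_derivative (rhs M) (at (0, U)) (0, b) = 0" for U
      using sec[of 0 U b] e0 by (simp add: rhs_zero frechet_derivative_const)
    have s: "frechet_derivative (rhs M) (at (e, U)) (0, b) = 0" if "\<bar>e\<bar> < scale_max" "norm U > 2 * M" for e U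
      using sec[OF that(1), of U b] frechet_derivative_zero_outside[OF rhs_support[OF M] that(2)] by simp
    have "\<eta> / ?n > 0" using \<eta> by simp
    from small_near_zero_section[OF cont e0 z s this] show ?thesis by metis
  qed
  then obtain E where E: "\<And>b. E b > 0"
    "\<And>b e U. \<bar>e\<bar> \<le> E b \<Longrightarrow> norm (frechet_derivative (rhs M) (at (e, U)) (0, b)) \<le> \<eta> / ?n" by metis
  define e where "e = min e1 (Min (E ` Basis))"
  have e: "0 < e" "e \<le> e1" "\<And>b. b \<in> Basis \<Longrightarrow> e \<le> E b" using e1(1) E(1) by (auto simp: e_def min_le_iff_disj)
  have ee: "\<bar>e\<bar> < scale_max" using e e1 by simp
  show ?thesis
  proof (rule that[of e])
    show "0 < e" "e < scale_max" using e ee by auto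
    show "norm (rhs M (e, U)) \<le> \<eta>" for U by (rule e1(3)) (use e in simp)
    show "Ck_on k UNIV (\<lambda>U. rhs M (e, U))" for k
      by (rule Ck_on_compose[where T = ?S]) (use S rhs_smooth mem[OF ee] in \<open>auto intro!: Ck_on_Pair Ck_on_const Ck_on_id\<close>)
    show "norm (frechet_derivative (\<lambda>U. rhs M (e, U)) (at U) W) \<le> \<eta> * norm W" for U W
    proof -
      let ?L = "frechet_derivative (\<lambda>U. rhs M (e, U)) (at U)"
      have lin: "linear ?L"
        using has_derivative_partial_snd[OF der[OF ee]] linear_frechet_derivative differentiable_def by blast
      have "?L W = ?L (\<Sum>b\<in>Basis. (W \<bullet> b) *\<^sub>R b)" by (simp add: euclidean_representation)
      also have "\<dots> = (\<Sum>b\<in>Basis. (W \<bullet> b) *\<^sub>R ?L b)" by (simp add: linear_sum[OF lin] linear_scale[OF lin])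
      also have "norm \<dots> \<le> (\<Sum>b\<in>(Basis :: 'n jet set). norm W * (\<eta> / ?n))"
      proof (rule order_trans[OF norm_sum sum_mono])
        fix b :: "'n jet" assume b: "b \<in> Basis"
        have "norm (?L b) \<le> \<eta> / ?n" unfolding sec[OF ee] by (rule E(2)) (use e b in auto)
        then show "norm ((W \<bullet> b) *\<^sub>R ?L b) \<le> norm W * (\<eta> / ?n)"
          unfolding norm_scaleR using Basis_le_norm[OF b, of W] by (intro mult_mono) auto
      qed
      also have "\<dots> = \<eta> * norm W" by simp
      finally show ?thesis .
    qed
  qed
qed

end

lemma frechet_derivative_scaled_disc:
  fixes u :: "complex \<Rightarrow> 'e::real_normed_vector"
  assumes "(u has_derivative D) (at (of_real r * z))"
  shows "((\<lambda>z. p + e *\<^sub>R u (of_real r * z)) has_derivative (\<lambda>v. (e * r) *\<^sub>R D v)) (at z)"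
proof -
  have "((\<lambda>z. of_real r * z) has_derivative (\<lambda>v. of_real r * v)) (at z)" by (auto intro!: derivative_eq_intros)
  from has_derivative_compose[OF this assms]
  have "((\<lambda>z. p + e *\<^sub>R u (of_real r * z)) has_derivative (\<lambda>v. 0 + e *\<^sub>R D (of_real r * v))) (at z)"
    by (intro has_derivative_add has_derivative_const has_derivative_scaleR_right)
  moreover have "linear D" using assms by (simp add: has_derivative_def bounded_linear.linear)
  then have "D (of_real r * v) = r *\<^sub>R D v" for v by (simp add: linear_scale scaleR_conv_of_real[symmetric])
  ultimately show ?thesis by simp
qed

text \<open>Rescaling by e turns the two points into nearby points close to the origin. The plane
  solution through them is restricted to a disc on which it stays in the unit ball, where the
  rescaled metric is the original one. C and \<delta> are uniform because the constants of the plane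
  problem are.\<close>

theorem (in local_metric) coordinate_discs:
  assumes dim: "CARD('n) \<ge> 2"
  obtains C \<delta> where "C > 0" "\<delta> > 0" "\<delta> \<le> \<rho>0"
    "\<And>X Y. X \<in> ball x0 \<delta> \<Longrightarrow> Y \<in> ball x0 \<delta> \<Longrightarrow> \<exists>u s. 0 \<le> s \<and> s \<le> 1/2 \<and> s \<le> C * norm (X - Y) \<and>
       (\<forall>k. Ck_on k unit_disc u) \<and> u ` unit_disc \<subseteq> ball x0 \<rho>0 \<and> u 0 = X \<and> u (of_real s) = Y \<and>
       (\<forall>z\<in>unit_disc. harmonic_at G u z \<and> conformal_immersive_at G u z)"
proof -
  interpret inner_matrix "G x0"
    by unfold_locales (use G_sym[of x0] G_pos[of x0] radius_pos in auto)
  obtain K where K: "K \<ge> 1" "\<And>a b. \<bar>ip a b\<bar> \<le> K * norm a * norm b" using ip_bound by blast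
  obtain l where l: "l > 0" "\<And>a. ip a a \<ge> l * (norm a)\<^sup>2" using ip_coercive by blast
  define N where "N = 1 / sqrt l"
  have N: "N > 0" using l(1) by (simp add: N_def)
  have unit_le: "norm a \<le> N" if "ip a a = 1" for a
  proof -
    have "(norm a)\<^sup>2 \<le> 1 / l" using l(2)[of a] that l(1) by (simp add: field_simps)
    then have "norm a \<le> sqrt (1 / l)" by (rule real_le_rsqrt)
    then show ?thesis by (simp add: N_def real_sqrt_divide)
  qed
  have unit_ge: "norm a \<ge> 1 / sqrt K" if "ip a a = 1" for a
  proof -
    have "1 / K \<le> (norm a)\<^sup>2" using K(2)[of a a] that K(1) by (simp add: field_simps power2_eq_square)
    then have "sqrt (1 / K) \<le> norm a" by (rule real_le_lsqrt[rotated]) simp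
    then show ?thesis by (simp add: real_sqrt_divide)
  qed
  \<comment> \<open>2 \<sigma> is below the lower bound 1 / sqrt K for the norm of an
    \<open>ip\<close>-unit vector, so the first derivative, which stays within 2 \<sigma> of q,
    cannot vanish.\<close>
  define \<sigma> where "\<sigma> = 1 / (4 * sqrt K)"
  have sK: "sqrt K \<ge> 1" using K(1) by simp
  have \<sigma>: "\<sigma> > 0" "\<sigma> \<le> 1/4" "2 * \<sigma> < 1 / sqrt K" using sK by (auto simp: \<sigma>_def field_simps)
  \<comment> \<open>N + 1 bounds each partial derivative, so B bounds the differential. M = 2 + B
    then bounds every jet of the solution whose value has norm at most 2, and the cutoff is inactive
    there.\<close>
  define B where "B = 2 * (N + 1)"
  have B: "B \<ge> 2" using N by (simp add: B_def)
  define M where "M = 2 + B"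
  have M: "M > 0" using B by (simp add: M_def)
  obtain r \<eta> where r: "r \<ge> 1" and \<eta>: "\<eta> > 0" and sol:
    "\<And>F x e b0 h. (\<And>k. Ck_on k UNIV F) \<Longrightarrow> (\<And>U. norm U > 2 * M \<Longrightarrow> F U = 0) \<Longrightarrow> (\<And>U. norm (F U) \<le> \<eta>) \<Longrightarrow>
       (\<And>U W. norm (frechet_derivative F (at U) W) \<le> \<eta> * norm W) \<Longrightarrow> norm x \<le> 1 \<Longrightarrow>
       ip e e = 1 \<Longrightarrow> ip b0 b0 = 1 \<Longrightarrow> ip e b0 = 0 \<Longrightarrow> 0 \<le> h \<Longrightarrow> h \<le> r \<Longrightarrow>
     \<exists>u u1 u2 w1 w2 a b. plane_solution F r \<sigma> u u1 u2 w1 w2 a b \<and>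
       u 0 = x \<and> u (of_real h) = x + h *\<^sub>R e \<and> norm (a - e) \<le> \<sigma> \<and> norm (b - b0) \<le> \<sigma>"
    by (rule plane_solution_exists[OF \<sigma>(1)]) blast
  obtain e where e: "0 < e" "e < scale_max" "\<And>U. norm (rhs M (e, U)) \<le> \<eta>"
    "\<And>U W. norm (frechet_derivative (\<lambda>U. rhs M (e, U)) (at U) W) \<le> \<eta> * norm W"
    "\<And>k. Ck_on k UNIV (\<lambda>U. rhs M (e, U))"
    using rhs_small[OF M \<eta>] by blast
  have ee: "\<bar>e\<bar> < scale_max" using e by simp
  \<comment> \<open>With the derivative bounded by B and the base point of norm below 1/2, the image
    of the disc of radius r1 stays in the unit ball.\<close>
  define r1 where "r1 = 1 / (2 * B)"
  have r1: "0 < r1" "r1 \<le> 1/4" "B * r1 = 1/2" using B by (auto simp: r1_def field_simps)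
  \<comment> \<open>h is at most sqrt K / e times norm (X - Y), and rescaling the disc of radius r1
    to the unit disc divides the parameter by r1.\<close>
  define C where "C = sqrt K / (e * r1)"
  have C: "C > 0" using sK e r1 by (auto simp: C_def intro!: divide_pos_pos)
  \<comment> \<open>The first entry puts x into the ball of radius 1/2; the second gives h \<le> r1
    / 2, hence s \<le> 1/2.\<close>
  define \<delta> where "\<delta> = min (e / 2) (1 / (4 * C))"
  have \<delta>: "\<delta> > 0" "\<delta> \<le> e / 2" "C * \<delta> \<le> 1/4"
  proof -
    show "\<delta> > 0" "\<delta> \<le> e / 2" using e C by (auto simp: \<delta>_def)
    have "\<delta> \<le> 1 / (4 * C)" by (simp add: \<delta>_def)
    then show "C * \<delta> \<le> 1/4" using C by (simp add: field_simps)
  qed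
  have \<delta>\<rho>: "\<delta> \<le> \<rho>0" using \<delta>(2) e(1,2) radius_pos by (simp add: scale_max_def)
  show ?thesis
  proof (rule that[OF C \<delta>(1) \<delta>\<rho>])
    fix X Y assume XY: "X \<in> ball x0 \<delta>" "Y \<in> ball x0 \<delta>"
    define x where "x = (1 / e) *\<^sub>R (X - x0)"
    define d where "d = (1 / e) *\<^sub>R (Y - X)"
    define h where "h = sqrt (ip d d)"
    have Xx: "X = x0 + e *\<^sub>R x" and Yd: "Y = x0 + e *\<^sub>R (x + d)" using e(1) by (simp_all add: x_def d_def scaleR_add_right)
    have nx: "norm x < 1/2"
    proof -
      have "norm (X - x0) < e / 2" using XY(1) \<delta>(2) by (simp add: dist_norm norm_minus_commute)
      moreover have "norm x = norm (X - x0) / e" unfolding x_def norm_scaleR using e(1) by simp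
      ultimately show ?thesis using e(1) by (simp add: divide_less_eq)
    qed
    have dd: "0 \<le> ip d d" using order_trans[OF _ l(2)[of d], of 0] l(1) by simp
    have h: "0 \<le> h" "h \<le> C * norm (X - Y) * r1" "h \<le> r1 / 2"
    proof -
      show "0 \<le> h" using dd by (simp add: h_def)
      have "ip d d \<le> K * (norm d)\<^sup>2" using K(2)[of d d] by (simp add: power2_eq_square)
      then have "h \<le> sqrt (K * (norm d)\<^sup>2)" unfolding h_def by (rule real_sqrt_le_mono)
      also have "\<dots> = sqrt K * norm d" by (simp add: real_sqrt_mult)
      also have "norm d = norm (X - Y) / e" using e(1) by (simp add: d_def norm_minus_commute)
      also have "sqrt K * (norm (X - Y) / e) = C * norm (X - Y) * r1" using r1 by (simp add: C_def)
      finally show *: "h \<le> C * norm (X - Y) * r1" .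
      have "norm (X - Y) \<le> 2 * \<delta>"
        using XY dist_triangle_less_add[of X x0 \<delta> Y \<delta>] by (simp add: dist_norm norm_minus_commute)
      then have "C * norm (X - Y) \<le> C * (2 * \<delta>)" using C by (intro mult_left_mono) auto
      also have "\<dots> \<le> 1/2" using \<delta>(3) by simp
      finally have "C * norm (X - Y) * r1 \<le> 1/2 * r1" using r1 by (intro mult_right_mono) auto
      then show "h \<le> r1 / 2" using * by simp
    qed
    \<comment> \<open>For X = Y the length h is 0 and any unit direction serves.\<close>
    have "\<exists>q. ip q q = 1 \<and> d = h *\<^sub>R q"
    proof (cases "d = 0")
      case True
      obtain v :: "real ^ 'n" where v: "v \<in> Basis" using nonempty_Basis by blast
      then have "v \<noteq> 0" by auto
      then have "ip v v > 0" unfolding ip_def by (rule G0_pos)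
      then have "ip ((1 / sqrt (ip v v)) *\<^sub>R v) ((1 / sqrt (ip v v)) *\<^sub>R v) = 1"
        by (simp add: ip_scaleR_left ip_scaleR_right)
      moreover have "h = 0" using True by (simp add: h_def ip_def)
      ultimately show ?thesis using True by auto
    next
      case False
      then have "ip d d > 0" unfolding ip_def by (rule G0_pos)
      then show ?thesis
        by (intro exI[of _ "(1 / h) *\<^sub>R d"]) (simp add: h_def ip_scaleR_left ip_scaleR_right)
    qed
    then obtain q where q: "ip q q = 1" "d = h *\<^sub>R q" by blast
    obtain b0 where b0: "ip b0 b0 = 1" "ip q b0 = 0" using ip_orthonormal_exists[OF dim q(1)] by blast
    have x1: "norm x \<le> 1" and hr: "h \<le> r" using nx h(3) r1 r by linarith+
    have "\<exists>u u1 u2 w1 w2 a b. plane_solution (\<lambda>U. rhs M (e, U)) r \<sigma> u u1 u2 w1 w2 a b \<and>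
       u 0 = x \<and> u (of_real h) = x + h *\<^sub>R q \<and> norm (a - q) \<le> \<sigma> \<and> norm (b - b0) \<le> \<sigma>"
      by (rule sol[OF e(5) _ e(3,4) x1 q(1) b0 h(1) hr]) (rule rhs_support[OF M])
    then obtain u u1 u2 w1 w2 a b where ps: "plane_solution (\<lambda>U. rhs M (e, U)) r \<sigma> u u1 u2 w1 w2 a b"
      and u0: "u 0 = x" and uh: "u (of_real h) = x + h *\<^sub>R q" and ab: "norm (a - q) \<le> \<sigma>" "norm (b - b0) \<le> \<sigma>"
      by blast
    note ps' = ps[unfolded plane_solution_def]
    have smooth: "Ck_on k UNIV u" "Ck_on k UNIV u1" "Ck_on k UNIV u2" for k using ps' by blast+
    have conf: "ip a b = 0" "ip a a = ip b b" using ps' by blast+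
    have near: "norm (u1 z - a) \<le> \<sigma>" "norm (u2 z - b) \<le> \<sigma>" for z using ps' by blast+
    have far: "norm (u z) > 2" if "norm z > r" for z using ps' that by blast
    have du: "(u has_derivative (\<lambda>v. Re v *\<^sub>R u1 z + Im v *\<^sub>R u2 z)) (at z)" "w1 z = u1 z" "w2 z = u2 z"
      if "norm z < 2 * r" for z using ps' that by blast+
    have dw: "\<exists>D1 D2. (w1 has_derivative D1) (at z) \<and> (w2 has_derivative D2) (at z) \<and>
        D1 1 + D2 \<i> = rhs M (e, (u z, u1 z, u2 z)) \<and> D1 \<i> = D2 1" for z using ps' by blast
    have lim: "(w1 \<longlongrightarrow> a) at_infinity" "(w2 \<longlongrightarrow> b) at_infinity" using ps' by blast+
    have bnd: "norm (u1 z) \<le> N + 1" "norm (u2 z) \<le> N + 1" for z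
    proof -
      have "norm (u1 z) \<le> norm (u1 z - a) + norm (a - q) + norm q"
        using norm_triangle_ineq[of "(u1 z - a) + (a - q)" q] norm_triangle_ineq[of "u1 z - a" "a - q"] by simp
      then show "norm (u1 z) \<le> N + 1" using near(1)[of z] ab(1) unit_le[OF q(1)] \<sigma>(2) by linarith
      have "norm (u2 z) \<le> norm (u2 z - b) + norm (b - b0) + norm b0"
        using norm_triangle_ineq[of "(u2 z - b) + (b - b0)" b0] norm_triangle_ineq[of "u2 z - b" "b - b0"] by simp
      then show "norm (u2 z) \<le> N + 1" using near(2)[of z] ab(2) unit_le[OF b0(1)] \<sigma>(2) by linarith
    qed
    have u1nz: "u1 z \<noteq> 0" for z
    proof
      assume "u1 z = 0"
      then have "norm a \<le> \<sigma>" using near(1)[of z] by simp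
      then have "norm q \<le> 2 * \<sigma>" using ab(1) norm_triangle_ineq[of a "q - a"] by (simp add: norm_minus_commute)
      then show False using unit_ge[OF q(1)] \<sigma>(3) by linarith
    qed
    let ?Ch = "\<lambda>z i j k. christoffel_symbol (scaled e) (u z) i j k"
    \<comment> \<open>The cutoff has no effect along the solution: either the value lies in the flat
      region, where the Christoffel symbols vanish, or the whole jet has norm at most M.\<close>
    have eqF: "rhs M (e, (u z, u1 z, u2 z)) $ i =
        - (\<Sum>j\<in>UNIV. \<Sum>k\<in>UNIV. ?Ch z i j k * (u1 z $ j * u1 z $ k + u2 z $ j * u2 z $ k))" for z i
    proof (cases "norm (u z) > 2")
      case True
      then show ?thesis by (simp add: rhs_def christoffel_flat)
    next
      case False
      have "norm (u z, u1 z, u2 z) \<le> norm (u z) + (norm (u1 z) + norm (u2 z))"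
        by (rule order_trans[OF norm_Pair_le add_left_mono[OF norm_Pair_le]])
      also have "\<dots> \<le> M" using False bnd[of z] by (simp add: M_def B_def)
      finally have "bump ((1 / M) *\<^sub>R (u z, u1 z, u2 z)) = 1" using M by (intro bump_eq_1) (simp del: scaleR_Pair)
      then show ?thesis by (simp add: rhs_def)
    qed
    have conformal: "w1 z \<bullet> (scaled e (u z) *v w1 z) = w2 z \<bullet> (scaled e (u z) *v w2 z) \<and> w1 z \<bullet> (scaled e (u z) *v w2 z) = 0" for z
    proof (rule hopf_differential_zero[where r = r and a = a and b = b])
      show "Ck_on k UNIV (\<lambda>y. scaled e y $ i $ j)" for k i j by (rule scaled_smooth_section[OF ee])
      show "transpose (scaled e y) = scaled e y" for y by (rule scaled_sym[OF ee])
      show "det (scaled e y) \<noteq> 0" for y by (rule pos_def_det_nz) (rule scaled_pos[OF ee])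
      show "scaled e y = G x0" if "norm y \<ge> 2" for y by (rule scaled_flat[OF that])
      show "inner_matrix (G x0)" by (rule inner_matrix_axioms)
      show "(u has_derivative (\<lambda>v. Re v *\<^sub>R w1 z + Im v *\<^sub>R w2 z)) (at z)" if "norm z < 2 * r" for z
        using du[OF that] by simp
      show "norm (u z) > 2" if "norm z > r" for z by (rule far[OF that])
      show "1 \<le> r" by (rule r)
      show "(w1 \<longlongrightarrow> a) at_infinity" "(w2 \<longlongrightarrow> b) at_infinity" by (rule lim)+
      show "ip a b = 0" "ip a a = ip b b" by (rule conf)+
      fix z
      obtain D1 D2 where D: "(w1 has_derivative D1) (at z)" "(w2 has_derivative D2) (at z)"
        "D1 1 + D2 \<i> = rhs M (e, (u z, u1 z, u2 z))" "D1 \<i> = D2 1" using dw[of z] by blast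
      have "(D1 1 + D2 \<i>) $ i + (\<Sum>j\<in>UNIV. \<Sum>k\<in>UNIV. ?Ch z i j k * (w1 z $ j * w1 z $ k + w2 z $ j * w2 z $ k)) = 0" for i
      proof (cases "norm z < 2 * r")
        case True
        then show ?thesis unfolding D(3) using eqF[of z i] du(2,3)[OF True] by simp
      next
        case False
        then have "norm (u z) > 2" using far[of z] r by simp
        then show ?thesis unfolding D(3) by (simp add: eqF christoffel_flat)
      qed
      then show "\<exists>D1 D2. (w1 has_derivative D1) (at z) \<and> (w2 has_derivative D2) (at z) \<and>
        (\<forall>i. (D1 1 + D2 \<i>) $ i + (\<Sum>j\<in>UNIV. \<Sum>k\<in>UNIV. ?Ch z i j k *
          (w1 z $ j * w1 z $ k + w2 z $ j * w2 z $ k)) = 0) \<and> D1 \<i> = D2 1"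
        using D by blast
    qed
    have lap: "frechet_derivative u1 (at z) 1 + frechet_derivative u2 (at z) \<i> = rhs M (e, (u z, u1 z, u2 z))"
      if z: "norm z < 2 * r" for z
    proof -
      obtain D1 D2 where D: "(w1 has_derivative D1) (at z)" "(w2 has_derivative D2) (at z)"
        "D1 1 + D2 \<i> = rhs M (e, (u z, u1 z, u2 z))" using dw[of z] by blast
      have "(u1 has_derivative D1) (at z)" "(u2 has_derivative D2) (at z)"
        using D(1,2) has_derivative_cong_open[of "ball 0 (2 * r)" z w1 u1] has_derivative_cong_open[of "ball 0 (2 * r)" z w2 u2]
          du z by auto
      then show ?thesis using D(3) by (simp add: frechet_derivative_eqI)
    qed
    have small: "norm (u z) < 1" if z: "norm z < r1" for z
    proof -
      have "norm (u z - u 0) \<le> B * norm (z - 0)"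
      proof (rule differentiable_bound[of "ball 0 (2 * r)" u "\<lambda>z v. Re v *\<^sub>R u1 z + Im v *\<^sub>R u2 z"])
        show "(u has_derivative (\<lambda>v. Re v *\<^sub>R u1 y + Im v *\<^sub>R u2 y)) (at y within ball 0 (2 * r))"
          if "y \<in> ball 0 (2 * r)" for y
          by (rule has_derivative_at_withinI[OF du(1)]) (use that in simp)
        show "onorm (\<lambda>v. Re v *\<^sub>R u1 y + Im v *\<^sub>R u2 y) \<le> B" for y
        proof (rule onorm_le)
          fix v
          have "norm (Re v *\<^sub>R u1 y) \<le> norm v * (N + 1)"
            unfolding norm_scaleR by (rule mult_mono[OF abs_Re_le_cmod bnd(1)]) auto
          moreover have "norm (Im v *\<^sub>R u2 y) \<le> norm v * (N + 1)"
            unfolding norm_scaleR by (rule mult_mono[OF abs_Im_le_cmod bnd(2)]) auto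
          ultimately
          show "norm (Re v *\<^sub>R u1 y + Im v *\<^sub>R u2 y) \<le> B * norm v"
            by (intro norm_triangle_le) (simp add: B_def algebra_simps)
        qed
        have "norm z < 2 * r" using z r1 r by linarith
        then show "z \<in> ball 0 (2 * r)" by simp
        show "0 \<in> ball (0::complex) (2 * r)" using r by simp
      qed simp
      also have "\<dots> \<le> B * r1" using z B by (intro mult_left_mono) auto
      finally have "norm (u z - x) \<le> 1/2" using r1(3) u0 by simp
      then show ?thesis using nx norm_triangle_ineq[of "u z - x" x] by simp
    qed
    define \<zeta> where "\<zeta> z = of_real r1 * z" for z :: complex
    define U where "U z = x0 + e *\<^sub>R u (of_real r1 * z)" for z
    have \<zeta>: "norm (of_real r1 * z) < r1" "norm (of_real r1 * z) < 2 * r" if "z \<in> unit_disc" for z :: complex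
    proof -
      show "norm (of_real r1 * z) < r1" using that r1(1) by (simp add: norm_mult)
      then show "norm (of_real r1 * z) < 2 * r" using r1 r by simp
    qed
    have dU: "(U has_derivative (\<lambda>v. (e * r1) *\<^sub>R (Re v *\<^sub>R u1 (of_real r1 * z) + Im v *\<^sub>R u2 (of_real r1 * z)))) (at z)"
      if "z \<in> unit_disc" for z
      unfolding U_def by (rule frechet_derivative_scaled_disc[OF du(1)[OF \<zeta>(2)[OF that]]])
    have U1: "frechet_derivative U (at z) 1 = (e * r1) *\<^sub>R u1 (of_real r1 * z)"
      and U2: "frechet_derivative U (at z) \<i> = (e * r1) *\<^sub>R u2 (of_real r1 * z)" if "z \<in> unit_disc" for z
      using frechet_derivative_eqI[OF dU[OF that]] by simp_all
    have lapU: "laplacian U z = (e * r1 * r1) *\<^sub>R rhs M (e, (u (of_real r1 * z), u1 (of_real r1 * z), u2 (of_real r1 * z)))"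
      if z: "z \<in> unit_disc" for z
    proof -
      have dd: "frechet_derivative (\<lambda>z. frechet_derivative U (at z) p) (at z) p = (e * r1 * r1) *\<^sub>R frechet_derivative v (at (of_real r1 * z)) p"
        if v: "\<And>z. z \<in> unit_disc \<Longrightarrow> frechet_derivative U (at z) p = (e * r1) *\<^sub>R v (of_real r1 * z)" "Ck_on 1 UNIV v" for v p
      proof -
        have "(v has_derivative frechet_derivative v (at (of_real r1 * z))) (at (of_real r1 * z))"
          using v(2) by (simp add: frechet_derivative_works)
        from frechet_derivative_scaled_disc[OF this, of 0 "e * r1"]
        have "((\<lambda>z. (e * r1) *\<^sub>R v (of_real r1 * z)) has_derivative
            (\<lambda>h. (e * r1 * r1) *\<^sub>R frechet_derivative v (at (of_real r1 * z)) h)) (at z)" by simp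
        then have "((\<lambda>z. frechet_derivative U (at z) p) has_derivative
            (\<lambda>h. (e * r1 * r1) *\<^sub>R frechet_derivative v (at (of_real r1 * z)) h)) (at z)"
          by (rule has_derivative_transform_within_open[where s = unit_disc]) (use z v(1) in auto)
        then show ?thesis by (simp add: frechet_derivative_eqI)
      qed
      have "frechet_derivative (\<lambda>z. frechet_derivative U (at z) 1) (at z) 1 =
          (e * r1 * r1) *\<^sub>R frechet_derivative u1 (at (of_real r1 * z)) 1"
        by (rule dd) (rule U1, assumption, rule smooth(2))
      moreover have "frechet_derivative (\<lambda>z. frechet_derivative U (at z) \<i>) (at z) \<i> =
          (e * r1 * r1) *\<^sub>R frechet_derivative u2 (at (of_real r1 * z)) \<i>"
        by (rule dd) (rule U2, assumption, rule smooth(3))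
      ultimately show ?thesis
        unfolding laplacian_def lap[OF \<zeta>(2)[OF z], symmetric] scaleR_add_right by (rule arg_cong2)
    qed
    have chrU: "?Ch (of_real r1 * z) i j k = e * christoffel_symbol G (U z) i j k" if "z \<in> unit_disc" for z i j k
      unfolding U_def by (rule christoffel_scaled[OF ee small[OF \<zeta>(1)[OF that]]])
    have GU: "scaled e (u (of_real r1 * z)) = G (U z)" if "z \<in> unit_disc" for z
      unfolding U_def by (rule scaled_inner) (use small[OF \<zeta>(1)[OF that]] in simp)
    define s where "s = h / r1"
    have "0 \<le> s" "s \<le> 1/2" "s \<le> C * norm (X - Y)" using h r1(1) by (simp_all add: s_def field_simps)
    moreover have "Ck_on k unit_disc U" for k
    proof -
      have "Ck_on k unit_disc (\<lambda>z. u (of_real r1 * z))"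
        by (rule Ck_on_compose[OF open_ball open_UNIV _ smooth(1)])
          (auto intro: Ck_on_mult Ck_on_const Ck_on_id)
      then show ?thesis unfolding U_def by (intro Ck_on_add Ck_on_const Ck_on_scaleR open_ball)
    qed
    moreover have "U ` unit_disc \<subseteq> ball x0 \<rho>0"
    proof safe
      fix z assume z: "z \<in> unit_disc"
      have "norm (u (of_real r1 * z)) < 3" using small[OF \<zeta>(1)[OF z]] by simp
      then show "U z \<in> ball x0 \<rho>0" unfolding U_def by (rule in_ball_scaled[OF ee])
    qed
    moreover have "U 0 = X" "U (of_real s) = Y"
      using u0 uh r1(1) q(2) by (simp_all add: U_def Xx Yd s_def)
    moreover have "harmonic_at G U z" if z: "z \<in> unit_disc" for z
      unfolding harmonic_at_def lapU[OF z] U1[OF z] U2[OF z]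
    proof
      fix i
      show "((e * r1 * r1) *\<^sub>R rhs M (e, u (of_real r1 * z), u1 (of_real r1 * z), u2 (of_real r1 * z))) $ i +
          (\<Sum>j\<in>UNIV. \<Sum>k\<in>UNIV. christoffel_symbol G (U z) i j k *
            (((e * r1) *\<^sub>R u1 (of_real r1 * z)) $ j * ((e * r1) *\<^sub>R u1 (of_real r1 * z)) $ k +
             ((e * r1) *\<^sub>R u2 (of_real r1 * z)) $ j * ((e * r1) *\<^sub>R u2 (of_real r1 * z)) $ k)) = 0"
        unfolding vector_scaleR_component real_scaleR_def eqF chrU[OF z] by (simp add: sum_distrib_left algebra_simps)
    qed
    moreover have "conformal_immersive_at G U z" if z: "z \<in> unit_disc" for z
      unfolding conformal_immersive_at_def U1[OF z] U2[OF z] GU[OF z, symmetric]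
      using conformal[of "of_real r1 * z"] du(2,3)[OF \<zeta>(2)[OF z]] u1nz[of "of_real r1 * z"] e(1) r1(1)
      by (simp add: matrix_vector_mult_scaleR)
    ultimately show "\<exists>u s. 0 \<le> s \<and> s \<le> 1/2 \<and> s \<le> C * norm (X - Y) \<and>
       (\<forall>k. Ck_on k unit_disc u) \<and> u ` unit_disc \<subseteq> ball x0 \<rho>0 \<and> u 0 = X \<and> u (of_real s) = Y \<and>
       (\<forall>z\<in>unit_disc. harmonic_at G u z \<and> conformal_immersive_at G u z)"
      by (intro exI[of _ U] exI[of _ s]) blast
  qed
qed

section \<open>Calculus on manifolds\<close>

context smooth_manifold
begin

lemma chart_inv_chart: "c \<in> A \<Longrightarrow> p \<in> fst c \<Longrightarrow> chart_inv c (snd c p) = p"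
  by (rule homeomorphism_apply1[OF chart_homeomorphism])

lemma chart_chart_inv: "c \<in> A \<Longrightarrow> x \<in> chart_image c \<Longrightarrow> snd c (chart_inv c x) = x"
  by (rule homeomorphism_apply2[OF chart_homeomorphism])

lemma chart_inv_mem: "c \<in> A \<Longrightarrow> x \<in> chart_image c \<Longrightarrow> chart_inv c x \<in> fst c"
  by (metis chart_inv_chart imageE)

lemma open_overlap: "c \<in> A \<Longrightarrow> d \<in> A \<Longrightarrow> open (snd c ` (fst c \<inter> fst d))"
proof -
  assume c: "c \<in> A" and d: "d \<in> A"
  have "openin (top_of_set (fst c)) (fst c \<inter> fst d)"
    using open_domain[OF d] by (simp add: openin_open_Int)
  then have "openin (top_of_set (chart_image c)) (snd c ` (fst c \<inter> fst d))"
    by (rule homeomorphism_imp_open_map[OF chart_homeomorphism[OF c]])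
  then show ?thesis using open_image[OF c] openin_open_trans by blast
qed

lemma transition_has_derivative:
  assumes "c \<in> A" "d \<in> A" "p \<in> fst c" "p \<in> fst d"
  shows "((snd d \<circ> chart_inv c) has_derivative frechet_derivative (snd d \<circ> chart_inv c) (at (snd c p))) (at (snd c p))"
  by (rule smooth_on_has_derivative[OF smooth_transition[OF assms(1,2)]]) (use assms in auto)

lemma chart_containing: obtains c where "c \<in> A" "p \<in> fst c"
  using covers by blast

lemma smooth_map_on_continuous: "smooth_map_on A S f \<Longrightarrow> continuous_on S f"
  by (simp add: smooth_map_on_def)

lemma smooth_map_on_open_preimage:
  "smooth_map_on A S f \<Longrightarrow> open S \<Longrightarrow> open U \<Longrightarrow> open {x \<in> S. f x \<in> U}"
  using continuous_open_preimage[of S f U] smooth_map_on_continuous[of S f]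
  by (simp add: Collect_conj_eq vimage_def)

lemma smooth_map_on_coord: "smooth_map_on A S f \<Longrightarrow> c \<in> A \<Longrightarrow> smooth_on {x \<in> S. f x \<in> fst c} (snd c \<circ> f)"
  by (simp add: smooth_map_on_def)

text \<open>Smoothness in one chart that contains the whole image passes to every other chart
  through the smooth transition maps.\<close>

lemma smooth_map_on_chartI:
  assumes S: "open S" and c: "c \<in> A" and f: "f ` S \<subseteq> fst c" and smooth: "smooth_on S (\<lambda>x. snd c (f x))"
  shows "smooth_map_on A S f"
proof -
  have eq: "f x = chart_inv c (snd c (f x))" if "x \<in> S" for x
    using chart_inv_chart[OF c, of "f x"] f that by auto
  have "continuous_on S (\<lambda>x. chart_inv c (snd c (f x)))"
    by (rule continuous_on_compose2[OF homeomorphism_cont2[OF chart_homeomorphism[OF c]] smooth_on_continuous_on[OF smooth]])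
      (use f in auto)
  then have cont: "continuous_on S f"
    by (subst continuous_on_cong[OF refl eq]) auto
  have "smooth_on {x \<in> S. f x \<in> fst d} (snd d \<circ> f)" if d: "d \<in> A" for d
  proof -
    let ?T = "{x \<in> S. f x \<in> fst d}"
    have T: "open ?T"
      using continuous_open_preimage[OF cont S open_domain[OF d]] by (simp add: Collect_conj_eq vimage_def)
    have "smooth_on ?T (\<lambda>x. (snd d \<circ> chart_inv c) (snd c (f x)))"
      by (rule smooth_on_compose[OF T open_overlap[OF c d] smooth_on_subset[OF smooth] smooth_transition[OF c d]])
        (use f in auto)
    moreover have "(snd d \<circ> chart_inv c) (snd c (f x)) = (snd d \<circ> f) x" if "x \<in> ?T" for x
      using eq[of x] that by simp
    ultimately show ?thesis using smooth_on_cong[OF T, of "\<lambda>x. (snd d \<circ> chart_inv c) (snd c (f x))" "snd d \<circ> f"] by blast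
  qed
  then show ?thesis using cont by (simp add: smooth_map_on_def)
qed

lemma smooth_map_on_compose:
  fixes f :: "'b::euclidean_space \<Rightarrow> 'm" and \<phi> :: "'c::real_normed_vector \<Rightarrow> 'b"
  assumes S: "open S" and T: "open T" and f: "smooth_map_on A T f" and \<phi>: "smooth_on S \<phi>" "\<And>x. x \<in> S \<Longrightarrow> \<phi> x \<in> T"
  shows "smooth_map_on A S (\<lambda>x. f (\<phi> x))"
proof -
  have cont: "continuous_on S (\<lambda>x. f (\<phi> x))"
    by (rule continuous_on_compose2[OF smooth_map_on_continuous[OF f] smooth_on_continuous_on[OF \<phi>(1)]]) (use \<phi>(2) in auto)
  have "smooth_on {x \<in> S. f (\<phi> x) \<in> fst c} (\<lambda>x. (snd c \<circ> f) (\<phi> x))" if c: "c \<in> A" for c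
  proof (rule smooth_on_compose[OF _ smooth_map_on_open_preimage[OF f T open_domain[OF c]] smooth_on_subset[OF \<phi>(1)]
        smooth_map_on_coord[OF f c]])
    show "open {x \<in> S. f (\<phi> x) \<in> fst c}"
      using continuous_open_preimage[OF cont S open_domain[OF c]] by (simp add: Collect_conj_eq vimage_def)
  qed (use \<phi>(2) in auto)
  then show ?thesis using cont by (simp add: smooth_map_on_def o_def)
qed

lemma smooth_map_on_subset: "smooth_map_on A S f \<Longrightarrow> T \<subseteq> S \<Longrightarrow> smooth_map_on A T f"
  unfolding smooth_map_on_def by (auto intro: continuous_on_subset smooth_on_subset)

lemma smooth_map_on_has_derivative:
  assumes "smooth_map_on A S f" "x \<in> S" "c \<in> A" "f x \<in> fst c"
  shows "((\<lambda>x. snd c (f x)) has_derivative (\<lambda>v. differential A f x v c)) (at x)"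
proof -
  have "((snd c \<circ> f) has_derivative frechet_derivative (snd c \<circ> f) (at x)) (at x)"
    by (rule smooth_on_has_derivative[OF smooth_map_on_coord[OF assms(1,3)]]) (use assms in auto)
  then show ?thesis using assms(3,4) by (simp add: differential_def o_def)
qed

lemma differential_eqI:
  assumes "c \<in> A" "f x \<in> fst c" "((\<lambda>x. snd c (f x)) has_derivative D) (at x)"
  shows "differential A f x v c = D v"
  using frechet_derivative_eqI[OF assms(3)] assms(1,2) by (simp add: differential_def o_def)

lemma differential_tangent:
  assumes S: "open S" and f: "smooth_map_on A S f" and x: "x \<in> S"
  shows "differential A f x v \<in> tangent_space A (f x)"
proof -
  have "differential A f x v d = frechet_derivative (snd d \<circ> chart_inv c) (at (snd c (f x))) (differential A f x v c)"
    if c: "c \<in> A" and d: "d \<in> A" and p: "f x \<in> fst c" "f x \<in> fst d" for c d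
  proof -
    let ?T = "{x \<in> S. f x \<in> fst c}"
    have "((\<lambda>x. (snd d \<circ> chart_inv c) (snd c (f x))) has_derivative
        (\<lambda>v. frechet_derivative (snd d \<circ> chart_inv c) (at (snd c (f x))) (differential A f x v c))) (at x)"
      by (rule has_derivative_compose[OF smooth_map_on_has_derivative[OF f x c p(1)] transition_has_derivative[OF c d p]])
    then have "((\<lambda>x. snd d (f x)) has_derivative
        (\<lambda>v. frechet_derivative (snd d \<circ> chart_inv c) (at (snd c (f x))) (differential A f x v c))) (at x)"
      by (rule has_derivative_transform_within_open[where s = ?T])
        (use smooth_map_on_open_preimage[OF f S open_domain[OF c]] x p chart_inv_chart[OF c] in auto)
    from differential_eqI[OF d p(2) this] show ?thesis .
  qed
  moreover have "differential A f x v c = 0" if "\<not> (c \<in> A \<and> f x \<in> fst c)" for c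
    unfolding differential_def using that by (rule if_not_P)
  ultimately show ?thesis unfolding tangent_space_def by blast
qed

lemma differential_chain:
  assumes f: "smooth_map_on A T f" "\<phi> x \<in> T" and \<phi>: "(\<phi> has_derivative D) (at x)"
  shows "differential A (\<lambda>x. f (\<phi> x)) x v = differential A f (\<phi> x) (D v)"
proof
  fix c
  show "differential A (\<lambda>x. f (\<phi> x)) x v c = differential A f (\<phi> x) (D v) c"
  proof (cases "c \<in> A \<and> f (\<phi> x) \<in> fst c")
    case True
    then show ?thesis
      by (intro differential_eqI has_derivative_compose[OF \<phi> smooth_map_on_has_derivative[OF f]]) auto
  next
    case False
    then show ?thesis by (auto simp: differential_def)
  qed
qed

lemma differential_cong:
  fixes f h :: "'a::real_normed_vector \<Rightarrow> 'm"
  assumes "open S" "x \<in> S" "\<And>y. y \<in> S \<Longrightarrow> f y = h y"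
  shows "differential A f x v = differential A h x v"
proof
  fix c :: "('m, 'n) chart"
  have "frechet_derivative (snd c \<circ> f) (at x) = frechet_derivative (snd c \<circ> h) (at x)"
    by (rule frechet_derivative_cong_open[OF assms(1,2)]) (simp add: assms(3))
  then show "differential A f x v c = differential A h x v c" by (simp add: differential_def assms(2,3))
qed

lemma differential_add_scaleR:
  assumes "smooth_map_on A S f" "x \<in> S"
  shows "differential A f x (v + w) = (\<lambda>c. differential A f x v c + differential A f x w c)"
    and "differential A f x (a *\<^sub>R v) = (\<lambda>c. a *\<^sub>R differential A f x v c)"
proof -
  have l: "linear (\<lambda>v. differential A f x v c)" for c
  proof (cases "c \<in> A \<and> f x \<in> fst c")
    case True
    then show ?thesis using smooth_map_on_has_derivative[OF assms, of c]
      by (simp add: has_derivative_def bounded_linear.linear)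
  next
    case False
    then have "(\<lambda>v. differential A f x v c) = (\<lambda>v. 0)" by (auto simp: differential_def)
    then show ?thesis by (simp add: module_hom_zero)
  qed
  show "differential A f x (v + w) = (\<lambda>c. differential A f x v c + differential A f x w c)"
    using linear_add[OF l] by (intro ext)
  show "differential A f x (a *\<^sub>R v) = (\<lambda>c. a *\<^sub>R differential A f x v c)"
    using linear_scale[OF l] by (intro ext)
qed

lemma tangent_eqI:
  assumes "\<xi> \<in> tangent_space A p" "\<eta> \<in> tangent_space A p" "c \<in> A" "p \<in> fst c" "\<xi> c = \<eta> c"
  shows "\<xi> = \<eta>"
proof
  fix d
  have *: "d \<in> A \<and> p \<in> fst d \<longrightarrow> \<zeta> d = frechet_derivative (snd d \<circ> chart_inv c) (at (snd c p)) (\<zeta> c)"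
    "\<not> (d \<in> A \<and> p \<in> fst d) \<longrightarrow> \<zeta> d = 0" if "\<zeta> \<in> tangent_space A p" for \<zeta>
    using that assms(3,4) unfolding tangent_space_def by blast+
  show "\<xi> d = \<eta> d"
    using *[OF assms(1)] *[OF assms(2)] assms(5) by (cases "d \<in> A \<and> p \<in> fst d") simp_all
qed

lemma chart_inv_smooth: "c \<in> A \<Longrightarrow> smooth_map_on A (chart_image c) (chart_inv c)"
proof (rule smooth_map_on_chartI[OF open_image])
  assume c: "c \<in> A"
  have "smooth_on (chart_image c) (\<lambda>x. x)" by (simp add: smooth_on_def Ck_on_id)
  then show "smooth_on (chart_image c) (\<lambda>x. snd c (chart_inv c x))"
    using smooth_on_cong[OF open_image[OF c], of "\<lambda>x. x" "\<lambda>x. snd c (chart_inv c x)"] chart_chart_inv[OF c] by auto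
qed (auto intro: chart_inv_mem)

lemma differential_chart_inv:
  assumes c: "c \<in> A" and x: "x \<in> chart_image c"
  shows "differential A (chart_inv c) x a c = a"
proof (rule differential_eqI)
  show "c \<in> A" "chart_inv c x \<in> fst c" using c chart_inv_mem[OF c x] by auto
  show "((\<lambda>x. snd c (chart_inv c x)) has_derivative (\<lambda>a. a)) (at x)"
    by (rule has_derivative_transform_within_open[OF has_derivative_ident open_image[OF c] x])
      (simp add: chart_chart_inv[OF c])
qed

lemma differential_chart_inv_tangent:
  "c \<in> A \<Longrightarrow> x \<in> chart_image c \<Longrightarrow> differential A (chart_inv c) x a \<in> tangent_space A (chart_inv c x)"
  by (rule differential_tangent[OF open_image chart_inv_smooth])

lemma tangent_eq_differential:
  assumes "\<xi> \<in> tangent_space A p" and c: "c \<in> A" "p \<in> fst c"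
  shows "\<xi> = differential A (chart_inv c) (snd c p) (\<xi> c)"
proof (rule tangent_eqI[OF assms(1) _ c])
  show "differential A (chart_inv c) (snd c p) (\<xi> c) \<in> tangent_space A p"
    using differential_chart_inv_tangent[OF c(1), of "snd c p"] chart_inv_chart[OF c] c(2) by simp
  show "\<xi> c = differential A (chart_inv c) (snd c p) (\<xi> c) c"
    using differential_chart_inv[OF c(1)] c(2) by simp
qed

end

section \<open>The metric in a chart\<close>

context riemannian_manifold
begin

text \<open>Tangent vectors are combinations of the coordinate vector fields. Linearity is an axiom
  for the first argument of the metric and reaches the second through symmetry.\<close>

lemma metric_chart:
  assumes \<xi>: "\<xi> \<in> tangent_space A p" and \<eta>: "\<eta> \<in> tangent_space A p" and c: "c \<in> A" "p \<in> fst c"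
  shows "g p \<xi> \<eta> = \<xi> c \<bullet> (metric_matrix A g c (snd c p) *v \<eta> c)"
proof -
  let ?E = "differential A (chart_inv c) (snd c p)"
  have x: "snd c p \<in> chart_image c" using c by auto
  have p: "chart_inv c (snd c p) = p" by (rule chart_inv_chart[OF c])
  have T: "?E a \<in> tangent_space A p" for a using differential_chart_inv_tangent[OF c(1) x] p by simp
  define B where "B a b = g p (?E a) (?E b)" for a b
  note E = differential_add_scaleR[OF chart_inv_smooth[OF c(1)] x]
  have l1: "linear (\<lambda>a. B a b)" for b
    by (rule linearI) (simp_all add: B_def E metric_add metric_scale T)
  have sym: "B a b = B b a" for a b unfolding B_def by (rule metric_sym[OF T T])
  have l2: "linear (B a)" for a
  proof -
    have "B a = (\<lambda>b. B b a)" by (rule ext) (rule sym)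
    from subst[OF this[symmetric], of linear, OF l1] show ?thesis .
  qed
  have expand: "v = (\<Sum>i\<in>UNIV. (v $ i) *\<^sub>R axis i 1)" for v :: "real ^ 'n"
    using basis_expansion[of v] by (simp add: scalar_mult_eq_scaleR)
  have "B a b = (\<Sum>i\<in>UNIV. a $ i * (\<Sum>j\<in>UNIV. b $ j * B (axis i 1) (axis j 1)))" for a b
  proof -
    have *: "B a b = (\<Sum>i\<in>UNIV. a $ i * B (axis i 1) b)"
      by (subst expand[of a]) (simp add: linear_sum[OF l1] linear_scale[OF l1])
    have "B (axis i 1) b = (\<Sum>j\<in>UNIV. b $ j * B (axis i 1) (axis j 1))" for i
      by (subst expand[of b]) (simp add: linear_sum[OF l2] linear_scale[OF l2])
    then show ?thesis using * by simp
  qed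
  also have "(\<Sum>i\<in>UNIV. a $ i * (\<Sum>j\<in>UNIV. b $ j * B (axis i 1) (axis j 1))) =
      a \<bullet> (metric_matrix A g c (snd c p) *v b)" for a b
    by (simp add: inner_vec_def matrix_vector_mult_def metric_matrix_def B_def p mult.commute)
  finally have "B (\<xi> c) (\<eta> c) = \<xi> c \<bullet> (metric_matrix A g c (snd c p) *v \<eta> c)" .
  then show ?thesis
    unfolding B_def using tangent_eq_differential[OF \<xi> c] tangent_eq_differential[OF \<eta> c] by simp
qed

lemma metric_matrix_sym:
  assumes c: "c \<in> A" and x: "x \<in> chart_image c"
  shows "transpose (metric_matrix A g c x) = metric_matrix A g c x"
  by (simp add: vec_eq_iff transpose_def metric_matrix_def)
    (intro allI metric_sym differential_chart_inv_tangent[OF c x])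

lemma metric_matrix_pos:
  assumes c: "c \<in> A" and x: "x \<in> chart_image c" and a: "a \<noteq> 0"
  shows "a \<bullet> (metric_matrix A g c x *v a) > 0"
proof -
  let ?\<xi> = "differential A (chart_inv c) x a"
  have p: "chart_inv c x \<in> fst c" "snd c (chart_inv c x) = x"
    using chart_inv_mem[OF c x] chart_chart_inv[OF c x] by auto
  have "?\<xi> c = a" by (rule differential_chart_inv[OF c x])
  then have "?\<xi> \<noteq> (\<lambda>c. 0)" using a by metis
  from metric_pos[OF differential_chart_inv_tangent[OF c x] this]
  show ?thesis
    using metric_chart[OF differential_chart_inv_tangent[OF c x] differential_chart_inv_tangent[OF c x] c p(1)]
      \<open>?\<xi> c = a\<close> p(2) by simp
qed

lemma local_metric_chart:
  assumes c: "c \<in> A" and p: "p \<in> fst c"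
  obtains \<rho> where "\<rho> > 0" "ball (snd c p) \<rho> \<subseteq> chart_image c" "local_metric (metric_matrix A g c) (snd c p) \<rho>"
proof -
  have "snd c p \<in> chart_image c" using p by auto
  then obtain \<rho> where \<rho>: "\<rho> > 0" "ball (snd c p) \<rho> \<subseteq> chart_image c"
    using open_image[OF c] open_contains_ball by blast
  have "local_metric (metric_matrix A g c) (snd c p) \<rho>"
  proof
    show "Ck_on k (ball (snd c p) \<rho>) (\<lambda>x. metric_matrix A g c x $ i $ j)" for k i j
      using metric_smooth[OF c] \<rho>(2) by (auto simp: smooth_on_def intro: Ck_on_subset)
  qed (use \<rho> metric_matrix_sym[OF c] metric_matrix_pos[OF c] in blast)+
  then show ?thesis using \<rho> that by blast
qed

end

section \<open>Invariance of the harmonic map equation\<close>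

lemma bounded_bilinear_matrix_vector_mult:
  "bounded_bilinear (\<lambda>(M :: real ^ 'n ^ 'm) v. M *v v)"
proof -
  have "bilinear (\<lambda>(M :: real ^ 'n ^ 'm) v. M *v v)"
    unfolding bilinear_def
    by (intro conjI allI linearI)
      (simp_all add: matrix_vector_mult_add_rdistrib matrix_vector_right_distrib matrix_vector_mult_scaleR
        scaleR_matrix_vector_assoc)
  then show ?thesis by (simp add: bilinear_conv_bounded_bilinear)
qed

lemmas has_derivative_matrix_vector = bounded_bilinear.FDERIV[OF bounded_bilinear_matrix_vector_mult]

text \<open>The first variation of the energy density of \<open>v\<close> at \<open>z\<close> in the direction \<open>a\<close>, in the form in which
  it is invariant under changes of coordinates.\<close>

definition euler_lagrange :: "(real ^ 'n \<Rightarrow> real ^ 'n ^ 'n) \<Rightarrow> (complex \<Rightarrow> real ^ 'n) \<Rightarrow> complex \<Rightarrow> real ^ 'n \<Rightarrow> real" where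
  "euler_lagrange G v z a = (\<Sum>e\<in>{1, \<i>}.
     frechet_derivative (\<lambda>z. G (v z) *v frechet_derivative v (at z) e) (at z) e \<bullet> a -
     frechet_derivative (\<lambda>y. frechet_derivative v (at z) e \<bullet> (G y *v frechet_derivative v (at z) e)) (at (v z)) a / 2)"

lemma euler_lagrange_term:
  fixes G :: "real ^ 'n \<Rightarrow> real ^ 'n ^ 'n"
  assumes S: "open S" "z \<in> S" and v: "Ck_on 2 S v" and G: "(G has_derivative DG) (at (v z))"
  shows "((\<lambda>z. G (v z) *v frechet_derivative v (at z) e) has_derivative
      (\<lambda>h. G (v z) *v frechet_derivative (\<lambda>z. frechet_derivative v (at z) e) (at z) h +
        DG (frechet_derivative v (at z) h) *v frechet_derivative v (at z) e)) (at z)"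
    and "((\<lambda>y. w \<bullet> (G y *v w)) has_derivative (\<lambda>a. w \<bullet> (DG a *v w))) (at (v z))"
proof -
  have v2: "Ck_on (Suc (Suc 0)) S v" using v by (simp add: numeral_2_eq_2)
  have dv: "(v has_derivative frechet_derivative v (at z)) (at z)" by (rule Ck_on_SucD[OF v2 S(2)])
  have ddv: "((\<lambda>z. frechet_derivative v (at z) e) has_derivative frechet_derivative (\<lambda>z. frechet_derivative v (at z) e) (at z)) (at z)"
    by (rule Ck_on_SucD[OF Ck_on_frechet[OF v2] S(2)])
  show "((\<lambda>z. G (v z) *v frechet_derivative v (at z) e) has_derivative
      (\<lambda>h. G (v z) *v frechet_derivative (\<lambda>z. frechet_derivative v (at z) e) (at z) h +
        DG (frechet_derivative v (at z) h) *v frechet_derivative v (at z) e)) (at z)"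
    by (rule has_derivative_matrix_vector[OF has_derivative_compose[OF dv G] ddv])
  have "((\<lambda>y. G y *v w) has_derivative (\<lambda>a. DG a *v w)) (at (v z))"
    using has_derivative_matrix_vector[OF G has_derivative_const[of w]] by simp
  then show "((\<lambda>y. w \<bullet> (G y *v w)) has_derivative (\<lambda>a. w \<bullet> (DG a *v w))) (at (v z))"
    by (rule has_derivative_inner_right)
qed

lemma has_derivative_frechet: "(f has_derivative D) (at x) \<Longrightarrow> (f has_derivative frechet_derivative f (at x)) (at x)"
  using frechet_derivative_eqI[of f D x] by simp

lemma euler_lagrange_eq:
  fixes G :: "real ^ 'n \<Rightarrow> real ^ 'n ^ 'n"
  assumes S: "open S" "z \<in> S" and v: "Ck_on 2 S v" and G: "(G has_derivative DG) (at (v z))"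
  shows "euler_lagrange G v z a = (\<Sum>e\<in>{1, \<i>}.
     (G (v z) *v frechet_derivative (\<lambda>z. frechet_derivative v (at z) e) (at z) e +
        DG (frechet_derivative v (at z) e) *v frechet_derivative v (at z) e) \<bullet> a -
     frechet_derivative v (at z) e \<bullet> (DG a *v frechet_derivative v (at z) e) / 2)"
  unfolding euler_lagrange_def
  by (simp only: frechet_derivative_eqI[OF euler_lagrange_term(1)[OF assms]]
      frechet_derivative_eqI[OF euler_lagrange_term(2)[OF assms]])

text \<open>Pairing with an arbitrary vector a amounts to lowering the index, and the lowered system
  is equivalent to the original one because G is invertible.\<close>

lemma harmonic_at_iff_euler_lagrange:
  fixes G :: "real ^ 'n \<Rightarrow> real ^ 'n ^ 'n"
  assumes S: "open S" "z \<in> S" and v: "Ck_on 2 S v" and G: "(G has_derivative DG) (at (v z))" and nz: "det (G (v z)) \<noteq> 0"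
  shows "harmonic_at G v z \<longleftrightarrow> (\<forall>a. euler_lagrange G v z a = 0)"
proof -
  let ?v = "\<lambda>e. frechet_derivative v (at z) e"
  let ?S = "\<lambda>j k. ?v 1 $ j * ?v 1 $ k + ?v \<i> $ j * ?v \<i> $ k"
  let ?T = "metric_partial G (v z)"
  let ?low = "\<lambda>l. (\<Sum>i\<in>UNIV. G (v z) $ l $ i * laplacian v z $ i) +
      (\<Sum>j\<in>UNIV. \<Sum>k\<in>UNIV. (?T j l k - ?T l j k / 2) * ?S j k)"
  have lin: "linear DG" using G by (simp add: has_derivative_def bounded_linear.linear)
  have T: "DG (axis l 1) $ i $ j = ?T l i j" for l i j
  proof -
    have "((\<lambda>y. G y $ i $ j) has_derivative (\<lambda>h. DG h $ i $ j)) (at (v z))"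
      by (intro bounded_linear.has_derivative[OF bounded_linear_vec_nth] G)
    then show ?thesis by (simp add: metric_partial_def frechet_derivative_eqI)
  qed
  have expand: "w = (\<Sum>i\<in>UNIV. (w $ i) *\<^sub>R axis i 1)" for w :: "real ^ 'n"
    using basis_expansion[of w] by (simp add: scalar_mult_eq_scaleR)
  have DG: "DG w $ i $ j = (\<Sum>l\<in>UNIV. w $ l * ?T l i j)" for w i j
    by (subst expand[of w]) (simp add: linear_sum[OF lin] linear_scale[OF lin] T)
  have D1: "(DG w *v w) $ l = (\<Sum>j\<in>UNIV. \<Sum>k\<in>UNIV. ?T j l k * (w $ j * w $ k))" for w l
  proof -
    have "(DG w *v w) $ l = (\<Sum>k\<in>UNIV. \<Sum>j\<in>UNIV. ?T j l k * (w $ j * w $ k))"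
      by (simp add: matrix_vector_mult_def DG sum_distrib_left sum_distrib_right mult_ac)
    then show ?thesis by (subst sum.swap)
  qed
  have D2: "w \<bullet> (DG a *v w) = (\<Sum>l\<in>UNIV. a $ l * (\<Sum>j\<in>UNIV. \<Sum>k\<in>UNIV. ?T l j k * (w $ j * w $ k)))" for w a
  proof -
    have "w \<bullet> (DG a *v w) = (\<Sum>j\<in>UNIV. \<Sum>k\<in>UNIV. \<Sum>l\<in>UNIV. a $ l * (?T l j k * (w $ j * w $ k)))"
      by (simp add: inner_vec_def matrix_vector_mult_def DG sum_distrib_right sum_distrib_left mult_ac)
    also have "\<dots> = (\<Sum>j\<in>UNIV. \<Sum>l\<in>UNIV. \<Sum>k\<in>UNIV. a $ l * (?T l j k * (w $ j * w $ k)))"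
      by (intro sum.cong refl sum.swap)
    also have "\<dots> = (\<Sum>l\<in>UNIV. \<Sum>j\<in>UNIV. \<Sum>k\<in>UNIV. a $ l * (?T l j k * (w $ j * w $ k)))"
      by (rule sum.swap)
    finally show ?thesis by (simp add: sum_distrib_left)
  qed
  define P where "P w l = (\<Sum>j\<in>UNIV. \<Sum>k\<in>UNIV. ?T j l k * (w $ j * w $ k))" for w l
  define Q where "Q w l = (\<Sum>j\<in>UNIV. \<Sum>k\<in>UNIV. ?T l j k * (w $ j * w $ k))" for w l
  have low: "?low l = (G (v z) *v laplacian v z) $ l + P (?v 1) l + P (?v \<i>) l - Q (?v 1) l / 2 - Q (?v \<i>) l / 2" for l
    by (simp add: P_def Q_def matrix_vector_mult_def algebra_simps sum.distrib sum_subtractf sum_divide_distrib)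
  have E: "euler_lagrange G v z a = (\<Sum>l\<in>UNIV. a $ l * ?low l)" for a
  proof -
    have "euler_lagrange G v z a = (\<Sum>l\<in>UNIV. a $ l * ((G (v z) *v laplacian v z) $ l +
        (DG (?v 1) *v ?v 1) $ l + (DG (?v \<i>) *v ?v \<i>) $ l)) - ?v 1 \<bullet> (DG a *v ?v 1) / 2 - ?v \<i> \<bullet> (DG a *v ?v \<i>) / 2"
      unfolding euler_lagrange_eq[OF S v G] laplacian_def
      by (simp add: complex_eq_iff inner_vec_def matrix_vector_right_distrib algebra_simps sum.distrib)
    also have "\<dots> = (\<Sum>l\<in>UNIV. a $ l * ((G (v z) *v laplacian v z) $ l + P (?v 1) l + P (?v \<i>) l)) -
        (\<Sum>l\<in>UNIV. a $ l * Q (?v 1) l) / 2 - (\<Sum>l\<in>UNIV. a $ l * Q (?v \<i>) l) / 2"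
      unfolding D1 D2 P_def Q_def ..
    also have "\<dots> = (\<Sum>l\<in>UNIV. a $ l * ?low l)"
      unfolding low by (simp add: sum.distrib sum_subtractf sum_divide_distrib algebra_simps)
    finally show ?thesis .
  qed
  have "harmonic_at G v z \<longleftrightarrow> (\<forall>l. ?low l = 0)"
    unfolding harmonic_at_def by (rule christoffel_lower) (simp_all add: mult.commute nz)
  also have "\<dots> \<longleftrightarrow> (\<forall>a. euler_lagrange G v z a = 0)"
  proof
    assume "\<forall>l. ?low l = 0"
    then show "\<forall>a. euler_lagrange G v z a = 0" unfolding E by simp
  next
    assume *: "\<forall>a. euler_lagrange G v z a = 0"
    show "\<forall>l. ?low l = 0"
    proof
      fix l
      have "(\<Sum>m\<in>UNIV. axis l 1 $ m * ?low m) = ?low l"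
        by (subst sum.remove[of _ l]) (auto simp: axis_def intro!: sum.neutral)
      then show "?low l = 0" using *[rule_format, of "axis l 1"] unfolding E by linarith
    qed
  qed
  finally show ?thesis .
qed

text \<open>Differentiating the pullback identity produces second derivatives of \<sigma> in both
  terms of the expression, with weight 1 and with weight 2/2; they cancel by symmetry of second
  derivatives. What remains is the expression for v in the direction of the image of a.\<close>

lemma euler_lagrange_change_of_coordinates:
  fixes G G' :: "real ^ 'n \<Rightarrow> real ^ 'n ^ 'n" and w v :: "complex \<Rightarrow> real ^ 'n"
  assumes S: "open S" "z \<in> S" and w: "Ck_on 2 S w" and v: "Ck_on 2 S v"
    and T: "open T" "\<And>z. z \<in> S \<Longrightarrow> w z \<in> T" and \<sigma>: "Ck_on 2 T \<sigma>" "\<And>z. z \<in> S \<Longrightarrow> \<sigma> (w z) = v z"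
    and G: "(G has_derivative DG) (at (v z))" and G': "(G' has_derivative DG') (at (w z))" and sym: "transpose (G (v z)) = G (v z)"
    and pull: "\<And>y a b. y \<in> T \<Longrightarrow> a \<bullet> (G' y *v b) =
      frechet_derivative \<sigma> (at y) a \<bullet> (G (\<sigma> y) *v frechet_derivative \<sigma> (at y) b)"
  shows "euler_lagrange G' w z a = euler_lagrange G v z (frechet_derivative \<sigma> (at (w z)) a)"
proof -
  let ?\<sigma> = "\<lambda>y a. frechet_derivative \<sigma> (at y) a" and ?w = "\<lambda>e z. frechet_derivative w (at z) e" and ?v = "\<lambda>e z. frechet_derivative v (at z) e"
  let ?D2 = "\<lambda>a b. frechet_derivative (\<lambda>y. ?\<sigma> y a) (at (w z)) b"
  have w2: "Ck_on (Suc (Suc 0)) S w" and v2: "Ck_on (Suc (Suc 0)) S v" and \<sigma>2: "Ck_on (Suc (Suc 0)) T \<sigma>"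
    using w v \<sigma>(1) by (simp_all add: numeral_2_eq_2)
  have wz: "w z \<in> T" and vz: "\<sigma> (w z) = v z" using S T \<sigma> by auto
  have d\<sigma>: "(\<sigma> has_derivative ?\<sigma> y) (at y)" if "y \<in> T" for y by (rule Ck_on_SucD[OF \<sigma>2 that])
  have dw: "(w has_derivative (\<lambda>e. ?w e y)) (at y)" if "y \<in> S" for y by (rule Ck_on_SucD[OF w2 that])
  have dd\<sigma>: "((\<lambda>y. ?\<sigma> y a) has_derivative ?D2 a) (at (w z))" for a
    by (rule Ck_on_SucD[OF Ck_on_frechet[OF \<sigma>2] wz])
  have chain: "?v e y = ?\<sigma> (w y) (?w e y)" if y: "y \<in> S" for e y
  proof -
    have "((\<lambda>z. \<sigma> (w z)) has_derivative (\<lambda>e. ?\<sigma> (w y) (?w e y))) (at y)"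
      by (rule has_derivative_compose[OF dw[OF y] d\<sigma>[OF T(2)[OF y]]])
    then have "(v has_derivative (\<lambda>e. ?\<sigma> (w y) (?w e y))) (at y)"
      by (rule has_derivative_transform_within_open[OF _ S(1) y]) (rule \<sigma>(2))
    then show ?thesis by (simp add: frechet_derivative_eqI)
  qed
  \<comment> \<open>Obtained by differentiating the pullback identity, evaluated on a and the
    derivative of w in direction e, along z with a held fixed.\<close>
  have first: "frechet_derivative (\<lambda>z. G' (w z) *v ?w e z) (at z) e \<bullet> a =
      frechet_derivative (\<lambda>z. G (v z) *v ?v e z) (at z) e \<bullet> ?\<sigma> (w z) a + ?D2 a (?w e z) \<bullet> (G (v z) *v ?v e z)" for e
  proof -
    let ?L = "frechet_derivative (\<lambda>z. G' (w z) *v ?w e z) (at z)" and ?R = "frechet_derivative (\<lambda>z. G (v z) *v ?v e z) (at z)"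
    have "((\<lambda>z. G' (w z) *v ?w e z) has_derivative ?L) (at z)"
      by (rule has_derivative_frechet[OF euler_lagrange_term(1)[OF S w G']])
    then have l: "((\<lambda>z. a \<bullet> (G' (w z) *v ?w e z)) has_derivative (\<lambda>h. a \<bullet> ?L h)) (at z)"
      by (rule has_derivative_inner_right)
    have "((\<lambda>z. G (v z) *v ?v e z) has_derivative ?R) (at z)"
      by (rule has_derivative_frechet[OF euler_lagrange_term(1)[OF S v G]])
    from has_derivative_inner[OF has_derivative_compose[OF dw[OF S(2)] dd\<sigma>[of a]] this]
    have "((\<lambda>z. ?\<sigma> (w z) a \<bullet> (G (v z) *v ?v e z)) has_derivative
        (\<lambda>h. ?\<sigma> (w z) a \<bullet> ?R h + ?D2 a (?w h z) \<bullet> (G (v z) *v ?v e z))) (at z)" .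
    then have "((\<lambda>z. a \<bullet> (G' (w z) *v ?w e z)) has_derivative
        (\<lambda>h. ?\<sigma> (w z) a \<bullet> ?R h + ?D2 a (?w h z) \<bullet> (G (v z) *v ?v e z))) (at z)"
      by (rule has_derivative_transform_within_open[OF _ S]) (simp add: pull T(2) \<sigma>(2) chain)
    from fun_cong[OF has_derivative_unique[OF l this], of e] show ?thesis by (simp only: inner_commute[of _ a] inner_commute[of _ "?\<sigma> (w z) a"])
  qed
  have second: "frechet_derivative (\<lambda>y. p \<bullet> (G' y *v p)) (at (w z)) a =
      frechet_derivative (\<lambda>x. ?\<sigma> (w z) p \<bullet> (G x *v ?\<sigma> (w z) p)) (at (v z)) (?\<sigma> (w z) a) +
      2 * (?D2 p a \<bullet> (G (v z) *v ?\<sigma> (w z) p))" for p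
  proof -
    let ?q = "?\<sigma> (w z) p"
    have "((\<lambda>y. G (\<sigma> y)) has_derivative (\<lambda>a. DG (?\<sigma> (w z) a))) (at (w z))"
      by (rule has_derivative_compose[OF d\<sigma>[OF wz]]) (use G vz in simp)
    from has_derivative_inner[OF dd\<sigma>[of p] has_derivative_matrix_vector[OF this dd\<sigma>[of p]]]
    have "((\<lambda>y. ?\<sigma> y p \<bullet> (G (\<sigma> y) *v ?\<sigma> y p)) has_derivative (\<lambda>a. ?q \<bullet> (G (v z) *v ?D2 p a + DG (?\<sigma> (w z) a) *v ?q) +
        ?D2 p a \<bullet> (G (v z) *v ?q))) (at (w z))" unfolding vz .
    then have "((\<lambda>y. p \<bullet> (G' y *v p)) has_derivative (\<lambda>a. ?q \<bullet> (G (v z) *v ?D2 p a + DG (?\<sigma> (w z) a) *v ?q) +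
        ?D2 p a \<bullet> (G (v z) *v ?q))) (at (w z))"
      by (rule has_derivative_transform_within_open[OF _ T(1) wz]) (simp add: pull)
    then have "frechet_derivative (\<lambda>y. p \<bullet> (G' y *v p)) (at (w z)) a =
        ?q \<bullet> (G (v z) *v ?D2 p a + DG (?\<sigma> (w z) a) *v ?q) + ?D2 p a \<bullet> (G (v z) *v ?q)"
      by (simp add: frechet_derivative_eqI)
    moreover have "?q \<bullet> (G (v z) *v ?D2 p a) = ?D2 p a \<bullet> (G (v z) *v ?q)"
      by (metis dot_lmul_matrix inner_commute sym transpose_matrix_vector)
    moreover have "frechet_derivative (\<lambda>x. ?q \<bullet> (G x *v ?q)) (at (v z)) (?\<sigma> (w z) a) = ?q \<bullet> (DG (?\<sigma> (w z) a) *v ?q)"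
      by (simp only: frechet_derivative_eqI[OF euler_lagrange_term(2)[OF S v G]])
    ultimately show ?thesis by (simp add: inner_add_right)
  qed
  have sym2: "?D2 a p = ?D2 p a" for p by (rule second_derivative_symmetric[OF T(1) wz \<sigma>(1)])
  show ?thesis
    unfolding euler_lagrange_def first second chain[OF S(2), symmetric] sym2
    by (intro sum.cong refl) (simp add: field_simps)
qed

lemma harmonic_at_change_of_coordinates:
  fixes G G' :: "real ^ 'n \<Rightarrow> real ^ 'n ^ 'n" and w v :: "complex \<Rightarrow> real ^ 'n"
  assumes S: "open S" "z \<in> S" and w: "Ck_on 2 S w" and v: "Ck_on 2 S v"
    and T: "open T" "\<And>z. z \<in> S \<Longrightarrow> w z \<in> T" and \<sigma>: "Ck_on 2 T \<sigma>" "\<And>z. z \<in> S \<Longrightarrow> \<sigma> (w z) = v z"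
    and G: "(G has_derivative DG) (at (v z))" and G': "(G' has_derivative DG') (at (w z))" and sym: "transpose (G (v z)) = G (v z)"
    and pull: "\<And>y a b. y \<in> T \<Longrightarrow> a \<bullet> (G' y *v b) =
      frechet_derivative \<sigma> (at y) a \<bullet> (G (\<sigma> y) *v frechet_derivative \<sigma> (at y) b)"
    and nz: "det (G (v z)) \<noteq> 0" "det (G' (w z)) \<noteq> 0"
    and harm: "harmonic_at G v z"
  shows "harmonic_at G' w z"
  using harm harmonic_at_iff_euler_lagrange[OF S v G nz(1)] harmonic_at_iff_euler_lagrange[OF S w G' nz(2)]
    euler_lagrange_change_of_coordinates[OF assms(1-12)] by simp

text \<open>Written in real derivatives, the complex quadratic term is a quarter of the real one
  plus an imaginary part that is antisymmetric in j and k, and the symmetric Christoffel symbols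
  annihilate the latter.\<close>

lemma harmonic_at_imp_complex:
  fixes v :: "complex \<Rightarrow> real ^ 'n"
  assumes S: "open S" "z \<in> S" and v: "Ck_on 2 S v" and sym: "\<And>l j k. metric_partial G (v z) l j k = metric_partial G (v z) l k j"
    and harm: "harmonic_at G v z"
  shows "d_dz (d_dzbar (\<lambda>z. complex_of_real (v z $ i))) z +
    (\<Sum>j\<in>UNIV. \<Sum>k\<in>UNIV. complex_of_real (christoffel_symbol G (v z) i j k) *
      d_dz (\<lambda>z. complex_of_real (v z $ j)) z * d_dzbar (\<lambda>z. complex_of_real (v z $ k)) z) = 0"
proof -
  let ?v = "\<lambda>e z. frechet_derivative v (at z) e"
  let ?vv = "\<lambda>e f. frechet_derivative (\<lambda>z. ?v e z) (at z) f"
  have v2: "Ck_on (Suc (Suc 0)) S v" using v by (simp add: numeral_2_eq_2)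
  have dv: "((\<lambda>z. complex_of_real (v z $ i)) has_derivative (\<lambda>e. complex_of_real (?v e y $ i))) (at y)" if "y \<in> S" for y i
    by (intro bounded_linear.has_derivative[OF bounded_linear_of_real] bounded_linear.has_derivative[OF bounded_linear_vec_nth]
        Ck_on_SucD[OF v2 that])
  have dz: "d_dz (\<lambda>z. complex_of_real (v z $ j)) y = (of_real (?v 1 y $ j) - \<i> * of_real (?v \<i> y $ j)) / 2"
    and dzbar: "d_dzbar (\<lambda>z. complex_of_real (v z $ j)) y = (of_real (?v 1 y $ j) + \<i> * of_real (?v \<i> y $ j)) / 2"
    if "y \<in> S" for y j
    unfolding d_dz_def d_dzbar_def frechet_derivative_eqI[OF dv[OF that]] by simp_all
  have ddv: "((\<lambda>z. complex_of_real (?v e z $ i)) has_derivative (\<lambda>f. complex_of_real (?vv e f $ i))) (at z)" for e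
    by (intro bounded_linear.has_derivative[OF bounded_linear_of_real] bounded_linear.has_derivative[OF bounded_linear_vec_nth]
        Ck_on_SucD[OF Ck_on_frechet[OF v2] S(2)])
  have "((\<lambda>y. (complex_of_real (?v 1 y $ i) + \<i> * of_real (?v \<i> y $ i)) / 2) has_derivative
      (\<lambda>f. (complex_of_real (?vv 1 f $ i) + \<i> * of_real (?vv \<i> f $ i)) / 2)) (at z)"
    by (intro bounded_linear.has_derivative[OF bounded_linear_divide] has_derivative_add has_derivative_mult_right ddv)
  then have "((d_dzbar (\<lambda>z. complex_of_real (v z $ i))) has_derivative
      (\<lambda>f. (complex_of_real (?vv 1 f $ i) + \<i> * of_real (?vv \<i> f $ i)) / 2)) (at z)"
    by (rule has_derivative_transform_within_open[OF _ S]) (simp add: dzbar)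
  then have "d_dz (d_dzbar (\<lambda>z. complex_of_real (v z $ i))) z =
      ((complex_of_real (?vv 1 1 $ i) + \<i> * of_real (?vv \<i> 1 $ i)) / 2 -
        \<i> * ((complex_of_real (?vv 1 \<i> $ i) + \<i> * of_real (?vv \<i> \<i> $ i)) / 2)) / 2"
    unfolding d_dz_def by (simp add: frechet_derivative_eqI)
  also have "?vv \<i> 1 = ?vv 1 \<i>" by (rule second_derivative_symmetric[OF S v])
  also have "((complex_of_real (?vv 1 1 $ i) + \<i> * of_real (?vv 1 \<i> $ i)) / 2 -
        \<i> * ((complex_of_real (?vv 1 \<i> $ i) + \<i> * of_real (?vv \<i> \<i> $ i)) / 2)) / 2 = of_real (laplacian v z $ i) / 4"
    by (simp add: laplacian_def complex_eq_iff)
  finally have lap: "d_dz (d_dzbar (\<lambda>z. complex_of_real (v z $ i))) z = of_real (laplacian v z $ i) / 4" .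
  let ?\<Gamma> = "christoffel_symbol G (v z) i"
  have \<Gamma>: "?\<Gamma> j k = ?\<Gamma> k j" for j k
    by (simp add: christoffel_symbol_def sym[of _ j k] add.commute)
  have anti: "(\<Sum>j\<in>UNIV. \<Sum>k\<in>UNIV. ?\<Gamma> j k * (?v 1 z $ j * ?v \<i> z $ k)) = (\<Sum>j\<in>UNIV. \<Sum>k\<in>UNIV. ?\<Gamma> j k * (?v \<i> z $ j * ?v 1 z $ k))"
    by (subst sum.swap) (intro sum.cong refl, simp add: \<Gamma> mult.commute)
  let ?X = "\<Sum>j\<in>UNIV. \<Sum>k\<in>UNIV. ?\<Gamma> j k * (?v 1 z $ j * ?v 1 z $ k + ?v \<i> z $ j * ?v \<i> z $ k)"
  have "(\<Sum>j\<in>UNIV. \<Sum>k\<in>UNIV. complex_of_real (?\<Gamma> j k) *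
      d_dz (\<lambda>z. complex_of_real (v z $ j)) z * d_dzbar (\<lambda>z. complex_of_real (v z $ k)) z) =
      (of_real (\<Sum>j\<in>UNIV. \<Sum>k\<in>UNIV. ?\<Gamma> j k * (?v 1 z $ j * ?v 1 z $ k + ?v \<i> z $ j * ?v \<i> z $ k)) +
       \<i> * of_real ((\<Sum>j\<in>UNIV. \<Sum>k\<in>UNIV. ?\<Gamma> j k * (?v 1 z $ j * ?v \<i> z $ k)) -
         (\<Sum>j\<in>UNIV. \<Sum>k\<in>UNIV. ?\<Gamma> j k * (?v \<i> z $ j * ?v 1 z $ k)))) / 4"
    unfolding dz[OF S(2)] dzbar[OF S(2)]
    by (simp add: of_real_sum sum_divide_distrib sum_distrib_left sum_subtractf[symmetric] sum.distrib[symmetric])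
      (intro sum.cong refl, simp add: field_simps)
  also have "\<dots> = of_real ?X / 4" unfolding anti by simp
  finally have sum: "(\<Sum>j\<in>UNIV. \<Sum>k\<in>UNIV. complex_of_real (?\<Gamma> j k) *
      d_dz (\<lambda>z. complex_of_real (v z $ j)) z * d_dzbar (\<lambda>z. complex_of_real (v z $ k)) z) = of_real ?X / 4" .
  have "laplacian v z $ i + ?X = 0" using harm by (simp add: harmonic_at_def)
  from arg_cong[OF this, of complex_of_real]
  have "complex_of_real (laplacian v z $ i) + of_real ?X = 0" by (simp only: of_real_0 of_real_add)
  then show ?thesis unfolding lap sum by (simp only: add_divide_distrib[symmetric] div_0)
qed

section \<open>Lifting coordinate discs to the manifold\<close>

context riemannian_manifold
begin

lemma christoffel_eq: "christoffel A g c x i j k = christoffel_symbol (metric_matrix A g c) x i j k"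
  by (simp add: christoffel_def christoffel_symbol_def metric_deriv_def metric_partial_def)

lemma metric_matrix_has_derivative:
  assumes c: "c \<in> A" and x: "x \<in> chart_image c"
  obtains D where "(metric_matrix A g c has_derivative D) (at x)"
proof -
  note o = open_image[OF c]
  have "Ck_on 1 (chart_image c) (metric_matrix A g c)"
  proof (rule Ck_on_componentwise[OF o])
    fix b :: "real ^ 'n ^ 'n" assume "b \<in> Basis"
    then obtain i j where "b = axis i (axis j 1)" by (auto simp: Basis_vec_def)
    then have "(\<lambda>x. metric_matrix A g c x \<bullet> b) = (\<lambda>x. metric_matrix A g c x $ i $ j)" by (simp add: inner_axis)
    then show "Ck_on 1 (chart_image c) (\<lambda>x. metric_matrix A g c x \<bullet> b)"
      using metric_smooth[OF c, of i j] by (simp only: smooth_on_def)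
  qed
  then have "(metric_matrix A g c has_derivative frechet_derivative (metric_matrix A g c) (at x)) (at x)"
    unfolding One_nat_def by (rule Ck_on_SucD[OF _ x])
  then show ?thesis by (rule that)
qed

text \<open>Both sides are the metric on the same two tangent vectors, read in the charts d and
  c.\<close>

lemma metric_matrix_pullback:
  assumes c: "c \<in> A" and d: "d \<in> A" and y: "y \<in> snd d ` (fst d \<inter> fst c)"
  shows "a \<bullet> (metric_matrix A g d y *v b) = frechet_derivative (snd c \<circ> chart_inv d) (at y) a \<bullet>
    (metric_matrix A g c ((snd c \<circ> chart_inv d) y) *v frechet_derivative (snd c \<circ> chart_inv d) (at y) b)"
proof -
  have y': "y \<in> chart_image d" and pc: "chart_inv d y \<in> fst c" and yy: "snd d (chart_inv d y) = y"
    using y chart_inv_chart[OF d] by auto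
  let ?E = "differential A (chart_inv d) y"
  note T = differential_chart_inv_tangent[OF d y']
  have "g (chart_inv d y) (?E a) (?E b) = a \<bullet> (metric_matrix A g d y *v b)"
    using metric_chart[OF T T d chart_inv_mem[OF d y']] differential_chart_inv[OF d y'] yy by simp
  moreover have "?E a c = frechet_derivative (snd c \<circ> chart_inv d) (at y) a" for a
    using c pc by (simp add: differential_def)
  ultimately show ?thesis using metric_chart[OF T T c pc, of a b] by simp
qed

text \<open>The equation is required in every chart of the atlas, while the disc was built in a
  single one; invariance under the transition maps carries it over.\<close>

lemma harmonic_disc_lift:
  assumes c: "c \<in> A" and v: "\<And>k. Ck_on k unit_disc v" and range: "v ` unit_disc \<subseteq> chart_image c"
    and harm: "\<And>z. z \<in> unit_disc \<Longrightarrow> harmonic_at (metric_matrix A g c) v z"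
  shows "harmonic_disc A g (\<lambda>z. chart_inv c (v z))"
proof -
  let ?u = "\<lambda>z. chart_inv c (v z)"
  have vi: "v z \<in> chart_image c" if "z \<in> unit_disc" for z using range that by auto
  have uc: "?u z \<in> fst c" "snd c (?u z) = v z" if "z \<in> unit_disc" for z
    using chart_inv_mem[OF c vi[OF that]] chart_chart_inv[OF c vi[OF that]] by auto
  have smooth: "smooth_map_on A unit_disc ?u"
  proof (rule smooth_map_on_chartI[OF open_ball c])
    show "?u ` unit_disc \<subseteq> fst c" using uc by auto
    have "smooth_on unit_disc v" using v by (simp add: smooth_on_def)
    then show "smooth_on unit_disc (\<lambda>z. snd c (?u z))"
      using smooth_on_cong[OF open_ball, of 0 1 v "\<lambda>z. snd c (?u z)"] uc(2) by simp
  qed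
  have "d_dz (d_dzbar (coord_fun d ?u i)) z +
        (\<Sum>j\<in>UNIV. \<Sum>k\<in>UNIV. complex_of_real (christoffel A g d (snd d (?u z)) i j k) *
           d_dz (coord_fun d ?u j) z * d_dzbar (coord_fun d ?u k) z) = 0"
    if d: "d \<in> A" and z: "z \<in> unit_disc" and zd: "?u z \<in> fst d" for d z i
  proof -
    let ?w = "\<lambda>z. snd d (?u z)" and ?S = "{z \<in> unit_disc. ?u z \<in> fst d}" and ?T = "snd d ` (fst d \<inter> fst c)"
    let ?\<sigma> = "snd c \<circ> chart_inv d"
    have S: "open ?S" "z \<in> ?S"
      using smooth_map_on_open_preimage[OF smooth open_ball open_domain[OF d]] z zd by auto
    have w2: "Ck_on 2 ?S ?w" using smooth_map_on_coord[OF smooth d] by (simp add: smooth_on_def o_def)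
    have v2: "Ck_on 2 ?S v" by (rule Ck_on_subset[OF v]) auto
    have T: "?w z \<in> ?T" if "z \<in> ?S" for z using that uc by auto
    have \<sigma>: "?\<sigma> (?w z) = v z" if "z \<in> ?S" for z using that uc chart_inv_chart[OF d] by simp
    have \<sigma>2: "Ck_on 2 ?T ?\<sigma>" using smooth_transition[OF d c] by (simp add: smooth_on_def)
    have wz: "?w z \<in> chart_image d" using zd by auto
    obtain DG where DG: "(metric_matrix A g c has_derivative DG) (at (v z))"
      by (rule metric_matrix_has_derivative[OF c vi[OF z]])
    obtain DG' where DG': "(metric_matrix A g d has_derivative DG') (at (?w z))"
      by (rule metric_matrix_has_derivative[OF d wz])
    have "harmonic_at (metric_matrix A g d) ?w z"
      by (rule harmonic_at_change_of_coordinates[OF S w2 v2 open_overlap[OF d c] T \<sigma>2 \<sigma> DG DG' metric_matrix_sym[OF c vi[OF z]]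
            metric_matrix_pullback[OF c d] pos_def_det_nz[OF metric_matrix_pos[OF c vi[OF z]]]
            pos_def_det_nz[OF metric_matrix_pos[OF d wz]] harm[OF z]])
    from harmonic_at_imp_complex[OF S w2 metric_partial_sym[OF open_image[OF d] wz metric_matrix_sym[OF d]] this]
    show ?thesis unfolding coord_fun_def christoffel_eq .
  qed
  then show ?thesis using smooth unfolding harmonic_disc_def by blast
qed

text \<open>The conformality conditions on the derivatives in the directions 1 and \<i> extend by
  linearity to all vectors, with the factor m; since m is positive and smooth, ln m is an admissible
  exponent.\<close>

lemma conformal_harmonic_immersion_lift:
  assumes c: "c \<in> A" and v: "\<And>k. Ck_on k unit_disc v" and range: "v ` unit_disc \<subseteq> chart_image c"
    and harm: "\<And>z. z \<in> unit_disc \<Longrightarrow> harmonic_at (metric_matrix A g c) v z"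
    and conf: "\<And>z. z \<in> unit_disc \<Longrightarrow> conformal_immersive_at (metric_matrix A g c) v z"
  shows "conformal_harmonic_immersion A g (\<lambda>z. chart_inv c (v z))"
proof -
  let ?u = "\<lambda>z. chart_inv c (v z)" and ?G = "metric_matrix A g c"
  let ?D = "\<lambda>z. frechet_derivative v (at z)"
  have harm: "harmonic_disc A g ?u" by (rule harmonic_disc_lift[OF c v range harm])
  then have smooth: "smooth_map_on A unit_disc ?u" by (simp add: harmonic_disc_def)
  have vi: "v z \<in> chart_image c" if "z \<in> unit_disc" for z using range that by auto
  have uc: "?u z \<in> fst c" "snd c (?u z) = v z" if "z \<in> unit_disc" for z
    using chart_inv_mem[OF c vi[OF that]] chart_chart_inv[OF c vi[OF that]] by auto
  have dv: "(v has_derivative ?D z) (at z)" if "z \<in> unit_disc" for z by (rule Ck_on_SucD[OF v that])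
  have diff: "differential A ?u z a c = ?D z a" if z: "z \<in> unit_disc" for z a
  proof (rule differential_eqI)
    show "((\<lambda>z. snd c (?u z)) has_derivative ?D z) (at z)"
      by (rule has_derivative_transform_within_open[OF dv[OF z] open_ball z]) (simp add: uc(2))
  qed (use c uc(1)[OF z] in auto)
  define m where "m z = ?D z 1 \<bullet> (?G (v z) *v ?D z 1)" for z
  have pos: "m z > 0" if "z \<in> unit_disc" for z
    unfolding m_def by (rule metric_matrix_pos[OF c vi[OF that]]) (use conf[OF that] in \<open>simp add: conformal_immersive_at_def\<close>)
  have metric: "?D z a \<bullet> (?G (v z) *v ?D z b) = m z * (a \<bullet> b)" if z: "z \<in> unit_disc" for z a b
  proof -
    have lin: "linear (?D z)" using dv[OF z] by (simp add: has_derivative_def bounded_linear.linear)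
    have D: "?D z a = Re a *\<^sub>R ?D z 1 + Im a *\<^sub>R ?D z \<i>" for a
    proof -
      have "a = Re a *\<^sub>R 1 + Im a *\<^sub>R \<i>" by (simp add: complex_eq_iff)
      then have "?D z a = ?D z (Re a *\<^sub>R 1 + Im a *\<^sub>R \<i>)" by simp
      then show ?thesis by (simp only: linear_add[OF lin] linear_scale[OF lin])
    qed
    note C = conf[OF z, unfolded conformal_immersive_at_def]
    have "?D z \<i> \<bullet> (?G (v z) *v ?D z 1) = ?D z 1 \<bullet> (?G (v z) *v ?D z \<i>)"
      by (metis dot_lmul_matrix inner_commute metric_matrix_sym[OF c vi[OF z]] transpose_matrix_vector)
    then show ?thesis unfolding D[of a] D[of b] using C
      by (simp add: m_def matrix_vector_right_distrib matrix_vector_mult_scaleR inner_add_left inner_add_right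
          inner_complex_def algebra_simps)
  qed
  have tang: "differential A ?u z a \<in> tangent_space A (?u z)" if "z \<in> unit_disc" for z a
    by (rule differential_tangent[OF open_ball smooth that])
  have "inj (differential A ?u z)" if z: "z \<in> unit_disc" for z
  proof (rule injI)
    fix a b assume "differential A ?u z a = differential A ?u z b"
    then have "?D z a = ?D z b" using diff[OF z] by metis
    then have "?D z (a - b) = 0"
      using dv[OF z] by (simp add: has_derivative_def bounded_linear.linear linear_diff)
    then have "m z * ((a - b) \<bullet> (a - b)) = 0" using metric[OF z, of "a - b" "a - b"] by simp
    then show "a = b" using pos[OF z] by simp
  qed
  then have immersed: "immersed_disc A ?u" using smooth by (simp add: immersed_disc_def)
  have "smooth_on unit_disc (\<lambda>z. ln (m z))"
    unfolding smooth_on_def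
  proof
    fix k
    have D: "Ck_on k unit_disc (\<lambda>z. ?D z 1)" by (rule Ck_on_frechet[OF v])
    have G: "Ck_on k unit_disc (\<lambda>z. ?G (v z) $ i $ j)" for i j
      by (rule Ck_on_compose[OF open_ball open_image[OF c] v _ vi])
        (use metric_smooth[OF c] in \<open>simp_all add: smooth_on_def\<close>)
    have "Ck_on k unit_disc (\<lambda>z. \<Sum>i\<in>UNIV. ?D z 1 $ i * (\<Sum>j\<in>UNIV. ?G (v z) $ i $ j * ?D z 1 $ j))"
      by (intro Ck_on_sum Ck_on_mult Ck_on_nth D G open_ball)
    then have "Ck_on k unit_disc m"
      by (simp add: m_def[abs_def] inner_vec_def matrix_vector_mult_def)
    then show "Ck_on k unit_disc (\<lambda>z. ln (m z))" by (rule Ck_on_ln[OF open_ball _ pos])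
  qed
  moreover have "g (?u z) (differential A ?u z a) (differential A ?u z b) = exp (ln (m z)) * (a \<bullet> b)"
    if z: "z \<in> unit_disc" for z a b
    using metric_chart[OF tang[OF z] tang[OF z] c uc(1)[OF z], of a b] diff[OF z] metric[OF z] uc(2)[OF z] pos[OF z] by simp
  ultimately have "conformal_disc A g ?u" using smooth unfolding conformal_disc_def by blast
  then show ?thesis using immersed harm by (simp add: conformal_harmonic_immersion_def)
qed

end

section \<open>The Kobayashi pseudodistance\<close>

lemma kobayashi_dist_le_poincare:
  assumes "conformal_harmonic_immersion A g u" "z \<in> unit_disc" "w \<in> unit_disc"
  shows "kobayashi_dist A g (u z) (u w) \<le> ennreal (poincare_dist z w)"
  unfolding kobayashi_dist_def
  by (rule INF_lower2[of "[(z, w, u)]"]) (use assms in \<open>auto simp: kobayashi_chain_def\<close>)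

lemma kobayashi_chain_append:
  assumes 1: "kobayashi_chain A g p q ch1" and 2: "kobayashi_chain A g q r ch2"
  shows "kobayashi_chain A g p r (ch1 @ ch2)"
proof -
  let ?R = "\<lambda>x y. case (x, y) of ((z, w, u), (z', w', u')) \<Rightarrow> u w = u' z'"
  have ne: "ch1 \<noteq> []" "ch2 \<noteq> []" using 1 2 by (auto simp: kobayashi_chain_def)
  have "?R ((ch1 @ ch2) ! k) ((ch1 @ ch2) ! Suc k)" if k: "Suc k < length (ch1 @ ch2)" for k
  proof -
    consider "Suc k < length ch1" | "Suc k = length ch1" | "length ch1 \<le> k" by linarith
    then show ?thesis
    proof cases
      case 1
      then show ?thesis using assms(1) by (simp add: kobayashi_chain_def nth_append)
    next
      case 2
      then have "(ch1 @ ch2) ! k = last ch1" "(ch1 @ ch2) ! Suc k = hd ch2"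
        using ne by (auto simp: nth_append last_conv_nth hd_conv_nth simp flip: 2)
      then show ?thesis using 1 assms(2) by (auto simp: kobayashi_chain_def split: prod.splits)
    next
      case 3
      then have "Suc (k - length ch1) < length ch2" using k by auto
      then have "?R (ch2 ! (k - length ch1)) (ch2 ! Suc (k - length ch1))" using assms(2) by (simp add: kobayashi_chain_def)
      then show ?thesis using 3 by (simp add: nth_append Suc_diff_le)
    qed
  qed
  then show ?thesis using 1 2 ne unfolding kobayashi_chain_def by auto
qed

text \<open>The quotient d in the Poincare distance is the modulus of a Moebius function, which
  makes the facts about disc automorphisms applicable.\<close>

lemma poincare_dist_Moebius:
  "poincare_dist z w = ln ((1 + cmod (Moebius_function 0 z w)) / (1 - cmod (Moebius_function 0 z w))) / 2"
proof -
  have "cmod (1 - z * cnj w) = cmod (1 - cnj z * w)"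
    using complex_mod_cnj[of "1 - z * cnj w"] by simp
  then show ?thesis
    by (simp add: poincare_dist_def Moebius_function_simple norm_divide norm_minus_commute Let_def)
qed

lemma poincare_dist_nonneg:
  assumes "z \<in> unit_disc" "w \<in> unit_disc" shows "poincare_dist z w \<ge> 0"
proof -
  have "cmod (Moebius_function 0 z w) < 1" using assms by (intro Moebius_function_norm_lt_1) auto
  then have "(1 + cmod (Moebius_function 0 z w)) / (1 - cmod (Moebius_function 0 z w)) \<ge> 1" by simp
  then show ?thesis unfolding poincare_dist_Moebius by simp
qed

lemma kobayashi_chain_length_nonneg:
  assumes "kobayashi_chain A g p q ch" shows "(\<Sum>(z, w, u)\<leftarrow>ch. poincare_dist z w) \<ge> 0"
  by (rule sum_list_nonneg) (use assms in \<open>auto simp: kobayashi_chain_def intro!: poincare_dist_nonneg\<close>)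

lemma kobayashi_dist_less_ex_chain:
  assumes "kobayashi_dist A g p q < a"
  obtains ch where "kobayashi_chain A g p q ch" "ennreal (\<Sum>(z, w, u)\<leftarrow>ch. poincare_dist z w) < a"
  using assms unfolding kobayashi_dist_def INF_less_iff by blast

lemma kobayashi_dist_triangle: "kobayashi_dist A g p r \<le> kobayashi_dist A g p q + kobayashi_dist A g q r"
proof (rule ennreal_le_epsilon)
  fix e :: real assume fin: "kobayashi_dist A g p q + kobayashi_dist A g q r < top" and e: "e > 0"
  have "x < x + ennreal (e / 2)" if "x < top" for x :: ennreal
    using that e by (cases x) (auto simp flip: ennreal_plus simp: ennreal_less_iff)
  then have lt: "kobayashi_dist A g p q < kobayashi_dist A g p q + ennreal (e / 2)"
    "kobayashi_dist A g q r < kobayashi_dist A g q r + ennreal (e / 2)"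
    using fin by (auto simp: less_top)
  obtain ch1 where 1: "kobayashi_chain A g p q ch1"
    "ennreal (\<Sum>(z, w, u)\<leftarrow>ch1. poincare_dist z w) < kobayashi_dist A g p q + ennreal (e / 2)"
    by (rule kobayashi_dist_less_ex_chain[OF lt(1)])
  obtain ch2 where 2: "kobayashi_chain A g q r ch2"
    "ennreal (\<Sum>(z, w, u)\<leftarrow>ch2. poincare_dist z w) < kobayashi_dist A g q r + ennreal (e / 2)"
    by (rule kobayashi_dist_less_ex_chain[OF lt(2)])
  have "kobayashi_dist A g p r \<le> ennreal (\<Sum>(z, w, u)\<leftarrow>ch1 @ ch2. poincare_dist z w)"
    unfolding kobayashi_dist_def
    by (rule INF_lower) (use kobayashi_chain_append[OF 1(1) 2(1)] in simp)
  also have "\<dots> = ennreal (\<Sum>(z, w, u)\<leftarrow>ch1. poincare_dist z w) + ennreal (\<Sum>(z, w, u)\<leftarrow>ch2. poincare_dist z w)"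
    using kobayashi_chain_length_nonneg[OF 1(1)] kobayashi_chain_length_nonneg[OF 2(1)]
    by (simp add: ennreal_plus)
  also have "\<dots> \<le> (kobayashi_dist A g p q + ennreal (e / 2)) + (kobayashi_dist A g q r + ennreal (e / 2))"
    using 1(2) 2(2) by (intro add_mono) auto
  also have "\<dots> = kobayashi_dist A g p q + kobayashi_dist A g q r + (ennreal (e / 2) + ennreal (e / 2))"
    by (simp only: ac_simps)
  also have "ennreal (e / 2) + ennreal (e / 2) = ennreal e" using e by (simp flip: ennreal_plus)
  finally show "kobayashi_dist A g p r \<le> kobayashi_dist A g p q + kobayashi_dist A g q r + ennreal e" .
qed

text \<open>By ln x \<le> x - 1; the bound s \<le> 1/2 keeps the denominator 1 - s at least
  1/2.\<close>

lemma poincare_dist_0_le: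
  assumes "0 \<le> s" "s \<le> 1/2" shows "poincare_dist 0 (of_real s) \<le> 2 * s"
proof -
  have "ln ((1 + s) / (1 - s)) \<le> (1 + s) / (1 - s) - 1" using assms by (intro ln_le_minus_one divide_pos_pos) auto
  also have "\<dots> = 2 * s / (1 - s)" using assms by (simp add: field_simps)
  also have "\<dots> \<le> 2 * s / (1/2)" using assms by (intro divide_left_mono) auto
  finally show ?thesis using assms by (simp add: poincare_dist_def)
qed

text \<open>Two nearby points lie on a single disc, which is a one-element chain of length at most 2
  s \<le> 2 C norm (x - y).\<close>

lemma (in riemannian_manifold) kobayashi_locally_lipschitz:
  assumes dim: "CARD('n) \<ge> 2" and c: "c \<in> A" and p: "p \<in> fst c"
  obtains C \<delta> where "C > 0" "\<delta> > 0" "ball (snd c p) \<delta> \<subseteq> chart_image c"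
    "\<And>x y. x \<in> ball (snd c p) \<delta> \<Longrightarrow> y \<in> ball (snd c p) \<delta> \<Longrightarrow>
      kobayashi_dist A g (chart_inv c x) (chart_inv c y) \<le> ennreal (C * norm (x - y))"
proof -
  obtain \<rho> where \<rho>: "\<rho> > 0" "ball (snd c p) \<rho> \<subseteq> chart_image c" and "local_metric (metric_matrix A g c) (snd c p) \<rho>"
    by (rule local_metric_chart[OF c p])
  then interpret local_metric "metric_matrix A g c" "snd c p" \<rho> by simp
  obtain C \<delta> where C: "C > 0" "\<delta> > 0" "\<delta> \<le> \<rho>" and disc:
    "\<And>x y. x \<in> ball (snd c p) \<delta> \<Longrightarrow> y \<in> ball (snd c p) \<delta> \<Longrightarrow> \<exists>u s. 0 \<le> s \<and> s \<le> 1/2 \<and> s \<le> C * norm (x - y) \<and>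
       (\<forall>k. Ck_on k unit_disc u) \<and> u ` unit_disc \<subseteq> ball (snd c p) \<rho> \<and> u 0 = x \<and> u (of_real s) = y \<and>
       (\<forall>z\<in>unit_disc. harmonic_at (metric_matrix A g c) u z \<and> conformal_immersive_at (metric_matrix A g c) u z)"
    by (rule coordinate_discs[OF dim]) blast
  have "kobayashi_dist A g (chart_inv c x) (chart_inv c y) \<le> ennreal (2 * C * norm (x - y))"
    if xy: "x \<in> ball (snd c p) \<delta>" "y \<in> ball (snd c p) \<delta>" for x y
  proof -
    obtain u s where s: "0 \<le> s" "s \<le> 1/2" "s \<le> C * norm (x - y)" and u: "\<And>k. Ck_on k unit_disc u"
      "u ` unit_disc \<subseteq> ball (snd c p) \<rho>" "u 0 = x" "u (of_real s) = y"
      "\<And>z. z \<in> unit_disc \<Longrightarrow> harmonic_at (metric_matrix A g c) u z"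
      "\<And>z. z \<in> unit_disc \<Longrightarrow> conformal_immersive_at (metric_matrix A g c) u z"
      using disc[OF xy] by blast
    have "conformal_harmonic_immersion A g (\<lambda>z. chart_inv c (u z))"
      by (rule conformal_harmonic_immersion_lift[OF c u(1) order_trans[OF u(2) \<rho>(2)] u(5,6)])
    from kobayashi_dist_le_poincare[OF this, of 0 "of_real s"]
    have "kobayashi_dist A g (chart_inv c x) (chart_inv c y) \<le> ennreal (poincare_dist 0 (of_real s))"
      using s u(3,4) by simp
    also have "\<dots> \<le> ennreal (2 * C * norm (x - y))"
      using poincare_dist_0_le[OF s(1,2)] s(3) by (intro ennreal_leI) simp
    finally show ?thesis .
  qed
  moreover have "ball (snd c p) \<delta> \<subseteq> chart_image c" using C(3) \<rho>(2) by (meson order_trans subset_ball)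
  ultimately show ?thesis using that[of "2 * C" \<delta>] C by simp
qed

section \<open>Reparametrization of discs\<close>

lemma wirtinger_linear:
  fixes D :: "complex \<Rightarrow> complex"
  assumes "linear D"
  shows "D h = (D 1 - \<i> * D \<i>) / 2 * h + (D 1 + \<i> * D \<i>) / 2 * cnj h"
  unfolding linear_complex_decomp[OF assms, of h] by (simp add: complex_eq_iff field_simps)

lemma wirtinger_compose:
  assumes f: "(f has_derivative D) (at (\<phi> z))" and \<phi>: "(\<phi> has_field_derivative \<phi>') (at z)"
  shows "d_dz (\<lambda>z. f (\<phi> z)) z = d_dz f (\<phi> z) * \<phi>'"
    and "d_dzbar (\<lambda>z. f (\<phi> z)) z = d_dzbar f (\<phi> z) * cnj \<phi>'"
proof -
  have "(\<phi> has_derivative (\<lambda>v. \<phi>' * v)) (at z)" using \<phi> by (simp add: has_field_derivative_def)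
  from has_derivative_compose[OF this f]
  have c: "frechet_derivative (\<lambda>z. f (\<phi> z)) (at z) = (\<lambda>v. D (\<phi>' * v))" by (rule frechet_derivative_eqI)
  have D: "frechet_derivative f (at (\<phi> z)) = D" by (rule frechet_derivative_eqI[OF f])
  have lin: "linear D" using f by (simp add: has_derivative_def bounded_linear.linear)
  show "d_dz (\<lambda>z. f (\<phi> z)) z = d_dz f (\<phi> z) * \<phi>'" "d_dzbar (\<lambda>z. f (\<phi> z)) z = d_dzbar f (\<phi> z) * cnj \<phi>'"
    unfolding d_dz_def d_dzbar_def c D wirtinger_linear[OF lin, of "\<phi>' * 1"] wirtinger_linear[OF lin, of "\<phi>' * \<i>"]
    by (simp_all add: algebra_simps add_divide_distrib diff_divide_distrib)
qed

text \<open>The conjugate of h is antiholomorphic, so the z-derivative treats it as a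
  constant.\<close>

lemma d_dz_mult_cnj:
  assumes f: "(f has_derivative D) (at z)" and h: "(h has_field_derivative h') (at z)"
  shows "d_dz (\<lambda>z. f z * cnj (h z)) z = d_dz f z * cnj (h z)"
proof -
  have "(h has_derivative (\<lambda>v. h' * v)) (at z)" using h by (simp add: has_field_derivative_def)
  from has_derivative_mult[OF f bounded_linear.has_derivative[OF bounded_linear_cnj this]]
  have "frechet_derivative (\<lambda>z. f z * cnj (h z)) (at z) = (\<lambda>v. f z * cnj (h' * v) + D v * cnj (h z))"
    by (rule frechet_derivative_eqI)
  then show ?thesis unfolding d_dz_def frechet_derivative_eqI[OF f] by (simp add: algebra_simps)
qed

context riemannian_manifold
begin

text \<open>Both terms of the equation are multiplied by |\<phi>'|^2; this is the conformal
  invariance of harmonicity in dimension two.\<close>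

lemma harmonic_disc_compose:
  assumes u: "harmonic_disc A g u" and \<phi>: "\<phi> holomorphic_on unit_disc" "\<phi> ` unit_disc \<subseteq> unit_disc"
  shows "harmonic_disc A g (\<lambda>z. u (\<phi> z))"
proof -
  have su: "smooth_map_on A unit_disc u" using u by (simp add: harmonic_disc_def)
  have smooth: "smooth_map_on A unit_disc (\<lambda>z. u (\<phi> z))"
  proof (rule smooth_map_on_compose[OF open_ball open_ball su])
    show "smooth_on unit_disc \<phi>" unfolding smooth_on_def using Ck_on_holomorphic[OF open_ball \<phi>(1)] by blast
    show "\<phi> z \<in> unit_disc" if "z \<in> unit_disc" for z using \<phi>(2) that by blast
  qed
  have "d_dz (d_dzbar (coord_fun c (\<lambda>z. u (\<phi> z)) i)) z +
        (\<Sum>j\<in>UNIV. \<Sum>k\<in>UNIV. complex_of_real (christoffel A g c (snd c (u (\<phi> z))) i j k) *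
           d_dz (coord_fun c (\<lambda>z. u (\<phi> z)) j) z * d_dzbar (coord_fun c (\<lambda>z. u (\<phi> z)) k) z) = 0"
    if c: "c \<in> A" and z: "z \<in> unit_disc" and zc: "u (\<phi> z) \<in> fst c" for c z i
  proof -
    let ?f = "coord_fun c u" and ?S = "{z \<in> unit_disc. u (\<phi> z) \<in> fst c}" and ?T = "{z \<in> unit_disc. u z \<in> fst c}"
    have S: "open ?S" "z \<in> ?S" and T: "open ?T"
      using smooth_map_on_open_preimage[OF smooth open_ball open_domain[OF c]]
        smooth_map_on_open_preimage[OF su open_ball open_domain[OF c]] z zc by auto
    have ST: "\<phi> y \<in> ?T" if "y \<in> ?S" for y using that \<phi>(2) by blast
    have d\<phi>: "(\<phi> has_field_derivative deriv \<phi> y) (at y)" if "y \<in> ?S" for y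
      by (rule holomorphic_derivI[OF \<phi>(1) open_ball]) (use that in simp)
    have d2\<phi>: "(deriv \<phi> has_field_derivative deriv (deriv \<phi>) z) (at z)"
      by (rule holomorphic_derivI[OF holomorphic_deriv[OF \<phi>(1) open_ball] open_ball z])
    have fk: "Ck_on k ?T (?f i)" for i k
      using smooth_map_on_coord[OF su c] unfolding coord_fun_def smooth_on_def
      by (intro Ck_on_of_real Ck_on_nth T) (simp add: o_def)
    have df: "(?f i has_derivative frechet_derivative (?f i) (at y)) (at y)" if "y \<in> ?T" for y i
      by (rule Ck_on_SucD[OF fk that])
    have comp: "coord_fun c (\<lambda>z. u (\<phi> z)) i = (\<lambda>z. ?f i (\<phi> z))" for i by (simp add: coord_fun_def)
    note w = wirtinger_compose[OF df[OF ST] d\<phi>]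
    have "Ck_on 1 ?T (\<lambda>y. d_dzbar (?f i) y)"
      unfolding d_dzbar_def divide_inverse
      by (intro Ck_on_mult Ck_on_add Ck_on_const T Ck_on_frechet fk)
    then have dd: "(d_dzbar (?f i) has_derivative frechet_derivative (d_dzbar (?f i)) (at (\<phi> z))) (at (\<phi> z))"
      unfolding One_nat_def by (rule Ck_on_SucD[OF _ ST[OF S(2)]])
    have "frechet_derivative (d_dzbar (\<lambda>z. ?f i (\<phi> z))) (at z) =
        frechet_derivative (\<lambda>y. d_dzbar (?f i) (\<phi> y) * cnj (deriv \<phi> y)) (at z)"
      by (rule frechet_derivative_cong_open[OF S w(2)])
    then have "d_dz (d_dzbar (coord_fun c (\<lambda>z. u (\<phi> z)) i)) z = d_dz (\<lambda>y. d_dzbar (?f i) (\<phi> y) * cnj (deriv \<phi> y)) z"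
      by (simp only: d_dz_def comp)
    also have "\<dots> = d_dz (\<lambda>y. d_dzbar (?f i) (\<phi> y)) z * cnj (deriv \<phi> z)"
      by (rule d_dz_mult_cnj[OF has_derivative_compose[OF d\<phi>[OF S(2), unfolded has_field_derivative_def] dd] d2\<phi>])
    also have "\<dots> = d_dz (d_dzbar (?f i)) (\<phi> z) * deriv \<phi> z * cnj (deriv \<phi> z)"
      by (simp only: wirtinger_compose(1)[OF dd d\<phi>[OF S(2)]])
    finally have lap: "d_dz (d_dzbar (coord_fun c (\<lambda>z. u (\<phi> z)) i)) z = d_dz (d_dzbar (?f i)) (\<phi> z) * deriv \<phi> z * cnj (deriv \<phi> z)" .
    have "d_dz (d_dzbar (?f i)) (\<phi> z) + (\<Sum>j\<in>UNIV. \<Sum>k\<in>UNIV. complex_of_real (christoffel A g c (snd c (u (\<phi> z))) i j k) *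
           d_dz (?f j) (\<phi> z) * d_dzbar (?f k) (\<phi> z)) = 0" (is "?a + ?b = 0")
      using u c zc \<phi>(2) z unfolding harmonic_disc_def by blast
    moreover have "d_dz (d_dzbar (coord_fun c (\<lambda>z. u (\<phi> z)) i)) z +
        (\<Sum>j\<in>UNIV. \<Sum>k\<in>UNIV. complex_of_real (christoffel A g c (snd c (u (\<phi> z))) i j k) *
           d_dz (coord_fun c (\<lambda>z. u (\<phi> z)) j) z * d_dzbar (coord_fun c (\<lambda>z. u (\<phi> z)) k) z) =
        (?a + ?b) * (deriv \<phi> z * cnj (deriv \<phi> z))"
      unfolding comp lap[unfolded comp] w[OF S(2) S(2)] distrib_right sum_distrib_right by (simp only: mult_ac)
    ultimately show ?thesis by (simp only: mult_zero_left)
  qed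
  then show ?thesis using smooth unfolding harmonic_disc_def by blast
qed

text \<open>The exponent of the conformal factor acquires the summand ln |\<phi>'|^2, which is
  smooth because \<phi>' has no zeros.\<close>

lemma conformal_harmonic_immersion_compose:
  assumes u: "conformal_harmonic_immersion A g u" and \<phi>: "\<phi> holomorphic_on unit_disc" "\<phi> ` unit_disc \<subseteq> unit_disc"
    and nz: "\<And>z. z \<in> unit_disc \<Longrightarrow> deriv \<phi> z \<noteq> 0"
  shows "conformal_harmonic_immersion A g (\<lambda>z. u (\<phi> z))"
proof -
  have hu: "harmonic_disc A g u" and cu: "conformal_disc A g u" and iu: "immersed_disc A u"
    using u by (auto simp: conformal_harmonic_immersion_def)
  have su: "smooth_map_on A unit_disc u" using hu by (simp add: harmonic_disc_def)
  have harm: "harmonic_disc A g (\<lambda>z. u (\<phi> z))" by (rule harmonic_disc_compose[OF hu \<phi>])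
  then have smooth: "smooth_map_on A unit_disc (\<lambda>z. u (\<phi> z))" by (simp add: harmonic_disc_def)
  have \<phi>d: "\<phi> z \<in> unit_disc" if "z \<in> unit_disc" for z using \<phi>(2) that by blast
  have diff: "differential A (\<lambda>z. u (\<phi> z)) z v = differential A u (\<phi> z) (deriv \<phi> z * v)" if z: "z \<in> unit_disc" for z v
    by (rule differential_chain[OF su \<phi>d[OF z] holomorphic_derivI[OF \<phi>(1) open_ball z, unfolded has_field_derivative_def]])
  have "inj (differential A (\<lambda>z. u (\<phi> z)) z)" if z: "z \<in> unit_disc" for z
  proof (rule injI)
    fix v w assume "differential A (\<lambda>z. u (\<phi> z)) z v = differential A (\<lambda>z. u (\<phi> z)) z w"
    then have "differential A u (\<phi> z) (deriv \<phi> z * v) = differential A u (\<phi> z) (deriv \<phi> z * w)"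
      by (simp only: diff[OF z])
    moreover have "inj (differential A u (\<phi> z))" using iu \<phi>d[OF z] by (simp add: immersed_disc_def)
    ultimately have "deriv \<phi> z * v = deriv \<phi> z * w" by (simp only: inj_eq)
    then show "v = w" using nz[OF z] by simp
  qed
  then have imm: "immersed_disc A (\<lambda>z. u (\<phi> z))" using smooth unfolding immersed_disc_def by blast
  obtain \<psi> :: "complex \<Rightarrow> real" where \<psi>: "smooth_on unit_disc \<psi>" and conf:
    "\<And>z v w. z \<in> unit_disc \<Longrightarrow> g (u z) (differential A u z v) (differential A u z w) = exp (\<psi> z) * (v \<bullet> w)"
    using cu unfolding conformal_disc_def by blast
  define m where "m z = \<psi> (\<phi> z) + ln (deriv \<phi> z \<bullet> deriv \<phi> z)" for z
  have "smooth_on unit_disc m"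
    unfolding smooth_on_def m_def
  proof
    fix k
    have d: "Ck_on k unit_disc (deriv \<phi>)" by (rule Ck_on_holomorphic[OF open_ball holomorphic_deriv[OF \<phi>(1) open_ball]])
    have "Ck_on k unit_disc (\<lambda>z. \<psi> (\<phi> z))"
      by (rule Ck_on_compose[OF open_ball open_ball Ck_on_holomorphic[OF open_ball \<phi>(1)] _ \<phi>d]) (use \<psi> in \<open>simp_all add: smooth_on_def\<close>)
    moreover have "Ck_on k unit_disc (\<lambda>z. ln (deriv \<phi> z \<bullet> deriv \<phi> z))"
      by (rule Ck_on_ln[OF open_ball Ck_on_inner[OF open_ball d d]]) (use nz in simp)
    ultimately show "Ck_on k unit_disc (\<lambda>z. \<psi> (\<phi> z) + ln (deriv \<phi> z \<bullet> deriv \<phi> z))" by (rule Ck_on_add[OF open_ball])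
  qed
  moreover have "g (u (\<phi> z)) (differential A (\<lambda>z. u (\<phi> z)) z v) (differential A (\<lambda>z. u (\<phi> z)) z w) = exp (m z) * (v \<bullet> w)"
    if z: "z \<in> unit_disc" for z v w
  proof -
    have "(a * v) \<bullet> (a * w) = (a \<bullet> a) * (v \<bullet> w)" for a :: complex
      by (simp add: inner_complex_def algebra_simps)
    then show ?thesis
      unfolding diff[OF z] conf[OF \<phi>d[OF z]] m_def exp_add using nz[OF z] by simp
  qed
  ultimately have "conformal_disc A g (\<lambda>z. u (\<phi> z))" using smooth unfolding conformal_disc_def by blast
  then show ?thesis using imm harm by (simp add: conformal_harmonic_immersion_def)
qed

end

lemma Moebius_has_field_derivative_0:
  "(Moebius_function 0 w has_field_derivative 1 - w * cnj w) (at 0)"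
  unfolding Moebius_function_def by (auto intro!: derivative_eq_intros)

lemma Moebius_deriv_nonzero:
  assumes "w \<in> unit_disc" "z \<in> unit_disc"
  shows "deriv (Moebius_function 0 w) z \<noteq> 0"
proof -
  have "Moebius_function 0 (- w) (Moebius_function 0 w y) = y" if "y \<in> unit_disc" for y
    using Moebius_function_compose[of "- w" w y] assms(1) that by simp
  then have "inj_on (Moebius_function 0 w) unit_disc" by (rule inj_on_inverseI)
  moreover have "Moebius_function 0 w holomorphic_on unit_disc"
    by (rule Moebius_function_holomorphic) (use assms in simp)
  ultimately show ?thesis using assms(2) by (intro holomorphic_injective_imp_regular) auto
qed

section \<open>From chains of discs to paths\<close>

text \<open>
  The pseudometric need not be measurable along a path, and the integral of a function that is not
  measurable is a lower integral, which is not subadditive; hence the measurable majorant \<open>h\<close>.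
\<close>

definition path_bound ::
  "('m::topological_space, 'n::finite) chart set \<Rightarrow> ('m, 'n) metric \<Rightarrow> ennreal \<Rightarrow> 'm \<Rightarrow> 'm \<Rightarrow> bool" where
  "path_bound A g L p q \<longleftrightarrow> (\<exists>\<gamma> h N. piecewise_smooth_path A \<gamma> \<and> \<gamma> 0 = p \<and> \<gamma> 1 = q \<and>
     h \<in> borel_measurable borel \<and> finite N \<and>
     (\<forall>t\<in>{0..1} - N. (\<exists>T. open T \<and> t \<in> T \<and> smooth_map_on A T \<gamma>) \<and>
        kobayashi_royden A g (\<gamma> t) (differential A \<gamma> t 1) \<le> h t) \<and>
     (\<integral>\<^sup>+t. h t \<partial>lborel) \<le> L)"

lemma AE_lborel_not_finite: "finite N \<Longrightarrow> AE t in lborel. (t::real) \<notin> N"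
  by (rule AE_not_in[OF finite_imp_null_set_lborel])

lemma integrated_le_path_bound:
  assumes "path_bound A g L p q"
  shows "integrated_kobayashi_royden A g p q \<le> L"
proof -
  obtain \<gamma> h N where \<gamma>: "piecewise_smooth_path A \<gamma>" "\<gamma> 0 = p" "\<gamma> 1 = q" and N: "finite N"
    and h: "\<And>t. t \<in> {0..1} - N \<Longrightarrow> kobayashi_royden A g (\<gamma> t) (differential A \<gamma> t 1) \<le> h t"
    and L: "(\<integral>\<^sup>+t. h t \<partial>lborel) \<le> L"
    using assms unfolding path_bound_def by blast
  have "(\<integral>\<^sup>+t\<in>{0..1}. kobayashi_royden A g (\<gamma> t) (differential A \<gamma> t 1) \<partial>lborel) \<le> (\<integral>\<^sup>+t. h t \<partial>lborel)"
    by (rule nn_integral_mono_AE, rule AE_mp[OF AE_lborel_not_finite[OF N]])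
      (auto intro!: AE_I2 h split: split_indicator)
  then show ?thesis
    unfolding integrated_kobayashi_royden_def using \<gamma> L
    by (intro INF_lower2[of \<gamma>]) (auto simp: pathstart_def pathfinish_def)
qed

text \<open>A disc realising r for \<xi> realises r / a for a \<xi>. The factor 1 / a is moved to
  the other side first, so that the estimate can be made disc by disc under the infimum.\<close>

lemma kobayashi_royden_scale:
  assumes a: "a > 0"
  shows "kobayashi_royden A g p (\<lambda>c. a *\<^sub>R \<xi> c) \<le> ennreal a * kobayashi_royden A g p \<xi>"
proof (cases "\<xi> = (\<lambda>c. 0)")
  case True
  then show ?thesis by (simp add: kobayashi_royden_def)
next
  case False
  then have False': "(\<lambda>c. a *\<^sub>R \<xi> c) \<noteq> (\<lambda>c. 0)" using a by (auto simp: fun_eq_iff)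
  let ?R = "\<lambda>\<xi>. {r. r > 0 \<and> (\<exists>u. conformal_harmonic_immersion A g u \<and> u 0 = p \<and> differential A u 0 1 = (\<lambda>c. r *\<^sub>R \<xi> c))}"
  let ?F = "kobayashi_royden A g p (\<lambda>c. a *\<^sub>R \<xi> c)"
  have F: "?F = (INF r \<in> ?R (\<lambda>c. a *\<^sub>R \<xi> c). ennreal (1 / r))"
    and F': "kobayashi_royden A g p \<xi> = (INF r \<in> ?R \<xi>. ennreal (1 / r))"
    using False False' unfolding kobayashi_royden_def by (simp_all only: if_False)
  have "?F * ennreal (1 / a) \<le> kobayashi_royden A g p \<xi>"
    unfolding F'
  proof (rule INF_greatest)
    fix r assume r: "r \<in> ?R \<xi>"
    have "r / a \<in> ?R (\<lambda>c. a *\<^sub>R \<xi> c)" using r a by auto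
    then have "?F \<le> ennreal (1 / (r / a))" unfolding F by (rule INF_lower)
    then have "?F * ennreal (1 / a) \<le> ennreal (1 / (r / a)) * ennreal (1 / a)" by (rule mult_right_mono) simp
    also have "\<dots> = ennreal (1 / r)" using a r by (simp flip: ennreal_mult')
    finally show "?F * ennreal (1 / a) \<le> ennreal (1 / r)" .
  qed
  then have "ennreal a * (?F * ennreal (1 / a)) \<le> ennreal a * kobayashi_royden A g p \<xi>" by (rule mult_left_mono) simp
  moreover have "ennreal a * (?F * ennreal (1 / a)) = ?F * (ennreal a * ennreal (1 / a))" by (simp only: ac_simps)
  moreover have "ennreal a * ennreal (1 / a) = 1" using a by (simp flip: ennreal_mult')
  ultimately show ?thesis by simp
qed

context riemannian_manifold
begin

text \<open>The Moebius map carrying 0 to s has derivative 1 - s^2 at 0, so precomposition gives a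
  disc centred at U s that realises r = 1 - s^2.\<close>

lemma kobayashi_royden_disc:
  assumes U: "conformal_harmonic_immersion A g U" and s: "\<bar>s\<bar> < 1"
  shows "kobayashi_royden A g (U (of_real s)) (differential A U (of_real s) 1) \<le> ennreal (1 / (1 - s\<^sup>2))"
proof -
  let ?M = "Moebius_function 0 (- of_real s)"
  have sU: "smooth_map_on A unit_disc U" using U by (simp add: conformal_harmonic_immersion_def immersed_disc_def)
  have sd: "- complex_of_real s \<in> unit_disc" using s by simp
  have M0: "?M 0 = of_real s" by (simp add: Moebius_function_of_zero)
  have "conformal_harmonic_immersion A g (\<lambda>z. U (?M z))"
    by (rule conformal_harmonic_immersion_compose[OF U Moebius_function_holomorphic _ Moebius_deriv_nonzero])
      (use sd in \<open>auto intro!: Moebius_function_norm_lt_1\<close>)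
  moreover have "differential A (\<lambda>z. U (?M z)) 0 1 = (\<lambda>c. (1 - s\<^sup>2) *\<^sub>R differential A U (of_real s) 1 c)"
  proof -
    have "(?M has_derivative (\<lambda>v. (1 - (- of_real s) * cnj (- of_real s)) * v)) (at 0)"
      using Moebius_has_field_derivative_0 by (simp only: has_field_derivative_def)
    moreover have "?M 0 \<in> unit_disc" using s M0 by simp
    ultimately have "differential A (\<lambda>z. U (?M z)) 0 1 = differential A U (?M 0) ((1 - (- of_real s) * cnj (- of_real s)) * 1)"
      by (intro differential_chain[OF sU])
    also have "(1 - (- of_real s) * cnj (- of_real s)) * 1 = (1 - s\<^sup>2) *\<^sub>R (1::complex)"
      by (simp add: scaleR_conv_of_real power2_eq_square)
    finally show ?thesis unfolding M0 using s by (simp only: differential_add_scaleR(2)[OF sU] mem_ball_0 norm_of_real)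
  qed
  moreover have "1 - s\<^sup>2 > 0" using s by (simp add: abs_square_less_1)
  ultimately show ?thesis
    unfolding kobayashi_royden_def using M0 by (auto intro!: INF_lower)
qed

text \<open>Radii are geodesics from 0: the bound b / (1 - (t b)^2) along the radius integrates
  exactly to the Poincare distance from 0 to b.\<close>

lemma path_bound_radius:
  assumes U: "conformal_harmonic_immersion A g U" and b: "0 \<le> b" "b < 1"
  shows "path_bound A g (ennreal (ln ((1 + b) / (1 - b)) / 2)) (U 0) (U (of_real b))"
proof -
  let ?\<gamma> = "\<lambda>t. U (of_real (t * b))" and ?T = "{t. \<bar>t * b\<bar> < 1}"
  let ?h = "\<lambda>t. ennreal (b / (1 - (t * b)\<^sup>2)) * indicator {0..1} t"
  have sU: "smooth_map_on A unit_disc U" using U by (simp add: conformal_harmonic_immersion_def immersed_disc_def)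
  have T: "open ?T" by (intro open_Collect_less continuous_intros)
  have tb: "\<bar>t * b\<bar> < 1" if "t \<in> {0..1}" for t
  proof -
    have "t * b \<le> 1 * b" using that b by (intro mult_right_mono) auto
    then show ?thesis using that b by simp
  qed
  have sm: "smooth_map_on A ?T ?\<gamma>"
  proof (rule smooth_map_on_compose[OF T open_ball sU])
    have "bounded_linear (\<lambda>t. complex_of_real (t * b))"
      by (intro bounded_linear_compose[OF bounded_linear_of_real] bounded_linear_mult_left)
    then show "smooth_on ?T (\<lambda>t. complex_of_real (t * b))" unfolding smooth_on_def by (blast intro: Ck_on_bounded_linear)
    show "complex_of_real (t * b) \<in> unit_disc" if "t \<in> ?T" for t using that by (simp add: norm_mult abs_mult)
  qed
  have "smooth_curve_on A 0 1 ?\<gamma>"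
    unfolding smooth_curve_on_def using T sm tb by (intro exI[of _ ?T] exI[of _ ?\<gamma>]) auto
  moreover have "path ?\<gamma>"
    unfolding path_def by (rule continuous_on_subset[OF smooth_map_on_continuous[OF sm]]) (use tb in auto)
  ultimately have ps: "piecewise_smooth_path A ?\<gamma>"
    unfolding piecewise_smooth_path_def by (auto intro!: exI[of _ 1] exI[of _ real])
  have bound: "kobayashi_royden A g (?\<gamma> t) (differential A ?\<gamma> t 1) \<le> ?h t" if t: "t \<in> {0..1}" for t
  proof -
    have tb': "complex_of_real (t * b) \<in> unit_disc" using tb[OF t] by (simp add: norm_mult abs_mult)
    have "((\<lambda>t. complex_of_real (t * b)) has_derivative (\<lambda>v. of_real (v * b))) (at t)"
      by (auto intro!: derivative_eq_intros)
    then have "differential A ?\<gamma> t 1 = differential A U (of_real (t * b)) (of_real (1 * b))"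
      using tb' by (intro differential_chain[OF sU, where \<phi> = "\<lambda>t. complex_of_real (t * b)"])
    also have "of_real (1 * b) = b *\<^sub>R (1::complex)" by (simp add: scaleR_conv_of_real)
    finally have d: "differential A ?\<gamma> t 1 = (\<lambda>c. b *\<^sub>R differential A U (of_real (t * b)) 1 c)"
      by (simp only: differential_add_scaleR(2)[OF sU tb'])
    show ?thesis
    proof (cases "b = 0")
      case True
      then show ?thesis unfolding d by (simp add: kobayashi_royden_def)
    next
      case False
      then have "kobayashi_royden A g (?\<gamma> t) (differential A ?\<gamma> t 1) \<le>
          ennreal b * kobayashi_royden A g (?\<gamma> t) (differential A U (of_real (t * b)) 1)"
        unfolding d using b by (intro kobayashi_royden_scale) simp
      also have "\<dots> \<le> ennreal b * ennreal (1 / (1 - (t * b)\<^sup>2))"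
        by (intro mult_left_mono kobayashi_royden_disc[OF U tb[OF t]]) simp
      also have "\<dots> = ?h t" using b t by (simp flip: ennreal_mult')
      finally show ?thesis .
    qed
  qed
  have "(\<integral>\<^sup>+t. ?h t \<partial>lborel) = ennreal ((ln (1 + 1 * b) - ln (1 - 1 * b)) / 2 - (ln (1 + 0 * b) - ln (1 - 0 * b)) / 2)"
  proof (rule nn_integral_FTC_Icc)
    fix t :: real assume t: "t \<in> {0..1}"
    have pos: "1 + t * b > 0" "1 - t * b > 0" using tb[OF t] by auto
    have "((\<lambda>t. 1 + t * b) has_real_derivative b) (at t)" "((\<lambda>t. 1 - t * b) has_real_derivative - b) (at t)"
      by (auto intro!: derivative_eq_intros)
    note DERIV_chain2[where f = ln, OF DERIV_ln_divide[OF pos(1)] this(1)]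
      DERIV_chain2[where f = ln, OF DERIV_ln_divide[OF pos(2)] this(2)]
    from DERIV_cdivide[OF DERIV_diff[OF this], of 2]
    have "((\<lambda>t. (ln (1 + t * b) - ln (1 - t * b)) / 2) has_real_derivative (b / (1 + t * b) + b / (1 - t * b)) / 2) (at t)"
      by simp
    moreover have "(b / (1 + x) + b / (1 - x)) / 2 = b / (1 - x\<^sup>2)" if "1 + x > 0" "1 - x > 0" for x
    proof -
      have "b / (1 + x) + b / (1 - x) = (b * (1 - x) + b * (1 + x)) / ((1 + x) * (1 - x))"
        using that by (intro add_frac_eq) auto
      also have "b * (1 - x) + b * (1 + x) = 2 * b" by (simp add: algebra_simps)
      also have "(1 + x) * (1 - x) = 1 - x\<^sup>2" by (simp add: power2_eq_square algebra_simps)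
      finally have "b / (1 + x) + b / (1 - x) = 2 * (b / (1 - x\<^sup>2))" by (simp only: times_divide_eq_right)
      then show ?thesis by (simp only: nonzero_mult_div_cancel_left[OF zero_neq_numeral[symmetric]])
    qed
    ultimately show "((\<lambda>t. (ln (1 + t * b) - ln (1 - t * b)) / 2) has_real_derivative b / (1 - (t * b)\<^sup>2)) (at t)"
      using pos by simp
    have "(t * b)\<^sup>2 < 1" using tb[OF t] by (simp add: abs_square_less_1)
    then show "0 \<le> b / (1 - (t * b)\<^sup>2)" using b by simp
  qed auto
  also have "\<dots> = ennreal (ln ((1 + b) / (1 - b)) / 2)" using b by (simp add: ln_div)
  finally have int: "(\<integral>\<^sup>+t. ?h t \<partial>lborel) = ennreal (ln ((1 + b) / (1 - b)) / 2)" .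
  show ?thesis unfolding path_bound_def
  proof (rule exI[of _ ?\<gamma>], rule exI[of _ ?h], rule exI[of _ "{}"], intro conjI ballI)
    show "?h \<in> borel_measurable borel" by measurable
    show "\<exists>T. open T \<and> t \<in> T \<and> smooth_map_on A T ?\<gamma>" if "t \<in> {0..1} - {}" for t
      using T sm tb[of t] that by (intro exI[of _ ?T]) auto
    show "kobayashi_royden A g (?\<gamma> t) (differential A ?\<gamma> t 1) \<le> ?h t" if "t \<in> {0..1} - {}" for t
      using bound that by blast
    show "(\<integral>\<^sup>+t. ?h t \<partial>lborel) \<le> ennreal (ln ((1 + b) / (1 - b)) / 2)" unfolding int by simp
  qed (use ps in simp_all)
qed

text \<open>A disc automorphism taking 0 to z, preceded by a rotation that turns the positive axis
  towards the preimage of w, reduces the pair z, w to 0 and a point of a radius.\<close>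

lemma path_bound_disc:
  assumes u: "conformal_harmonic_immersion A g u" and zw: "z \<in> unit_disc" "w \<in> unit_disc"
  shows "path_bound A g (ennreal (poincare_dist z w)) (u z) (u w)"
proof -
  define \<mu> where "\<mu> = Moebius_function 0 z w"
  obtain \<kappa> where \<kappa>: "norm \<kappa> = 1" "\<kappa> * of_real (norm \<mu>) = \<mu>"
  proof (cases "\<mu> = 0")
    case False
    then show ?thesis by (intro that[of "\<mu> / of_real (norm \<mu>)"]) (simp_all add: norm_divide)
  qed (rule that[of 1], simp_all)
  have \<mu>: "norm \<mu> < 1" unfolding \<mu>_def using zw by (intro Moebius_function_norm_lt_1) auto
  let ?M = "Moebius_function 0 (- z)"
  have z': "- z \<in> unit_disc" using zw by simp
  have hol: "?M holomorphic_on unit_disc" using z' by (intro Moebius_function_holomorphic) simp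
  have Md: "?M y \<in> unit_disc" if "y \<in> unit_disc" for y
    using Moebius_function_norm_lt_1[of "- z" y 0] z' that by simp
  have rot: "\<kappa> * y \<in> unit_disc" if "y \<in> unit_disc" for y using that \<kappa>(1) by (simp add: norm_mult)
  have d: "((\<lambda>y. ?M (\<kappa> * y)) has_field_derivative deriv ?M (\<kappa> * y) * \<kappa>) (at y)" if "y \<in> unit_disc" for y
    by (rule DERIV_chain2[where f = ?M and g = "\<lambda>y. \<kappa> * y"], rule holomorphic_derivI[OF hol open_ball rot[OF that]])
      (auto intro!: derivative_eq_intros)
  have "conformal_harmonic_immersion A g (\<lambda>y. u (?M (\<kappa> * y)))"
  proof (rule conformal_harmonic_immersion_compose[OF u])
    show "(\<lambda>y. ?M (\<kappa> * y)) holomorphic_on unit_disc"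
      unfolding holomorphic_on_open[OF open_ball] using d by blast
    show "(\<lambda>y. ?M (\<kappa> * y)) ` unit_disc \<subseteq> unit_disc"
      using Md rot by blast
    show "deriv (\<lambda>y. ?M (\<kappa> * y)) y \<noteq> 0" if "y \<in> unit_disc" for y
    proof -
      have "\<kappa> \<noteq> 0" using \<kappa>(1) by auto
      then show ?thesis
        unfolding DERIV_imp_deriv[OF d[OF that]] using Moebius_deriv_nonzero[OF z' rot[OF that]] by simp
    qed
  qed
  from path_bound_radius[OF this, of "norm \<mu>"]
  have "path_bound A g (ennreal (ln ((1 + norm \<mu>) / (1 - norm \<mu>)) / 2)) (u (?M 0)) (u (?M \<mu>))"
    using \<mu> \<kappa>(2) by simp
  moreover have "?M 0 = z" by (simp add: Moebius_function_of_zero)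
  moreover have "?M \<mu> = w" unfolding \<mu>_def by (rule Moebius_function_compose) (use zw in auto)
  ultimately show ?thesis by (simp add: poincare_dist_Moebius \<mu>_def)
qed

end

section \<open>Affine reparametrization and concatenation of paths\<close>

context smooth_manifold
begin

lemma smooth_map_on_cong:
  assumes S: "open S" and eq: "\<And>x. x \<in> S \<Longrightarrow> f x = h x" and f: "smooth_map_on A S f"
  shows "smooth_map_on A S h"
proof -
  have "continuous_on S f = continuous_on S h" by (rule continuous_on_cong[OF refl]) (rule eq)
  then have "continuous_on S h" using smooth_map_on_continuous[OF f] by simp
  moreover have "smooth_on {x \<in> S. h x \<in> fst c} (snd c \<circ> h)" if c: "c \<in> A" for c
  proof -
    have e: "{x \<in> S. h x \<in> fst c} = {x \<in> S. f x \<in> fst c}" using eq by auto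
    have "smooth_on {x \<in> S. f x \<in> fst c} (snd c \<circ> f) = smooth_on {x \<in> S. f x \<in> fst c} (snd c \<circ> h)"
      by (rule smooth_on_cong[OF smooth_map_on_open_preimage[OF f S open_domain[OF c]]]) (simp add: eq)
    then show ?thesis unfolding e using smooth_map_on_coord[OF f c] by simp
  qed
  ultimately show ?thesis by (simp add: smooth_map_on_def)
qed

lemma smooth_map_on_affine:
  assumes "open T" "smooth_map_on A T f"
  shows "open {t::real. k * t + m \<in> T}" "smooth_map_on A {t. k * t + m \<in> T} (\<lambda>t. f (k * t + m))"
proof -
  have "continuous_on UNIV (\<lambda>t::real. k * t + m)" by (intro continuous_intros)
  from continuous_open_preimage[OF this open_UNIV assms(1)]
  show o: "open {t::real. k * t + m \<in> T}" by (simp add: vimage_def)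
  show "smooth_map_on A {t. k * t + m \<in> T} (\<lambda>t. f (k * t + m))"
  proof (rule smooth_map_on_compose[OF o assms])
    show "smooth_on {t. k * t + m \<in> T} (\<lambda>t. k * t + m)"
      unfolding smooth_on_def by (intro allI Ck_on_add Ck_on_mult Ck_on_const Ck_on_id o)
  qed simp
qed

lemma smooth_curve_on_affine:
  assumes "smooth_curve_on A a b \<gamma>" and eq: "\<And>t. t \<in> {a'..b'} \<Longrightarrow> k * t + m \<in> {a..b} \<and> \<gamma>' t = \<gamma> (k * t + m)"
  shows "smooth_curve_on A a' b' \<gamma>'"
proof -
  obtain T \<sigma> where T: "open T" "{a..b} \<subseteq> T" "smooth_map_on A T \<sigma>" "\<And>t. t \<in> {a..b} \<Longrightarrow> \<sigma> t = \<gamma> t"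
    using assms(1) unfolding smooth_curve_on_def by blast
  show ?thesis
    unfolding smooth_curve_on_def
    by (rule exI[of _ "{t. k * t + m \<in> T}"], rule exI[of _ "\<lambda>t. \<sigma> (k * t + m)"])
      (use smooth_map_on_affine[OF T(1,3), of k m] T(2,4) eq in auto)
qed

text \<open>The velocity is multiplied by k, and the pseudometric scales accordingly. Agreement of
  the two curves is asked for near t, so that the lemma applies on either half of a joined
  path.\<close>

lemma kobayashi_royden_affine:
  assumes T: "open T" "k * t + m \<in> T" "smooth_map_on A T \<gamma>" and k: "k > 0"
    and S: "open S" "t \<in> S" "\<And>s. s \<in> S \<Longrightarrow> \<gamma>' s = \<gamma> (k * s + m)"
  shows "\<exists>T. open T \<and> t \<in> T \<and> smooth_map_on A T \<gamma>'"
    and "kobayashi_royden A g (\<gamma>' t) (differential A \<gamma>' t 1) \<le>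
      ennreal k * kobayashi_royden A g (\<gamma> (k * t + m)) (differential A \<gamma> (k * t + m) 1)"
proof -
  let ?T = "{t. k * t + m \<in> T}"
  note aff = smooth_map_on_affine[OF T(1,3), of k m]
  have "smooth_map_on A (?T \<inter> S) (\<lambda>t. \<gamma> (k * t + m))" by (rule smooth_map_on_subset[OF aff(2)]) simp
  then have "smooth_map_on A (?T \<inter> S) \<gamma>'"
    by (rule smooth_map_on_cong[rotated -1]) (use aff(1) S in auto)
  then show "\<exists>T. open T \<and> t \<in> T \<and> smooth_map_on A T \<gamma>'"
    using aff(1) S T(2) by (intro exI[of _ "?T \<inter> S"]) auto
  have d: "((\<lambda>t. k * t + m) has_derivative (\<lambda>v. k * v)) (at t)" by (auto intro!: derivative_eq_intros)
  have "differential A \<gamma>' t 1 = differential A (\<lambda>t. \<gamma> (k * t + m)) t 1" by (rule differential_cong[OF S])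
  also have "\<dots> = differential A \<gamma> (k * t + m) (k * 1)"
    using T(2) d by (intro differential_chain[OF T(3), where \<phi> = "\<lambda>t. k * t + m"])
  also have "k * 1 = k *\<^sub>R (1::real)" by simp
  finally have "differential A \<gamma>' t 1 = (\<lambda>c. k *\<^sub>R differential A \<gamma> (k * t + m) 1 c)"
    by (simp only: differential_add_scaleR(2)[OF T(3,2)])
  then show "kobayashi_royden A g (\<gamma>' t) (differential A \<gamma>' t 1) \<le>
      ennreal k * kobayashi_royden A g (\<gamma> (k * t + m)) (differential A \<gamma> (k * t + m) 1)"
    using kobayashi_royden_scale[OF k] S by simp
qed

lemma partition_le:
  fixes \<tau> :: "nat \<Rightarrow> real"
  assumes "\<And>i. i < n \<Longrightarrow> \<tau> i < \<tau> (Suc i)" "i \<le> j" "j \<le> n"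
  shows "\<tau> i \<le> \<tau> j"
  using assms(2,3)
proof (induction j rule: dec_induct)
  case (step j)
  then show ?case using assms(1)[of j] by simp
qed simp

lemma piecewise_smooth_path_join:
  assumes \<gamma>1: "piecewise_smooth_path A \<gamma>1" and \<gamma>2: "piecewise_smooth_path A \<gamma>2" and join: "\<gamma>1 1 = \<gamma>2 0"
  shows "piecewise_smooth_path A (\<gamma>1 +++ \<gamma>2)"
proof -
  let ?\<gamma> = "\<gamma>1 +++ \<gamma>2"
  obtain n1 \<tau>1 where 1: "\<tau>1 0 = 0" "\<tau>1 n1 = (1::real)" "\<And>i. i < n1 \<Longrightarrow> \<tau>1 i < \<tau>1 (Suc i)"
    "\<And>i. i < n1 \<Longrightarrow> smooth_curve_on A (\<tau>1 i) (\<tau>1 (Suc i)) \<gamma>1"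
    using \<gamma>1 unfolding piecewise_smooth_path_def by blast
  obtain n2 \<tau>2 where 2: "\<tau>2 0 = 0" "\<tau>2 n2 = (1::real)" "\<And>i. i < n2 \<Longrightarrow> \<tau>2 i < \<tau>2 (Suc i)"
    "\<And>i. i < n2 \<Longrightarrow> smooth_curve_on A (\<tau>2 i) (\<tau>2 (Suc i)) \<gamma>2"
    using \<gamma>2 unfolding piecewise_smooth_path_def by blast
  define \<tau> where "\<tau> i = (if i \<le> n1 then \<tau>1 i / 2 else (\<tau>2 (i - n1) + 1) / 2)" for i
  have \<tau>2: "\<tau> (n1 + j) = (\<tau>2 j + 1) / 2" for j using 1(2) 2(1) by (simp add: \<tau>_def)
  have "\<tau> i < \<tau> (Suc i) \<and> smooth_curve_on A (\<tau> i) (\<tau> (Suc i)) ?\<gamma>" if i: "i < n1 + n2" for i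
  proof (cases "i < n1")
    case True
    have le: "\<tau>1 (Suc i) \<le> 1" using partition_le[of n1 \<tau>1 "Suc i" n1] 1 True by simp
    have \<tau>: "\<tau> i = \<tau>1 i / 2" "\<tau> (Suc i) = \<tau>1 (Suc i) / 2" using True by (simp_all add: \<tau>_def)
    have "smooth_curve_on A (\<tau> i) (\<tau> (Suc i)) ?\<gamma>" unfolding \<tau>
      by (rule smooth_curve_on_affine[OF 1(4)[OF True], where k = 2 and m = 0]) (use le in \<open>auto simp: joinpaths_def\<close>)
    then show ?thesis using 1(3)[OF True] by (simp add: \<tau>)
  next
    case False
    define j where "j = i - n1"
    have j: "j < n2" "i = n1 + j" using i False by (auto simp: j_def)
    have ge: "0 \<le> \<tau>2 j" using partition_le[of n2 \<tau>2 0 j] 2 j(1) by simp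
    have \<tau>: "\<tau> i = (\<tau>2 j + 1) / 2" "\<tau> (Suc i) = (\<tau>2 (Suc j) + 1) / 2"
      using \<tau>2[of j] \<tau>2[of "Suc j"] j(2) by simp_all
    have "smooth_curve_on A (\<tau> i) (\<tau> (Suc i)) ?\<gamma>" unfolding \<tau>
    proof (rule smooth_curve_on_affine[OF 2(4)[OF j(1)], where k = 2 and m = "-1"])
      fix t assume "t \<in> {(\<tau>2 j + 1) / 2..(\<tau>2 (Suc j) + 1) / 2}"
      then have "1/2 \<le> t" "2 * t + -1 \<in> {\<tau>2 j..\<tau>2 (Suc j)}" using ge by auto
      moreover have "?\<gamma> t = \<gamma>2 (2 * t - 1)"
      \<comment> \<open>At t = 1/2 the joined path takes its first branch, which agrees with the
        second one there by \<open>join\<close>.\<close>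
      proof (cases "t = 1/2")
        case True
        then show ?thesis unfolding True by (simp add: joinpaths_def join)
      next
        case False
        then show ?thesis using \<open>1/2 \<le> t\<close> by (simp add: joinpaths_def)
      qed
      ultimately show "2 * t + -1 \<in> {\<tau>2 j..\<tau>2 (Suc j)} \<and> ?\<gamma> t = \<gamma>2 (2 * t + -1)" by simp
    qed
    then show ?thesis using 2(3)[OF j(1)] by (simp add: \<tau>)
  qed
  moreover have "\<tau> 0 = 0" using 1(1) by (simp add: \<tau>_def)
  moreover have "\<tau> (n1 + n2) = 1" using \<tau>2[of n2] 2(2) by simp
  moreover have "path ?\<gamma>"
    using \<gamma>1 \<gamma>2 join by (intro path_join_imp) (auto simp: piecewise_smooth_path_def pathstart_def pathfinish_def)
  ultimately show ?thesis unfolding piecewise_smooth_path_def by blast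
qed

lemma path_bound_join:
  assumes 1: "path_bound A g L1 p q" and 2: "path_bound A g L2 q r"
  shows "path_bound A g (L1 + L2) p r"
proof -
  let ?F = "\<lambda>\<gamma> t. kobayashi_royden A g (\<gamma> t) (differential A \<gamma> t 1)"
  obtain \<gamma>1 h1 N1 where \<gamma>1: "piecewise_smooth_path A \<gamma>1" "\<gamma>1 0 = p" "\<gamma>1 1 = q" and N1: "finite N1"
    and sm1: "\<And>t. t \<in> {0..1} - N1 \<Longrightarrow> \<exists>T. open T \<and> t \<in> T \<and> smooth_map_on A T \<gamma>1"
    and h1: "\<And>t. t \<in> {0..1} - N1 \<Longrightarrow> ?F \<gamma>1 t \<le> h1 t"
    and m1 [measurable]: "h1 \<in> borel_measurable borel" and L1: "(\<integral>\<^sup>+t. h1 t \<partial>lborel) \<le> L1"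
    using 1 unfolding path_bound_def by blast
  obtain \<gamma>2 h2 N2 where \<gamma>2: "piecewise_smooth_path A \<gamma>2" "\<gamma>2 0 = q" "\<gamma>2 1 = r" and N2: "finite N2"
    and sm2: "\<And>t. t \<in> {0..1} - N2 \<Longrightarrow> \<exists>T. open T \<and> t \<in> T \<and> smooth_map_on A T \<gamma>2"
    and h2: "\<And>t. t \<in> {0..1} - N2 \<Longrightarrow> ?F \<gamma>2 t \<le> h2 t"
    and m2 [measurable]: "h2 \<in> borel_measurable borel" and L2: "(\<integral>\<^sup>+t. h2 t \<partial>lborel) \<le> L2"
    using 2 unfolding path_bound_def by blast
  \<comment> \<open>The two majorants are added on the whole line instead of being cut at 1/2: a
    further nonnegative term keeps a majorant, and the substitutions preserve both integrals
    exactly.\<close>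
  let ?\<gamma> = "\<gamma>1 +++ \<gamma>2" and ?h = "\<lambda>t. 2 * h1 (2 * t) + 2 * h2 (-1 + 2 * t)"
  \<comment> \<open>The break point joins the exceptional set, as the joined path may fail to be
    smooth there.\<close>
  let ?N = "(\<lambda>t. t / 2) ` N1 \<union> (\<lambda>t. (t + 1) / 2) ` N2 \<union> {1/2}"
  have main: "(\<exists>T. open T \<and> t \<in> T \<and> smooth_map_on A T ?\<gamma>) \<and> ?F ?\<gamma> t \<le> ?h t" if t: "t \<in> {0..1} - ?N" for t
  proof (cases "t < 1/2")
    case True
    have "2 * t + 0 \<notin> N1"
    proof
      assume "2 * t + 0 \<in> N1"
      then have "(2 * t + 0) / 2 \<in> (\<lambda>t. t / 2) ` N1" by blast
      then show False using t by simp
    qed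
    then have t1: "2 * t + 0 \<in> {0..1} - N1" using t True by auto
    then obtain T where T: "open T" "2 * t + 0 \<in> T" "smooth_map_on A T \<gamma>1" using sm1 by blast
    note aff = kobayashi_royden_affine[OF T _ open_lessThan[of "1/2"], of ?\<gamma>]
    have "?F ?\<gamma> t \<le> ennreal 2 * ?F \<gamma>1 (2 * t + 0)" by (rule aff(2)) (use True in \<open>auto simp: joinpaths_def\<close>)
    also have "\<dots> \<le> 2 * h1 (2 * t)" using h1[OF t1] by (simp add: mult_left_mono)
    also have "\<dots> \<le> ?h t" by simp
    finally show ?thesis using aff(1) True by (auto simp: joinpaths_def)
  next
    case False
    then have gt: "1/2 < t" using t by auto
    have "2 * t + -1 \<notin> N2"
    proof
      assume "2 * t + -1 \<in> N2"
      then have "(2 * t + -1 + 1) / 2 \<in> (\<lambda>t. (t + 1) / 2) ` N2" by blast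
      then show False using t by simp
    qed
    then have t2: "2 * t + -1 \<in> {0..1} - N2" using t gt by auto
    then obtain T where T: "open T" "2 * t + -1 \<in> T" "smooth_map_on A T \<gamma>2" using sm2 by blast
    note aff = kobayashi_royden_affine[OF T _ open_greaterThan[of "1/2"], of ?\<gamma>]
    have "?F ?\<gamma> t \<le> ennreal 2 * ?F \<gamma>2 (2 * t + -1)" by (rule aff(2)) (use gt in \<open>auto simp: joinpaths_def\<close>)
    also have "\<dots> \<le> 2 * h2 (2 * t + -1)" using h2[OF t2] by (simp add: mult_left_mono)
    also have "\<dots> \<le> ?h t" by (simp add: add.commute)
    finally show ?thesis using aff(1) gt by (auto simp: joinpaths_def)
  qed
  have "(\<integral>\<^sup>+t. ?h t \<partial>lborel) = (\<integral>\<^sup>+t. h1 t \<partial>lborel) + (\<integral>\<^sup>+t. h2 t \<partial>lborel)"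
    using nn_integral_real_affine[OF m1, of 2 0] nn_integral_real_affine[OF m2, of 2 "-1"]
    by (simp add: nn_integral_add nn_integral_cmult)
  also have "\<dots> \<le> L1 + L2" by (rule add_mono[OF L1 L2])
  finally have int: "(\<integral>\<^sup>+t. ?h t \<partial>lborel) \<le> L1 + L2" .
  have meas: "?h \<in> borel_measurable borel" by measurable
  have "?\<gamma> 0 = p" "?\<gamma> 1 = r" using \<gamma>1 \<gamma>2 by (simp_all add: joinpaths_def)
  moreover have "piecewise_smooth_path A ?\<gamma>" using \<gamma>1 \<gamma>2 by (intro piecewise_smooth_path_join) auto
  moreover have "finite ?N" using N1 N2 by simp
  ultimately show ?thesis unfolding path_bound_def using meas int main
    by (intro exI[of _ ?\<gamma>] exI[of _ ?h] exI[of _ ?N]) blast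
qed

end

context riemannian_manifold
begin

lemma path_bound_chain:
  assumes "kobayashi_chain A g p q ch"
  shows "path_bound A g (ennreal (\<Sum>(z, w, u)\<leftarrow>ch. poincare_dist z w)) p q"
  using assms
proof (induction ch arbitrary: p)
  case Nil
  then show ?case by (simp add: kobayashi_chain_def)
next
  case (Cons x ch)
  obtain z w u where x: "x = (z, w, u)" by (cases x)
  have u: "conformal_harmonic_immersion A g u" "z \<in> unit_disc" "w \<in> unit_disc" "u z = p"
    using Cons.prems by (auto simp: kobayashi_chain_def x)
  have b: "path_bound A g (ennreal (poincare_dist z w)) p (u w)" using path_bound_disc[OF u(1-3)] u(4) by simp
  show ?case
  proof (cases "ch = []")
    case True
    then show ?thesis using b Cons.prems by (simp add: kobayashi_chain_def x)
  next
    case False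
    have "\<forall>k. Suc k < length (x # ch) \<longrightarrow>
        (case ((x # ch) ! k, (x # ch) ! Suc k) of ((z, w, u), (z', w', u')) \<Rightarrow> u w = u' z')"
      using Cons.prems unfolding kobayashi_chain_def by (elim conjE)
    note step = this[THEN spec, THEN mp]
    have ch: "kobayashi_chain A g (u w) q ch"
      unfolding kobayashi_chain_def
    proof (intro conjI)
      show "case hd ch of (z', w', u') \<Rightarrow> u' z' = u w"
        using step[of 0] False by (auto simp: x hd_conv_nth split: prod.splits)
      show "\<forall>k. Suc k < length ch \<longrightarrow> (case (ch ! k, ch ! Suc k) of ((z, w, u), (z', w', u')) \<Rightarrow> u w = u' z')"
      proof (intro allI impI)
        fix k assume "Suc k < length ch"
        then have "Suc (Suc k) < length (x # ch)" by simp
        from step[OF this] show "case (ch ! k, ch ! Suc k) of ((z, w, u), (z', w', u')) \<Rightarrow> u w = u' z'" by simp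
      qed
    qed (use Cons.prems False in \<open>auto simp: kobayashi_chain_def\<close>)
    from path_bound_join[OF b Cons.IH[OF ch]] show ?thesis
      using kobayashi_chain_length_nonneg[OF ch] poincare_dist_nonneg[OF u(2,3)] by (simp add: x)
  qed
qed

theorem integrated_le_kobayashi_dist: "integrated_kobayashi_royden A g p q \<le> kobayashi_dist A g p q"
  unfolding kobayashi_dist_def
  by (rule INF_greatest) (use integrated_le_path_bound path_bound_chain in blast)

end

section \<open>Integrating the upper derivative of a Lipschitz function\<close>

lemma filterlim_inverse_Suc_at_0: "filterlim (\<lambda>n. 1 / real (Suc n)) (at 0) sequentially"
  using LIMSEQ_inverse_real_of_nat by (simp add: filterlim_at inverse_eq_divide)

text \<open>With E an antiderivative of f, the integral of the quotient is the mean of f over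
  [b, b + h] minus its mean over [a, a + h]. The first is f b, as f is constant beyond b; the second
  exceeds f a by at most K h.\<close>

lemma difference_quotient_integral:
  fixes f :: "real \<Rightarrow> real"
  assumes cont: "continuous_on UNIV f" and ab: "a \<le> b" and h: "0 < h"
    and K: "K \<ge> 0" and lip: "\<And>s t. \<bar>f t - f s\<bar> \<le> K * \<bar>t - s\<bar>" and const: "\<And>t. t \<ge> b \<Longrightarrow> f t = f b"
  shows "ennreal (f b - f a - K * h) \<le> (\<integral>\<^sup>+t. ennreal ((f (t + h) - f t) / h) * indicator {a..b} t \<partial>lborel)"
proof -
  let ?D = "\<lambda>t. (f (t + h) - f t) / h"
  \<comment> \<open>The margin 1 at both ends makes the derivative of E two-sided on
    [a, b + h].\<close>
  obtain E where E0: "\<And>x. x \<in> {a - 1..b + h + 1} \<Longrightarrow> (E has_vector_derivative f x) (at x within {a - 1..b + h + 1})"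
    using antiderivative_continuous[OF continuous_on_subset[OF cont subset_UNIV]] by blast
  then have E: "(E has_real_derivative f x) (at x)" if "a \<le> x" "x \<le> b + h" for x
    using E0[of x] that h ab at_within_Icc_at[of "a - 1" x "b + h + 1"]
    by (simp add: has_real_derivative_iff_has_vector_derivative)
  \<comment> \<open>The summand K t makes the integrand nonnegative, as the fundamental theorem for
    nonnegative integrals requires; the resulting K (b - a) is cancelled at the end.\<close>
  define P where "P t = (E (t + h) - E t) / h + K * t" for t
  have P: "(P has_real_derivative ?D t + K) (at t)" if "t \<in> {a..b}" for t
  proof -
    have "((\<lambda>t. E (t + h)) has_real_derivative f (t + h)) (at t)"
      unfolding DERIV_shift[symmetric] by (rule E) (use that h in auto)
    moreover have "(E has_real_derivative f t) (at t)" by (rule E) (use that h in auto)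
    ultimately show ?thesis
      unfolding P_def using DERIV_cmult[OF DERIV_ident, of K t]
      by (intro DERIV_add DERIV_cdivide DERIV_diff) simp_all
  qed
  have mv: "\<exists>x\<in>{s<..<s + h}. E (s + h) - E s = h * f x" if s: "a \<le> s" "s \<le> b" for s
  proof -
    have "\<exists>x. s < x \<and> x < s + h \<and> E (s + h) - E s = (s + h - s) * f x"
      by (rule MVT2) (use h s in \<open>auto intro!: E\<close>)
    then show ?thesis by auto
  qed
  obtain xb where xb: "b < xb" "E (b + h) - E b = h * f xb" using mv[of b] ab by auto
  obtain xa where xa: "a < xa" "xa < a + h" "E (a + h) - E a = h * f xa" using mv[of a] ab by auto
  have "f xa \<le> f a + K * h"
    using lip[of xa a] xa mult_left_mono[OF _ K, of "\<bar>xa - a\<bar>" h] by linarith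
  then have PP: "f b - f a - K * h + K * (b - a) \<le> P b - P a"
    using xb xa const[of xb] h by (simp add: P_def algebra_simps)
  have Dnn: "0 \<le> ?D t + K" for t
  proof -
    have "- (K * h) \<le> f (t + h) - f t" using lip[of "t + h" t] h by simp
    then show ?thesis using h by (simp add: field_simps)
  qed
  have meas [measurable]: "f \<in> borel_measurable borel" by (rule borel_measurable_continuous_onI[OF cont])
  have "ennreal (f b - f a - K * h + K * (b - a)) \<le> ennreal (P b - P a)" by (rule ennreal_leI[OF PP])
  also have "\<dots> = (\<integral>\<^sup>+t. ennreal (?D t + K) * indicator {a..b} t \<partial>lborel)"
    by (rule nn_integral_FTC_Icc[symmetric]) (use P Dnn ab in auto)
  also have "\<dots> \<le> (\<integral>\<^sup>+t. ennreal (?D t) * indicator {a..b} t + ennreal K * indicator {a..b} t \<partial>lborel)"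
  proof (rule nn_integral_mono)
    fix t
    have "ennreal (x + K) \<le> ennreal x + ennreal K" for x
      using K by (cases "x \<ge> 0") (auto simp: ennreal_plus ennreal_neg intro!: ennreal_leI)
    then show "ennreal (?D t + K) * indicator {a..b} t \<le> ennreal (?D t) * indicator {a..b} t + ennreal K * indicator {a..b} t"
      by (simp split: split_indicator)
  qed
  also have "\<dots> = (\<integral>\<^sup>+t. ennreal (?D t) * indicator {a..b} t \<partial>lborel) + ennreal (K * (b - a))"
    using K ab by (simp add: nn_integral_add nn_integral_cmult_indicator ennreal_mult')
  finally have main: "ennreal (f b - f a - K * h + K * (b - a)) \<le>
      (\<integral>\<^sup>+t. ennreal (?D t) * indicator {a..b} t \<partial>lborel) + ennreal (K * (b - a))" .
  show ?thesis
  proof (cases "f b - f a - K * h \<ge> 0")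
    case True
    then have "ennreal (f b - f a - K * h) + ennreal (K * (b - a)) \<le>
        (\<integral>\<^sup>+t. ennreal (?D t) * indicator {a..b} t \<partial>lborel) + ennreal (K * (b - a))"
      using main K ab by (simp add: ennreal_plus)
    then show ?thesis using ennreal_add_left_cancel_le by (simp add: add.commute)
  next
    case False
    then show ?thesis by (simp add: ennreal_neg)
  qed
qed

text \<open>G is an upper limit of measurable difference quotients, hence measurable even when F is
  not. The Lipschitz constant is the dominating function for the passage to the limit.\<close>

lemma lipschitz_upper_derivative_integral:
  fixes f :: "real \<Rightarrow> real"
  assumes ab: "a < b" and K: "K \<ge> 0" and lip: "\<And>s t. s \<in> {a..b} \<Longrightarrow> t \<in> {a..b} \<Longrightarrow> \<bar>f t - f s\<bar> \<le> K * \<bar>t - s\<bar>"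
    and F: "\<And>t. t \<in> {a..<b} \<Longrightarrow> limsup (\<lambda>n. ennreal (real (Suc n) * (f (t + 1 / real (Suc n)) - f t))) \<le> F t"
  obtains G where "G \<in> borel_measurable borel" "\<And>t. t \<in> {a..<b} \<Longrightarrow> G t \<le> F t" "\<And>t. t \<notin> {a..b} \<Longrightarrow> G t = 0"
    "ennreal (f b - f a) \<le> (\<integral>\<^sup>+t. G t \<partial>lborel)"
proof -
  \<comment> \<open>Clamping extends f to the line as a K-Lipschitz function that is constant beyond
    b.\<close>
  define cl where "cl t = max a (min b t)" for t
  define e where "e t = f (cl t)" for t
  have cl: "cl t \<in> {a..b}" "\<bar>cl t - cl s\<bar> \<le> \<bar>t - s\<bar>" for s t using ab by (auto simp: cl_def max_def min_def)
  have elip: "\<bar>e t - e s\<bar> \<le> K * \<bar>t - s\<bar>" for s t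
    unfolding e_def by (rule order_trans[OF lip[OF cl(1) cl(1)] mult_left_mono[OF cl(2) K]])
  have e_eq: "e t = f t" if "t \<in> {a..b}" for t using that by (simp add: e_def cl_def)
  have e_const: "e t = e b" if "t \<ge> b" for t using that ab by (simp add: e_def cl_def)
  have "K-lipschitz_on UNIV e" using K elip by (intro lipschitz_onI) (auto simp: dist_real_def)
  then have cont: "continuous_on UNIV e" by (rule lipschitz_on_continuous_on)
  have [measurable]: "e \<in> borel_measurable borel" by (rule borel_measurable_continuous_onI[OF cont])
  define h where "h n = 1 / real (Suc n)" for n
  have h: "h n > 0" for n by (simp add: h_def)
  define u where "u n t = ennreal ((e (t + h n) - e t) / h n) * indicator {a..b} t" for n t
  have [measurable]: "u n \<in> borel_measurable borel" for n unfolding u_def by measurable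
  define G where "G t = limsup (\<lambda>n. u n t)" for t
  have meas: "G \<in> borel_measurable borel" unfolding G_def by measurable
  have h0: "h \<longlonglongrightarrow> 0" using LIMSEQ_inverse_real_of_nat by (simp add: h_def[abs_def] inverse_eq_divide)
  have "limsup (\<lambda>n. integral\<^sup>N lborel (u n)) \<le> (\<integral>\<^sup>+t. G t \<partial>lborel)"
    unfolding G_def
  proof (rule nn_integral_limsup[where w = "\<lambda>t. ennreal K * indicator {a..b} t"])
    show "AE t in lborel. u n t \<le> ennreal K * indicator {a..b} t" for n
    proof (rule AE_I2)
      fix t
      have "(e (t + h n) - e t) / h n \<le> K" using elip[of "t + h n" t] h[of n] by (simp add: pos_divide_le_eq)
      then show "u n t \<le> ennreal K * indicator {a..b} t" unfolding u_def by (intro mult_right_mono ennreal_leI) auto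
    qed
    show "(\<integral>\<^sup>+t. ennreal K * indicator {a..b} t \<partial>lborel) < \<infinity>"
      using ab by (simp add: nn_integral_cmult_indicator ennreal_mult_less_top)
  qed simp_all
  moreover have "ennreal (f b - f a) \<le> limsup (\<lambda>n. integral\<^sup>N lborel (u n))"
  proof -
    have "(\<lambda>n. ennreal (e b - e a - K * h n)) \<longlonglongrightarrow> ennreal (e b - e a - K * 0)"
      by (intro tendsto_intros h0)
    then have "limsup (\<lambda>n. ennreal (e b - e a - K * h n)) = ennreal (e b - e a)"
      by (intro lim_imp_Limsup) simp_all
    moreover have "limsup (\<lambda>n. ennreal (e b - e a - K * h n)) \<le> limsup (\<lambda>n. integral\<^sup>N lborel (u n))"
      unfolding u_def using ab
      by (intro Limsup_mono always_eventually allI difference_quotient_integral cont h K elip e_const) auto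
    ultimately show ?thesis using e_eq[of a] e_eq[of b] ab by simp
  qed
  ultimately have int: "ennreal (f b - f a) \<le> (\<integral>\<^sup>+t. G t \<partial>lborel)" by (rule order_trans[rotated])
  have GF: "G t \<le> F t" if t: "t \<in> {a..<b}" for t
  proof -
    have "\<forall>\<^sub>F n in sequentially. h n < b - t" using h0 t by (intro order_tendstoD(2)) auto
    then have "\<forall>\<^sub>F n in sequentially. u n t = ennreal (real (Suc n) * (f (t + 1 / real (Suc n)) - f t))"
    proof eventually_elim
      case (elim n)
      then have "t + h n \<in> {a..b}" using t h[of n] by simp
      then show ?case using t by (simp add: u_def e_eq) (simp add: h_def mult.commute)
    qed
    then have "G t = limsup (\<lambda>n. ennreal (real (Suc n) * (f (t + 1 / real (Suc n)) - f t)))"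
      unfolding G_def by (rule Limsup_eq)
    then show ?thesis using F[OF t] by simp
  qed
  have G0: "G t = 0" if "t \<notin> {a..b}" for t using that by (simp add: G_def u_def Limsup_const)
  show ?thesis by (rule that[OF meas GF G0 int])
qed

section \<open>From paths to chains of discs\<close>

lemma has_derivative_zero_sequence:
  fixes f :: "real \<Rightarrow> 'e::real_normed_vector"
  assumes "(f has_derivative (\<lambda>_. 0)) (at 0)" "f 0 = 0"
  shows "(\<lambda>n. real (Suc n) * norm (f (1 / real (Suc n)))) \<longlonglongrightarrow> 0"
proof -
  have "(\<lambda>h. norm (f h) / norm h) \<midarrow>0\<rightarrow> 0" using assms by (simp add: has_derivative_at)
  from filterlim_compose[OF this filterlim_inverse_Suc_at_0] show ?thesis by (simp add: mult.commute)
qed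

context riemannian_manifold
begin

text \<open>The infimum runs over chains of discs, so some disc through p has to exist; the local
  Lipschitz estimate at a pair of equal points provides it and gives the bound 0.\<close>

lemma kobayashi_dist_refl:
  assumes dim: "CARD('n) \<ge> 2" shows "kobayashi_dist A g p p = 0"
proof -
  obtain c where c: "c \<in> A" "p \<in> fst c" by (rule chart_containing)
  obtain C \<delta> where "C > 0" "\<delta> > 0" and lip: "\<And>x y. x \<in> ball (snd c p) \<delta> \<Longrightarrow> y \<in> ball (snd c p) \<delta> \<Longrightarrow>
      kobayashi_dist A g (chart_inv c x) (chart_inv c y) \<le> ennreal (C * norm (x - y))"
    by (rule kobayashi_locally_lipschitz[OF dim c]) blast
  then have "kobayashi_dist A g (chart_inv c (snd c p)) (chart_inv c (snd c p)) \<le> ennreal (C * norm (snd c p - snd c p))"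
    by (intro lip) auto
  then show ?thesis using chart_inv_chart[OF c] by simp
qed

text \<open>w is a comparison curve in the chart, tangent to \<sigma> at t; its point at time h is
  reached from \<sigma> t at cost \<kappa> h, which is l h + o(h) along h = 1/(n + 1). Its distance
  from \<sigma> (t + h) is o(h) in the chart, and the local Lipschitz bound makes this gap
  negligible.\<close>

lemma kobayashi_forward_limsup:
  assumes \<sigma>: "open T" "smooth_map_on A T \<sigma>" "t \<in> T" and c: "c \<in> A" "\<sigma> t \<in> fst c"
    and B: "open B" "B \<subseteq> chart_image c" "snd c (\<sigma> t) \<in> B" and C: "C \<ge> 0"
    and lip: "\<And>x y. x \<in> B \<Longrightarrow> y \<in> B \<Longrightarrow> kobayashi_dist A g (chart_inv c x) (chart_inv c y) \<le> ennreal (C * norm (x - y))"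
    and w: "(w has_derivative (\<lambda>v. v *\<^sub>R differential A \<sigma> t 1 c)) (at 0)" "w 0 = snd c (\<sigma> t)"
    and \<kappa>: "(\<lambda>n. real (Suc n) * \<kappa> (1 / real (Suc n))) \<longlonglongrightarrow> l"
    and disc: "\<forall>\<^sub>F n in sequentially. 0 \<le> \<kappa> (1 / real (Suc n)) \<and>
      kobayashi_dist A g (\<sigma> t) (chart_inv c (w (1 / real (Suc n)))) \<le> ennreal (\<kappa> (1 / real (Suc n)))"
  shows "limsup (\<lambda>n. ennreal (real (Suc n)) * kobayashi_dist A g (\<sigma> t) (\<sigma> (t + 1 / real (Suc n)))) \<le> ennreal l"
proof -
  define h where "h n = 1 / real (Suc n)" for n
  have h: "h n > 0" for n by (simp add: h_def)
  have h0: "h \<longlonglongrightarrow> 0" using LIMSEQ_inverse_real_of_nat by (simp add: h_def[abs_def] inverse_eq_divide)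
  define y where "y s = snd c (\<sigma> s)" for s
  have dy: "(y has_derivative (\<lambda>v. v *\<^sub>R differential A \<sigma> t 1 c)) (at t)"
  proof -
    have "differential A \<sigma> t v c = v *\<^sub>R differential A \<sigma> t 1 c" for v
      using fun_cong[OF differential_add_scaleR(2)[OF \<sigma>(2,3), of v 1], of c] by simp
    then have eq: "(\<lambda>v. differential A \<sigma> t v c) = (\<lambda>v. v *\<^sub>R differential A \<sigma> t 1 c)" by (rule ext)
    show ?thesis using smooth_map_on_has_derivative[OF \<sigma>(2,3) c] unfolding eq by (simp add: y_def[abs_def])
  qed
  have "((\<lambda>s. t + s) has_derivative (\<lambda>v. v)) (at 0)" by (auto intro!: derivative_eq_intros)
  from has_derivative_compose[OF this, of y "\<lambda>v. v *\<^sub>R differential A \<sigma> t 1 c"] dy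
  have dy': "((\<lambda>s. y (t + s)) has_derivative (\<lambda>v. v *\<^sub>R differential A \<sigma> t 1 c)) (at 0)" by simp
  have "((\<lambda>s. w s - y (t + s)) has_derivative (\<lambda>_. 0)) (at 0)" using has_derivative_diff[OF w(1) dy'] by simp
  then have diff: "(\<lambda>n. real (Suc n) * norm (w (h n) - y (t + h n))) \<longlonglongrightarrow> 0"
    unfolding h_def by (rule has_derivative_zero_sequence) (simp add: w(2) y_def)
  have "isCont w 0" using w(1) by (rule has_derivative_continuous)
  from isCont_tendsto_compose[OF this h0] have "(\<lambda>n. w (h n)) \<longlonglongrightarrow> snd c (\<sigma> t)" by (simp add: w(2))
  from topological_tendstoD[OF this B(1,3)] have wB: "\<forall>\<^sub>F n in sequentially. w (h n) \<in> B" .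
  have "isCont (\<lambda>s. y (t + s)) 0" using dy' by (rule has_derivative_continuous)
  from isCont_tendsto_compose[OF this h0] have "(\<lambda>n. y (t + h n)) \<longlonglongrightarrow> snd c (\<sigma> t)" by (simp add: y_def)
  from topological_tendstoD[OF this B(1,3)] have yB: "\<forall>\<^sub>F n in sequentially. y (t + h n) \<in> B" .
  have "(\<lambda>n. t + h n) \<longlonglongrightarrow> t" using tendsto_add[OF tendsto_const h0, of t] by simp
  from topological_tendstoD[OF this smooth_map_on_open_preimage[OF \<sigma>(2,1) open_domain[OF c(1)]]]
  have fc: "\<forall>\<^sub>F n in sequentially. t + h n \<in> {s \<in> T. \<sigma> s \<in> fst c}" using \<sigma>(3) c(2) by simp
  have "\<forall>\<^sub>F n in sequentially. ennreal (real (Suc n)) * kobayashi_dist A g (\<sigma> t) (\<sigma> (t + h n)) \<le>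
      ennreal (real (Suc n) * \<kappa> (h n) + C * (real (Suc n) * norm (w (h n) - y (t + h n))))"
    using wB yB fc disc[folded h_def]
  proof eventually_elim
    case (elim n)
    have "chart_inv c (y (t + h n)) = \<sigma> (t + h n)" unfolding y_def using elim(3) by (intro chart_inv_chart[OF c(1)]) simp
    then have "kobayashi_dist A g (\<sigma> t) (\<sigma> (t + h n)) \<le> kobayashi_dist A g (\<sigma> t) (chart_inv c (w (h n))) +
        kobayashi_dist A g (chart_inv c (w (h n))) (chart_inv c (y (t + h n)))"
      using kobayashi_dist_triangle[of A g "\<sigma> t" "\<sigma> (t + h n)" "chart_inv c (w (h n))"] by simp
    also have "\<dots> \<le> ennreal (\<kappa> (h n)) + ennreal (C * norm (w (h n) - y (t + h n)))"
      by (intro add_mono lip) (use elim in auto)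
    also have "\<dots> = ennreal (\<kappa> (h n) + C * norm (w (h n) - y (t + h n)))"
      using elim(4) C by (intro ennreal_plus[symmetric]) auto
    finally have "ennreal (real (Suc n)) * kobayashi_dist A g (\<sigma> t) (\<sigma> (t + h n)) \<le>
        ennreal (real (Suc n)) * ennreal (\<kappa> (h n) + C * norm (w (h n) - y (t + h n)))"
      by (rule mult_left_mono) simp
    also have "\<dots> = ennreal (real (Suc n) * (\<kappa> (h n) + C * norm (w (h n) - y (t + h n))))"
      by (rule ennreal_mult'[symmetric]) simp
    finally show ?case by (simp only: distrib_left mult.left_commute)
  qed
  then have "limsup (\<lambda>n. ennreal (real (Suc n)) * kobayashi_dist A g (\<sigma> t) (\<sigma> (t + h n))) \<le>
      limsup (\<lambda>n. ennreal (real (Suc n) * \<kappa> (h n) + C * (real (Suc n) * norm (w (h n) - y (t + h n)))))"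
    by (rule Limsup_mono)
  also have "\<dots> = ennreal (l + C * 0)"
    by (intro lim_imp_Limsup sequentially_bot tendsto_ennrealI tendsto_add tendsto_mult tendsto_const \<kappa>[folded h_def] diff)
  finally show ?thesis by (simp add: h_def)
qed

text \<open>The difference of logarithms is an odd function that is differentiable at 0 with
  derivative 1/r, whereas the Poincare distance involves an absolute value; for 0 < h < r the two
  agree.\<close>

lemma poincare_dist_sequence:
  assumes r: "r > 0"
  defines "\<kappa> \<equiv> \<lambda>h. (ln (1 + h / r) - ln (1 - h / r)) / 2"
  shows "(\<lambda>n. real (Suc n) * \<kappa> (1 / real (Suc n))) \<longlonglongrightarrow> 1 / r"
    and "0 < h \<Longrightarrow> h < r \<Longrightarrow> \<kappa> h = poincare_dist 0 (of_real (h / r))"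
proof -
  have "(\<kappa> has_real_derivative 1 / r) (at 0)"
    unfolding \<kappa>_def using r by (auto intro!: derivative_eq_intros simp: divide_simps)
  then have "(\<lambda>h. (\<kappa> (0 + h) - \<kappa> 0) / h) \<midarrow>0\<rightarrow> 1 / r" by (simp only: DERIV_def)
  then have "(\<lambda>h. \<kappa> h / h) \<midarrow>0\<rightarrow> 1 / r" by (simp add: \<kappa>_def)
  from filterlim_compose[OF this filterlim_inverse_Suc_at_0]
  show "(\<lambda>n. real (Suc n) * \<kappa> (1 / real (Suc n))) \<longlonglongrightarrow> 1 / r" by (simp add: mult.commute)
  assume h: "0 < h" "h < r"
  have "poincare_dist 0 (of_real s) = (ln (1 + s) - ln (1 - s)) / 2" if "0 \<le> s" "s < 1" for s
    using that by (simp add: poincare_dist_def ln_div)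
  from this[of "h / r"] show "\<kappa> h = poincare_dist 0 (of_real (h / r))" using h by (simp only: \<kappa>_def) simp
qed

lemma kobayashi_forward_derivative:
  assumes \<sigma>: "open T" "smooth_map_on A T \<sigma>" "t \<in> T" and c: "c \<in> A" "\<sigma> t \<in> fst c"
    and B: "open B" "B \<subseteq> chart_image c" "snd c (\<sigma> t) \<in> B" and C: "C \<ge> 0"
    and lip: "\<And>x y. x \<in> B \<Longrightarrow> y \<in> B \<Longrightarrow> kobayashi_dist A g (chart_inv c x) (chart_inv c y) \<le> ennreal (C * norm (x - y))"
  shows "limsup (\<lambda>n. ennreal (real (Suc n)) * kobayashi_dist A g (\<sigma> t) (\<sigma> (t + 1 / real (Suc n)))) \<le>
    kobayashi_royden A g (\<sigma> t) (differential A \<sigma> t 1)"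
proof -
  let ?\<xi> = "differential A \<sigma> t 1"
  note forward = kobayashi_forward_limsup[OF \<sigma> c B C lip]
  show ?thesis
  proof (cases "?\<xi> = (\<lambda>c. 0)")
    case True
    have "kobayashi_dist A g (\<sigma> t) (\<sigma> t) \<le> 0" using lip[OF B(3,3)] chart_inv_chart[OF c] by simp
    then have "limsup (\<lambda>n. ennreal (real (Suc n)) * kobayashi_dist A g (\<sigma> t) (\<sigma> (t + 1 / real (Suc n)))) \<le> ennreal 0"
      by (intro forward[where w = "\<lambda>_. snd c (\<sigma> t)" and \<kappa> = "\<lambda>_. 0"])
        (simp_all add: True chart_inv_chart[OF c])
    then show ?thesis by (simp add: kobayashi_royden_def True)
  next
    case False
    have "limsup (\<lambda>n. ennreal (real (Suc n)) * kobayashi_dist A g (\<sigma> t) (\<sigma> (t + 1 / real (Suc n)))) \<le> ennreal (1 / r)"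
      if r: "r > 0" and u: "conformal_harmonic_immersion A g u" "u 0 = \<sigma> t" "differential A u 0 1 = (\<lambda>c. r *\<^sub>R ?\<xi> c)" for r u
    proof -
      have su: "smooth_map_on A unit_disc u" using u(1) by (simp add: conformal_harmonic_immersion_def immersed_disc_def)
      have u0: "u 0 \<in> fst c" using c u(2) by simp
      let ?w = "\<lambda>h. snd c (u (of_real (h / r)))"
      let ?\<kappa> = "\<lambda>h. (ln (1 + h / r) - ln (1 - h / r)) / 2"
      have "((\<lambda>h. complex_of_real (h / r)) has_derivative (\<lambda>v. of_real (v / r))) (at 0)"
        using r by (auto intro!: derivative_eq_intros)
      moreover have "((\<lambda>z. snd c (u z)) has_derivative (\<lambda>v. differential A u 0 v c)) (at (complex_of_real (0 / r)))"
        using smooth_map_on_has_derivative[OF su _ c(1) u0] by simp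
      ultimately have "(?w has_derivative (\<lambda>v. differential A u 0 (of_real (v / r)) c)) (at 0)"
        by (rule has_derivative_compose)
      moreover have "differential A u 0 (of_real (v / r)) c = v *\<^sub>R ?\<xi> c" for v
      proof -
        have "of_real (v / r) = (v / r) *\<^sub>R (1::complex)" by (simp only: scaleR_conv_of_real mult_1_right)
        then have "differential A u 0 (of_real (v / r)) c = (v / r) *\<^sub>R differential A u 0 1 c"
          using fun_cong[OF differential_add_scaleR(2)[OF su, of 0 "v / r" 1], of c] by simp
        then show ?thesis using r by (simp add: u(3))
      qed
      ultimately have dw: "(?w has_derivative (\<lambda>v. v *\<^sub>R ?\<xi> c)) (at 0)" by simp
      have O: "open {z \<in> unit_disc. u z \<in> fst c}" by (rule smooth_map_on_open_preimage[OF su open_ball open_domain[OF c(1)]])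
      have h0: "(\<lambda>n. 1 / real (Suc n)) \<longlonglongrightarrow> 0" using LIMSEQ_inverse_real_of_nat by (simp add: inverse_eq_divide)
      have "(\<lambda>n. complex_of_real (1 / real (Suc n) / r)) \<longlonglongrightarrow> complex_of_real (0 / r)"
        using r by (intro tendsto_of_real tendsto_divide h0 tendsto_const) auto
      then have ev: "\<forall>\<^sub>F n in sequentially. complex_of_real (1 / real (Suc n) / r) \<in> {z \<in> unit_disc. u z \<in> fst c}"
        by (rule topological_tendstoD[OF _ O]) (use u0 in simp)
      have ev': "\<forall>\<^sub>F n in sequentially. 1 / real (Suc n) < r" by (rule order_tendstoD(2)[OF h0 r])
      show ?thesis
      proof (rule forward[where w = ?w and \<kappa> = ?\<kappa>])
        show "(?w has_derivative (\<lambda>v. v *\<^sub>R ?\<xi> c)) (at 0)" by (rule dw)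
        show "(\<lambda>n. real (Suc n) * ?\<kappa> (1 / real (Suc n))) \<longlonglongrightarrow> 1 / r" by (rule poincare_dist_sequence(1)[OF r])
        show "?w 0 = snd c (\<sigma> t)" by (simp add: u(2))
        show "\<forall>\<^sub>F n in sequentially. 0 \<le> ?\<kappa> (1 / real (Suc n)) \<and>
          kobayashi_dist A g (\<sigma> t) (chart_inv c (?w (1 / real (Suc n)))) \<le> ennreal (?\<kappa> (1 / real (Suc n)))"
          using ev ev'
        proof eventually_elim
          case (elim n)
          let ?z = "complex_of_real (1 / real (Suc n) / r)"
          have z: "?z \<in> unit_disc" "u ?z \<in> fst c" using elim(1) by auto
          have \<kappa>: "?\<kappa> (1 / real (Suc n)) = poincare_dist 0 ?z"
            by (rule poincare_dist_sequence(2)[OF r]) (use elim(2) in auto)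
          have "kobayashi_dist A g (\<sigma> t) (u ?z) \<le> ennreal (poincare_dist 0 ?z)"
            using kobayashi_dist_le_poincare[OF u(1), of 0 ?z] z(1) u(2) by simp
          then show ?case
            unfolding \<kappa> chart_inv_chart[OF c(1) z(2)] using poincare_dist_nonneg[of 0 ?z] z(1) by simp
        qed
      qed
    qed
    then show ?thesis unfolding kobayashi_royden_def if_not_P[OF False] by (auto intro!: INF_greatest)
  qed
qed

end

text \<open>The measurable minorant \<open>G\<close> makes up for the missing measurability of the pseudometric.\<close>

definition length_bound ::
  "('m::topological_space, 'n::finite) chart set \<Rightarrow> ('m, 'n) metric \<Rightarrow> (real \<Rightarrow> 'm) \<Rightarrow> real \<Rightarrow> real \<Rightarrow> bool" where
  "length_bound A g \<gamma> a b \<longleftrightarrow> (\<exists>G N. G \<in> borel_measurable borel \<and> finite N \<and>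
     (\<forall>t\<in>{a..b} - N. G t \<le> kobayashi_royden A g (\<gamma> t) (differential A \<gamma> t 1)) \<and>
     (\<forall>t. t \<notin> {a..b} \<longrightarrow> G t = 0) \<and> kobayashi_dist A g (\<gamma> a) (\<gamma> b) \<le> (\<integral>\<^sup>+t. G t \<partial>lborel))"

text \<open>The minorants vanish off their intervals, so their sum is a minorant on the union; the
  common endpoint b, where both may be nonzero, joins the exceptional set.\<close>

lemma length_bound_trans:
  assumes 1: "length_bound A g \<gamma> a b" and 2: "length_bound A g \<gamma> b c" and abc: "a \<le> b" "b \<le> c"
  shows "length_bound A g \<gamma> a c"
proof -
  let ?F = "\<lambda>t. kobayashi_royden A g (\<gamma> t) (differential A \<gamma> t 1)"
  obtain G1 N1 where 1: "G1 \<in> borel_measurable borel" "finite N1" "\<And>t. t \<in> {a..b} - N1 \<Longrightarrow> G1 t \<le> ?F t"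
    "\<And>t. t \<notin> {a..b} \<Longrightarrow> G1 t = 0" "kobayashi_dist A g (\<gamma> a) (\<gamma> b) \<le> (\<integral>\<^sup>+t. G1 t \<partial>lborel)"
    using 1 unfolding length_bound_def by blast
  obtain G2 N2 where 2: "G2 \<in> borel_measurable borel" "finite N2" "\<And>t. t \<in> {b..c} - N2 \<Longrightarrow> G2 t \<le> ?F t"
    "\<And>t. t \<notin> {b..c} \<Longrightarrow> G2 t = 0" "kobayashi_dist A g (\<gamma> b) (\<gamma> c) \<le> (\<integral>\<^sup>+t. G2 t \<partial>lborel)"
    using 2 unfolding length_bound_def by blast
  note [measurable] = 1(1) 2(1)
  let ?G = "\<lambda>t. G1 t + G2 t"
  have "kobayashi_dist A g (\<gamma> a) (\<gamma> c) \<le> kobayashi_dist A g (\<gamma> a) (\<gamma> b) + kobayashi_dist A g (\<gamma> b) (\<gamma> c)"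
    by (rule kobayashi_dist_triangle)
  also have "\<dots> \<le> (\<integral>\<^sup>+t. G1 t \<partial>lborel) + (\<integral>\<^sup>+t. G2 t \<partial>lborel)" by (rule add_mono[OF 1(5) 2(5)])
  also have "\<dots> = (\<integral>\<^sup>+t. ?G t \<partial>lborel)" by (simp add: nn_integral_add)
  finally have int: "kobayashi_dist A g (\<gamma> a) (\<gamma> c) \<le> (\<integral>\<^sup>+t. ?G t \<partial>lborel)" .
  have le: "?G t \<le> ?F t" if t: "t \<in> {a..c} - (N1 \<union> N2 \<union> {b})" for t
  proof (cases "t < b")
    case True
    then show ?thesis using 1(3)[of t] 2(4)[of t] t by auto
  next
    case False
    then show ?thesis using 1(4)[of t] 2(3)[of t] t by auto
  qed
  have zero: "?G t = 0" if "t \<notin> {a..c}" for t using 1(4)[of t] 2(4)[of t] that abc by auto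
  have meas: "?G \<in> borel_measurable borel" by measurable
  have fin: "finite (N1 \<union> N2 \<union> {b})" using 1(2) 2(2) by simp
  show ?thesis unfolding length_bound_def
    by (rule exI[of _ ?G], rule exI[of _ "N1 \<union> N2 \<union> {b}"]) (use meas fin le zero int in blast)
qed

text \<open>Agreement on a closed interval does not determine the differentials at its endpoints,
  which are therefore added to the exceptional set.\<close>

lemma length_bound_cong:
  assumes "length_bound A g \<sigma> a b" and eq: "\<And>t. t \<in> {a..b} \<Longrightarrow> \<sigma> t = \<gamma> t" and ab: "a \<le> b"
    and diff: "\<And>t. t \<in> {a<..<b} \<Longrightarrow> differential A \<sigma> t 1 = differential A \<gamma> t 1"
  shows "length_bound A g \<gamma> a b"
proof -
  let ?F = "\<lambda>\<gamma> t. kobayashi_royden A g (\<gamma> t) (differential A \<gamma> t 1)"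
  obtain G N where G: "G \<in> borel_measurable borel" "finite N" "\<And>t. t \<in> {a..b} - N \<Longrightarrow> G t \<le> ?F \<sigma> t"
    "\<And>t. t \<notin> {a..b} \<Longrightarrow> G t = 0" "kobayashi_dist A g (\<sigma> a) (\<sigma> b) \<le> (\<integral>\<^sup>+t. G t \<partial>lborel)"
    using assms(1) unfolding length_bound_def by blast
  have "G t \<le> ?F \<gamma> t" if "t \<in> {a..b} - (N \<union> {a, b})" for t
    using G(3)[of t] that eq[of t] diff[of t] by auto
  moreover have "kobayashi_dist A g (\<gamma> a) (\<gamma> b) \<le> (\<integral>\<^sup>+t. G t \<partial>lborel)" using G(5) eq ab by simp
  moreover have "finite (N \<union> {a, b})" using G(2) by simp
  ultimately show ?thesis unfolding length_bound_def using G(1,4)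
    by (intro exI[of _ G] exI[of _ "N \<union> {a, b}"]) blast
qed

section \<open>Length bounds by subdivision of the path\<close>

context riemannian_manifold
begin

lemma length_bound_refl: "CARD('n) \<ge> 2 \<Longrightarrow> length_bound A g \<gamma> a a"
  unfolding length_bound_def
  by (rule exI[of _ "\<lambda>_. 0"], rule exI[of _ "{}"]) (simp add: kobayashi_dist_refl)

text \<open>Inside a ball on which the pseudodistance is Lipschitz, the distance from \<sigma> a to
  \<sigma> t is finite and Lipschitz in t. The form a \<le> x \<le> b with b - a < d is the one that
  the bisection argument consumes.\<close>

lemma length_bound_local:
  assumes dim: "CARD('n) \<ge> 2" and \<sigma>: "open T" "smooth_map_on A T \<sigma>" "x \<in> T"
  obtains d where "d > 0" "\<And>a b. a \<le> x \<Longrightarrow> x \<le> b \<Longrightarrow> b - a < d \<Longrightarrow> length_bound A g \<sigma> a b"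
proof -
  obtain c where c: "c \<in> A" "\<sigma> x \<in> fst c" by (rule chart_containing)
  obtain C \<delta> where C: "C > 0" "\<delta> > 0" and B: "ball (snd c (\<sigma> x)) \<delta> \<subseteq> chart_image c" and
    lip: "\<And>p q. p \<in> ball (snd c (\<sigma> x)) \<delta> \<Longrightarrow> q \<in> ball (snd c (\<sigma> x)) \<delta> \<Longrightarrow>
      kobayashi_dist A g (chart_inv c p) (chart_inv c q) \<le> ennreal (C * norm (p - q))"
    by (rule kobayashi_locally_lipschitz[OF dim c]) blast
  let ?B = "ball (snd c (\<sigma> x)) \<delta>"
  define y where "y s = snd c (\<sigma> s)" for s
  let ?T = "{s \<in> T. \<sigma> s \<in> fst c}"
  have T: "open ?T" by (rule smooth_map_on_open_preimage[OF \<sigma>(2,1) open_domain[OF c(1)]])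
  have sy: "smooth_on ?T y" using smooth_map_on_coord[OF \<sigma>(2) c(1)] by (simp add: y_def[abs_def] o_def)
  have yT: "open {s \<in> ?T. y s \<in> ?B}"
    using continuous_open_preimage[OF smooth_on_continuous_on[OF sy] T open_ball] by (simp add: Collect_conj_eq vimage_def Int_assoc)
  moreover have "x \<in> {s \<in> ?T. y s \<in> ?B}" using \<sigma>(3) c(2) C(2) by (simp add: y_def)
  ultimately obtain d where d: "d > 0" "cball x d \<subseteq> {s \<in> ?T. y s \<in> ?B}" using open_contains_cball by blast
  have dT: "s \<in> T" "\<sigma> s \<in> fst c" "y s \<in> ?B" if "s \<in> cball x d" for s using d(2) that by auto
  have dy: "(y has_derivative frechet_derivative y (at s)) (at s)" if "s \<in> cball x d" for s
    by (rule smooth_on_has_derivative[OF sy]) (use dT that in simp)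
  have "continuous_on (cball x d) (\<lambda>s. frechet_derivative y (at s) 1)"
    by (rule continuous_on_subset[OF smooth_on_continuous_on[OF smooth_on_frechet[OF sy]]]) (use dT in auto)
  then have "bounded ((\<lambda>s. frechet_derivative y (at s) 1) ` cball x d)"
    by (intro compact_imp_bounded compact_continuous_image compact_cball)
  then obtain L where L: "L > 0" "\<And>s. s \<in> cball x d \<Longrightarrow> norm (frechet_derivative y (at s) 1) \<le> L"
    unfolding bounded_pos by blast
  have ylip: "norm (y t - y s) \<le> L * \<bar>t - s\<bar>" if "s \<in> cball x d" "t \<in> cball x d" for s t
  proof -
    have "norm (y t - y s) \<le> L * norm (t - s)"
    proof (rule differentiable_bound[OF convex_cball _ _ that(2,1)])
      show "(y has_derivative frechet_derivative y (at r)) (at r within cball x d)" if "r \<in> cball x d" for r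
        by (rule has_derivative_at_withinI[OF dy[OF that]])
      show "onorm (frechet_derivative y (at r)) \<le> L" if r: "r \<in> cball x d" for r
      proof (rule onorm_le)
        fix v :: real
        have "linear (frechet_derivative y (at r))" using dy[OF r] by (simp add: has_derivative_def bounded_linear.linear)
        from linear_scale[OF this, of v 1] have "frechet_derivative y (at r) v = v *\<^sub>R frechet_derivative y (at r) 1" by simp
        then have "norm (frechet_derivative y (at r) v) = \<bar>v\<bar> * norm (frechet_derivative y (at r) 1)" by simp
        also have "\<dots> \<le> \<bar>v\<bar> * L" by (rule mult_left_mono[OF L(2)[OF r]]) simp
        finally show "norm (frechet_derivative y (at r) v) \<le> L * norm v" by (simp add: mult.commute)
      qed
    qed
    then show ?thesis by simp
  qed
  define K where "K = C * L"
  have K: "K \<ge> 0" using C L by (simp add: K_def)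
  have klip: "kobayashi_dist A g (\<sigma> s) (\<sigma> t) \<le> ennreal (K * \<bar>t - s\<bar>)" if st: "s \<in> cball x d" "t \<in> cball x d" for s t
  proof -
    have "kobayashi_dist A g (chart_inv c (y s)) (chart_inv c (y t)) \<le> ennreal (C * norm (y s - y t))"
      by (rule lip[OF dT(3)[OF st(1)] dT(3)[OF st(2)]])
    also have "\<dots> \<le> ennreal (K * \<bar>t - s\<bar>)"
      unfolding K_def mult.assoc using ylip[OF st] C by (intro ennreal_leI mult_left_mono) (auto simp: norm_minus_commute)
    finally show ?thesis using chart_inv_chart[OF c(1)] dT(2) st by (simp add: y_def)
  qed
  have "length_bound A g \<sigma> a b" if ab: "a \<le> x" "x \<le> b" "b - a < d" for a b
  proof (cases "a = b")
    case True
    then show ?thesis using length_bound_refl[OF dim] by simp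
  next
    case False
    then have lt: "a < b" using ab by simp
    have in_d: "s \<in> cball x d" if "s \<in> {a..b}" for s using that ab by (auto simp: dist_real_def)
    let ?k = "\<lambda>s t. kobayashi_dist A g (\<sigma> s) (\<sigma> t)"
    have fin: "?k s t = ennreal (enn2real (?k s t))" if "s \<in> {a..b}" "t \<in> {a..b}" for s t
    proof -
      have "?k s t < top" by (rule le_less_trans[OF klip]) (use that in_d in auto)
      then show ?thesis by simp
    qed
    define f where "f t = enn2real (?k a t)" for t
    \<comment> \<open>The triangle inequality bounds increments of f by the distance between the two
      points themselves, so the base point a drops out of the derivative estimate.\<close>
    have step: "f t - f s \<le> enn2real (?k s t)" if "s \<in> {a..b}" "t \<in> {a..b}" for s t
    proof -
      have "?k a t \<le> ?k a s + ?k s t" by (rule kobayashi_dist_triangle)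
      also have "\<dots> = ennreal (enn2real (?k a s) + enn2real (?k s t))"
        using fin[of a s] fin[of s t] that lt by (simp add: ennreal_plus)
      finally have "ennreal (f t) \<le> ennreal (enn2real (?k a s) + enn2real (?k s t))"
        using fin[of a t] that lt by (simp add: f_def)
      then have "f t \<le> enn2real (?k a s) + enn2real (?k s t)" by (subst (asm) ennreal_le_iff) simp_all
      then show ?thesis by (simp add: f_def)
    qed
    have kK: "enn2real (?k s t) \<le> K * \<bar>t - s\<bar>" if "s \<in> {a..b}" "t \<in> {a..b}" for s t
      using klip[OF in_d[OF that(1)] in_d[OF that(2)]] K by (intro enn2real_leI) auto
    have flip: "\<bar>f t - f s\<bar> \<le> K * \<bar>t - s\<bar>" if "s \<in> {a..b}" "t \<in> {a..b}" for s t
      using step[OF that] step[OF that(2,1)] kK[OF that] kK[OF that(2,1)] by (simp add: abs_minus_commute)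
    let ?F = "\<lambda>t. kobayashi_royden A g (\<sigma> t) (differential A \<sigma> t 1)"
    have lim: "limsup (\<lambda>n. ennreal (real (Suc n) * (f (t + 1 / real (Suc n)) - f t))) \<le> ?F t" if t: "t \<in> {a..<b}" for t
    proof -
      have td: "t \<in> cball x d" using in_d[of t] t by simp
      have "(\<lambda>n. 1 / real (Suc n)) \<longlonglongrightarrow> 0" using LIMSEQ_inverse_real_of_nat by (simp add: inverse_eq_divide)
      then have "\<forall>\<^sub>F n in sequentially. 1 / real (Suc n) < b - t" using t by (intro order_tendstoD(2)) auto
      then have "\<forall>\<^sub>F n in sequentially. ennreal (real (Suc n) * (f (t + 1 / real (Suc n)) - f t)) \<le>
          ennreal (real (Suc n)) * ?k t (t + 1 / real (Suc n))"
      proof eventually_elim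
        case (elim n)
        have "0 < 1 / real (Suc n)" by simp
        then have m: "t \<in> {a..b}" "t + 1 / real (Suc n) \<in> {a..b}" using t elim
          unfolding atLeastAtMost_iff atLeastLessThan_iff by linarith+
        have "ennreal (real (Suc n) * (f (t + 1 / real (Suc n)) - f t)) \<le>
            ennreal (real (Suc n) * enn2real (?k t (t + 1 / real (Suc n))))"
          by (intro ennreal_leI mult_left_mono step m) simp
        also have "\<dots> = ennreal (real (Suc n)) * ennreal (enn2real (?k t (t + 1 / real (Suc n))))"
          by (rule ennreal_mult) auto
        finally show ?case using fin[OF m] by simp
      qed
      then have "limsup (\<lambda>n. ennreal (real (Suc n) * (f (t + 1 / real (Suc n)) - f t))) \<le>
          limsup (\<lambda>n. ennreal (real (Suc n)) * ?k t (t + 1 / real (Suc n)))" by (rule Limsup_mono)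
      also have "\<dots> \<le> ?F t"
        by (rule kobayashi_forward_derivative[OF \<sigma>(1,2) dT(1)[OF td] c(1) dT(2)[OF td] open_ball B dT(3)[OF td, unfolded y_def] less_imp_le[OF C(1)]])
          (rule lip)
      finally show ?thesis .
    qed
    obtain G where G: "G \<in> borel_measurable borel" "\<And>t. t \<in> {a..<b} \<Longrightarrow> G t \<le> ?F t" "\<And>t. t \<notin> {a..b} \<Longrightarrow> G t = 0"
      "ennreal (f b - f a) \<le> (\<integral>\<^sup>+t. G t \<partial>lborel)"
      using lipschitz_upper_derivative_integral[where f = f and F = ?F, OF lt K flip lim] by blast
    have "f a = 0" by (simp add: f_def kobayashi_dist_refl[OF dim])
    then have "?k a b \<le> (\<integral>\<^sup>+t. G t \<partial>lborel)" using G(4) fin[of a b] lt by (simp add: f_def)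
    \<comment> \<open>At b the forward quotients leave the interval, so b is the exceptional
      point.\<close>
    then show ?thesis unfolding length_bound_def using G
      by (intro exI[of _ G] exI[of _ "{b}"]) auto
  qed
  then show ?thesis using that d(1) by blast
qed

text \<open>Local validity and additivity give validity on the compact interval by bisection. This
  is carried out for the smooth extension \<sigma>, whose differential is that of \<gamma> in the
  interior.\<close>

lemma length_bound_smooth:
  assumes dim: "CARD('n) \<ge> 2" and \<gamma>: "smooth_curve_on A a b \<gamma>" and ab: "a \<le> b"
  shows "length_bound A g \<gamma> a b"
proof -
  obtain T \<sigma> where T: "open T" "{a..b} \<subseteq> T" "smooth_map_on A T \<sigma>" "\<And>t. t \<in> {a..b} \<Longrightarrow> \<sigma> t = \<gamma> t"
    using \<gamma> unfolding smooth_curve_on_def by blast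
  have "length_bound A g \<sigma> a b"
  proof (rule Bolzano[OF ab])
    show "length_bound A g \<sigma> s u" if "length_bound A g \<sigma> s t" "length_bound A g \<sigma> t u" "s \<le> t" "t \<le> u" for s t u
      by (rule length_bound_trans[OF that])
    fix x assume "a \<le> x" "x \<le> b"
    then have "x \<in> T" using T(2) by auto
    then obtain d where "d > 0" "\<And>s u. s \<le> x \<Longrightarrow> x \<le> u \<Longrightarrow> u - s < d \<Longrightarrow> length_bound A g \<sigma> s u"
      by (rule length_bound_local[OF dim T(1,3)]) blast
    then show "\<exists>d>0. \<forall>s u. s \<le> x \<and> x \<le> u \<and> u - s < d \<longrightarrow> length_bound A g \<sigma> s u" by blast
  qed
  then show ?thesis
  proof (rule length_bound_cong)
    show "differential A \<sigma> t 1 = differential A \<gamma> t 1" if "t \<in> {a<..<b}" for t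
      by (rule differential_cong[OF open_greaterThanLessThan that]) (simp add: T(4))
  qed (use T(4) ab in auto)
qed

text \<open>The bounds add up along the partition of the path, and the integral of the resulting
  minorant G is at most that of the pseudometric, measurable or not.\<close>

theorem kobayashi_dist_le_integrated:
  assumes dim: "CARD('n) \<ge> 2"
  shows "kobayashi_dist A g p q \<le> integrated_kobayashi_royden A g p q"
  unfolding integrated_kobayashi_royden_def
proof (rule INF_greatest)
  fix \<gamma> assume "\<gamma> \<in> {\<gamma>. piecewise_smooth_path A \<gamma> \<and> pathstart \<gamma> = p \<and> pathfinish \<gamma> = q}"
  then have pq: "\<gamma> 0 = p" "\<gamma> 1 = q" and \<gamma>: "piecewise_smooth_path A \<gamma>" by (auto simp: pathstart_def pathfinish_def)
  obtain n \<tau> where \<tau>: "\<tau> 0 = 0" "\<tau> n = (1::real)" "\<And>i. i < n \<Longrightarrow> \<tau> i < \<tau> (Suc i)"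
    "\<And>i. i < n \<Longrightarrow> smooth_curve_on A (\<tau> i) (\<tau> (Suc i)) \<gamma>"
    using \<gamma> unfolding piecewise_smooth_path_def by blast
  have "length_bound A g \<gamma> 0 (\<tau> i)" if "i \<le> n" for i
    using that
  proof (induction i)
    case 0
    then show ?case using length_bound_refl[OF dim] \<tau>(1) by simp
  next
    case (Suc i)
    then have i: "i < n" by simp
    have "0 \<le> \<tau> i" using partition_le[of n \<tau> 0 i] \<tau> i by simp
    moreover have "length_bound A g \<gamma> (\<tau> i) (\<tau> (Suc i))"
      by (rule length_bound_smooth[OF dim \<tau>(4)[OF i]]) (use \<tau>(3)[OF i] in simp)
    ultimately show ?case using length_bound_trans[of A g \<gamma> 0 "\<tau> i" "\<tau> (Suc i)"] Suc \<tau>(3)[OF i] by simp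
  qed
  from this[of n] have "length_bound A g \<gamma> 0 1" using \<tau>(2) by simp
  then obtain G N where G: "finite N" "\<And>t. t \<in> {0..1} - N \<Longrightarrow> G t \<le> kobayashi_royden A g (\<gamma> t) (differential A \<gamma> t 1)"
    "\<And>t. t \<notin> {0..1} \<Longrightarrow> G t = 0" "kobayashi_dist A g (\<gamma> 0) (\<gamma> 1) \<le> (\<integral>\<^sup>+t. G t \<partial>lborel)"
    unfolding length_bound_def by blast
  note G(4)
  also have "(\<integral>\<^sup>+t. G t \<partial>lborel) \<le> (\<integral>\<^sup>+t\<in>{0..1}. kobayashi_royden A g (\<gamma> t) (differential A \<gamma> t 1) \<partial>lborel)"
    by (rule nn_integral_mono_AE, rule AE_mp[OF AE_lborel_not_finite[OF G(1)]])
      (auto intro!: AE_I2 G(2,3) split: split_indicator)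
  finally show "kobayashi_dist A g p q \<le> (\<integral>\<^sup>+t\<in>{0..1}. kobayashi_royden A g (\<gamma> t) (differential A \<gamma> t 1) \<partial>lborel)"
    unfolding pq .
qed

end

theorem theorem4p1:
  fixes A :: "('m::{t2_space, second_countable_topology}, 'n::finite) chart set"
    and g :: "('m, 'n) metric"
  assumes "riemannian_manifold A g"
    and "connected (UNIV :: 'm set)"
    and "CARD('n) \<ge> 2"
  shows "\<forall>p q. kobayashi_dist A g p q = integrated_kobayashi_royden A g p q"
proof -
  interpret riemannian_manifold A g by (rule assms(1))
  show ?thesis
    by (intro allI antisym kobayashi_dist_le_integrated integrated_le_kobayashi_dist assms(3))
qed

end
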